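(* Let $d\ge2$, $1<p<\infty$, $q=\frac p{p-1}$, $A,B_\infty\in\mathbb C^{m,m}$, $S\in\mathbb R^{d,d}$ skew-symmetric. Assume (A4$_p$) for $A$ with constant $\gamma_A$, (A4$_q$) for $A$ with constant $\delta_A$, and that $A$ and $B_\infty$ are simultaneously diagonalizable over $\mathbb C$. Let $b_0=-s(-B_\infty)$, $a_0=-s(-A)$, $a_{\max}=\rho(A)$, and let $\beta_\infty\in\mathbb R$ satisfy $\Re\langle w,B_\infty w\rangle\ge\beta_\infty|w|^2$ for all $w\in\mathbb C^m$. Let $\gamma>0$ with $\beta_\infty-b_0+\gamma>0$ and $0<\varepsilon<1$. Then there is $\eta_0>0$ (depending only on $A,B_\infty,d,p,\gamma,\varepsilon,\beta_\infty$) such that the following holds. Let $Q\in C(\mathbb R^d,\mathbb C^{m,m})$ with $\sup_{|x|\ge R_0}|Q(x)|\le\eta_0$ for some $R_0>0$, let $\lambda\in\mathbb C$ with $\Re\lambda\ge-b_0+\gamma$, and let $\theta_j(x)=\exp(\mu_j\sqrt{|x|^2+1})$, $j=1,2,3,4$, where $$-\sqrt{\varepsilon\tfrac{\gamma_A(\beta_\infty-b_0+\gamma)}{2d|A|^2}}\le\mu_1\le0\le\mu_2\le\varepsilon\tfrac{\sqrt{a_0\gamma}}{a_{\max}p},\qquad -\sqrt{\varepsilon\tfrac{\delta_A(\beta_\infty-b_0+\gamma)}{2d|A|^2}}\le\mu_3\le0\le\mu_4\le\varepsilon\tfrac{\sqrt{a_0\gamma}}{a_{\max}q}.$$ Then every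 $v\in W^{2,p}_{\rm loc}(\mathbb R^d,\mathbb C^m)\cap L^p_{\theta_1}(\mathbb R^d,\mathbb C^m)$ solving $(\lambda I-\mathcal L_Q)v=g$ in $L^p_{\rm loc}$ with $g\in L^p_{\theta_2}(\mathbb R^d,\mathbb C^m)$ satisfies $v\in W^{1,p}_{\theta_2}(\mathbb R^d,\mathbb C^m)$ and $$\|v\|_{W^{k,p}_{\theta_2}}\le C_1(\Re\lambda+b_0)^{-k/2}\big(\|v\|_{L^p_{\theta_1}}+\|g\|_{L^p_{\theta_2}}\big),\quad k=0,1;$$ and every $\psi\in W^{2,q}_{\rm loc}(\mathbb R^d,\mathbb C^m)\cap L^q_{\theta_3}(\mathbb R^d,\mathbb C^m)$ solving $(\bar\lambda I-\mathcal L_Q^* )\psi=\phi$ in $L^q_{\rm loc}$ with $\phi\in L^q_{\theta_4}(\mathbb R^d,\mathbb C^m)$ satisfies $\psi\in W^{1,q}_{\theta_4}(\mathbb R^d,\mathbb C^m)$ and $$\|\psi\|_{W^{k,q}_{\theta_4}}\le C_3(\Re\lambda+b_0)^{-k/2}\big(\|\psi\|_{L^q_{\theta_3}}+\|\phi\|_{L^q_{\theta_4}}\big),\quad k=0,1.$$ Here $C_1,C_3>0$ depend only on $\gamma$, $|\mu_2-\mu_1|$ resp. $|\mu_4-\mu_3|$, $R_0$, $\|Q\|_{L^\infty}$, $\varepsilon$ (and the fixed data $A,B_\infty,d,p$), but not on $\lambda$, $v$, $\psi$, $g$, $\phi$.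
   Context: Inner product on $\mathbb C^m$: $\langle u,v\rangle=u^{H}v$ with $u^H=\bar u^\top$; $|A|$ is the spectral norm. Condition (A4$_p$) for a matrix $A\in\mathbb C^{m,m}$ and $1<p<\infty$: there is $\gamma_A>0$ such that $|z|^2\Re\langle w,Aw\rangle+(p-2)\Re\langle w,z\rangle\Re\langle z,Aw\rangle\ge\gamma_A|z|^2|w|^2$ for all $z,w\in\mathbb C^m$. Condition (A4$_q$) for $A$ and $q=\frac p{p-1}$: there is $\delta_A>0$ such that $|z|^2\Re\langle w,A^Hw\rangle+(q-2)\Re\langle w,z\rangle\Re\langle z,A^Hw\rangle\ge\delta_A|z|^2|w|^2$ for all $z,w\in\mathbb C^m$. For a matrix $C$, $s(C)=\max_{\mu\in\sigma(C)}\Re\mu$ (spectral abscissa) and $\rho(C)=\max_{\mu\in\sigma(C)}|\mu|$ (spectral radius). For $x\in\mathbb R^d$, $\langle Sx,\nabla v(x)\rangle=\sum_{i,j=1}^dS_{ij}x_j\partial_{x_i}v(x)$. $\mathcal L_Qv(x)=A\Delta v(x)+\langle Sx,\nabla v(x)\rangle-B_\infty v(x)+Q(x)v(x)$ and $\mathcal L_Q^*v(x)=A^H\Delta v(x)-\langle Sx,\nabla v(x)\rangle-B_\infty^Hv(x)+Q(x)^Hv(x)$. Weighted spaces for a weight $\theta(x)=\exp(\mu\sqrt{|x|^2+1})$: $L^p_\theta(\mathbb R^d,\mathbb C^m)=\{u\in L^1_{\rm loc}:\|u\|_{L^p_\theta}:=\|\theta u\|_{L^p}<\infty\}$ and $W^{k,p}_\theta(\mathbb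 R^d,\mathbb C^m)=\{u\in L^p_\theta:\|u\|^p_{W^{k,p}_\theta}:=\sum_{|\beta|\le k}\|D^\beta u\|^p_{L^p_\theta}<\infty\}$. *)

theory Defs
  imports "HOL-Analysis.Analysis"
begin

definition cinner :: "complex^'m \<Rightarrow> complex^'m \<Rightarrow> complex" where
  "cinner u v = (\<Sum>i\<in>UNIV. cnj (u$i) * v$i)"

definition mat_H :: "complex^'m^'m \<Rightarrow> complex^'m^'m" where
  "mat_H M = (\<chi> i j. cnj (M$j$i))"

definition specnorm :: "complex^'m^'m \<Rightarrow> real" where
  "specnorm M = onorm (\<lambda>w. M *v w)"

definition cspectrum :: "complex^'m^'m \<Rightarrow> complex set" where
  "cspectrum M = {\<mu>. \<exists>w. w \<noteq> 0 \<and> M *v w = \<mu> *s w}"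

definition spec_abscissa :: "complex^'m^'m \<Rightarrow> real" where
  "spec_abscissa M = Max (Re ` cspectrum M)"

definition spec_radius :: "complex^'m^'m \<Rightarrow> real" where
  "spec_radius M = Max (cmod ` cspectrum M)"

definition is_diag :: "complex^'m^'m \<Rightarrow> bool" where
  "is_diag M \<longleftrightarrow> (\<forall>i j. i \<noteq> j \<longrightarrow> M$i$j = 0)"

definition simult_diagonalizable :: "complex^'m^'m \<Rightarrow> complex^'m^'m \<Rightarrow> bool" where
  "simult_diagonalizable M N \<longleftrightarrow>
     (\<exists>P Pinv :: complex^'m^'m. P ** Pinv = mat 1 \<and> Pinv ** P = mat 1 \<and>
        is_diag (Pinv ** M ** P) \<and> is_diag (Pinv ** N ** P))"

definition A4 :: "real \<Rightarrow> complex^'m^'m \<Rightarrow> real \<Rightarrow> bool" where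
  "A4 p M c \<longleftrightarrow> c > 0 \<and> (\<forall>z w.
     (norm z)^2 * Re (cinner w (M *v w)) + (p - 2) * Re (cinner w z) * Re (cinner z (M *v w))
       \<ge> c * (norm z)^2 * (norm w)^2)"

coinductive smooth_fun :: "(real^'d \<Rightarrow> real) \<Rightarrow> bool" where
  "(\<forall>x. f differentiable at x) \<Longrightarrow>
   (\<forall>i. smooth_fun (\<lambda>x. frechet_derivative f (at x) (axis i 1))) \<Longrightarrow> smooth_fun f"

definition pderiv_fun :: "(real^'d \<Rightarrow> real) \<Rightarrow> 'd \<Rightarrow> real^'d \<Rightarrow> real" where
  "pderiv_fun f i x = frechet_derivative f (at x) (axis i 1)"

definition test_fun :: "(real^'d \<Rightarrow> real) \<Rightarrow> bool" where
  "test_fun \<phi> \<longleftrightarrow> smooth_fun \<phi> \<and> compact (closure {x. \<phi> x \<noteq> 0})"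

definition loc_integrable :: "(real^'d \<Rightarrow> complex^'m) \<Rightarrow> bool" where
  "loc_integrable u \<longleftrightarrow> (\<forall>K. compact K \<longrightarrow> set_integrable lborel K u)"

definition weak_pderiv :: "'d \<Rightarrow> (real^'d \<Rightarrow> complex^'m) \<Rightarrow> (real^'d \<Rightarrow> complex^'m) \<Rightarrow> bool" where
  "weak_pderiv i u w \<longleftrightarrow> loc_integrable u \<and> loc_integrable w \<and>
     (\<forall>\<phi>. test_fun \<phi> \<longrightarrow>
        (\<integral>x. pderiv_fun \<phi> i x *\<^sub>R u x \<partial>lborel) = - (\<integral>x. \<phi> x *\<^sub>R w x \<partial>lborel))"

definition Lp_loc :: "real \<Rightarrow> (real^'d \<Rightarrow> complex^'m) \<Rightarrow> bool" where
  "Lp_loc p u \<longleftrightarrow> u \<in> borel_measurable lborel \<and>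
     (\<forall>K. compact K \<longrightarrow> (\<integral>\<^sup>+x\<in>K. ennreal (norm (u x) powr p) \<partial>lborel) < \<infinity>)"

definition exp_weight :: "real \<Rightarrow> real^'d \<Rightarrow> real" where
  "exp_weight \<mu> x = exp (\<mu> * sqrt ((norm x)^2 + 1))"

definition Lp_weighted :: "real \<Rightarrow> (real^'d \<Rightarrow> real) \<Rightarrow> (real^'d \<Rightarrow> complex^'m) \<Rightarrow> bool" where
  "Lp_weighted p \<theta> u \<longleftrightarrow> u \<in> borel_measurable lborel \<and>
     (\<integral>\<^sup>+x. ennreal (norm (\<theta> x *\<^sub>R u x) powr p) \<partial>lborel) < \<infinity>"

definition Lp_wnorm :: "real \<Rightarrow> (real^'d \<Rightarrow> real) \<Rightarrow> (real^'d \<Rightarrow> complex^'m) \<Rightarrow> real" where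
  "Lp_wnorm p \<theta> u = (enn2real (\<integral>\<^sup>+x. ennreal (norm (\<theta> x *\<^sub>R u x) powr p) \<partial>lborel)) powr (1 / p)"

text \<open>W^{1,p}_theta norm of u whose weak first derivatives are Du i:
  ||u||^p = ||u||^p_{L^p_theta} + sum_i ||D_i u||^p_{L^p_theta}.\<close>
definition W1p_wnorm :: "real \<Rightarrow> (real^'d \<Rightarrow> real) \<Rightarrow> (real^'d \<Rightarrow> complex^'m)
    \<Rightarrow> ('d \<Rightarrow> real^'d \<Rightarrow> complex^'m) \<Rightarrow> real" where
  "W1p_wnorm p \<theta> u Du =
     ((Lp_wnorm p \<theta> u) powr p + (\<Sum>i\<in>UNIV. (Lp_wnorm p \<theta> (Du i)) powr p)) powr (1 / p)"

definition W2p_loc_derivs :: "real \<Rightarrow> (real^'d \<Rightarrow> complex^'m) \<Rightarrow> ('d \<Rightarrow> real^'d \<Rightarrow> complex^'m)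
    \<Rightarrow> ('d \<Rightarrow> 'd \<Rightarrow> real^'d \<Rightarrow> complex^'m) \<Rightarrow> bool" where
  "W2p_loc_derivs p v Dv D2v \<longleftrightarrow> Lp_loc p v \<and>
     (\<forall>i. weak_pderiv i v (Dv i) \<and> Lp_loc p (Dv i)) \<and>
     (\<forall>i j. weak_pderiv j (Dv i) (D2v i j) \<and> Lp_loc p (D2v i j))"

definition Linf_mat_norm :: "(real^'d \<Rightarrow> complex^'m^'m) \<Rightarrow> real" where
  "Linf_mat_norm Q = (SUP x. specnorm (Q x))"

text \<open>(lambda I - L_Q) v evaluated with the given weak derivatives:
  lambda v - A Delta v - <Sx, grad v> + B v - Q v.\<close>
definition resolvent_op :: "complex \<Rightarrow> complex^'m^'m \<Rightarrow> real^'d^'d \<Rightarrow> complex^'m^'m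
    \<Rightarrow> (real^'d \<Rightarrow> complex^'m^'m) \<Rightarrow> (real^'d \<Rightarrow> complex^'m) \<Rightarrow> ('d \<Rightarrow> real^'d \<Rightarrow> complex^'m)
    \<Rightarrow> ('d \<Rightarrow> 'd \<Rightarrow> real^'d \<Rightarrow> complex^'m) \<Rightarrow> real^'d \<Rightarrow> complex^'m" where
  "resolvent_op lam A S B Q v Dv D2v x =
     lam *s v x - A *v (\<Sum>i\<in>UNIV. D2v i i x) - (\<Sum>i\<in>UNIV. (S *v x)$i *\<^sub>R Dv i x)
       + B *v v x - Q x *v v x"

text \<open>(conj lambda I - L_Q^* ) psi:
  conj lambda psi - A^H Delta psi + <Sx, grad psi> + B^H psi - Q^H psi.\<close>
definition adj_resolvent_op :: "complex \<Rightarrow> complex^'m^'m \<Rightarrow> real^'d^'d \<Rightarrow> complex^'m^'m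
    \<Rightarrow> (real^'d \<Rightarrow> complex^'m^'m) \<Rightarrow> (real^'d \<Rightarrow> complex^'m) \<Rightarrow> ('d \<Rightarrow> real^'d \<Rightarrow> complex^'m)
    \<Rightarrow> ('d \<Rightarrow> 'd \<Rightarrow> real^'d \<Rightarrow> complex^'m) \<Rightarrow> real^'d \<Rightarrow> complex^'m" where
  "adj_resolvent_op lam A S B Q v Dv D2v x =
     cnj lam *s v x - mat_H A *v (\<Sum>i\<in>UNIV. D2v i i x) + (\<Sum>i\<in>UNIV. (S *v x)$i *\<^sub>R Dv i x)
       + mat_H B *v v x - mat_H (Q x) *v v x"

end

theory Submission
  imports Defs "HOL-Computational_Algebra.Polynomial" "HOL-Real_Asymp.Real_Asymp"
begin

text \<open>A common eigenbasis of \<open>A\<close> and \<open>B\<close> decouples the equation into scalar equations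
  \<open>(\<lambda> + b) w - a \<Delta>w - \<langle>Sx, \<nabla>w\<rangle> = f\<close>, with \<open>f\<close> a component of \<open>g + Q v\<close>. Testing
  such an equation with the rotated heat kernel
  \<open>s\<^sup>-\<^sup>d\<^sup>/\<^sup>2 exp(-(\<lambda> + b) s - |e\<^sup>s\<^sup>S x - \<xi>|\<^sup>2 / (4 a s))\<close> and integrating over
  \<open>s > 0\<close> represents \<open>w\<close>, and after differentiation also \<open>\<nabla>w\<close>, as a kernel integral of \<open>f\<close>: the
  boundary term at \<open>s = \<infinity>\<close> vanishes by the a priori growth bound \<open>v \<in> L\<^sup>p\<close> with weight
  \<open>\<theta>\<^sub>1\<close>. Schur's test bounds the kernel integrals in \<open>L\<^sup>p\<close> for every weight growing no faster than
  \<open>exp(\<mu> |x|)\<close> with \<open>\<mu>\<^sup>2 \<le> \<epsilon> a\<^sub>0 \<gamma> / a\<^sub>m\<^sub>a\<^sub>x\<^sup>2\<close>. Applied to the truncated weights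
  \<open>exp(min (\<mu>\<^sub>2 r) (n + \<mu>\<^sub>1 r))\<close>, \<open>r = \<surd>(|x|\<^sup>2 + 1)\<close>, for which every norm is finite, this allows the
  part of \<open>Q\<close> outside the ball of radius \<open>R\<^sub>0\<close> to be absorbed; then \<open>n \<rightarrow> \<infinity>\<close>. Condition (A4)
  enters only through \<open>\<gamma>\<^sub>A \<le> a\<^sub>0\<close> and \<open>\<delta>\<^sub>A \<le> a\<^sub>0\<close>, obtained by inserting an eigenvector \<open>w\<close> and
  \<open>z = \<i> w\<close>, and the numerical range bound through \<open>\<beta>\<^sub>\<infinity> \<le> b\<^sub>0\<close>. The adjoint equation is of the
  same form, for \<open>A\<^sup>H\<close>, \<open>-S\<close>, \<open>B\<^sup>H\<close> and \<open>Q\<^sup>H\<close>.\<close>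

section \<open>Smooth functions and test functions\<close>

text \<open>The eigenvalues a of A are complex, so the kernel is not positive. Every estimate passes
  to the real kernel \<open>rker\<close> with rate \<open>\<alpha>0\<close> = a0 / (4 amax^2), a
  lower bound of Re (1/(4a)) = Re a / (4 |a|^2). Only \<Lambda> = Re lam + b0 survives as decay rate
  in s: the time integrals of exp(-\<Lambda> s) and s^(-1/2) exp(-\<Lambda> s) produce the powers
  \<Lambda>^(-1) and \<Lambda>^(-1/2), and nothing depends on Im lam. The unbounded drift is
  harmless because exp(sS) is orthogonal while weights and kernel moduli are radial. The obstacle is
  that v is only a weak solution and may grow exponentially. The representation is therefore proved
  after pairing with test functions, for a growth rate M with M^2 < 4 \<theta> \<alpha> \<Lambda>,
  which the Gaussian and the decay in s can jointly compensate. The kernel stays unnormalised; its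
  complex mass \<open>gint\<close> is divided out once it is known to be nonzero. Q need not be
  small inside the ball. That part is estimated in the weight in which v is given, which is how
  \<open>R0\<close> and |\<mu>2 - \<mu>1| enter the constants.\<close>

primrec Cdiff :: "nat \<Rightarrow> (real^'d \<Rightarrow> real) \<Rightarrow> bool" where
  "Cdiff 0 f \<longleftrightarrow> True"
| "Cdiff (Suc k) f \<longleftrightarrow> (\<forall>x. f differentiable at x) \<and> (\<forall>i. Cdiff k (pderiv_fun f i))"

lemma smooth_fun_imp_Cdiff: "smooth_fun f \<Longrightarrow> Cdiff k f"
proof (induction k arbitrary: f)
  case (Suc k)
  from Suc.prems have "(\<forall>x. f differentiable at x)"
    "\<forall>i. smooth_fun (\<lambda>x. frechet_derivative f (at x) (axis i 1))"
    by (rule smooth_fun.cases; simp)+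
  with Suc.IH show ?case by (auto simp: pderiv_fun_def[abs_def])
qed simp

text \<open>A coinductive predicate gives no induction for products and chains, where derivatives of
  several functions mix. The closure rules are proved for each finite order by induction and
  transferred through this equivalence.\<close>

lemma smooth_fun_iff_Cdiff: "smooth_fun f \<longleftrightarrow> (\<forall>k. Cdiff k f)"
proof
  assume "\<forall>k. Cdiff k f"
  then show "smooth_fun f"
  proof (coinduction arbitrary: f)
    case smooth_fun
    then have "Cdiff (Suc k) f" for k by blast
    then show ?case by (auto simp: pderiv_fun_def[abs_def])
  qed
qed (blast intro: smooth_fun_imp_Cdiff)

lemma Cdiff_SucD: "Cdiff (Suc k) f \<Longrightarrow> Cdiff k f"
  by (induction k arbitrary: f) auto

lemma pderiv_fun_eqI: "(f has_derivative f') (at x) \<Longrightarrow> pderiv_fun f i x = f' (axis i 1)"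
  unfolding pderiv_fun_def by (simp add: frechet_derivative_at[symmetric])

lemma pderiv_fun_add:
  "f differentiable at x \<Longrightarrow> g differentiable at x \<Longrightarrow>
    pderiv_fun (\<lambda>x. f x + g x) i x = pderiv_fun f i x + pderiv_fun g i x"
  by (intro pderiv_fun_eqI[THEN trans])
     (auto intro!: derivative_eq_intros simp: frechet_derivative_works pderiv_fun_def)

lemma pderiv_fun_mult:
  "f differentiable at x \<Longrightarrow> g differentiable at x \<Longrightarrow>
    pderiv_fun (\<lambda>x. f x * g x) i x = f x * pderiv_fun g i x + pderiv_fun f i x * g x"
  by (intro pderiv_fun_eqI[THEN trans])
     (auto intro!: derivative_eq_intros simp: frechet_derivative_works pderiv_fun_def)

lemma pderiv_fun_compose:
  assumes "f differentiable at x" and "(g has_real_derivative g') (at (f x))"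
  shows "pderiv_fun (\<lambda>x. g (f x)) i x = g' * pderiv_fun f i x"
proof -
  have "((\<lambda>x. g (f x)) has_derivative (\<lambda>h. g' * frechet_derivative f (at x) h)) (at x)"
    using has_derivative_compose[OF assms(1)[unfolded frechet_derivative_works]
        assms(2)[unfolded has_field_derivative_def]] .
  then show ?thesis by (simp add: pderiv_fun_eqI) (simp add: pderiv_fun_def)
qed

lemma Cdiff_add: "Cdiff k f \<Longrightarrow> Cdiff k g \<Longrightarrow> Cdiff k (\<lambda>x. f x + g x)"
proof (induction k arbitrary: f g)
  case (Suc k)
  then have "pderiv_fun (\<lambda>x. f x + g x) i = (\<lambda>x. pderiv_fun f i x + pderiv_fun g i x)" for i
    by (auto simp: fun_eq_iff pderiv_fun_add)
  with Suc show ?case by auto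
qed simp

lemma Cdiff_mult: "Cdiff k f \<Longrightarrow> Cdiff k g \<Longrightarrow> Cdiff k (\<lambda>x. f x * g x)"
proof (induction k arbitrary: f g)
  case (Suc k)
  then have "pderiv_fun (\<lambda>x. f x * g x) i =
      (\<lambda>x. f x * pderiv_fun g i x + pderiv_fun f i x * g x)" for i
    by (auto simp: fun_eq_iff pderiv_fun_mult)
  moreover have "Cdiff k f" "Cdiff k g" using Suc.prems by (auto intro: Cdiff_SucD)
  ultimately show ?case using Suc by (auto intro!: Cdiff_add Suc.IH)
qed simp

text \<open>The outer function comes as a sequence in which each member is the derivative of the
  previous one. With \<open>n\<close> generalised, the induction stays inside this family.\<close>

lemma Cdiff_compose:
  assumes "\<And>n s. (g n has_real_derivative g (Suc n) s) (at s)"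
  shows "Cdiff k f \<Longrightarrow> Cdiff k (\<lambda>x. g n (f x))"
proof (induction k arbitrary: n)
  case (Suc k)
  then have fd: "\<And>x. f differentiable at x" by auto
  have "pderiv_fun (\<lambda>x. g n (f x)) i = (\<lambda>x. g (Suc n) (f x) * pderiv_fun f i x)" for i
    using pderiv_fun_compose[OF fd assms] by (auto simp: fun_eq_iff)
  moreover have "(\<lambda>x. g n (f x)) differentiable at x" for x
    using differentiable_chain_at[OF fd, of "g n" x] assms[of n "f x"]
    unfolding o_def real_differentiable_def by blast
  ultimately show ?case using Suc.prems Suc.IH[OF Cdiff_SucD[OF Suc.prems]]
    by (auto intro!: Cdiff_mult)
qed simp

lemma Cdiff_const: "Cdiff k (\<lambda>x. c)"
proof (induction k arbitrary: c)
  case (Suc k)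
  have "pderiv_fun (\<lambda>x. c) i = (\<lambda>x. 0)" for i :: 'a
    by (auto simp: fun_eq_iff intro!: pderiv_fun_eqI[THEN trans])
  with Suc show ?case by auto
qed simp

lemma pderiv_fun_nth: "pderiv_fun (\<lambda>x. x $ j) i x = (if i = j then 1 else 0)"
  by (auto simp: axis_def intro!: pderiv_fun_eqI[THEN trans] bounded_linear_imp_has_derivative)

lemma smooth_fun_const [intro, simp]: "smooth_fun (\<lambda>x. c)"
  by (simp add: smooth_fun_iff_Cdiff Cdiff_const)

lemma smooth_fun_nth [intro, simp]: "smooth_fun (\<lambda>x. x $ j)"
proof -
  have "Cdiff k (\<lambda>x. x $ j)" for k
    by (cases k) (auto simp: pderiv_fun_nth[abs_def] Cdiff_const
        intro!: bounded_linear_imp_differentiable)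
  then show ?thesis by (simp add: smooth_fun_iff_Cdiff)
qed

lemma smooth_fun_add [intro, simp]: "smooth_fun f \<Longrightarrow> smooth_fun g \<Longrightarrow> smooth_fun (\<lambda>x. f x + g x)"
  by (simp add: smooth_fun_iff_Cdiff Cdiff_add)

lemma smooth_fun_mult [intro, simp]: "smooth_fun f \<Longrightarrow> smooth_fun g \<Longrightarrow> smooth_fun (\<lambda>x. f x * g x)"
  by (simp add: smooth_fun_iff_Cdiff Cdiff_mult)

lemma smooth_fun_compose:
  assumes "\<And>n s. (g n has_real_derivative g (Suc n) s) (at s)" "smooth_fun f"
  shows "smooth_fun (\<lambda>x. g n (f x))"
  using assms by (simp add: smooth_fun_iff_Cdiff Cdiff_compose)

lemma smooth_fun_uminus [intro, simp]: "smooth_fun f \<Longrightarrow> smooth_fun (\<lambda>x. - f x)"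
  using smooth_fun_mult[of "\<lambda>x. -1" f] by simp

lemma smooth_fun_diff [intro, simp]: "smooth_fun f \<Longrightarrow> smooth_fun g \<Longrightarrow> smooth_fun (\<lambda>x. f x - g x)"
  using smooth_fun_add[of f "\<lambda>x. - g x"] by simp

lemma smooth_fun_sum [intro, simp]:
  "(\<And>i. i \<in> I \<Longrightarrow> smooth_fun (f i)) \<Longrightarrow> smooth_fun (\<lambda>x. \<Sum>i\<in>I. f i x)"
  by (induction I rule: infinite_finite_induct) auto

lemma smooth_fun_prod [intro, simp]:
  "(\<And>i. i \<in> I \<Longrightarrow> smooth_fun (f i)) \<Longrightarrow> smooth_fun (\<lambda>x. \<Prod>i\<in>I. f i x)"
  by (induction I rule: infinite_finite_induct) auto

lemma smooth_fun_pderiv [intro, simp]: "smooth_fun f \<Longrightarrow> smooth_fun (pderiv_fun f i)"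
  unfolding pderiv_fun_def[abs_def] by (erule smooth_fun.cases) simp

lemma smooth_fun_differentiable: "smooth_fun f \<Longrightarrow> f differentiable at x"
  by (erule smooth_fun.cases) simp

lemma smooth_fun_continuous: "smooth_fun f \<Longrightarrow> continuous_on A f"
  by (intro continuous_at_imp_continuous_on ballI differentiable_imp_continuous_within
      smooth_fun_differentiable)

lemma smooth_fun_exp [intro, simp]: "smooth_fun f \<Longrightarrow> smooth_fun (\<lambda>x. exp (f x))"
  by (rule smooth_fun_compose[where g = "\<lambda>_. exp"]) (auto intro!: derivative_eq_intros)

text \<open>Sine and cosine repeat their derivatives with period four. Packing them into one list
  indexed modulo 4 yields the derivative sequence that \<open>smooth_fun_compose\<close>
  expects.\<close>

lemma has_derivative_cycle4:
  assumes "\<And>s. (a has_real_derivative b s) (at s)" "\<And>s. (b has_real_derivative - a s) (at s)"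
  shows "((\<lambda>s. [a s, b s, - a s, - b s] ! (n mod 4)) has_real_derivative
     [a s, b s, - a s, - b s] ! (Suc n mod 4)) (at s)"
proof -
  have "n mod 4 < 4" by simp
  then consider "n mod 4 = 0" | "n mod 4 = 1" | "n mod 4 = 2" | "n mod 4 = 3" by linarith
  then show ?thesis
  proof cases
    case 1 then show ?thesis using assms(1) by (simp add: mod_Suc)
  next
    case 2 then show ?thesis using assms(2) by (simp add: mod_Suc)
  next
    case 3 then show ?thesis using DERIV_minus[OF assms(1)] by (simp add: mod_Suc)
  next
    case 4 then show ?thesis using DERIV_minus[OF assms(2)] by (simp add: mod_Suc)
  qed
qed

lemma smooth_fun_cos_sin [intro, simp]:
  assumes "smooth_fun f"
  shows "smooth_fun (\<lambda>x. cos (f x))" and "smooth_fun (\<lambda>x. sin (f x))"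
proof -
  have "smooth_fun (\<lambda>x. [a (f x), b (f x), - a (f x), - b (f x)] ! (0 mod 4))"
    if "\<And>s. (a has_real_derivative b s) (at s)" "\<And>s. (b has_real_derivative - a s) (at s)" for a b
    by (rule smooth_fun_compose[where g = "\<lambda>n s. [a s, b s, - a s, - b s] ! (n mod 4)"])
       (use assms has_derivative_cycle4 that in auto)
  from this[of cos "\<lambda>s. - sin s"] this[of sin cos]
  show "smooth_fun (\<lambda>x. cos (f x))" "smooth_fun (\<lambda>x. sin (f x))"
    by (simp_all add: DERIV_minus[OF DERIV_sin])
qed

section \<open>The flat function exp(-1/s) and its derivatives\<close>

fun flat_poly :: "nat \<Rightarrow> real poly" where
  "flat_poly 0 = 1"
| "flat_poly (Suc n) = [:0, 0, 1:] * (flat_poly n - pderiv (flat_poly n))"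

text \<open>The \<open>n\<close>-th derivative of \<open>flat 0 s = exp (-1/s)\<close>, which vanishes for \<open>s \<le> 0\<close>.\<close>

definition flat :: "nat \<Rightarrow> real \<Rightarrow> real" where
  "flat n s = (if s > 0 then poly (flat_poly n) (1 / s) * exp (- 1 / s) else 0)"

lemma poly_div_exp_tendsto_0: "((\<lambda>r::real. poly P r * exp (- r)) \<longlongrightarrow> 0) at_top"
proof -
  have "((\<lambda>r. \<Sum>i\<le>degree P. coeff P i * (r ^ i / exp r)) \<longlongrightarrow> (\<Sum>i\<le>degree P. coeff P i * 0)) at_top"
    by (intro tendsto_intros tendsto_power_div_exp_0)
  moreover have "poly P r * exp (- r) = (\<Sum>i\<le>degree P. coeff P i * (r ^ i / exp r))" for r
    by (simp add: poly_altdef exp_minus sum_distrib_right divide_inverse mult.assoc)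
  ultimately show ?thesis by simp
qed

lemma flat_derivative_pos:
  assumes 2: "s > 0"
  shows "((\<lambda>s. poly (flat_poly n) (1 / s) * exp (- 1 / s)) has_real_derivative flat (Suc n) s) (at s)"
proof -
  \<comment> \<open>With r = 1/s this derivative is r^2 (P - P')(r) exp(-r), which is where the
    recursion for \<open>flat_poly\<close> comes from.\<close>
  have "((\<lambda>s. poly P (1 / s) * exp (- 1 / s)) has_real_derivative
     (poly (pderiv P) (1/s) * (- 1 / s\<^sup>2)) * exp (-1/s) + (exp (-1/s) * (1/s\<^sup>2)) * poly P (1/s)) (at s)" for P
    using 2 by (intro DERIV_mult DERIV_chain2[OF poly_DERIV] DERIV_chain2[OF DERIV_exp])
      (auto intro!: derivative_eq_intros simp: power2_eq_square)
  from this[of "flat_poly n"] show ?thesis using 2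
    by (simp add: flat_def power2_eq_square algebra_simps)
qed

text \<open>With r = 1/h the difference quotient is r P(r) exp(-r), where the factor
  \<open>[:0,1:]\<close> stands for the division by h; exponential decay beats the
  polynomial.\<close>

lemma flat_derivative_right: "((\<lambda>h. (flat n h - flat n 0) / (h - 0)) \<longlongrightarrow> 0) (at_right 0)"
proof -
    have "((\<lambda>h. poly ([:0,1:] * flat_poly n) (inverse h) * exp (- inverse h)) \<longlongrightarrow> 0) (at_right 0)"
      using filterlim_compose[OF poly_div_exp_tendsto_0 filterlim_inverse_at_top_right] .
    moreover have "\<forall>\<^sub>F h in at_right 0. poly ([:0,1:] * flat_poly n) (inverse h) * exp (- inverse h)
        = (flat n h - flat n 0) / (h - 0)"
      by (rule eventually_at_rightI[of 0 1]) (auto simp: flat_def divide_inverse)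
    ultimately show ?thesis
      by (rule Lim_transform_eventually)
qed

lemma flat_derivative_left: "((\<lambda>h. (flat n h - flat n 0) / (h - 0)) \<longlongrightarrow> 0) (at_left 0)"
proof -
  have "\<forall>\<^sub>F h in at_left 0. 0 = (flat n h - flat n 0) / (h - 0)"
    by (rule eventually_at_leftI[of "-1" 0]) (auto simp: flat_def)
  from Lim_transform_eventually[OF tendsto_const this] show ?thesis .
qed

lemma flat_derivative: "(flat n has_real_derivative flat (Suc n) s) (at s)"
proof -
  consider "s < 0" | "s > 0" | "s = 0" by linarith
  then show ?thesis
  proof cases
    case 1
    have "((\<lambda>_. 0) has_real_derivative flat (Suc n) s) (at s)"
      using 1 by (auto simp: flat_def)
    then show ?thesis
      by (rule has_field_derivative_transform_within_open[where S = "{..<0}"])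
         (use 1 in \<open>auto simp: flat_def\<close>)
  next
    case 2
    show ?thesis
      by (rule has_field_derivative_transform_within_open[OF flat_derivative_pos, where S = "{0<..}"])
         (use 2 in \<open>auto simp: flat_def\<close>)
  next
    case 3
    with flat_derivative_right[of n] flat_derivative_left[of n] show ?thesis
      unfolding has_field_derivative_iff by (intro filterlim_split_at) (simp_all add: flat_def)
  qed
qed

lemma smooth_fun_flat [intro, simp]: "smooth_fun f \<Longrightarrow> smooth_fun (\<lambda>x. flat n (f x))"
  by (rule smooth_fun_compose[where g = flat]) (rule flat_derivative)

lemma flat_0_bounds: "0 \<le> flat 0 s" "flat 0 s \<le> 1"
  by (auto simp: flat_def)

lemma flat_continuous: "continuous_on A (flat n)"
  by (intro continuous_at_imp_continuous_on ballI DERIV_isCont[OF flat_derivative])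

section \<open>Change of variables and integrability of exponentials\<close>

lemma integral_lborel_translate:
  fixes f :: "'a::euclidean_space \<Rightarrow> 'b::{banach, second_countable_topology}"
  shows "integral\<^sup>L lborel (\<lambda>x. f (x + a)) = integral\<^sup>L lborel f"
proof (cases "f \<in> borel_measurable borel")
  case True
  have "integral\<^sup>L lborel f = integral\<^sup>L (distr lborel borel ((+) a)) f"
    by (simp add: lborel_distr_plus)
  also have "\<dots> = integral\<^sup>L lborel (\<lambda>x. f (a + x))"
    using True by (intro integral_distr) auto
  finally show ?thesis by (simp add: add.commute)
next
  case False
  \<comment> \<open>Outside the measurable case both Bochner integrals take the default value 0;
    translating back shows that f and its translate fail to be measurable together.\<close>
  have "(\<lambda>x. f (x + a)) \<notin> borel_measurable borel"
  proof
    assume "(\<lambda>x. f (x + a)) \<in> borel_measurable borel"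
    then have "(\<lambda>x. f (x + a)) \<circ> (\<lambda>x. x - a) \<in> borel_measurable borel"
      by (intro measurable_comp[of _ _ borel]) auto
    then show False using False by (simp add: o_def)
  qed
  with False have "\<not> integrable lborel (\<lambda>x. f (x + a))" "\<not> integrable lborel f"
    using borel_measurable_integrable by auto
  then show ?thesis
    by (simp add: not_integrable_integral_eq)
qed

lemma nn_integral_lborel_translate:
  fixes f :: "'a::euclidean_space \<Rightarrow> ennreal"
  assumes [measurable]: "f \<in> borel_measurable borel"
  shows "(\<integral>\<^sup>+x. f (x + a) \<partial>lborel) = (\<integral>\<^sup>+x. f x \<partial>lborel)"
proof -
  have "(\<integral>\<^sup>+x. f x \<partial>lborel) = (\<integral>\<^sup>+x. f x \<partial>(distr lborel borel ((+) a)))"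
    by (simp add: lborel_distr_plus)
  also have "\<dots> = (\<integral>\<^sup>+x. f (a + x) \<partial>lborel)"
    by (intro nn_integral_distr) auto
  finally show ?thesis by (simp add: add.commute)
qed

lemma nn_integral_lborel_scale:
  fixes f :: "'a::euclidean_space \<Rightarrow> ennreal"
  assumes [measurable]: "f \<in> borel_measurable borel" and "c > 0"
  shows "(\<integral>\<^sup>+x. f x \<partial>lborel) = ennreal (c ^ DIM('a)) * (\<integral>\<^sup>+x. f (c *\<^sub>R x) \<partial>lborel)"
  using assms(2) by (subst lborel_affine[of c 0])
    (simp_all add: nn_integral_density nn_integral_distr nn_integral_cmult)

lemma integral_lborel_scale:
  fixes f :: "'a::euclidean_space \<Rightarrow> 'b::{banach, second_countable_topology}"
  assumes [measurable]: "f \<in> borel_measurable borel" and "c > 0"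
  shows "integral\<^sup>L lborel f = (c ^ DIM('a)) *\<^sub>R integral\<^sup>L lborel (\<lambda>x. f (c *\<^sub>R x))"
  using assms(2) by (subst lborel_affine[of c 0])
    (simp_all add: integral_density integral_distr)

lemma integrable_exp_abs:
  assumes "k > 0"
  shows "(\<integral>\<^sup>+t. ennreal (exp (- k * \<bar>t\<bar>)) \<partial>(lborel :: real measure)) < \<infinity>"
proof -
  have *: "(\<integral>\<^sup>+t\<in>{0..}. ennreal (exp (- k * t)) \<partial>lborel) < \<infinity>"
  proof -
    have "((\<lambda>t. - exp (- k * t) / k) \<longlongrightarrow> 0) at_top"
      using assms by real_asymp
    then have "(\<integral>\<^sup>+t\<in>{0..}. ennreal (exp (- k * t)) \<partial>lborel) = ennreal (0 - (- exp (- k * 0) / k))"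
      using assms
      by (intro nn_integral_FTC_atLeast) (auto intro!: derivative_eq_intros simp: field_simps)
    then show ?thesis by simp
  qed
  have "(\<integral>\<^sup>+t. ennreal (exp (- k * \<bar>t\<bar>)) \<partial>lborel) \<le>
     (\<integral>\<^sup>+t. ennreal (exp (- k * t)) * indicator {0..} t +
        ennreal (exp (- k * - t)) * indicator {0..} (- t) \<partial>lborel)"
    by (intro nn_integral_mono) (auto split: split_indicator)
  also have "\<dots> = (\<integral>\<^sup>+t\<in>{0..}. ennreal (exp (- k * t)) \<partial>lborel)
      + (\<integral>\<^sup>+t. ennreal (exp (- k * - t)) * indicator {0..} (- t) \<partial>lborel)"
    by (intro nn_integral_add) auto
  also have "(\<integral>\<^sup>+t. ennreal (exp (- k * - t)) * indicator {0..} (- t) \<partial>lborel) =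
     (\<integral>\<^sup>+t. ennreal (exp (- k * t)) * indicator {0..} t \<partial>lborel)"
    by (subst (2) nn_integral_real_affine[where c = "-1" and t = 0]) auto
  finally show ?thesis using * by (auto simp: ennreal_add_eq_top less_top[symmetric] top_unique)
qed

text \<open>The norm dominates the average of the coordinate moduli, so the integrand lies below a
  product of one-dimensional exponentials of rate k/d, whose integral factorises.\<close>

lemma integrable_exp_neg_norm:
  assumes "k > 0"
  shows "integrable lborel (\<lambda>x::'a::euclidean_space. exp (- k * norm x))"
proof (rule integrableI_bounded)
  let ?d = "real DIM('a)"
  have *: "k / ?d > 0" using assms by simp
  have "(\<integral>\<^sup>+x. ennreal (norm (exp (- k * norm x))) \<partial>(lborel :: 'a measure)) \<le>
     (\<integral>\<^sup>+x. (\<Prod>b\<in>Basis. ennreal (exp (- (k / ?d) * \<bar>x \<bullet> b\<bar>))) \<partial>(lborel :: 'a measure))"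
  proof (rule nn_integral_mono)
    fix x :: 'a
    have "(\<Sum>b\<in>Basis. \<bar>x \<bullet> b\<bar>) \<le> (\<Sum>b\<in>(Basis::'a set). norm x)"
      by (intro sum_mono Basis_le_norm) auto
    then have "(\<Sum>b\<in>Basis. (k / ?d) * \<bar>x \<bullet> b\<bar>) \<le> k * norm x"
      using * mult_left_mono[of "(\<Sum>b\<in>Basis. \<bar>x \<bullet> b\<bar>)" "?d * norm x" "k / ?d"]
      by (simp add: sum_distrib_left)
    then have "exp (- k * norm x) \<le> exp (\<Sum>b\<in>Basis. - (k / ?d) * \<bar>x \<bullet> b\<bar>)"
      by (simp add: sum_negf)
    then show "ennreal (norm (exp (- k * norm x))) \<le> (\<Prod>b\<in>Basis. ennreal (exp (- (k / ?d) * \<bar>x \<bullet> b\<bar>)))"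
      by (simp only: prod_ennreal exp_sum real_norm_def abs_exp_cancel ennreal_leI exp_ge_zero finite_Basis)
  qed
  also have "\<dots> = (\<Prod>b\<in>(Basis::'a set). (\<integral>\<^sup>+t. ennreal (exp (- (k / ?d) * \<bar>t\<bar>)) \<partial>lborel))"
    by (intro nn_integral_lborel_prod) auto
  also have "\<dots> < \<infinity>"
    using integrable_exp_abs[OF *] by (auto simp: less_top[symmetric] ennreal_prod_eq_top power_eq_top_ennreal)
  finally show "(\<integral>\<^sup>+x. ennreal (norm (exp (- k * norm x))) \<partial>(lborel :: 'a measure)) < \<infinity>" .
qed simp

lemma nn_integral_translate_minus:
  fixes f :: "'a::euclidean_space \<Rightarrow> ennreal"
  assumes [measurable]: "f \<in> borel_measurable borel"
  shows "(\<integral>\<^sup>+x. f (a - x) \<partial>lborel) = (\<integral>\<^sup>+x. f x \<partial>lborel)"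
  by (subst (2) lborel_affine[of "-1" a]) (simp_all add: nn_integral_density nn_integral_distr)

section \<open>Smooth bumps and the fundamental lemma of the calculus of variations\<close>

definition box_bump :: "real \<Rightarrow> real^'d \<Rightarrow> real^'d \<Rightarrow> real^'d \<Rightarrow> real" where
  "box_bump n a b x = (\<Prod>i\<in>UNIV. flat 0 (n * (x $ i - a $ i)) * flat 0 (n * (b $ i - x $ i)))"

lemma box_bump_bounds: "0 \<le> box_bump n a b x" "box_bump n a b x \<le> 1"
  unfolding box_bump_def
  by (auto intro!: prod_nonneg prod_le_1 mult_le_one simp: flat_0_bounds)

lemma box_bump_zero:
  assumes "0 \<le> n" "x \<notin> box a b"
  shows "box_bump n a b x = 0"
proof -
  from assms obtain i where "x $ i \<le> a $ i \<or> b $ i \<le> x $ i"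
    by (auto simp: mem_box_cart not_less)
  then have "flat 0 (n * (x $ i - a $ i)) * flat 0 (n * (b $ i - x $ i)) = 0"
    using assms(1) by (auto simp: flat_def zero_less_mult_iff)
  then show ?thesis unfolding box_bump_def by (intro prod_zero) auto
qed

lemma test_fun_box_bump:
  assumes "0 \<le> n"
  shows "test_fun (box_bump n a b)"
proof -
  have "closure {x. box_bump n a b x \<noteq> 0} \<subseteq> cbox a b"
  proof (rule closure_minimal)
    show "{x. box_bump n a b x \<noteq> 0} \<subseteq> cbox a b"
      using box_bump_zero[OF assms] box_subset_cbox by blast
  qed (rule closed_cbox)
  then have "compact (closure {x. box_bump n a b x \<noteq> 0})"
    by (meson bounded_cbox bounded_subset closed_closure compact_eq_bounded_closed)
  moreover have "smooth_fun (box_bump n a b)"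
    unfolding box_bump_def[abs_def]
    by (intro smooth_fun_prod smooth_fun_mult smooth_fun_flat smooth_fun_diff smooth_fun_const smooth_fun_nth)
  ultimately show ?thesis by (simp add: test_fun_def)
qed

lemma flat_0_tendsto_1: "s > 0 \<Longrightarrow> (\<lambda>n. flat 0 (real n * s)) \<longlonglongrightarrow> 1"
proof -
  assume s: "s > 0"
  have "(\<lambda>n. exp (- 1 / (real n * s))) \<longlonglongrightarrow> 1"
    using s by real_asymp
  then show ?thesis
    by (rule Lim_transform_eventually)
       (use s in \<open>auto simp: flat_def intro!: eventually_sequentiallyI[of 1]\<close>)
qed

text \<open>For s > 0 the factor \<open>flat 0 (n * s)\<close> is exp(-1/(n s)), which tends to 1.
  Scaling the argument thus approximates the indicator of a box by test functions bounded by 1,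
  without mollification.\<close>

lemma box_bump_tendsto: "(\<lambda>n. box_bump (real n) a b x) \<longlonglongrightarrow> indicator (box a b) x"
proof (cases "x \<in> box a b")
  case True
  then have "(\<lambda>n. box_bump (real n) a b x) \<longlonglongrightarrow> (\<Prod>i\<in>(UNIV::'a set). 1 * 1)"
    unfolding box_bump_def by (intro tendsto_intros flat_0_tendsto_1) (auto simp: mem_box_cart)
  with True show ?thesis by simp
qed (simp add: box_bump_zero)

lemma test_fun_continuous: "test_fun f \<Longrightarrow> continuous_on A f"
  by (simp add: test_fun_def smooth_fun_continuous)

lemma test_fun_measurable [measurable_dest]: "test_fun f \<Longrightarrow> f \<in> borel_measurable borel"
  by (intro borel_measurable_continuous_onI test_fun_continuous)

lemma fundamental_lemma_box:
  fixes u :: "real^'d \<Rightarrow> real"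
  assumes int: "\<And>K. compact K \<Longrightarrow> set_integrable lborel K u"
    and u[measurable]: "u \<in> borel_measurable borel"
    and test: "\<And>\<phi>. test_fun \<phi> \<Longrightarrow> (\<integral>x. \<phi> x * u x \<partial>lborel) = 0"
  shows "(\<integral>x. indicator (box a b) x * u x \<partial>lborel) = 0"
proof -
  have [measurable]: "box_bump (real n) a b \<in> borel_measurable borel" for n
    by (rule test_fun_measurable[OF test_fun_box_bump]) simp
  have "(\<lambda>n. \<integral>x. box_bump (real n) a b x * u x \<partial>lborel) \<longlonglongrightarrow> (\<integral>x. indicator (box a b) x * u x \<partial>lborel)"
  proof (rule integral_dominated_convergence)
    show "integrable lborel (\<lambda>x. norm (indicator (cbox a b) x *\<^sub>R u x))"
      using int[OF compact_cbox, unfolded set_integrable_def] by (rule integrable_norm)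
    show "AE x in lborel. (\<lambda>n. box_bump (real n) a b x * u x) \<longlonglongrightarrow> indicator (box a b) x * u x"
      by (intro AE_I2 tendsto_intros box_bump_tendsto)
    fix n
    show "AE x in lborel. norm (box_bump (real n) a b x * u x) \<le> norm (indicator (cbox a b) x *\<^sub>R u x)"
    proof (intro AE_I2)
      fix x
      show "norm (box_bump (real n) a b x * u x) \<le> norm (indicator (cbox a b) x *\<^sub>R u x)"
        using box_bump_bounds[of "real n" a b x] box_bump_zero[of "real n" x a b]
          subsetD[OF box_subset_cbox, of x a b]
        by (cases "x \<in> box a b") (auto simp: abs_mult mult_left_le_one_le)
    qed
  qed auto
  moreover have "(\<integral>x. box_bump (real n) a b x * u x \<partial>lborel) = 0" for n
    by (intro test test_fun_box_bump) simp
  ultimately show ?thesis by (simp add: LIMSEQ_const_iff)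
qed

text \<open>The positive and negative parts of u, cut to a large box, are densities of two measures
  that agree on all open boxes. Boxes are stable under intersection and generate the Borel sets, so
  the measures and then the densities coincide; a number with equal positive and negative part is
  0.\<close>

lemma fundamental_lemma_real:
  fixes u :: "real^'d \<Rightarrow> real"
  assumes int: "\<And>K. compact K \<Longrightarrow> set_integrable lborel K u"
    and u[measurable]: "u \<in> borel_measurable borel"
    and test: "\<And>\<phi>. test_fun \<phi> \<Longrightarrow> (\<integral>x. \<phi> x * u x \<partial>lborel) = 0"
  shows "AE x in lborel. u x = 0"
proof -
  define B :: "nat \<Rightarrow> (real^'d) set" where "B N = box (- (\<chi> i. real N)) (\<chi> i. real N)" for N
  have B[measurable]: "B N \<in> sets borel" for N by (simp add: B_def)
  have "AE x in lborel. x \<in> B N \<longrightarrow> u x = 0" for N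
  proof -
    define p where "p x = ennreal (u x) * indicator (B N) x" for x
    define m where "m x = ennreal (- u x) * indicator (B N) x" for x
    have [measurable]: "p \<in> borel_measurable borel" "m \<in> borel_measurable borel"
      by (simp_all add: p_def[abs_def] m_def[abs_def])
    have boxes: "emeasure (density lborel p) X = emeasure (density lborel m) X
       \<and> emeasure (density lborel p) X < \<infinity>" if "X = box a b" for X a b
    proof -
      obtain c d where cd: "box a b \<inter> B N = box c d" unfolding B_def
        by (auto simp: box_Int_box)
      have i: "integrable lborel (\<lambda>x. indicator (box c d) x * u x)"
        using set_integrable_subset[OF int[OF compact_cbox] _ box_subset_cbox, of c d]
        by (simp add: set_integrable_def)
      have p: "(\<integral>\<^sup>+x. ennreal (indicator (box c d) x * u x) \<partial>lborel) = emeasure (density lborel p) X"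
        using that cd[symmetric] by (auto simp: emeasure_density p_def intro!: nn_integral_cong split: split_indicator)
      have m: "(\<integral>\<^sup>+x. ennreal (- (indicator (box c d) x * u x)) \<partial>lborel) = emeasure (density lborel m) X"
        using that cd[symmetric] by (auto simp: emeasure_density m_def intro!: nn_integral_cong split: split_indicator)
      from i have fin: "emeasure (density lborel p) X < \<infinity>" "emeasure (density lborel m) X < \<infinity>"
        unfolding p[symmetric] m[symmetric] real_integrable_def by (auto simp: less_top)
      have "enn2real (emeasure (density lborel p) X) - enn2real (emeasure (density lborel m) X) = 0"
        using fundamental_lemma_box[OF assms, of c d] unfolding real_lebesgue_integral_def[OF i] p m by simp
      with fin show ?thesis
        by (auto simp: less_top[symmetric]) (metis ennreal_enn2real_if infinity_ennreal_def)
    qed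
    have "density lborel p = density lborel m"
    proof (rule measure_eqI_generator_eq)
      let ?E = "range (\<lambda>(a, b). box a b :: (real^'d) set)"
      show "Int_stable ?E"
        by (auto simp: Int_stable_def box_Int_box)
      show "?E \<subseteq> Pow UNIV" "sets (density lborel p) = sigma_sets UNIV ?E" "sets (density lborel m) = sigma_sets UNIV ?E"
        by (simp_all add: borel_eq_box)
      let ?A = "\<lambda>n::nat. box (- (real n *\<^sub>R One)) (real n *\<^sub>R One) :: (real^'d) set"
      show "range ?A \<subseteq> ?E" "(\<Union>i. ?A i) = UNIV"
        unfolding UN_box_eq_UNIV by auto
      show "emeasure (density lborel p) X = emeasure (density lborel m) X" if "X \<in> ?E" for X
        using that boxes by auto
      show "emeasure (density lborel p) (?A i) \<noteq> \<infinity>" for i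
        using boxes[OF refl, of "- (real i *\<^sub>R One)" "real i *\<^sub>R One"] by auto
    qed
    then have "AE x in lborel. p x = m x"
      by (intro sigma_finite_measure.density_unique[OF lborel.sigma_finite_measure_axioms]) auto
    then show ?thesis
    proof eventually_elim
      case (elim x)
      then show ?case
        by (auto simp: p_def m_def) (metis ennreal_eq_0_iff ennreal_neg linorder_linear neg_le_0_iff_le order_antisym)
    qed
  qed
  then have "AE x in lborel. \<forall>N. x \<in> B N \<longrightarrow> u x = 0"
    by (subst AE_all_countable) blast
  then show ?thesis
  proof eventually_elim
    case (elim x)
    obtain N where N: "norm x < real N" using reals_Archimedean2 by blast
    have "\<bar>x $ i\<bar> < real N" for i
      using component_le_norm_cart[of x i] N by linarith
    then have "x \<in> B N" by (auto simp: B_def mem_box_cart abs_less_iff minus_less_iff)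
    with elim show ?case by blast
  qed
qed

lemma test_fun_vanish_outside:
  assumes "test_fun f"
  obtains r where "r > 0" "\<And>x. norm x \<ge> r \<Longrightarrow> f x = 0" "\<And>i x. norm x \<ge> r \<Longrightarrow> pderiv_fun f i x = 0"
proof -
  let ?K = "closure {x. f x \<noteq> 0}"
  have "bounded ?K" using assms by (simp add: test_fun_def compact_imp_bounded)
  then obtain r where r: "r > 0" "\<And>x. x \<in> ?K \<Longrightarrow> norm x < r"
    by (meson bounded_pos_less)
  have 0: "f x = 0" if "norm x \<ge> r" for x
    using r(2)[of x] that closure_subset[of "{x. f x \<noteq> 0}"] by fastforce
  moreover have "pderiv_fun f i x = 0" if "norm x \<ge> r" for x i
  proof -
    \<comment> \<open>Points of the support satisfy the strict bound norm < r, so a point with norm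
      at least r lies in an open set on which f vanishes.\<close>
    have "x \<in> - ?K" using r(2)[of x] that by auto
    have "(f has_derivative (\<lambda>_. 0)) (at x)"
      by (rule has_derivative_transform_within_open[of "\<lambda>_. 0" _ x UNIV "- ?K"])
         (use \<open>x \<in> - ?K\<close> closure_subset[of "{x. f x \<noteq> 0}"] in auto)
    then show ?thesis by (simp add: pderiv_fun_eqI)
  qed
  ultimately show ?thesis using that r(1) by blast
qed

lemma test_fun_pderiv:
  assumes "test_fun f"
  shows "test_fun (pderiv_fun f i)"
proof -
  obtain r where r: "r > 0" "\<And>i x. norm x \<ge> r \<Longrightarrow> pderiv_fun f i x = 0"
    using test_fun_vanish_outside[OF assms] by metis
  have "closure {x. pderiv_fun f i x \<noteq> 0} \<subseteq> cball 0 r"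
  proof (rule closure_minimal)
    show "{x. pderiv_fun f i x \<noteq> 0} \<subseteq> cball 0 r"
      using r(2) by (force simp: not_le[symmetric])
  qed simp
  then have "compact (closure {x. pderiv_fun f i x \<noteq> 0})"
    by (meson bounded_cball bounded_subset closed_closure compact_eq_bounded_closed)
  with assms show ?thesis by (simp add: test_fun_def)
qed

lemma test_fun_mult:
  assumes "test_fun f" "smooth_fun g"
  shows "test_fun (\<lambda>x. f x * g x)"
proof -
  have "closure {x. f x * g x \<noteq> 0} \<subseteq> closure {x. f x \<noteq> 0}"
    by (intro closure_mono) auto
  then have "compact (closure {x. f x * g x \<noteq> 0})"
    using assms(1) unfolding test_fun_def
    by (meson bounded_subset closed_closure compact_eq_bounded_closed)
  with assms show ?thesis by (simp add: test_fun_def)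
qed

lemma test_fun_bounded:
  assumes "test_fun f"
  obtains C where "C > 0" "\<And>x. \<bar>f x\<bar> \<le> C"
proof -
  obtain r where r: "r > 0" "\<And>x. norm x \<ge> r \<Longrightarrow> f x = 0"
    using test_fun_vanish_outside[OF assms] by metis
  have "bounded (f ` cball 0 r)"
    by (intro compact_imp_bounded compact_continuous_image test_fun_continuous assms) auto
  then obtain C where C: "C > 0" "\<And>x. norm x \<le> r \<Longrightarrow> \<bar>f x\<bar> \<le> C"
    by (auto simp: bounded_pos image_iff)
  have "\<bar>f x\<bar> \<le> C" for x using C r(2)[of x] by (cases "norm x \<le> r") auto
  with C(1) that show ?thesis by blast
qed

text \<open>Difference quotients integrate to 0 by translation invariance. The mean value theorem
  bounds them uniformly on a fixed ball, and dominated convergence passes to the derivative.\<close>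

lemma integral_pderiv_test_fun:
  assumes "test_fun f"
  shows "(\<integral>x. pderiv_fun f i x \<partial>lborel) = 0"
proof -
  obtain r where r: "r > 0" "\<And>x. norm x \<ge> r \<Longrightarrow> f x = 0"
    using test_fun_vanish_outside[OF assms] by metis
  obtain C where C: "C > 0" "\<And>x. \<bar>pderiv_fun f i x\<bar> \<le> C"
    using test_fun_bounded[OF test_fun_pderiv[OF assms]] by metis
  note [measurable] = test_fun_measurable[OF assms] test_fun_measurable[OF test_fun_pderiv[OF assms]]
  have fi: "integrable lborel f"
  proof -
    have "integrable lborel (\<lambda>x. indicator (cball 0 r) x *\<^sub>R f x)"
      using borel_integrable_compact[OF compact_cball[of 0 r] test_fun_continuous[OF assms]]
      by (simp add: indicator_def if_distrib cong: if_cong)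
    also have "(\<lambda>x. indicator (cball 0 r) x *\<^sub>R f x) = f"
      using r(2) by (fastforce simp: fun_eq_iff split: split_indicator)
    finally show ?thesis .
  qed
  let ?e = "axis i 1 :: real^'a"
  have dir: "((\<lambda>t. f (x + t *\<^sub>R ?e)) has_real_derivative pderiv_fun f i (x + t *\<^sub>R ?e)) (at t)" for x t
  proof -
    have "(f has_derivative frechet_derivative f (at (x + t *\<^sub>R ?e))) (at (x + t *\<^sub>R ?e))"
      using assms by (simp add: test_fun_def smooth_fun_differentiable frechet_derivative_works[symmetric])
    moreover have "((\<lambda>t. x + t *\<^sub>R ?e) has_derivative (\<lambda>t. t *\<^sub>R ?e)) (at t)"
      by (auto intro!: derivative_eq_intros)
    ultimately have "((\<lambda>t. f (x + t *\<^sub>R ?e)) has_derivative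
        (\<lambda>s. frechet_derivative f (at (x + t *\<^sub>R ?e)) (s *\<^sub>R ?e))) (at t)"
      using has_derivative_compose by fastforce
    moreover have "(\<lambda>s. frechet_derivative f (at (x + t *\<^sub>R ?e)) (s *\<^sub>R ?e)) = (*) (pderiv_fun f i (x + t *\<^sub>R ?e))"
      using assms by (simp add: fun_eq_iff pderiv_fun_def test_fun_def
        linear_cmul[OF linear_frechet_derivative] smooth_fun_differentiable)
    ultimately show ?thesis by (simp add: has_field_derivative_def)
  qed
  define q where "q n x = (f (x + (1 / real (Suc n)) *\<^sub>R ?e) - f x) * real (Suc n)" for n x
  have "(\<lambda>n. \<integral>x. q n x \<partial>lborel) \<longlonglongrightarrow> (\<integral>x. pderiv_fun f i x \<partial>lborel)"
  proof (rule integral_dominated_convergence)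
    \<comment> \<open>The increments have length at most 1, so all quotients vanish outside the ball
      of radius r + 1.\<close>
    show "integrable lborel (\<lambda>x. C * indicator (cball 0 (r + 1)) x :: real)"
      by (intro integrable_mult_right integrable_real_indicator) (use emeasure_bounded_finite[OF bounded_cball] in auto)
    show "AE x in lborel. (\<lambda>n. q n x) \<longlonglongrightarrow> pderiv_fun f i x"
    proof (intro AE_I2)
      fix x
      have "((\<lambda>h. (f (x + (0 + h) *\<^sub>R ?e) - f (x + 0 *\<^sub>R ?e)) / h) \<longlongrightarrow> pderiv_fun f i (x + 0 *\<^sub>R ?e)) (at 0)"
        using dir[of x 0] by (rule DERIV_D)
      then have "((\<lambda>h. (f (x + h *\<^sub>R ?e) - f x) / h) \<longlongrightarrow> pderiv_fun f i x) (at 0)" by simp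
      moreover have "filterlim (\<lambda>n. 1 / real (Suc n)) (at 0) sequentially"
        by real_asymp
      ultimately have "(\<lambda>n. (f (x + (1 / real (Suc n)) *\<^sub>R ?e) - f x) / (1 / real (Suc n))) \<longlonglongrightarrow> pderiv_fun f i x"
        by (rule filterlim_compose)
      then show "(\<lambda>n. q n x) \<longlonglongrightarrow> pderiv_fun f i x"
        by (simp add: q_def)
    qed
    fix n
    show "AE x in lborel. norm (q n x) \<le> C * indicator (cball 0 (r + 1)) x"
    proof (intro AE_I2)
      fix x
      define h where "h = 1 / real (Suc n)"
      have h: "0 < h" "h \<le> 1" by (simp_all add: h_def)
      have q: "q n x = (f (x + h *\<^sub>R ?e) - f (x + 0 *\<^sub>R ?e)) / h" by (simp add: q_def h_def)
      obtain z where "f (x + h *\<^sub>R ?e) - f (x + 0 *\<^sub>R ?e) = (h - 0) * pderiv_fun f i (x + z *\<^sub>R ?e)"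
        using MVT2[OF h(1), of "\<lambda>t. f (x + t *\<^sub>R ?e)", OF dir] by blast
      then have "\<bar>q n x\<bar> \<le> C" using C(2) h by (simp add: q)
      moreover have "q n x = 0" if "norm x > r + 1"
      proof -
        have "norm x \<le> norm (x + h *\<^sub>R ?e) + norm (h *\<^sub>R ?e)"
          using norm_triangle_ineq4[of "x + h *\<^sub>R ?e" "h *\<^sub>R ?e"] by simp
        then have "norm (x + h *\<^sub>R ?e) \<ge> r" using h that by simp
        with that show ?thesis by (simp add: q r(2))
      qed
      ultimately show "norm (q n x) \<le> C * indicator (cball 0 (r + 1)) x"
        by (cases "norm x > r + 1") (simp_all add: indicator_def)
    qed
  qed (simp_all add: q_def[abs_def])
  moreover have "(\<integral>x. q n x \<partial>lborel) = 0" for n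
  proof -
    have "integrable lborel (\<lambda>x. f (x + (1 / real (Suc n)) *\<^sub>R ?e))"
    proof -
      have "integrable (distr lborel borel ((+) ((1 / real (Suc n)) *\<^sub>R ?e))) f"
        using fi by (simp add: lborel_distr_plus)
      then show ?thesis by (subst (asm) integrable_distr_eq) (auto simp: add.commute)
    qed
    then show ?thesis using fi unfolding q_def
      by (simp add: Bochner_Integration.integral_diff integral_lborel_translate)
  qed
  ultimately show ?thesis by (simp add: LIMSEQ_const_iff)
qed

section \<open>Weak derivatives\<close>

abbreviation locally_integrable :: "('a::euclidean_space \<Rightarrow> 'b::{banach, second_countable_topology}) \<Rightarrow> bool" where
  "locally_integrable u \<equiv> \<forall>K. compact K \<longrightarrow> set_integrable lborel K u"

text \<open>Truncations to balls of integer radius are integrable, hence measurable, and at each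
  point they are eventually equal to u.\<close>

lemma locally_integrable_measurable:
  fixes u :: "'a::euclidean_space \<Rightarrow> 'b::{banach, second_countable_topology}"
  assumes "locally_integrable u"
  shows "u \<in> borel_measurable borel"
proof (rule borel_measurable_LIMSEQ_metric)
  have "integrable lborel (\<lambda>x. indicator (cball 0 (real n)) x *\<^sub>R u x)" for n
    using assms by (simp add: set_integrable_def)
  from borel_measurable_integrable[OF this]
  show "(\<lambda>x. indicator (cball 0 (real n)) x *\<^sub>R u x) \<in> borel_measurable borel" for n
    by simp
  fix x :: 'a
  obtain N where N: "norm x < real N" using reals_Archimedean2 by blast
  have "\<forall>\<^sub>F n in sequentially. u x = indicator (cball 0 (real n)) x *\<^sub>R u x"
    using N by (intro eventually_sequentiallyI[of N]) auto
  then show "(\<lambda>n. indicator (cball 0 (real n)) x *\<^sub>R u x) \<longlonglongrightarrow> u x"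
    by (rule Lim_transform_eventually[OF tendsto_const])
qed

lemma integrable_test_fun_scaleR:
  fixes u :: "real^'d \<Rightarrow> 'b::{banach, second_countable_topology}"
  assumes "test_fun \<phi>" "locally_integrable u"
  shows "integrable lborel (\<lambda>x. \<phi> x *\<^sub>R u x)"
proof -
  note [measurable] = test_fun_measurable[OF assms(1)] locally_integrable_measurable[OF assms(2)]
  obtain r where r: "r > 0" "\<And>x. norm x \<ge> r \<Longrightarrow> \<phi> x = 0"
    using test_fun_vanish_outside[OF assms(1)] by metis
  obtain C where C: "C > 0" "\<And>x. \<bar>\<phi> x\<bar> \<le> C" using test_fun_bounded[OF assms(1)] by metis
  show ?thesis
  proof (rule Bochner_Integration.integrable_bound)
    show "integrable lborel (\<lambda>x. C * norm (indicator (cball 0 r) x *\<^sub>R u x))"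
      using assms(2) compact_cball[of "0::real^'d" r] unfolding set_integrable_def
      by (intro integrable_mult_right integrable_norm) auto
    show "AE x in lborel. norm (\<phi> x *\<^sub>R u x) \<le> norm (C * norm (indicator (cball 0 r) x *\<^sub>R u x))"
    proof (intro AE_I2)
      fix x
      show "norm (\<phi> x *\<^sub>R u x) \<le> norm (C * norm (indicator (cball 0 r) x *\<^sub>R u x))"
        using C r(2)[of x] by (cases "norm x \<le> r") (auto simp: mult_right_mono)
    qed
  qed simp
qed

text \<open>The weak derivatives of the problem are tested with real functions, whereas the kernels
  are complex Gaussians. Coding complex test functions by real and imaginary part extends the
  defining identity by linearity.\<close>

definition ctest :: "(real^'d \<Rightarrow> complex) \<Rightarrow> bool" where
  "ctest \<phi> \<longleftrightarrow> test_fun (\<lambda>x. Re (\<phi> x)) \<and> test_fun (\<lambda>x. Im (\<phi> x))"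

definition csmooth :: "(real^'d \<Rightarrow> complex) \<Rightarrow> bool" where
  "csmooth \<phi> \<longleftrightarrow> smooth_fun (\<lambda>x. Re (\<phi> x)) \<and> smooth_fun (\<lambda>x. Im (\<phi> x))"

definition cpderiv :: "'d \<Rightarrow> (real^'d \<Rightarrow> complex) \<Rightarrow> real^'d \<Rightarrow> complex" where
  "cpderiv i \<phi> x = Complex (pderiv_fun (\<lambda>x. Re (\<phi> x)) i x) (pderiv_fun (\<lambda>x. Im (\<phi> x)) i x)"

lemma ctest_cpderiv: "ctest \<phi> \<Longrightarrow> ctest (cpderiv i \<phi>)"
  by (simp add: ctest_def cpderiv_def test_fun_pderiv)

lemma cpderiv_eqI:
  assumes "(\<phi> has_derivative D) (at x)"
  shows "cpderiv i \<phi> x = D (axis i 1)"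
  using pderiv_fun_eqI[OF has_derivative_Re[OF assms]] pderiv_fun_eqI[OF has_derivative_Im[OF assms]]
  by (simp add: cpderiv_def complex_eq_iff)

lemma ctest_scaleR: "test_fun h \<Longrightarrow> csmooth E \<Longrightarrow> ctest (\<lambda>x. h x *\<^sub>R E x)"
  by (simp add: ctest_def csmooth_def test_fun_mult)

lemma ctest_scaleR': "ctest \<phi> \<Longrightarrow> smooth_fun g \<Longrightarrow> ctest (\<lambda>x. g x *\<^sub>R \<phi> x)"
  using test_fun_mult[of "\<lambda>x. Re (\<phi> x)" g] test_fun_mult[of "\<lambda>x. Im (\<phi> x)" g]
  by (simp add: ctest_def mult.commute)

lemma ctest_has_derivative:
  assumes "ctest \<phi>"
  obtains D where "(\<phi> has_derivative D) (at x)"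
proof -
  obtain D1 D2 where "((\<lambda>x. Re (\<phi> x)) has_derivative D1) (at x)" "((\<lambda>x. Im (\<phi> x)) has_derivative D2) (at x)"
    using assms unfolding ctest_def test_fun_def by (metis smooth_fun_differentiable differentiable_def)
  from has_derivative_add[OF has_derivative_of_real[OF this(1)] has_derivative_mult_right[OF has_derivative_of_real[OF this(2)], of \<i>]]
  have "((\<lambda>x. complex_of_real (Re (\<phi> x)) + \<i> * complex_of_real (Im (\<phi> x))) has_derivative
     (\<lambda>h. complex_of_real (D1 h) + \<i> * complex_of_real (D2 h))) (at x)" .
  then show ?thesis using that by (simp add: complex_eq[symmetric])
qed

definition weak_deriv :: "'d \<Rightarrow> (real^'d \<Rightarrow> complex) \<Rightarrow> (real^'d \<Rightarrow> complex) \<Rightarrow> bool" where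
  "weak_deriv i u w \<longleftrightarrow> locally_integrable u \<and> locally_integrable w \<and>
     (\<forall>\<phi>. test_fun \<phi> \<longrightarrow> (\<integral>x. pderiv_fun \<phi> i x *\<^sub>R u x \<partial>lborel) = - (\<integral>x. \<phi> x *\<^sub>R w x \<partial>lborel))"

text \<open>A bounded linear map commutes with both integrals. It is applied with \<open>l\<close> a
  coordinate in the common eigenbasis, which turns the system into scalar weak equations.\<close>

lemma weak_pderiv_component:
  assumes "weak_pderiv i u w" and l: "bounded_linear l"
  shows "weak_deriv i (\<lambda>x. l (u x)) (\<lambda>x. l (w x))"
proof -
  have l2: "locally_integrable (\<lambda>x. l (h x))" if "locally_integrable h" for h :: "real^'a \<Rightarrow> complex^'b"
    using that by (auto simp: set_integrable_def linear_cmul[OF bounded_linear.linear[OF l], symmetric]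
        intro!: integrable_bounded_linear[OF l])
  have u: "locally_integrable u" "locally_integrable w"
    using assms by (auto simp: weak_pderiv_def loc_integrable_def)
  have "(\<integral>x. pderiv_fun \<phi> i x *\<^sub>R l (u x) \<partial>lborel) = - (\<integral>x. \<phi> x *\<^sub>R l (w x) \<partial>lborel)" if "test_fun \<phi>" for \<phi>
  proof -
    have "(\<integral>x. l (pderiv_fun \<phi> i x *\<^sub>R u x) \<partial>lborel) = l (\<integral>x. pderiv_fun \<phi> i x *\<^sub>R u x \<partial>lborel)"
      by (intro integral_bounded_linear l integrable_test_fun_scaleR u test_fun_pderiv that)
    moreover have "(\<integral>x. l (\<phi> x *\<^sub>R w x) \<partial>lborel) = l (\<integral>x. \<phi> x *\<^sub>R w x \<partial>lborel)"
      by (intro integral_bounded_linear l integrable_test_fun_scaleR u that)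
    ultimately show ?thesis using assms(1) that
      by (simp add: weak_pderiv_def linear_cmul[OF bounded_linear.linear[OF l]] linear_neg[OF bounded_linear.linear[OF l]])
  qed
  with l2 u show ?thesis by (simp add: weak_deriv_def)
qed

lemma integrable_ctest_mult:
  assumes "ctest \<phi>" "locally_integrable (u :: real^'d \<Rightarrow> complex)"
  shows "integrable lborel (\<lambda>x. \<phi> x * u x)"
proof -
  have "integrable lborel (\<lambda>x. Re (\<phi> x) *\<^sub>R u x + \<i> * (Im (\<phi> x) *\<^sub>R u x))"
    using assms by (intro Bochner_Integration.integrable_add integrable_mult_right integrable_test_fun_scaleR) (auto simp: ctest_def)
  moreover have "Re (\<phi> x) *\<^sub>R u x + \<i> * (Im (\<phi> x) *\<^sub>R u x) = \<phi> x * u x" for x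
    by (simp add: complex_eq_iff)
  ultimately show ?thesis by simp
qed

lemma integral_ctest_mult:
  assumes "ctest \<phi>" "locally_integrable (u :: real^'d \<Rightarrow> complex)"
  shows "(\<integral>x. \<phi> x * u x \<partial>lborel) = (\<integral>x. Re (\<phi> x) *\<^sub>R u x \<partial>lborel) + \<i> * (\<integral>x. Im (\<phi> x) *\<^sub>R u x \<partial>lborel)"
proof -
  have "(\<integral>x. \<phi> x * u x \<partial>lborel) = (\<integral>x. Re (\<phi> x) *\<^sub>R u x + \<i> * (Im (\<phi> x) *\<^sub>R u x) \<partial>lborel)"
    by (intro Bochner_Integration.integral_cong) (auto simp: complex_eq_iff)
  also have "\<dots> = (\<integral>x. Re (\<phi> x) *\<^sub>R u x \<partial>lborel) + (\<integral>x. \<i> * (Im (\<phi> x) *\<^sub>R u x) \<partial>lborel)"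
    using assms by (intro Bochner_Integration.integral_add integrable_mult_right integrable_test_fun_scaleR) (auto simp: ctest_def)
  finally show ?thesis by (simp only: integral_mult_right_zero)
qed

lemma weak_deriv_ctest:
  assumes "weak_deriv i u w" "ctest \<phi>"
  shows "(\<integral>x. cpderiv i \<phi> x * u x \<partial>lborel) = - (\<integral>x. \<phi> x * w x \<partial>lborel)"
  using assms(1) assms(2)[unfolded ctest_def]
  unfolding integral_ctest_mult[OF assms(2) conjunct1[OF conjunct2[OF assms(1)[unfolded weak_deriv_def]]]]
    integral_ctest_mult[OF ctest_cpderiv[OF assms(2)] conjunct1[OF assms(1)[unfolded weak_deriv_def]]]
  by (simp add: weak_deriv_def cpderiv_def)

lemma skew_inner_zero:
  fixes S :: "real^'d^'d"
  assumes "transpose S = - S"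
  shows "(S *v x) \<bullet> x = 0" and "S $ i $ i = 0" and "(S *v x) \<bullet> y = - (x \<bullet> (S *v y))"
proof -
  show *: "(S *v x) \<bullet> y = - (x \<bullet> (S *v y))" for x y
  proof -
    have "(transpose S *v x) \<bullet> y = x \<bullet> (S *v y)"
      by (simp add: dot_lmul_matrix)
    moreover have "(- S) *v x = - (S *v x)"
      by (simp add: vec_eq_iff matrix_vector_mult_def sum_negf)
    ultimately show ?thesis using assms by simp
  qed
  show "(S *v x) \<bullet> x = 0" using *[of x x] by (simp add: inner_commute)
  have "S $ i $ i = - S $ i $ i"
    using arg_cong[OF assms, of "\<lambda>M. M $ i $ i"] by (simp add: transpose_def)
  then show "S $ i $ i = 0" by simp
qed

lemma smooth_fun_matrix_vector: "smooth_fun (\<lambda>x. (S *v x) $ i)"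
  by (simp add: matrix_vector_mult_def)

text \<open>All derivatives move onto the test function. The drift merely changes sign, because the
  divergence of S x is the trace of S and skewness makes it 0.\<close>

lemma weak_equation:
  fixes w f :: "real^'d \<Rightarrow> complex" and S :: "real^'d^'d"
  assumes S: "transpose S = - S"
    and 1: "\<And>i. weak_deriv i w (Dw i)" and 2: "\<And>i. weak_deriv i (Dw i) (D2 i)"
    and eq: "AE x in lborel. f x = c * w x - a * (\<Sum>i\<in>UNIV. D2 i x) - (\<Sum>i\<in>UNIV. (S *v x) $ i *\<^sub>R Dw i x)"
    and f[measurable]: "f \<in> borel_measurable borel"
    and \<phi>: "ctest \<phi>"
  shows "(\<integral>x. \<phi> x * f x \<partial>lborel) =
    (\<integral>x. (c * \<phi> x - a * (\<Sum>i\<in>UNIV. cpderiv i (cpderiv i \<phi>) x)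
       + (\<Sum>i\<in>UNIV. (S *v x) $ i *\<^sub>R cpderiv i \<phi> x)) * w x \<partial>lborel)"
proof -
  have li: "locally_integrable w" "\<And>i. locally_integrable (Dw i)" "\<And>i. locally_integrable (D2 i)"
    using 1 2 by (auto simp: weak_deriv_def)
  note [measurable] = li[THEN locally_integrable_measurable]
  have S\<phi>: "ctest (\<lambda>x. (S *v x) $ i *\<^sub>R \<phi> x)" "ctest (\<lambda>x. (S *v x) $ i *\<^sub>R cpderiv i \<phi> x)" for i
    by (intro ctest_scaleR' smooth_fun_matrix_vector ctest_cpderiv \<phi>)+
  note int = integrable_ctest_mult[OF \<phi> li(1)] integrable_ctest_mult[OF \<phi> li(3)] integrable_ctest_mult[OF S\<phi>(1) li(2)]
    integrable_ctest_mult[OF ctest_cpderiv[OF ctest_cpderiv[OF \<phi>]] li(1)] integrable_ctest_mult[OF S\<phi>(2) li(1)]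
  have [measurable]: "\<phi> \<in> borel_measurable borel"
    using \<phi> unfolding ctest_def borel_measurable_complex_iff by (auto intro: test_fun_measurable)
  have [measurable]: "(\<lambda>x. (S *v x) $ i) \<in> borel_measurable borel" for i
    by (intro borel_measurable_continuous_onI smooth_fun_continuous smooth_fun_matrix_vector)
  \<comment> \<open>The product rule adds a term with the diagonal entry \<open>S $ i $ i\<close>,
    which is 0 for a skew matrix.\<close>
  have drift: "cpderiv i (\<lambda>x. (S *v x) $ i *\<^sub>R \<phi> x) x = (S *v x) $ i *\<^sub>R cpderiv i \<phi> x" for i x
  proof -
    obtain D where D: "(\<phi> has_derivative D) (at x)" using ctest_has_derivative[OF \<phi>] by blast
    have "((\<lambda>x. (S *v x) $ i) has_derivative (\<lambda>h. (S *v h) $ i)) (at x)"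
      by (intro bounded_linear_imp_has_derivative bounded_linear_compose[OF bounded_linear_vec_nth matrix_vector_mul_bounded_linear])
    from has_derivative_scaleR[OF this D]
    have "cpderiv i (\<lambda>x. (S *v x) $ i *\<^sub>R \<phi> x) x = (S *v x) $ i *\<^sub>R D (axis i 1) + (S *v axis i 1) $ i *\<^sub>R \<phi> x"
      by (rule cpderiv_eqI)
    then show ?thesis
      using skew_inner_zero(2)[OF S] by (simp add: cpderiv_eqI[OF D] matrix_vector_mul_component inner_axis)
  qed
  have "(\<integral>x. \<phi> x * f x \<partial>lborel) = (\<integral>x. c * (\<phi> x * w x) - a * (\<Sum>i\<in>UNIV. \<phi> x * D2 i x)
      - (\<Sum>i\<in>UNIV. ((S *v x) $ i *\<^sub>R \<phi> x) * Dw i x) \<partial>lborel)"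
  proof (intro integral_cong_AE)
    show "AE x in lborel. \<phi> x * f x = c * (\<phi> x * w x) - a * (\<Sum>i\<in>UNIV. \<phi> x * D2 i x)
      - (\<Sum>i\<in>UNIV. ((S *v x) $ i *\<^sub>R \<phi> x) * Dw i x)"
      using eq by eventually_elim (simp add: right_diff_distrib mult_ac sum_distrib_left scaleR_conv_of_real)
  qed simp_all
  also have "\<dots> = c * (\<integral>x. \<phi> x * w x \<partial>lborel) - a * (\<Sum>i\<in>UNIV. \<integral>x. \<phi> x * D2 i x \<partial>lborel)
      - (\<Sum>i\<in>UNIV. \<integral>x. ((S *v x) $ i *\<^sub>R \<phi> x) * Dw i x \<partial>lborel)"
    using int by simp
  also have "\<dots> = c * (\<integral>x. \<phi> x * w x \<partial>lborel) - a * (\<Sum>i\<in>UNIV. \<integral>x. cpderiv i (cpderiv i \<phi>) x * w x \<partial>lborel)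
      + (\<Sum>i\<in>UNIV. \<integral>x. ((S *v x) $ i *\<^sub>R cpderiv i \<phi> x) * w x \<partial>lborel)"
  proof -
    have "(\<integral>x. \<phi> x * D2 i x \<partial>lborel) = (\<integral>x. cpderiv i (cpderiv i \<phi>) x * w x \<partial>lborel)" for i
      using weak_deriv_ctest[OF 2 \<phi>, of i] weak_deriv_ctest[OF 1 ctest_cpderiv[OF \<phi>], of i i] by simp
    moreover have "(\<integral>x. ((S *v x) $ i *\<^sub>R \<phi> x) * Dw i x \<partial>lborel) = - (\<integral>x. ((S *v x) $ i *\<^sub>R cpderiv i \<phi> x) * w x \<partial>lborel)" for i
      using weak_deriv_ctest[OF 1 S\<phi>(1), of i i] by (simp add: drift)
    ultimately show ?thesis by (simp only: sum_negf) simp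
  qed
  also have "\<dots> = (\<integral>x. c * (\<phi> x * w x) - a * (\<Sum>i\<in>UNIV. cpderiv i (cpderiv i \<phi>) x * w x)
      + (\<Sum>i\<in>UNIV. ((S *v x) $ i *\<^sub>R cpderiv i \<phi> x) * w x) \<partial>lborel)"
    using int by simp
  also have "\<dots> = (\<integral>x. (c * \<phi> x - a * (\<Sum>i\<in>UNIV. cpderiv i (cpderiv i \<phi>) x)
       + (\<Sum>i\<in>UNIV. (S *v x) $ i *\<^sub>R cpderiv i \<phi> x)) * w x \<partial>lborel)"
    by (intro Bochner_Integration.integral_cong) (auto simp: algebra_simps sum_distrib_left sum_distrib_right)
  finally show ?thesis .
qed

lemma fundamental_lemma_complex:
  fixes u :: "real^'d \<Rightarrow> complex"
  assumes u: "locally_integrable u"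
    and test: "\<And>\<phi>. test_fun \<phi> \<Longrightarrow> (\<integral>x. \<phi> x *\<^sub>R u x \<partial>lborel) = 0"
  shows "AE x in lborel. u x = 0"
proof -
  note [measurable] = locally_integrable_measurable[OF u]
  have int: "set_integrable lborel K (\<lambda>x. Re (u x))" "set_integrable lborel K (\<lambda>x. Im (u x))" if "compact K" for K
    using integrable_Re[of lborel "\<lambda>x. indicator K x *\<^sub>R u x"] integrable_Im[of lborel "\<lambda>x. indicator K x *\<^sub>R u x"]
      u that by (simp_all add: set_integrable_def)
  have "(\<integral>x. \<phi> x * Re (u x) \<partial>lborel) = 0 \<and> (\<integral>x. \<phi> x * Im (u x) \<partial>lborel) = 0" if "test_fun \<phi>" for \<phi>
    using integral_Re[OF integrable_test_fun_scaleR[OF that u]] integral_Im[OF integrable_test_fun_scaleR[OF that u]]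
      test[OF that] by simp
  then have "AE x in lborel. Re (u x) = 0" "AE x in lborel. Im (u x) = 0"
    using int by (intro fundamental_lemma_real; simp)+
  then show ?thesis by eventually_elim (simp add: complex_eq_iff)
qed

lemma cpderiv_add:
  "csmooth f \<Longrightarrow> csmooth g \<Longrightarrow> cpderiv i (\<lambda>x. f x + g x) x = cpderiv i f x + cpderiv i g x"
  by (simp add: cpderiv_def csmooth_def pderiv_fun_add smooth_fun_differentiable complex_eq_iff)

lemma cpderiv_scaleR:
  "smooth_fun h \<Longrightarrow> csmooth g \<Longrightarrow>
    cpderiv i (\<lambda>x. h x *\<^sub>R g x) x = h x *\<^sub>R cpderiv i g x + pderiv_fun h i x *\<^sub>R g x"
  by (simp add: cpderiv_def csmooth_def pderiv_fun_mult smooth_fun_differentiable complex_eq_iff)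

lemma csmooth_scaleR: "smooth_fun h \<Longrightarrow> csmooth g \<Longrightarrow> csmooth (\<lambda>x. h x *\<^sub>R g x)"
  by (simp add: csmooth_def)

lemma csmooth_cpderiv: "csmooth g \<Longrightarrow> csmooth (cpderiv i g)"
  by (simp add: csmooth_def cpderiv_def)

lemma cpderiv2_scaleR:
  assumes "smooth_fun h" "csmooth g"
  shows "cpderiv i (cpderiv i (\<lambda>x. h x *\<^sub>R g x)) x = h x *\<^sub>R cpderiv i (cpderiv i g) x
     + 2 * (pderiv_fun h i x *\<^sub>R cpderiv i g x) + pderiv_fun (pderiv_fun h i) i x *\<^sub>R g x"
proof -
  have "cpderiv i (\<lambda>x. h x *\<^sub>R g x) = (\<lambda>x. h x *\<^sub>R cpderiv i g x + pderiv_fun h i x *\<^sub>R g x)"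
    using assms by (simp add: fun_eq_iff cpderiv_scaleR)
  then show ?thesis
    using assms by (simp add: cpderiv_add cpderiv_scaleR csmooth_scaleR csmooth_cpderiv algebra_simps)
qed

section \<open>Gaussian test functions\<close>

definition gauss :: "complex \<Rightarrow> real^'d \<Rightarrow> real^'d \<Rightarrow> complex" where
  "gauss \<zeta> Y x = exp (- \<zeta> * of_real ((norm (x - Y))\<^sup>2))"

lemma norm_gauss: "norm (gauss \<zeta> Y x) = exp (- Re \<zeta> * (norm (x - Y))\<^sup>2)"
  by (simp add: gauss_def)

lemma smooth_fun_norm_sq: "smooth_fun (\<lambda>x. (norm (x - Y))\<^sup>2)"
  unfolding power2_norm_eq_inner inner_vec_def inner_real_def vector_minus_component
  by (intro smooth_fun_sum smooth_fun_mult smooth_fun_diff smooth_fun_const smooth_fun_nth)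

lemma csmooth_gauss: "csmooth (gauss \<zeta> Y)"
  unfolding csmooth_def gauss_def Re_exp Im_exp
  by (auto intro!: smooth_fun_mult smooth_fun_exp smooth_fun_cos_sin smooth_fun_const smooth_fun_norm_sq simp del: of_real_power)

lemma has_derivative_gauss:
  "(gauss \<zeta> Y has_derivative (\<lambda>h. (- 2 * \<zeta> * of_real ((x - Y) \<bullet> h)) * gauss \<zeta> Y x)) (at x)"
proof -
  have "((\<lambda>x. (x - Y) \<bullet> (x - Y)) has_derivative (\<lambda>h. 2 * ((x - Y) \<bullet> h))) (at x)"
    by (auto intro!: derivative_eq_intros simp: inner_commute)
  then have "((\<lambda>x. (norm (x - Y))\<^sup>2) has_derivative (\<lambda>h. 2 * ((x - Y) \<bullet> h))) (at x)"
    by (simp add: power2_norm_eq_inner)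
  then have "((\<lambda>x. - \<zeta> * of_real ((norm (x - Y))\<^sup>2)) has_derivative (\<lambda>h. - \<zeta> * of_real (2 * ((x - Y) \<bullet> h)))) (at x)"
    by (intro has_derivative_mult_right has_derivative_of_real)
  from has_derivative_compose[OF this DERIV_exp[unfolded has_field_derivative_def]]
  have "((\<lambda>x. exp (- \<zeta> * of_real ((norm (x - Y))\<^sup>2))) has_derivative
     (\<lambda>h. exp (- \<zeta> * of_real ((norm (x - Y))\<^sup>2)) * (- \<zeta> * of_real (2 * ((x - Y) \<bullet> h))))) (at x)" .
  then show ?thesis by (simp add: gauss_def[abs_def] mult_ac)
qed

lemma cpderiv_gauss: "cpderiv i (gauss \<zeta> Y) x = (- 2 * \<zeta> * of_real ((x - Y) $ i)) * gauss \<zeta> Y x"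
  using cpderiv_eqI[OF has_derivative_gauss, of i \<zeta> Y x] by (simp add: inner_axis)

lemma cpderiv2_gauss:
  "cpderiv i (cpderiv i (gauss \<zeta> Y)) x = (- 2 * \<zeta> + 4 * \<zeta>\<^sup>2 * of_real (((x - Y) $ i)\<^sup>2)) * gauss \<zeta> Y x"
proof -
  have "((\<lambda>x. (x - Y) $ i) has_derivative (\<lambda>h. h $ i)) (at x)"
    by (auto intro!: derivative_eq_intros bounded_linear_imp_has_derivative)
  then have "((\<lambda>x. - 2 * \<zeta> * of_real ((x - Y) $ i)) has_derivative (\<lambda>h. - 2 * \<zeta> * of_real (h $ i))) (at x)"
    by (intro has_derivative_mult_right has_derivative_of_real)
  from cpderiv_eqI[OF has_derivative_mult[OF this has_derivative_gauss], of i \<zeta> Y]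
  have "cpderiv i (\<lambda>x. (- 2 * \<zeta> * of_real ((x - Y) $ i)) * gauss \<zeta> Y x) x =
     (- 2 * \<zeta> * of_real ((x - Y) $ i)) * ((- 2 * \<zeta> * of_real ((x - Y) \<bullet> axis i 1)) * gauss \<zeta> Y x)
       + (- 2 * \<zeta> * of_real (axis i 1 $ i)) * gauss \<zeta> Y x" .
  also have "\<dots> = (- 2 * \<zeta> + 4 * \<zeta>\<^sup>2 * of_real (((x - Y) $ i)\<^sup>2)) * gauss \<zeta> Y x"
    unfolding inner_axis by (simp add: power2_eq_square algebra_simps)
  finally have "cpderiv i (\<lambda>x. (- 2 * \<zeta> * of_real ((x - Y) $ i)) * gauss \<zeta> Y x) x =
     (- 2 * \<zeta> + 4 * \<zeta>\<^sup>2 * of_real (((x - Y) $ i)\<^sup>2)) * gauss \<zeta> Y x" .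
  then show ?thesis by (simp add: cpderiv_gauss[abs_def])
qed

text \<open>The index k is the order of the derivative of \<open>flat\<close>, so that derivatives
  of \<open>cutoff 0\<close> are expressed by \<open>cutoff 1\<close> and \<open>cutoff 2\<close>.
  The factor \<open>exp 1\<close> normalises the value of \<open>cutoff 0\<close> at the origin,
  since \<open>flat 0 1\<close> is exp(-1).\<close>

definition cutoff :: "nat \<Rightarrow> real \<Rightarrow> real^'d \<Rightarrow> real" where
  "cutoff k n x = exp 1 * flat k (1 - (norm x)\<^sup>2 / n\<^sup>2)"

lemma smooth_fun_cutoff: "smooth_fun (cutoff k n)"
  unfolding cutoff_def[abs_def] divide_inverse
  using smooth_fun_norm_sq[of 0]
  by (intro smooth_fun_mult smooth_fun_const smooth_fun_flat smooth_fun_diff) simp_all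

lemma cutoff_zero: "n > 0 \<Longrightarrow> norm x \<ge> n \<Longrightarrow> cutoff k n x = 0"
proof -
  assume "n > 0" "norm x \<ge> n"
  then have "n\<^sup>2 \<le> (norm x)\<^sup>2" by (intro power_mono) auto
  with \<open>n > 0\<close> have "1 - (norm x)\<^sup>2 / n\<^sup>2 \<le> 0" by (simp add: field_simps)
  then show ?thesis by (simp add: cutoff_def flat_def)
qed

lemma test_fun_cutoff:
  assumes "n > 0"
  shows "test_fun (cutoff 0 n :: real^'d \<Rightarrow> real)"
proof -
  have "closure {x :: real^'d. cutoff 0 n x \<noteq> 0} \<subseteq> cball 0 n"
  proof (rule closure_minimal)
    show "{x :: real^'d. cutoff 0 n x \<noteq> 0} \<subseteq> cball 0 n"
      using cutoff_zero[OF assms] by (force simp: not_le[symmetric])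
  qed simp
  then have "compact (closure {x :: real^'d. cutoff 0 n x \<noteq> 0})"
    by (meson bounded_cball bounded_subset closed_closure compact_eq_bounded_closed)
  then show ?thesis by (simp add: test_fun_def smooth_fun_cutoff)
qed

lemma pderiv_cutoff: "pderiv_fun (cutoff k n) i x = - (2 * x $ i / n\<^sup>2) * cutoff (Suc k) n x"
proof -
  have "((\<lambda>x. 1 - (norm x)\<^sup>2 / n\<^sup>2) has_derivative (\<lambda>h. - (2 * (x \<bullet> h) / n\<^sup>2))) (at x)"
    unfolding power2_norm_eq_inner divide_inverse
    by (auto intro!: derivative_eq_intros simp: inner_commute)
  from has_derivative_compose[OF this flat_derivative[unfolded has_field_derivative_def]]
  have "((\<lambda>x. exp 1 * flat k (1 - (norm x)\<^sup>2 / n\<^sup>2)) has_derivative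
      (\<lambda>h. exp 1 * (flat (Suc k) (1 - (norm x)\<^sup>2 / n\<^sup>2) * - (2 * (x \<bullet> h) / n\<^sup>2)))) (at x)"
    by (rule has_derivative_mult_right)
  from pderiv_fun_eqI[OF this, of i] show ?thesis
    by (simp add: cutoff_def[abs_def] inner_axis)
qed

lemma pderiv2_cutoff: "pderiv_fun (pderiv_fun (cutoff 0 n) i) i x =
    - (2 / n\<^sup>2) * cutoff 1 n x + (2 * x $ i / n\<^sup>2)\<^sup>2 * cutoff 2 n x"
proof -
  have "pderiv_fun (cutoff 0 n) i = (\<lambda>x. (- (2 / n\<^sup>2) * x $ i) * cutoff 1 n x)"
    by (simp add: pderiv_cutoff fun_eq_iff)
  moreover have "pderiv_fun (\<lambda>x. (- (2 / n\<^sup>2) * x $ i) * cutoff 1 n x) i x =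
     (- (2 / n\<^sup>2) * x $ i) * pderiv_fun (cutoff 1 n) i x + (- (2 / n\<^sup>2)) * cutoff 1 n x"
  proof -
    have 1: "(\<lambda>x. - (2 / n\<^sup>2) * x $ i) differentiable at x"
      by (intro smooth_fun_differentiable smooth_fun_mult smooth_fun_const smooth_fun_nth)
    have 2: "cutoff 1 n differentiable at x" by (intro smooth_fun_differentiable smooth_fun_cutoff)
    have 3: "pderiv_fun (\<lambda>x. - (2 / n\<^sup>2) * x $ i) i x = - (2 / n\<^sup>2)"
      using pderiv_fun_mult[of "\<lambda>x. - (2 / n\<^sup>2)" x "\<lambda>x. x $ i" i]
      by (simp add: pderiv_fun_nth smooth_fun_differentiable pderiv_fun_eqI[OF has_derivative_const])
    show ?thesis using pderiv_fun_mult[OF 1 2, of i] 3 by simp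
  qed
  ultimately show ?thesis by (simp add: pderiv_cutoff power2_eq_square numeral_2_eq_2)
qed

lemma flat_bounded:
  obtains C where "C > 0" "\<And>s. s \<le> 1 \<Longrightarrow> \<bar>flat k s\<bar> \<le> C"
proof -
  have "bounded (flat k ` {0..1})"
    by (intro compact_imp_bounded compact_continuous_image flat_continuous) auto
  then obtain C where "C > 0" "\<And>s. 0 \<le> s \<Longrightarrow> s \<le> 1 \<Longrightarrow> \<bar>flat k s\<bar> \<le> C"
    by (auto simp: bounded_pos)
  then have "\<bar>flat k s\<bar> \<le> C" if "s \<le> 1" for s
    using that by (cases "s \<ge> 0") (auto simp: flat_def)
  with \<open>C > 0\<close> that show ?thesis by blast
qed

lemma cutoff_bounded:
  obtains C where "C > 0" "\<And>n x. \<bar>cutoff k n (x :: real^'d)\<bar> \<le> C"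
proof -
  obtain C where C: "C > 0" "\<And>s. s \<le> 1 \<Longrightarrow> \<bar>flat k s\<bar> \<le> C" using flat_bounded by metis
  have "\<bar>cutoff k n x\<bar> \<le> exp 1 * C" for n and x :: "real^'d"
    by (simp add: cutoff_def abs_mult C)
  with C(1) that[of "exp 1 * C"] show ?thesis by simp
qed

lemma cutoff_0_bounds: "0 \<le> cutoff 0 n x" "cutoff 0 n x \<le> 1"
proof -
  show "0 \<le> cutoff 0 n x" by (simp add: cutoff_def flat_0_bounds)
  have *: "exp 1 * exp (- 1 / s) \<le> 1" if "0 < s" "s \<le> 1" for s :: real
    using that by (simp add: exp_add[symmetric])
  show "cutoff 0 n x \<le> 1"
    unfolding cutoff_def flat_def using *[of "1 - (norm x)\<^sup>2 / n\<^sup>2"] by (simp split: if_split)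
qed

lemma cutoff_tendsto: "(\<lambda>n. cutoff 0 (real (Suc n)) x) \<longlonglongrightarrow> 1"
proof -
  have "(\<lambda>n. 1 - (norm x)\<^sup>2 / (real (Suc n))\<^sup>2) \<longlonglongrightarrow> 1" by real_asymp
  moreover have "isCont (flat 0) 1" by (rule DERIV_isCont[OF flat_derivative])
  ultimately have "(\<lambda>n. flat 0 (1 - (norm x)\<^sup>2 / (real (Suc n))\<^sup>2)) \<longlonglongrightarrow> flat 0 1"
    by (rule isCont_tendsto_compose[rotated])
  from tendsto_mult_left[OF this, of "exp 1"] show ?thesis
    by (simp add: cutoff_def flat_def exp_minus)
qed

text \<open>The derivatives carry factors x_i / n^2 or 1 / n^2, and |x| <= n on the support, so at
  least one power of 1/n remains. This rate makes the commutator with the Gaussian disappear in the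
  limit.\<close>

lemma cutoff_derivatives_bounded:
  obtains K where "K > 0"
    "\<And>n i (x :: real^'d). n \<ge> 1 \<Longrightarrow> \<bar>pderiv_fun (cutoff 0 n) i x\<bar> \<le> K / n"
    "\<And>n i (x :: real^'d). n \<ge> 1 \<Longrightarrow> \<bar>pderiv_fun (pderiv_fun (cutoff 0 n) i) i x\<bar> \<le> K / n"
proof -
  obtain C1 where C1: "C1 > 0" "\<And>n (x :: real^'d). \<bar>cutoff 1 n x\<bar> \<le> C1"
    using cutoff_bounded by metis
  obtain C2 where C2: "C2 > 0" "\<And>n (x :: real^'d). \<bar>cutoff 2 n x\<bar> \<le> C2"
    using cutoff_bounded by metis
  have xi: "\<bar>2 * x $ i / n\<^sup>2\<bar> \<le> 2 / n" if "n \<ge> 1" "norm x \<le> n" for n i and x :: "real^'d"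
    using component_le_norm_cart[of x i] that by (simp add: field_simps power2_eq_square)
  show ?thesis
  proof (rule that[of "2 * C1 + 4 * C2"])
    show "2 * C1 + 4 * C2 > 0" using C1 C2 by simp
    fix n :: real and i :: 'd and x :: "real^'d"
    assume n: "n \<ge> 1"
    show "\<bar>pderiv_fun (cutoff 0 n) i x\<bar> \<le> (2 * C1 + 4 * C2) / n"
    proof (cases "norm x \<le> n")
      case True
      have "\<bar>pderiv_fun (cutoff 0 n) i x\<bar> = \<bar>2 * x $ i / n\<^sup>2\<bar> * \<bar>cutoff 1 n x\<bar>"
        by (simp add: pderiv_cutoff abs_mult)
      also have "\<dots> \<le> (2 / n) * C1" using n by (intro mult_mono xi True C1(2)) auto
      also have "\<dots> \<le> (2 * C1 + 4 * C2) / n" using n C1 C2 by (simp add: field_simps)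
      finally show ?thesis .
    next
      case False
      then show ?thesis using n C1 C2 cutoff_zero[of n x 1] by (simp add: pderiv_cutoff)
    qed
    show "\<bar>pderiv_fun (pderiv_fun (cutoff 0 n) i) i x\<bar> \<le> (2 * C1 + 4 * C2) / n"
    proof (cases "norm x \<le> n")
      case True
      have "\<bar>pderiv_fun (pderiv_fun (cutoff 0 n) i) i x\<bar> \<le> (2 / n\<^sup>2) * \<bar>cutoff 1 n x\<bar> + (2 * x $ i / n\<^sup>2)\<^sup>2 * \<bar>cutoff 2 n x\<bar>"
        unfolding pderiv2_cutoff by (rule order_trans[OF abs_triangle_ineq]) (simp add: abs_mult)
      also have "\<dots> \<le> (2 / n\<^sup>2) * C1 + (2 / n)\<^sup>2 * C2"
        using n xi[OF n True, of i] abs_le_square_iff[of "2 * x $ i / n\<^sup>2" "2 / n"]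
        by (intro add_mono mult_mono C1(2) C2(2)) auto
      also have "\<dots> = (2 * C1 + 4 * C2) / n / n" by (simp add: power2_eq_square add_divide_distrib mult_ac)
      also have "\<dots> \<le> (2 * C1 + 4 * C2) / n / 1" using n C1 C2 by (intro divide_left_mono) auto
      finally show ?thesis by simp
    next
      case False
      then show ?thesis using n C1 C2 cutoff_zero[of n x 1] cutoff_zero[of n x 2] by (simp add: pderiv2_cutoff)
    qed
  qed
qed

text \<open>From |x|^2 <= 2 |x - Y|^2 + 2 |Y|^2, half of the rate k survives around the origin. It
  is split evenly: one k/4 pays for the polynomial, the other for exp(M |x|). This provides the
  dominating functions for solutions of exponential growth.\<close>

lemma gauss_beats_exp:
  fixes x Y :: "'a::real_inner"
  assumes k: "k > 0"
  shows "(1 + (norm x)\<^sup>2) * exp (- k * (norm (x - Y))\<^sup>2) \<le>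
    max 1 (4 / k) * exp (M\<^sup>2 / k + k * (norm Y)\<^sup>2) * exp (- M * norm x)"
proof -
  have "norm x \<le> norm (x - Y) + norm Y" using norm_triangle_ineq[of "x - Y" Y] by simp
  then have "(norm x)\<^sup>2 \<le> (norm (x - Y) + norm Y)\<^sup>2" by (intro power_mono) auto
  also have "\<dots> \<le> 2 * (norm (x - Y))\<^sup>2 + 2 * (norm Y)\<^sup>2"
    using sum_squares_bound[of "norm (x - Y)" "norm Y"] by (simp add: power2_sum)
  finally have "k * (norm x)\<^sup>2 \<le> k * (2 * (norm (x - Y))\<^sup>2 + 2 * (norm Y)\<^sup>2)"
    using k by (intro mult_left_mono) auto
  then have 1: "- k * (norm (x - Y))\<^sup>2 \<le> - (k / 2) * (norm x)\<^sup>2 + k * (norm Y)\<^sup>2"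
    by (simp add: algebra_simps)
  have 2: "M * norm x \<le> (k / 4) * (norm x)\<^sup>2 + M\<^sup>2 / k"
  proof -
    have "0 \<le> (k * norm x / 2 - M)\<^sup>2 / k" using k by simp
    also have "\<dots> = (k / 4) * (norm x)\<^sup>2 + M\<^sup>2 / k - M * norm x"
      using k by (simp add: field_simps power2_eq_square)
    finally show ?thesis by simp
  qed
  have 3: "1 + (norm x)\<^sup>2 \<le> max 1 (4 / k) * exp ((k / 4) * (norm x)\<^sup>2)"
  proof -
    have "1 + (norm x)\<^sup>2 \<le> max 1 (4 / k) * 1 + (max 1 (4 / k) * (k / 4)) * (norm x)\<^sup>2"
    proof -
      have "1 \<le> max 1 (4 / k) * (k / 4)" using k by (simp add: max_def field_simps)
      then have "(norm x)\<^sup>2 \<le> (max 1 (4 / k) * (k / 4)) * (norm x)\<^sup>2"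
        using mult_right_mono[of 1 "max 1 (4 / k) * (k / 4)" "(norm x)\<^sup>2"] by simp
      then show ?thesis by (auto intro!: add_mono)
    qed
    also have "\<dots> = max 1 (4 / k) * (1 + (k / 4) * (norm x)\<^sup>2)" by (simp add: algebra_simps)
    also have "\<dots> \<le> max 1 (4 / k) * exp ((k / 4) * (norm x)\<^sup>2)"
      by (intro mult_left_mono exp_ge_add_one_self) auto
    finally show ?thesis .
  qed
  have "(1 + (norm x)\<^sup>2) * exp (- k * (norm (x - Y))\<^sup>2) \<le>
     (max 1 (4 / k) * exp ((k / 4) * (norm x)\<^sup>2)) * exp (- (k / 2) * (norm x)\<^sup>2 + k * (norm Y)\<^sup>2)"
    using 1 by (intro mult_mono 3) auto
  also have "\<dots> = max 1 (4 / k) * exp (- (k / 4) * (norm x)\<^sup>2 + k * (norm Y)\<^sup>2)"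
    by (simp add: mult.assoc exp_add[symmetric] algebra_simps)
  also have "\<dots> \<le> max 1 (4 / k) * exp (M\<^sup>2 / k + k * (norm Y)\<^sup>2 + - M * norm x)"
    using 2 by (intro mult_left_mono) auto
  finally show ?thesis by (simp add: exp_add[symmetric] mult.assoc)
qed

text \<open>The weak equation tested against a Gaussian, which is not compactly supported: the radial
  cutoffs are annihilated by the drift because \<open>S\<close> is skew, and the remaining commutator is
  \<open>O(1/n)\<close>.\<close>

lemma gauss_equation:
  fixes w f :: "real^'d \<Rightarrow> complex" and S :: "real^'d^'d"
  assumes S: "transpose S = - S" and \<zeta>: "Re \<zeta> > 0"
    and [measurable]: "w \<in> borel_measurable borel" "f \<in> borel_measurable borel"
    and w: "integrable lborel (\<lambda>x. exp (- M * norm x) *\<^sub>R w x)"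
    and f: "integrable lborel (\<lambda>x. exp (- M * norm x) *\<^sub>R f x)"
    and weak: "\<And>\<phi>. ctest \<phi> \<Longrightarrow> (\<integral>x. \<phi> x * f x \<partial>lborel) =
      (\<integral>x. (c * \<phi> x - a * (\<Sum>i\<in>UNIV. cpderiv i (cpderiv i \<phi>) x)
         + (\<Sum>i\<in>UNIV. (S *v x) $ i *\<^sub>R cpderiv i \<phi> x)) * w x \<partial>lborel)"
  shows "(\<integral>x. gauss \<zeta> Y x * f x \<partial>lborel) =
    (\<integral>x. (c + 2 * a * \<zeta> * of_nat CARD('d) - 4 * a * \<zeta>\<^sup>2 * of_real ((norm (x - Y))\<^sup>2)
       + 2 * \<zeta> * of_real ((S *v x) \<bullet> Y)) * gauss \<zeta> Y x * w x \<partial>lborel)"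
proof -
  \<comment> \<open>\<open>G\<close> is the dual operator applied to the Gaussian, divided by the
    Gaussian. Below, \<open>r n\<close> collects the second order terms in which a derivative falls
    on the cutoff.\<close>
  define G where "G x = c + 2 * a * \<zeta> * of_nat CARD('d) - 4 * a * \<zeta>\<^sup>2 * of_real ((norm (x - Y))\<^sup>2)
       + 2 * \<zeta> * of_real ((S *v x) \<bullet> Y)" for x
  define \<eta> where "\<eta> n = (cutoff 0 (real (Suc n)) :: real^'d \<Rightarrow> real)" for n
  define r where "r n x = - a * (\<Sum>i\<in>UNIV. 2 * (pderiv_fun (\<eta> n) i x *\<^sub>R (- 2 * \<zeta> * of_real ((x - Y) $ i)))
     + of_real (pderiv_fun (pderiv_fun (\<eta> n) i) i x))" for n x
  have sm: "smooth_fun (\<eta> n)" and te: "test_fun (\<eta> n)" for n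
    by (simp_all add: \<eta>_def smooth_fun_cutoff test_fun_cutoff)
  obtain K where K: "K > 0"
    "\<And>n i x. \<bar>pderiv_fun (\<eta> n) i x\<bar> \<le> K / real (Suc n)"
    "\<And>n i x. \<bar>pderiv_fun (pderiv_fun (\<eta> n) i) i x\<bar> \<le> K / real (Suc n)"
    unfolding \<eta>_def by (rule cutoff_derivatives_bounded[where 'd = 'd]) (metis One_nat_def Suc_leI of_nat_1 of_nat_mono zero_less_Suc)
  have key: "c * (\<eta> n x *\<^sub>R gauss \<zeta> Y x) - a * (\<Sum>i\<in>UNIV. cpderiv i (cpderiv i (\<lambda>x. \<eta> n x *\<^sub>R gauss \<zeta> Y x)) x)
         + (\<Sum>i\<in>UNIV. (S *v x) $ i *\<^sub>R cpderiv i (\<lambda>x. \<eta> n x *\<^sub>R gauss \<zeta> Y x) x)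
      = (\<eta> n x *\<^sub>R G x + r n x) * gauss \<zeta> Y x" for n x
  proof -
    have sum2: "(\<Sum>i\<in>UNIV. complex_of_real (((x - Y) $ i)\<^sup>2)) = of_real ((norm (x - Y))\<^sup>2)"
      unfolding power2_norm_eq_inner inner_vec_def by (simp add: power2_eq_square)
    \<comment> \<open>The gradient of the radial cutoff is parallel to x, and S x is orthogonal to
      x; without this the unbounded drift would leave a term that is not small.\<close>
    have radial: "(\<Sum>i\<in>UNIV. (S *v x) $ i * pderiv_fun (\<eta> n) i x) = 0"
    proof -
      have "(\<Sum>i\<in>UNIV. (S *v x) $ i * pderiv_fun (\<eta> n) i x) =
        - (2 / (real (Suc n))\<^sup>2) * cutoff 1 (real (Suc n)) x * ((S *v x) \<bullet> x)"
        unfolding inner_vec_def \<eta>_def pderiv_cutoff by (simp add: sum_distrib_left mult_ac sum_negf sum_divide_distrib)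
      then show ?thesis by (simp add: skew_inner_zero(1)[OF S])
    qed
    have drift: "(\<Sum>i\<in>UNIV. (S *v x) $ i * (x - Y) $ i) = - ((S *v x) \<bullet> Y)"
      using skew_inner_zero(1)[OF S, of x]
      by (simp add: inner_vec_def right_diff_distrib sum_subtractf)
    have 1: "(\<Sum>i\<in>UNIV. cpderiv i (cpderiv i (\<lambda>x. \<eta> n x *\<^sub>R gauss \<zeta> Y x)) x) =
       (\<eta> n x *\<^sub>R (- 2 * \<zeta> * of_nat CARD('d) + 4 * \<zeta>\<^sup>2 * of_real ((norm (x - Y))\<^sup>2))
        + (\<Sum>i\<in>UNIV. 2 * (pderiv_fun (\<eta> n) i x *\<^sub>R (- 2 * \<zeta> * of_real ((x - Y) $ i)))
     + of_real (pderiv_fun (pderiv_fun (\<eta> n) i) i x))) * gauss \<zeta> Y x"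
    proof -
      have split: "(\<Sum>i\<in>UNIV. (c0 + c1 * s i + T i) * g) = (of_nat CARD('d) * c0 + c1 * (\<Sum>i\<in>UNIV. s i) + (\<Sum>i\<in>UNIV. T i)) * g"
        for c0 c1 g :: complex and s T :: "'d \<Rightarrow> complex"
        by (simp add: sum.distrib sum_distrib_left sum_distrib_right ring_distribs)
      have "(\<Sum>i\<in>UNIV. cpderiv i (cpderiv i (\<lambda>x. \<eta> n x *\<^sub>R gauss \<zeta> Y x)) x) =
        (\<Sum>i\<in>UNIV. (of_real (\<eta> n x) * (- 2 * \<zeta>) + (of_real (\<eta> n x) * 4 * \<zeta>\<^sup>2) * complex_of_real (((x - Y) $ i)\<^sup>2)
          + (2 * (pderiv_fun (\<eta> n) i x *\<^sub>R (- 2 * \<zeta> * of_real ((x - Y) $ i)))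
             + of_real (pderiv_fun (pderiv_fun (\<eta> n) i) i x))) * gauss \<zeta> Y x)"
        unfolding cpderiv2_scaleR[OF sm csmooth_gauss] cpderiv_gauss cpderiv2_gauss
        by (intro sum.cong) (simp_all only: ring_distribs scaleR_conv_of_real mult_ac add_ac)
      then show ?thesis unfolding split sum2
        by (simp only: ring_distribs scaleR_conv_of_real mult_ac)
    qed
    have 2: "(\<Sum>i\<in>UNIV. (S *v x) $ i *\<^sub>R cpderiv i (\<lambda>x. \<eta> n x *\<^sub>R gauss \<zeta> Y x) x) =
       (\<eta> n x *\<^sub>R (2 * \<zeta> * of_real ((S *v x) \<bullet> Y))) * gauss \<zeta> Y x"
    proof -
      have "(\<Sum>i\<in>UNIV. (S *v x) $ i *\<^sub>R cpderiv i (\<lambda>x. \<eta> n x *\<^sub>R gauss \<zeta> Y x) x) =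
        (\<Sum>i\<in>UNIV. (- 2 * \<zeta> * of_real (\<eta> n x) * gauss \<zeta> Y x) * of_real ((S *v x) $ i * (x - Y) $ i)
           + gauss \<zeta> Y x * of_real ((S *v x) $ i * pderiv_fun (\<eta> n) i x))"
        unfolding cpderiv_scaleR[OF sm csmooth_gauss] cpderiv_gauss
        by (intro sum.cong) (simp_all add: algebra_simps scaleR_conv_of_real)
      also have "\<dots> = (- 2 * \<zeta> * of_real (\<eta> n x) * gauss \<zeta> Y x) * of_real (\<Sum>i\<in>UNIV. (S *v x) $ i * (x - Y) $ i)
           + gauss \<zeta> Y x * of_real (\<Sum>i\<in>UNIV. (S *v x) $ i * pderiv_fun (\<eta> n) i x)"
        by (simp only: sum.distrib sum_distrib_left of_real_sum)
      finally show ?thesis unfolding radial drift by (simp add: scaleR_conv_of_real mult_ac)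
    qed
    show ?thesis unfolding 1 2 G_def r_def by (simp add: algebra_simps scaleR_conv_of_real)
  qed
  have rbound: "norm (r n x) \<le> (norm a * CARD('d) * K * (4 * norm \<zeta> * (norm x + norm Y) + 1)) / real (Suc n)" for n x
  proof -
    have "norm (\<Sum>i\<in>UNIV. 2 * (pderiv_fun (\<eta> n) i x *\<^sub>R (- 2 * \<zeta> * of_real ((x - Y) $ i)))
     + of_real (pderiv_fun (pderiv_fun (\<eta> n) i) i x)) \<le> (\<Sum>i\<in>(UNIV::'d set). K / real (Suc n) * (4 * norm \<zeta> * (norm x + norm Y) + 1))"
    proof (rule sum_norm_le)
      fix i
      have "norm ((x - Y) $ i) \<le> norm x + norm Y"
        using component_le_norm_cart[of "x - Y" i] norm_triangle_ineq4[of x Y] by (simp add: real_norm_def)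
      then have "\<bar>pderiv_fun (\<eta> n) i x\<bar> * (4 * norm \<zeta> * \<bar>(x - Y) $ i\<bar>) \<le> K / real (Suc n) * (4 * norm \<zeta> * (norm x + norm Y))"
        using K(1) by (intro mult_mono K(2) mult_left_mono) auto
      moreover have "norm (2 * (pderiv_fun (\<eta> n) i x *\<^sub>R (- 2 * \<zeta> * of_real ((x - Y) $ i))) + of_real (pderiv_fun (pderiv_fun (\<eta> n) i) i x))
         \<le> \<bar>pderiv_fun (\<eta> n) i x\<bar> * (4 * norm \<zeta> * \<bar>(x - Y) $ i\<bar>) + \<bar>pderiv_fun (pderiv_fun (\<eta> n) i) i x\<bar>"
        by (rule order_trans[OF norm_triangle_ineq]) (simp add: norm_mult del: vector_minus_component)
      ultimately show "norm (2 * (pderiv_fun (\<eta> n) i x *\<^sub>R (- 2 * \<zeta> * of_real ((x - Y) $ i))) + of_real (pderiv_fun (pderiv_fun (\<eta> n) i) i x))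
         \<le> K / real (Suc n) * (4 * norm \<zeta> * (norm x + norm Y) + 1)"
        using K(3)[of n i x] by (simp only: ring_distribs mult_1_right)
    qed
    then have "norm a * norm (\<Sum>i\<in>UNIV. 2 * (pderiv_fun (\<eta> n) i x *\<^sub>R (- 2 * \<zeta> * of_real ((x - Y) $ i)))
     + of_real (pderiv_fun (pderiv_fun (\<eta> n) i) i x)) \<le> norm a * (CARD('d) * (K / real (Suc n) * (4 * norm \<zeta> * (norm x + norm Y) + 1)))"
      by (intro mult_left_mono) auto
    then show ?thesis unfolding r_def norm_mult norm_minus_cancel by (simp add: mult_ac)
  qed
  obtain BS where BS: "BS > 0" "\<And>x. norm (S *v x) \<le> BS * norm x"
    using bounded_linear.pos_bounded[OF matrix_vector_mul_bounded_linear[of S]] by (auto simp: mult.commute)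
  define C where "C = norm c + 2 * norm a * norm \<zeta> * CARD('d) + 4 * norm a * (norm \<zeta>)\<^sup>2 * (2 + 2 * (norm Y)\<^sup>2) + 2 * norm \<zeta> * (BS * norm Y)
     + norm a * CARD('d) * K * (4 * norm \<zeta> * (1 + norm Y) + 1)"
  \<comment> \<open>Uniform in n and of quadratic growth, which is exactly what
    \<open>gauss_beats_exp\<close> absorbs into the weight.\<close>
  have Gr: "norm (\<eta> n x *\<^sub>R G x + r n x) \<le> C * (1 + (norm x)\<^sup>2)" for n x
  proof -
    let ?q = "1 + (norm x)\<^sup>2"
    have n1: "norm x \<le> ?q"
      using sum_squares_bound[of "norm x" 1] norm_ge_zero[of x] by (simp only: power_one mult_1_right)
    have q1: "1 \<le> ?q" by simp
    have n2: "(norm (x - Y))\<^sup>2 \<le> (2 + 2 * (norm Y)\<^sup>2) * ?q"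
    proof -
      have "(norm (x - Y))\<^sup>2 \<le> (norm x + norm Y)\<^sup>2" by (intro power_mono norm_triangle_ineq4) auto
      also have "\<dots> \<le> 2 * (norm x)\<^sup>2 + 2 * (norm Y)\<^sup>2"
        using sum_squares_bound[of "norm x" "norm Y"] by (simp add: power2_sum)
      also have "\<dots> \<le> (2 + 2 * (norm Y)\<^sup>2) * ?q" by (simp add: algebra_simps)
      finally show ?thesis .
    qed
    have n3: "\<bar>(S *v x) \<bullet> Y\<bar> \<le> (BS * norm Y) * ?q"
    proof -
      have "\<bar>(S *v x) \<bullet> Y\<bar> \<le> norm (S *v x) * norm Y" by (rule Cauchy_Schwarz_ineq2)
      also have "\<dots> \<le> (BS * norm x) * norm Y" by (intro mult_right_mono BS) auto
      also have "\<dots> \<le> (BS * ?q) * norm Y" using BS n1 by (intro mult_right_mono mult_left_mono) auto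
      finally show ?thesis by (simp add: mult_ac)
    qed
    have "norm (G x) \<le> norm c + norm (2 * a * \<zeta> * of_nat CARD('d)) + norm (4 * a * \<zeta>\<^sup>2 * of_real ((norm (x - Y))\<^sup>2))
       + norm (2 * \<zeta> * of_real ((S *v x) \<bullet> Y))"
      unfolding G_def by (intro norm_triangle_le norm_triangle_le_diff add_mono order_refl)
    also have "\<dots> = norm c * 1 + 2 * norm a * norm \<zeta> * CARD('d) * 1 + 4 * norm a * (norm \<zeta>)\<^sup>2 * (norm (x - Y))\<^sup>2 + 2 * norm \<zeta> * \<bar>(S *v x) \<bullet> Y\<bar>"
      by (simp add: norm_mult norm_power)
    also have "\<dots> \<le> norm c * ?q + 2 * norm a * norm \<zeta> * CARD('d) * ?q + 4 * norm a * (norm \<zeta>)\<^sup>2 * ((2 + 2 * (norm Y)\<^sup>2) * ?q) + 2 * norm \<zeta> * ((BS * norm Y) * ?q)"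
      by (intro add_mono mult_left_mono n2 n3 q1) auto
    finally have g: "norm (G x) \<le> norm c * ?q + 2 * norm a * norm \<zeta> * CARD('d) * ?q + 4 * norm a * (norm \<zeta>)\<^sup>2 * ((2 + 2 * (norm Y)\<^sup>2) * ?q) + 2 * norm \<zeta> * ((BS * norm Y) * ?q)" .
    have "0 \<le> norm a * CARD('d) * K * (4 * norm \<zeta> * (norm x + norm Y) + 1)"
      using K(1) by (intro mult_nonneg_nonneg add_nonneg_nonneg) auto
    then have "norm (r n x) \<le> (norm a * CARD('d) * K * (4 * norm \<zeta> * (norm x + norm Y) + 1)) / 1"
      by (intro order_trans[OF rbound] divide_left_mono) auto
    also have "\<dots> \<le> norm a * CARD('d) * K * (4 * norm \<zeta> * (?q + norm Y * ?q) + 1 * ?q)"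
    proof -
      have "norm Y * 1 \<le> norm Y * ?q" by (intro mult_left_mono q1) auto
      then have "4 * norm \<zeta> * (norm x + norm Y) + 1 \<le> 4 * norm \<zeta> * (?q + norm Y * ?q) + 1 * ?q"
        using n1 q1 by (intro add_mono mult_left_mono) auto
      then show ?thesis using K(1) unfolding div_by_1 by (intro mult_left_mono mult_nonneg_nonneg) auto
    qed
    finally have "norm (r n x) \<le> norm a * CARD('d) * K * (4 * norm \<zeta> * (1 + norm Y) + 1) * ?q"
      by (simp add: algebra_simps)
    moreover have "norm (\<eta> n x *\<^sub>R G x) \<le> norm (G x)"
      using cutoff_0_bounds[of "real (Suc n)" x] by (simp add: \<eta>_def mult_left_le_one_le)
    ultimately have "norm (\<eta> n x *\<^sub>R G x) + norm (r n x) \<le> C * ?q"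
      using g unfolding C_def by (simp only: ring_distribs mult_ac)
    then show ?thesis by (rule order_trans[OF norm_triangle_ineq])
  qed
  have C0: "C \<ge> 0" using order_trans[OF norm_ge_zero Gr[of 0 0]] by simp
  define L where "L = max 1 (4 / Re \<zeta>) * exp (M\<^sup>2 / Re \<zeta> + Re \<zeta> * (norm Y)\<^sup>2)"
  have gb: "(1 + (norm x)\<^sup>2) * norm (gauss \<zeta> Y x) \<le> L * exp (- M * norm x)" for x
    unfolding norm_gauss L_def using gauss_beats_exp[OF \<zeta>] .
  have gb1: "norm (gauss \<zeta> Y x) \<le> L * exp (- M * norm x)" for x
  proof -
    have "1 * norm (gauss \<zeta> Y x) \<le> (1 + (norm x)\<^sup>2) * norm (gauss \<zeta> Y x)"
      by (intro mult_right_mono) auto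
    with gb[of x] show ?thesis by simp
  qed
  have meas[measurable]: "gauss \<zeta> Y \<in> borel_measurable borel" "G \<in> borel_measurable borel"
    "\<eta> n \<in> borel_measurable borel" "r n \<in> borel_measurable borel" for n
  proof -
    note [measurable] = te[THEN test_fun_measurable] te[THEN test_fun_pderiv, THEN test_fun_measurable]
       te[THEN test_fun_pderiv, THEN test_fun_pderiv, THEN test_fun_measurable]
    have [measurable]: "(\<lambda>x. S *v x) \<in> borel_measurable borel"
      by (intro borel_measurable_continuous_onI linear_continuous_on matrix_vector_mul_bounded_linear)
    have [measurable]: "(\<lambda>x :: real^'d. x $ i) \<in> borel_measurable borel" for i
      by (intro borel_measurable_continuous_onI continuous_on_component continuous_on_id)
    show "gauss \<zeta> Y \<in> borel_measurable borel" unfolding gauss_def[abs_def] by measurable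
    show "G \<in> borel_measurable borel" unfolding G_def[abs_def] by measurable
    show "\<eta> n \<in> borel_measurable borel" by simp
    show "r n \<in> borel_measurable borel" unfolding r_def[abs_def] vector_minus_component by measurable
  qed
  have rlim: "(\<lambda>n. r n x) \<longlonglongrightarrow> 0" for x
  proof (rule Lim_null_comparison[OF always_eventually])
    show "\<forall>n. norm (r n x) \<le> (norm a * CARD('d) * K * (4 * norm \<zeta> * (norm x + norm Y) + 1)) / real (Suc n)"
      using rbound by blast
    show "(\<lambda>n. (norm a * CARD('d) * K * (4 * norm \<zeta> * (norm x + norm Y) + 1)) / real (Suc n)) \<longlonglongrightarrow> 0"
      by (rule LIMSEQ_Suc[OF lim_const_over_n])
  qed
  have lhs: "(\<lambda>n. \<integral>x. (\<eta> n x *\<^sub>R gauss \<zeta> Y x) * f x \<partial>lborel) \<longlonglongrightarrow> (\<integral>x. gauss \<zeta> Y x * f x \<partial>lborel)"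
  proof (rule integral_dominated_convergence)
    show "integrable lborel (\<lambda>x. L * norm (exp (- M * norm x) *\<^sub>R f x))"
      using f by (intro integrable_mult_right integrable_norm)
    have "(\<lambda>n. (\<eta> n x *\<^sub>R gauss \<zeta> Y x) * f x) \<longlonglongrightarrow> (1 *\<^sub>R gauss \<zeta> Y x) * f x" for x
      unfolding \<eta>_def by (intro tendsto_intros cutoff_tendsto)
    then show "AE x in lborel. (\<lambda>n. (\<eta> n x *\<^sub>R gauss \<zeta> Y x) * f x) \<longlonglongrightarrow> gauss \<zeta> Y x * f x"
      by simp
    fix n
    have "norm ((\<eta> n x *\<^sub>R gauss \<zeta> Y x) * f x) \<le> L * norm (exp (- M * norm x) *\<^sub>R f x)" for x
    proof -
      have "\<bar>\<eta> n x\<bar> * norm (gauss \<zeta> Y x) \<le> 1 * (L * exp (- M * norm x))"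
        using cutoff_0_bounds[of "real (Suc n)" x] by (intro mult_mono gb1) (auto simp: \<eta>_def)
      then have "\<bar>\<eta> n x\<bar> * norm (gauss \<zeta> Y x) * norm (f x) \<le> (L * exp (- M * norm x)) * norm (f x)"
        by (intro mult_right_mono) auto
      then show ?thesis by (simp add: norm_mult mult_ac)
    qed
    then show "AE x in lborel. norm ((\<eta> n x *\<^sub>R gauss \<zeta> Y x) * f x) \<le> L * norm (exp (- M * norm x) *\<^sub>R f x)"
      by simp
  qed simp_all
  have rhs: "(\<lambda>n. \<integral>x. (\<eta> n x *\<^sub>R G x + r n x) * gauss \<zeta> Y x * w x \<partial>lborel) \<longlonglongrightarrow> (\<integral>x. G x * gauss \<zeta> Y x * w x \<partial>lborel)"
  proof (rule integral_dominated_convergence)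
    show "integrable lborel (\<lambda>x. (C * L) * norm (exp (- M * norm x) *\<^sub>R w x))"
      using w by (intro integrable_mult_right integrable_norm)
    have "(\<lambda>n. (\<eta> n x *\<^sub>R G x + r n x) * gauss \<zeta> Y x * w x) \<longlonglongrightarrow> (1 *\<^sub>R G x + 0) * gauss \<zeta> Y x * w x" for x
      using cutoff_tendsto[of x] rlim[of x] by (intro tendsto_intros) (simp_all add: \<eta>_def)
    then show "AE x in lborel. (\<lambda>n. (\<eta> n x *\<^sub>R G x + r n x) * gauss \<zeta> Y x * w x) \<longlonglongrightarrow> G x * gauss \<zeta> Y x * w x"
      by simp
    fix n
    have "norm ((\<eta> n x *\<^sub>R G x + r n x) * gauss \<zeta> Y x * w x) \<le> (C * L) * norm (exp (- M * norm x) *\<^sub>R w x)" for x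
    proof -
      have "norm (\<eta> n x *\<^sub>R G x + r n x) * norm (gauss \<zeta> Y x) \<le> (C * (1 + (norm x)\<^sup>2)) * norm (gauss \<zeta> Y x)"
        by (intro mult_right_mono Gr) auto
      also have "\<dots> \<le> C * (L * exp (- M * norm x))"
        using gb[of x] C0 by (simp only: mult.assoc) (intro mult_left_mono)
      finally have "norm (\<eta> n x *\<^sub>R G x + r n x) * norm (gauss \<zeta> Y x) * norm (w x) \<le> C * (L * exp (- M * norm x)) * norm (w x)"
        by (intro mult_right_mono) auto
      then show ?thesis by (simp add: norm_mult mult_ac)
    qed
    then show "AE x in lborel. norm ((\<eta> n x *\<^sub>R G x + r n x) * gauss \<zeta> Y x * w x) \<le> (C * L) * norm (exp (- M * norm x) *\<^sub>R w x)"
      by simp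
  qed simp_all
  have "(\<integral>x. (\<eta> n x *\<^sub>R gauss \<zeta> Y x) * f x \<partial>lborel) = (\<integral>x. (\<eta> n x *\<^sub>R G x + r n x) * gauss \<zeta> Y x * w x \<partial>lborel)" for n
    unfolding weak[OF ctest_scaleR[OF te csmooth_gauss]] key ..
  with lhs rhs show ?thesis
    unfolding G_def[symmetric] using LIMSEQ_unique by simp
qed

section \<open>The rotated heat kernel\<close>

primrec mat_pow :: "real^'d^'d \<Rightarrow> nat \<Rightarrow> real^'d^'d" where
  "mat_pow S 0 = mat 1"
| "mat_pow S (Suc k) = S ** mat_pow S k"

text \<open>The matrix exponential \<open>exp (s S)\<close>, defined entrywise by its power series.\<close>

definition rot :: "real^'d^'d \<Rightarrow> real \<Rightarrow> real^'d^'d" where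
  "rot S s = (\<chi> i j. \<Sum>k. (mat_pow S k $ i $ j / fact k) * s ^ k)"

lemma mat_pow_bound: "\<bar>mat_pow S k $ i $ j\<bar> \<le> (\<Sum>i\<in>UNIV. \<Sum>j\<in>UNIV. \<bar>S $ i $ j\<bar>) ^ k"
proof (induction k arbitrary: i j)
  case 0
  show ?case by (simp add: mat_def)
next
  case (Suc k)
  let ?B = "\<Sum>i\<in>UNIV. \<Sum>j\<in>UNIV. \<bar>S $ i $ j\<bar>"
  have B: "0 \<le> ?B" by (intro sum_nonneg) auto
  have "\<bar>mat_pow S (Suc k) $ i $ j\<bar> \<le> (\<Sum>l\<in>UNIV. \<bar>S $ i $ l\<bar> * \<bar>mat_pow S k $ l $ j\<bar>)"
    unfolding mat_pow.simps matrix_matrix_mult_def by (simp add: abs_mult[symmetric])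
  also have "\<dots> \<le> (\<Sum>l\<in>UNIV. \<bar>S $ i $ l\<bar> * ?B ^ k)"
    by (intro sum_mono mult_left_mono Suc.IH) auto
  also have "\<dots> = (\<Sum>l\<in>UNIV. \<bar>S $ i $ l\<bar>) * ?B ^ k" by (simp add: sum_distrib_right)
  also have "\<dots> \<le> ?B * ?B ^ k"
    using B by (intro mult_right_mono member_le_sum[of i UNIV "\<lambda>i. \<Sum>j\<in>UNIV. \<bar>S $ i $ j\<bar>"]) (auto intro: sum_nonneg)
  finally show ?case by simp
qed

lemma summable_rot: "summable (\<lambda>k. (mat_pow S k $ i $ j / fact k) * s ^ k)"
proof (rule summable_comparison_test')
  let ?B = "\<Sum>i\<in>UNIV. \<Sum>j\<in>UNIV. \<bar>S $ i $ j\<bar>"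
  show "summable (\<lambda>k. inverse (fact k) * (?B * \<bar>s\<bar>) ^ k)"
    by (rule summable_exp)
  fix k
  have "\<bar>mat_pow S k $ i $ j\<bar> * \<bar>s\<bar> ^ k \<le> ?B ^ k * \<bar>s\<bar> ^ k"
    by (intro mult_right_mono mat_pow_bound) auto
  then show "norm ((mat_pow S k $ i $ j / fact k) * s ^ k) \<le> inverse (fact k) * (?B * \<bar>s\<bar>) ^ k"
    by (simp add: abs_mult power_abs power_mult_distrib divide_inverse mult_ac)
qed

lemma rot_0: "rot S 0 = mat 1"
  unfolding rot_def vec_eq_iff by (simp only: vec_lambda_beta powser_zero) simp

text \<open>Termwise differentiation shifts the exponential series by one index, and the shifted
  matrix power splits off a factor S on the left.\<close>

lemma rot_entry_derivative:
  "((\<lambda>s. rot S s $ i $ j) has_real_derivative (S ** rot S s) $ i $ j) (at s)"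
proof -
  let ?c = "\<lambda>k. mat_pow S k $ i $ j / fact k"
  have "((\<lambda>s. \<Sum>k. ?c k * s ^ k) has_real_derivative (\<Sum>k. diffs ?c k * s ^ k)) (at s)"
    by (rule termdiffs_strong_converges_everywhere) (rule summable_rot)
  moreover have "diffs ?c k * s ^ k = (\<Sum>l\<in>UNIV. S $ i $ l * ((mat_pow S k $ l $ j / fact k) * s ^ k))" for k
    by (simp add: diffs_def matrix_matrix_mult_def sum_divide_distrib sum_distrib_right sum_distrib_left field_simps del: of_nat_Suc)
  moreover have "(\<Sum>k. \<Sum>l\<in>UNIV. S $ i $ l * ((mat_pow S k $ l $ j / fact k) * s ^ k)) =
     (\<Sum>l\<in>UNIV. S $ i $ l * (\<Sum>k. (mat_pow S k $ l $ j / fact k) * s ^ k))"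
    by (subst suminf_sum) (intro summable_mult summable_rot sum.cong suminf_mult refl)+
  ultimately show ?thesis by (simp add: rot_def matrix_matrix_mult_def)
qed

lemma rot_component_derivative:
  "((\<lambda>s. (rot S s *v x) $ i) has_real_derivative (S *v (rot S s *v x)) $ i) (at s)"
proof -
  have "((\<lambda>s. \<Sum>j\<in>UNIV. rot S s $ i $ j * x $ j) has_real_derivative (\<Sum>j\<in>UNIV. (S ** rot S s) $ i $ j * x $ j)) (at s)"
    by (intro DERIV_sum DERIV_cmult_right rot_entry_derivative)
  then show ?thesis
    unfolding matrix_vector_mul_assoc by (simp add: matrix_vector_mult_def)
qed

lemma rot_inner_derivative:
  "((\<lambda>s. (rot S s *v x) \<bullet> y) has_real_derivative (S *v (rot S s *v x)) \<bullet> y) (at s)"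
  unfolding inner_vec_def inner_real_def by (intro DERIV_sum DERIV_cmult_right rot_component_derivative)

locale skew_matrix =
  fixes S :: "real^'d^'d"
  assumes skew: "transpose S = - S"
begin

text \<open>Skewness makes the s-derivative of the inner product vanish, so it keeps its value at s
  = 0, where the exponential is the identity.\<close>

lemma rot_inner: "(rot S s *v x) \<bullet> (rot S s *v y) = x \<bullet> y"
proof -
  have "((\<lambda>s. (rot S s *v x) \<bullet> (rot S s *v y)) has_real_derivative 0) (at s)" for s
  proof -
    have "((\<lambda>s. \<Sum>i\<in>UNIV. (rot S s *v x) $ i * (rot S s *v y) $ i) has_real_derivative
      (\<Sum>i\<in>UNIV. (S *v (rot S s *v x)) $ i * (rot S s *v y) $ i + (S *v (rot S s *v y)) $ i * (rot S s *v x) $ i)) (at s)"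
      by (intro DERIV_sum DERIV_mult rot_component_derivative)
    moreover have "(\<Sum>i\<in>UNIV. (S *v (rot S s *v x)) $ i * (rot S s *v y) $ i + (S *v (rot S s *v y)) $ i * (rot S s *v x) $ i) = 0"
      using skew_inner_zero(3)[OF skew, of "rot S s *v x" "rot S s *v y"]
      by (simp add: sum.distrib inner_vec_def mult.commute)
    ultimately show ?thesis by (simp add: inner_vec_def)
  qed
  then have "(rot S s *v x) \<bullet> (rot S s *v y) = (rot S 0 *v x) \<bullet> (rot S 0 *v y)"
    by (rule DERIV_isconst_all[rule_format])
  then show ?thesis by (simp add: rot_0)
qed

lemma norm_rot [simp]: "norm (rot S s *v x) = norm x"
  by (simp add: norm_eq_sqrt_inner rot_inner)

lemma rot_transpose: "rot S s *v (x v* rot S s) = x"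
proof -
  have "orthogonal_transformation ((*v) (rot S s))"
    by (simp add: orthogonal_transformation_def rot_inner)
  then have "orthogonal_matrix (rot S s)"
    by (simp add: orthogonal_transformation_matrix matrix_of_matrix_vector_mul)
  then have "rot S s ** transpose (rot S s) = mat 1"
    by (simp add: orthogonal_matrix_def)
  then have "rot S s *v (transpose (rot S s) *v x) = x"
    by (simp only: matrix_vector_mul_assoc matrix_vector_mul_lid)
  then show ?thesis by simp
qed

text \<open>The row product \<open>\<xi> v* rot S s\<close> is the transpose, hence the inverse
  rotation, applied to \<xi>. A radial kernel thus becomes a function of x centred at a point that
  depends on s and \<xi> only, the form needed to integrate and differentiate in x.\<close>

lemma norm_rot_diff: "norm (rot S s *v x - \<xi>) = norm (x - \<xi> v* rot S s)"
proof -
  have "rot S s *v x - \<xi> = rot S s *v (x - \<xi> v* rot S s)"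
    by (simp add: matrix_vector_mult_diff_distrib rot_transpose)
  then show ?thesis by simp
qed

end

lemma continuous_rot_entry: "continuous_on A (\<lambda>s. rot S s $ i $ j)"
  by (intro continuous_at_imp_continuous_on ballI DERIV_isCont[OF rot_entry_derivative])

lemma continuous_rot: "continuous_on A (\<lambda>z. rot S (fst z) *v snd z)"
proof -
  have *: "continuous_on A (\<lambda>z. rot S (fst z) $ i $ j)" for i j
    by (rule continuous_on_compose2[OF continuous_rot_entry[of UNIV]]) (auto intro: continuous_intros)
  show ?thesis unfolding matrix_vector_mult_def
    by (intro continuous_on_vec_lambda continuous_on_sum continuous_on_mult *) (intro continuous_intros)
qed

lemma continuous_rot_transpose: "continuous_on A (\<lambda>z. snd z v* rot S (fst z))"
proof -
  have *: "continuous_on A (\<lambda>z. rot S (fst z) $ i $ j)" for i j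
    by (rule continuous_on_compose2[OF continuous_rot_entry[of UNIV]]) (auto intro: continuous_intros)
  show ?thesis unfolding vector_matrix_mult_def
    by (intro continuous_on_vec_lambda continuous_on_sum continuous_on_mult *) (intro continuous_intros)
qed

lemma rot_measurable [measurable]:
  assumes "f \<in> borel_measurable M" "g \<in> borel_measurable M"
  shows "(\<lambda>x. rot S (f x) *v g x) \<in> borel_measurable M"
  using borel_measurable_continuous_on[OF continuous_rot borel_measurable_Pair[OF assms]] by simp

lemma rot_transpose_measurable [measurable]:
  assumes "f \<in> borel_measurable M" "g \<in> borel_measurable M"
  shows "(\<lambda>x. g x v* rot S (f x)) \<in> borel_measurable M"
  using borel_measurable_continuous_on[OF continuous_rot_transpose borel_measurable_Pair[OF assms]] by simp

section \<open>Real and complex Gaussian kernels\<close>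

definition rker :: "real \<Rightarrow> real \<Rightarrow> real \<Rightarrow> real^'d \<Rightarrow> real" where
  "rker \<kappa> \<rho> s y = exp (- (real CARD('d) / 2) * ln s - \<rho> * s - \<kappa> * ((norm y)\<^sup>2 / s))"

text \<open>With z = 1/(4a) and c = lam + b this is, for s > 0, the heat kernel of a times the
  Laplacian minus c, without the constant (4 pi a)^(-d/2); the inverse of that constant reappears as
  \<open>gint\<close>. The power s^(-d/2) sits in the exponent as a logarithm, so that factors split
  by \<open>exp_add\<close> for every s.\<close>

definition hker :: "complex \<Rightarrow> complex \<Rightarrow> real \<Rightarrow> real^'d \<Rightarrow> complex" where
  "hker z c s y = exp (of_real (- (real CARD('d) / 2) * ln s) - c * of_real s - z * of_real ((norm y)\<^sup>2 / s))"

lemma norm_hker: "norm (hker z c s y) = rker (Re z) (Re c) s y"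
  by (simp add: hker_def rker_def)

lemma rker_measurable [measurable]:
  assumes [measurable]: "f \<in> borel_measurable M" "g \<in> borel_measurable M"
  shows "(\<lambda>x. rker \<kappa> \<rho> (f x) (g x)) \<in> borel_measurable M"
  unfolding rker_def by measurable

lemma hker_measurable [measurable]:
  assumes [measurable]: "f \<in> borel_measurable M" "g \<in> borel_measurable M"
  shows "(\<lambda>x. hker z c (f x) (g x)) \<in> borel_measurable M"
  unfolding hker_def by measurable

lemma rker_mono:
  assumes "\<kappa> \<le> \<kappa>'" "\<rho> \<le> \<rho>'" "s > 0"
  shows "rker \<kappa>' \<rho>' s y \<le> rker \<kappa> \<rho> s y"
proof -
  have "\<rho> * s \<le> \<rho>' * s" "\<kappa> * ((norm y)\<^sup>2 / s) \<le> \<kappa>' * ((norm y)\<^sup>2 / s)"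
    using assms by (intro mult_right_mono; simp)+
  then show ?thesis by (simp add: rker_def)
qed

lemma rker_pos: "rker \<kappa> \<rho> s y > 0"
  by (simp add: rker_def)

lemma integrable_gauss:
  assumes "\<kappa> > 0"
  shows "integrable lborel (\<lambda>y::'a::euclidean_space. exp (- \<kappa> * (norm y)\<^sup>2))"
proof (rule Bochner_Integration.integrable_bound)
  let ?C = "max 1 (4 / \<kappa>) * exp (1 / \<kappa>)"
  show "integrable lborel (\<lambda>y::'a. ?C * exp (- 1 * norm y))"
    by (intro integrable_mult_right integrable_exp_neg_norm) simp
  have "exp (- \<kappa> * (norm y)\<^sup>2) \<le> ?C * exp (- 1 * norm y)" for y :: 'a
  proof -
    have "1 * exp (- \<kappa> * (norm y)\<^sup>2) \<le> (1 + (norm y)\<^sup>2) * exp (- \<kappa> * (norm y)\<^sup>2)"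
      by (intro mult_right_mono) auto
    also have "\<dots> \<le> ?C * exp (- 1 * norm y)"
      using gauss_beats_exp[OF assms, of y 0 1] by simp
    finally show ?thesis by simp
  qed
  then show "AE y in lborel. norm (exp (- \<kappa> * (norm y)\<^sup>2)) \<le> norm (?C * exp (- 1 * norm (y::'a)))"
    by (simp add: abs_mult)
qed simp

text \<open>Left unevaluated: it enters only the final constants, where finiteness and sign
  suffice.\<close>

definition gmass :: "'d::finite itself \<Rightarrow> real \<Rightarrow> real" where
  "gmass _ \<kappa> = (\<integral>y. exp (- \<kappa> * (norm (y :: real^'d))\<^sup>2) \<partial>lborel)"

lemma gmass_nonneg: "gmass T \<kappa> \<ge> 0"
  unfolding gmass_def by simp

lemma nn_integral_gauss:
  "\<kappa> > 0 \<Longrightarrow> (\<integral>\<^sup>+y. ennreal (exp (- \<kappa> * (norm (y :: real^'d))\<^sup>2)) \<partial>lborel) = ennreal (gmass TYPE('d) \<kappa>)"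
  unfolding gmass_def by (intro nn_integral_eq_integral integrable_gauss) auto

lemma exp_ln_half_power: "s > 0 \<Longrightarrow> exp (- (real n / 2) * ln s) * (sqrt s) ^ n = 1"
proof -
  assume "s > 0"
  then have "(sqrt s) ^ n = exp ((real n / 2) * ln s)"
    by (simp add: powr_realpow[symmetric] powr_def ln_sqrt)
  then show ?thesis by (simp add: exp_add[symmetric])
qed

text \<open>Scaling y by sqrt s turns the Gaussian into a fixed one, and the Jacobian s^(d/2)
  cancels the power in the kernel.\<close>

lemma nn_integral_rker:
  assumes "\<kappa> > 0" "s > 0"
  shows "(\<integral>\<^sup>+y. ennreal (rker \<kappa> \<rho> s (y :: real^'d)) \<partial>lborel) = ennreal (exp (- \<rho> * s) * gmass TYPE('d) \<kappa>)"
proof -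
  have *: "rker \<kappa> \<rho> s (sqrt s *\<^sub>R y) = (exp (- (real CARD('d) / 2) * ln s) * exp (- \<rho> * s)) * exp (- \<kappa> * (norm y)\<^sup>2)" for y :: "real^'d"
    using assms(2) by (simp add: rker_def exp_add[symmetric] power_mult_distrib)
  have "(\<integral>\<^sup>+y. ennreal (rker \<kappa> \<rho> s (y :: real^'d)) \<partial>lborel) =
    ennreal ((sqrt s) ^ CARD('d)) * (\<integral>\<^sup>+y. ennreal (rker \<kappa> \<rho> s (sqrt s *\<^sub>R y :: real^'d)) \<partial>lborel)"
    using assms(2) by (subst nn_integral_lborel_scale[of _ "sqrt s"]) auto
  also have "\<dots> = ennreal ((sqrt s) ^ CARD('d)) * (ennreal (exp (- (real CARD('d) / 2) * ln s) * exp (- \<rho> * s)) *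
     (\<integral>\<^sup>+y. ennreal (exp (- \<kappa> * (norm (y :: real^'d))\<^sup>2)) \<partial>lborel))"
    unfolding * by (subst nn_integral_cmult[symmetric]) (auto simp: ennreal_mult)
  also have "\<dots> = ennreal ((sqrt s) ^ CARD('d) * (exp (- (real CARD('d) / 2) * ln s) * exp (- \<rho> * s) * gmass TYPE('d) \<kappa>))"
    using assms gmass_nonneg[of "TYPE('d)" \<kappa>] by (simp only: nn_integral_gauss ennreal_mult) (simp add: ennreal_mult)
  also have "(sqrt s) ^ CARD('d) * (exp (- (real CARD('d) / 2) * ln s) * exp (- \<rho> * s) * gmass TYPE('d) \<kappa>) =
    (exp (- (real CARD('d) / 2) * ln s) * (sqrt s) ^ CARD('d)) * (exp (- \<rho> * s) * gmass TYPE('d) \<kappa>)"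
    by (simp only: mult_ac)
  finally show ?thesis by (simp only: exp_ln_half_power[OF assms(2)] mult_1)
qed

lemma nn_integral_exp_halfline:
  assumes "\<rho> > 0" "a \<ge> 0"
  shows "(\<integral>\<^sup>+s. ennreal (exp (- \<rho> * s)) * indicator {a..} s \<partial>lborel) \<le> ennreal (1 / \<rho>)"
proof -
  have "((\<lambda>t. - exp (- \<rho> * t) / \<rho>) \<longlongrightarrow> 0) at_top"
    using assms by real_asymp
  then have "(\<integral>\<^sup>+t\<in>{a..}. ennreal (exp (- \<rho> * t)) \<partial>lborel) = ennreal (0 - (- exp (- \<rho> * a) / \<rho>))"
    using assms
    by (intro nn_integral_FTC_atLeast) (auto intro!: derivative_eq_intros simp: field_simps)
  then show ?thesis using assms by (auto intro!: ennreal_leI divide_right_mono)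
qed

text \<open>Splitting at s = 1/\<rho>: the singular part contributes 2 / sqrt \<rho>; beyond it the
  power is at most sqrt \<rho> and the exponential integrates to at most 1/\<rho>. The singularity
  s^(-1/2) is the cost of one spatial derivative of the kernel.\<close>

lemma nn_integral_exp_sqrt_halfline:
  assumes "\<rho> > 0"
  shows "(\<integral>\<^sup>+s. ennreal (s powr (- 1 / 2) * exp (- \<rho> * s)) * indicator {0<..} s \<partial>lborel) \<le> ennreal (3 / sqrt \<rho>)"
proof -
  let ?b = "1 / \<rho>"
  have 1: "(\<integral>\<^sup>+s. ennreal (indicator {0..?b} s * s powr (- 1 / 2)) \<partial>lborel) = ennreal (2 / sqrt \<rho>)"
  proof -
    have "((\<lambda>s. s powr (- 1 / 2)) has_integral (?b powr (- 1 / 2 + 1) / (- 1 / 2 + 1))) {0..?b}"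
      using assms by (intro has_integral_powr_from_0) auto
    also have "?b powr (- 1 / 2 + 1) / (- 1 / 2 + 1) = 2 / sqrt \<rho>"
      using assms by (simp add: powr_half_sqrt real_sqrt_divide)
    finally have "((\<lambda>s. indicator {0..?b} s * s powr (- 1 / 2)) has_integral (2 / sqrt \<rho>)) UNIV"
    proof (subst (asm) has_integral_restrict_UNIV[symmetric])
      have "(\<lambda>s. if s \<in> {0..?b} then s powr (- 1 / 2) else 0) = (\<lambda>s. indicator {0..?b} s * s powr (- 1 / 2))"
        by (auto simp: fun_eq_iff)
      then show "((\<lambda>s. if s \<in> {0..?b} then s powr (- 1 / 2) else 0) has_integral 2 / sqrt \<rho>) UNIV \<Longrightarrow> ?thesis" by simp
    qed
    then show ?thesis by (intro nn_integral_has_integral_lborel) auto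
  qed
  have "(\<integral>\<^sup>+s. ennreal (s powr (- 1 / 2) * exp (- \<rho> * s)) * indicator {0<..} s \<partial>lborel) \<le>
     (\<integral>\<^sup>+s. ennreal (indicator {0..?b} s * s powr (- 1 / 2)) + ennreal (sqrt \<rho>) * (ennreal (exp (- \<rho> * s)) * indicator {?b..} s) \<partial>lborel)"
  proof (rule nn_integral_mono)
    fix s
    show "ennreal (s powr (- 1 / 2) * exp (- \<rho> * s)) * indicator {0<..} s \<le>
      ennreal (indicator {0..?b} s * s powr (- 1 / 2)) + ennreal (sqrt \<rho>) * (ennreal (exp (- \<rho> * s)) * indicator {?b..} s)"
    proof -
      consider "s \<le> 0" | "0 < s" "s \<le> ?b" | "s > ?b" "s > 0" by linarith
      then show ?thesis
      proof cases
        case 2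
        then have "s powr (- 1 / 2) * exp (- \<rho> * s) \<le> s powr (- 1 / 2) * 1"
          using assms by (intro mult_left_mono) auto
        with 2 show ?thesis by (auto intro!: add_increasing2 ennreal_leI)
      next
        case 3
        have "s powr (- 1 / 2) \<le> ?b powr (- 1 / 2)"
          using 3 assms by (intro powr_mono2') auto
        also have "?b powr (- 1 / 2) = sqrt \<rho>"
          using assms by (simp add: powr_minus powr_half_sqrt real_sqrt_divide)
        finally have "s powr (- 1 / 2) * exp (- \<rho> * s) \<le> sqrt \<rho> * exp (- \<rho> * s)" by (intro mult_right_mono) auto
        then have "ennreal (s powr (- 1 / 2) * exp (- \<rho> * s)) \<le> ennreal (sqrt \<rho>) * ennreal (exp (- \<rho> * s))"
          using assms by (subst ennreal_mult[symmetric]) (auto intro!: ennreal_leI)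
        with 3 show ?thesis by (auto intro!: add_increasing)
      qed auto
    qed
  qed
  also have "\<dots> = ennreal (2 / sqrt \<rho>) + ennreal (sqrt \<rho>) * (\<integral>\<^sup>+s. ennreal (exp (- \<rho> * s)) * indicator {?b..} s \<partial>lborel)"
    by (subst nn_integral_add, simp, simp, subst nn_integral_cmult, simp, simp only: 1)
  also have "\<dots> \<le> ennreal (2 / sqrt \<rho>) + ennreal (sqrt \<rho>) * ennreal (1 / \<rho>)"
    using assms by (intro add_mono mult_left_mono nn_integral_exp_halfline) auto
  also have "\<dots> = ennreal (2 / sqrt \<rho> + sqrt \<rho> * (1 / \<rho>))"
    using assms by (simp add: ennreal_mult[symmetric] ennreal_plus[symmetric] del: ennreal_plus)
  also have "sqrt \<rho> * (1 / \<rho>) = 1 / sqrt \<rho>"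
    using assms by (simp add: real_div_sqrt field_simps)
  finally show ?thesis by simp
qed

text \<open>Completing the square gives M |y| <= \<theta> \<alpha> |y|^2 / s + M^2 s / (4 \<theta>
  \<alpha>).\<close>

lemma exp_rker_le:
  assumes "\<theta> > 0" "\<alpha> > 0" "s > 0"
  shows "exp (M * norm y) * rker \<alpha> \<Lambda> s y \<le> rker ((1 - \<theta>) * \<alpha>) (\<Lambda> - M\<^sup>2 / (4 * \<theta> * \<alpha>)) s y"
proof -
  have "0 \<le> (2 * \<theta> * \<alpha> * norm y - M * s)\<^sup>2 / (4 * \<theta> * \<alpha> * s)" using assms by simp
  also have "\<dots> = \<theta> * \<alpha> * ((norm y)\<^sup>2 / s) + M\<^sup>2 / (4 * \<theta> * \<alpha>) * s - M * norm y"
    using assms by (simp add: power2_eq_square field_simps)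
  finally have "M * norm y \<le> \<theta> * \<alpha> * ((norm y)\<^sup>2 / s) + M\<^sup>2 / (4 * \<theta> * \<alpha>) * s" by simp
  then show ?thesis by (simp add: rker_def exp_add[symmetric] algebra_simps diff_divide_distrib)
qed

text \<open>In the scale-free variable t = sqrt \<kappa> |y| / sqrt s, half of the exponent absorbs
  the factor t because t <= exp(t^2/2). What is left is the integrable singularity s^(-1/2).\<close>

lemma norm_div_rker_le:
  assumes "\<kappa> > 0" "s > 0"
  shows "norm y / s * rker \<kappa> \<rho> s y \<le> (1 / sqrt \<kappa>) * (s powr (- 1 / 2) * rker (\<kappa> / 2) \<rho> s y)"
proof -
  define t where "t = sqrt \<kappa> * norm y / sqrt s"
  have t2: "t\<^sup>2 = \<kappa> * ((norm y)\<^sup>2 / s)" using assms by (simp add: t_def power_mult_distrib power_divide)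
  have "t \<le> 1 + t\<^sup>2 / 2" using zero_le_power2[of "t - 1"] by (simp add: power2_eq_square algebra_simps)
  also have "\<dots> \<le> exp (t\<^sup>2 / 2)" by (rule exp_ge_add_one_self)
  finally have "t * rker \<kappa> \<rho> s y \<le> exp (t\<^sup>2 / 2) * rker \<kappa> \<rho> s y"
    using rker_pos[of \<kappa> \<rho> s y] by (intro mult_right_mono) auto
  also have "\<dots> = rker (\<kappa> / 2) \<rho> s y"
    unfolding t2 by (simp add: rker_def exp_add[symmetric])
  finally have "(1 / sqrt \<kappa>) * s powr (- 1 / 2) * (t * rker \<kappa> \<rho> s y) \<le> (1 / sqrt \<kappa>) * s powr (- 1 / 2) * rker (\<kappa> / 2) \<rho> s y"
    using assms by (intro mult_left_mono) auto
  moreover have "norm y / s = (1 / sqrt \<kappa>) * s powr (- 1 / 2) * t"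
    using assms by (simp add: t_def powr_minus powr_half_sqrt field_simps)
  ultimately show ?thesis by (simp only: mult.assoc)
qed

section \<open>Jensen's inequality and Schur's test\<close>

lemma Youngs_tangent:
  fixes p :: real
  assumes "p \<ge> 1" "a > 0" "t \<ge> 0"
  shows "t \<le> a * (1 - 1 / p) + (a powr (1 - p) / p) * t powr p"
proof (cases "t = 0")
  case False
  then have t: "t > 0" using assms by simp
  have "((t / a) powr p) powr (1 / p) * 1 powr (1 - 1 / p) \<le> (1 / p) * (t / a) powr p + (1 - 1 / p) * 1"
    using assms t by (intro Youngs_inequality_0) auto
  then have "t / a \<le> (1 / p) * (t / a) powr p + (1 - 1 / p)"
    using assms t by (simp add: powr_powr)
  then have "a * (t / a) \<le> a * ((1 / p) * (t / a) powr p + (1 - 1 / p))"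
    using assms by (intro mult_left_mono) auto
  also have "a * (t / a) = t" using assms by simp
  finally have "t \<le> a * (1 - 1 / p) + (a * ((1 / a) powr p) / p) * t powr p"
    using assms t by (simp add: powr_divide algebra_simps)
  moreover have "a * ((1 / a) powr p) = a powr (1 - p)"
    using assms by (simp add: powr_diff powr_divide)
  ultimately show ?thesis by simp
qed (use assms in simp)

text \<open>Integrating the tangent bound \<open>Youngs_tangent\<close> against k replaces the
  passage to a probability measure. Stating the result for a number u below the integral, rather
  than for the integral itself, keeps it meaningful where the integral is infinite.\<close>

lemma nn_integral_Jensen:
  assumes [measurable]: "k \<in> borel_measurable M" "F \<in> borel_measurable M"
    and k: "(\<integral>\<^sup>+x. k x \<partial>M) \<le> ennreal m" and m: "m > 0" and p: "p \<ge> 1"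
    and F: "\<And>x. F x \<ge> 0" and u: "u \<ge> 0" "ennreal u \<le> (\<integral>\<^sup>+x. k x * ennreal (F x) \<partial>M)"
  shows "ennreal (u powr p) \<le> ennreal (m powr (p - 1)) * (\<integral>\<^sup>+x. k x * ennreal (F x powr p) \<partial>M)"
proof (cases "u = 0")
  case False
  then have u0: "u > 0" using u by simp
  let ?I = "\<integral>\<^sup>+x. k x * ennreal (F x powr p) \<partial>M"
  \<comment> \<open>With this tangent point the constant terms integrate to at most u - u/p, and the
    remaining u/p carries the estimate.\<close>
  define a where "a = u / m"
  have a: "a > 0" using u0 m by (simp add: a_def)
  show ?thesis
  proof (cases "?I = \<infinity>")
    case True
    then show ?thesis using m by (simp add: ennreal_mult_top)
  next
    case False
    then obtain i where i: "?I = ennreal i" "i \<ge> 0" by (cases ?I) auto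
    have "ennreal u \<le> (\<integral>\<^sup>+x. ennreal (a * (1 - 1 / p)) * k x + ennreal (a powr (1 - p) / p) * (k x * ennreal (F x powr p)) \<partial>M)"
    proof (rule order_trans[OF u(2)], rule nn_integral_mono)
      fix x
      have "ennreal (F x) \<le> ennreal (a * (1 - 1 / p) + (a powr (1 - p) / p) * F x powr p)"
        by (intro ennreal_leI Youngs_tangent p a F)
      also have "\<dots> = ennreal (a * (1 - 1 / p)) + ennreal (a powr (1 - p) / p) * ennreal (F x powr p)"
      proof -
        have "ennreal ((a powr (1 - p) / p) * F x powr p) = ennreal (a powr (1 - p) / p) * ennreal (F x powr p)"
          using p by (intro ennreal_mult) auto
        then show ?thesis using a p by (subst ennreal_plus) auto
      qed
      finally have "k x * ennreal (F x) \<le> k x * (ennreal (a * (1 - 1 / p)) + ennreal (a powr (1 - p) / p) * ennreal (F x powr p))"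
        by (intro mult_left_mono) auto
      then show "k x * ennreal (F x) \<le> ennreal (a * (1 - 1 / p)) * k x + ennreal (a powr (1 - p) / p) * (k x * ennreal (F x powr p))"
        by (simp add: distrib_left mult_ac)
    qed
    also have "\<dots> = ennreal (a * (1 - 1 / p)) * (\<integral>\<^sup>+x. k x \<partial>M) + ennreal (a powr (1 - p) / p) * ?I"
      by (simp add: nn_integral_add nn_integral_cmult)
    also have "\<dots> \<le> ennreal (a * (1 - 1 / p)) * ennreal m + ennreal (a powr (1 - p) / p) * ennreal i"
      by (intro add_mono mult_left_mono k) (auto simp: i)
    also have "\<dots> = ennreal (a * (1 - 1 / p) * m + (a powr (1 - p) / p) * i)"
    proof -
      have "ennreal (a * (1 - 1 / p) * m) = ennreal (a * (1 - 1 / p)) * ennreal m"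
        "ennreal ((a powr (1 - p) / p) * i) = ennreal (a powr (1 - p) / p) * ennreal i"
        using a p m i by (intro ennreal_mult; simp)+
      then show ?thesis using a p m i by (subst ennreal_plus) auto
    qed
    finally have "u \<le> a * (1 - 1 / p) * m + (a powr (1 - p) / p) * i"
      using a p m i by (subst (asm) ennreal_le_iff) auto
    also have "a * (1 - 1 / p) * m = u - u / p" using m by (simp add: a_def field_simps)
    finally have "u / p \<le> a powr (1 - p) * i / p" by simp
    then have "u \<le> a powr (1 - p) * i" using p by (simp add: divide_le_cancel)
    then have "u * u powr (p - 1) \<le> a powr (1 - p) * i * u powr (p - 1)"
      by (intro mult_right_mono) auto
    also have "u * u powr (p - 1) = u powr p" using u0 powr_add[of u 1 "p - 1"] by simp
    also have "a powr (1 - p) * i * u powr (p - 1) = m powr (p - 1) * i"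
      using u0 m powr_minus_divide[of "u / m" "p - 1"] by (simp add: a_def powr_divide)
    finally have "ennreal (u powr p) \<le> ennreal (m powr (p - 1) * i)" by (rule ennreal_leI)
    then show ?thesis using i by (simp add: ennreal_mult)
  qed
qed (use p in simp)

lemma nn_integral_lborel_pair:
  fixes h :: "'a::euclidean_space \<times> 'b::euclidean_space \<Rightarrow> ennreal"
  assumes "h \<in> borel_measurable borel"
  shows "(\<integral>\<^sup>+z. h z \<partial>lborel) = (\<integral>\<^sup>+x. \<integral>\<^sup>+y. h (x, y) \<partial>lborel \<partial>lborel)"
  using assms by (subst lborel_prod[symmetric], subst lborel.nn_integral_fst[symmetric])
    (simp_all add: lborel_prod)

lemma nn_integral_lborel_pair':
  fixes h :: "'a::euclidean_space \<times> 'b::euclidean_space \<Rightarrow> ennreal"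
  assumes "h \<in> borel_measurable borel"
  shows "(\<integral>\<^sup>+z. h z \<partial>lborel) = (\<integral>\<^sup>+y. \<integral>\<^sup>+x. h (x, y) \<partial>lborel \<partial>lborel)"
  using assms by (subst lborel_prod[symmetric], subst lborel_pair.nn_integral_snd[symmetric])
    (simp_all add: lborel_prod)

lemma integral_lborel_pair:
  fixes h :: "'a::euclidean_space \<times> 'b::euclidean_space \<Rightarrow> 'c::{banach, second_countable_topology}"
  assumes "integrable lborel h"
  shows "(\<integral>z. h z \<partial>lborel) = (\<integral>x. \<integral>y. h (x, y) \<partial>lborel \<partial>lborel)"
    and "(\<integral>z. h z \<partial>lborel) = (\<integral>y. \<integral>x. h (x, y) \<partial>lborel \<partial>lborel)"
  using lborel_pair.integral_fst'[of h] lborel_pair.integral_snd[of "\<lambda>x y. h (x, y)"] assms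
  by (simp_all add: lborel_prod)

lemma integral_bound_nn:
  fixes h :: "'a \<Rightarrow> 'b::{banach, second_countable_topology}"
  assumes "h \<in> borel_measurable M" "(\<integral>\<^sup>+x. ennreal (norm (h x)) \<partial>M) \<le> ennreal B" "B \<ge> 0"
  shows "integrable M h" and "norm (\<integral>x. h x \<partial>M) \<le> B"
proof -
  show i: "integrable M h"
    using assms by (intro integrableI_bounded) (auto simp: le_less_trans)
  have "ennreal (norm (\<integral>x. h x \<partial>M)) \<le> ennreal B"
    using integral_norm_bound_ennreal[OF i] assms(2) by (rule order_trans)
  then show "norm (\<integral>x. h x \<partial>M) \<le> B" using assms(3) by simp
qed

lemma norm_integral_le_nn_integral:
  fixes h :: "'a \<Rightarrow> 'b::{banach, second_countable_topology}"
  shows "ennreal (norm (\<integral>x. h x \<partial>M)) \<le> (\<integral>\<^sup>+x. ennreal (norm (h x)) \<partial>M)"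
  using integral_norm_bound_ennreal[of M h] by (cases "integrable M h") (simp_all add: not_integrable_integral_eq)

lemma fst_snd_borel [measurable]:
  "fst \<in> borel_measurable (borel :: ('a::second_countable_topology \<times> 'b::second_countable_topology) measure)"
  "snd \<in> borel_measurable (borel :: ('a::second_countable_topology \<times> 'b::second_countable_topology) measure)"
  by (intro borel_measurable_continuous_onI continuous_intros)+

text \<open>Time and space are one integral over pairs, with values in the extended nonnegative
  reals, so that Tonelli applies throughout and finiteness is decided only at the end.\<close>

definition kop :: "real^'d^'d \<Rightarrow> (real \<Rightarrow> real^'d \<Rightarrow> real) \<Rightarrow> (real^'d \<Rightarrow> ennreal) \<Rightarrow> real^'d \<Rightarrow> ennreal" where
  "kop S K F x = (\<integral>\<^sup>+z. indicator {0<..} (fst z) *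
      ennreal (K (fst z) (rot S (fst z) *v x - snd z)) * F (snd z) \<partial>lborel)"

lemma kop_mono:
  assumes "\<And>s y. s > 0 \<Longrightarrow> K s y \<le> K' s y" "\<And>x. F x \<le> F' x"
  shows "kop S K F x \<le> kop S K' F' x"
  unfolding kop_def
proof (rule nn_integral_mono)
  fix z :: "real \<times> (real^'a)"
  show "indicator {0<..} (fst z) * ennreal (K (fst z) (rot S (fst z) *v x - snd z)) * F (snd z)
    \<le> indicator {0<..} (fst z) * ennreal (K' (fst z) (rot S (fst z) *v x - snd z)) * F' (snd z)"
    using assms by (cases "fst z > 0") (auto intro!: mult_mono ennreal_leI)
qed

lemma kop_cmult:
  assumes "a \<ge> 0" "(\<lambda>z. K (fst z) (snd z)) \<in> borel_measurable (borel :: (real \<times> (real^'d)) measure)" and [measurable]: "F \<in> borel_measurable borel"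
  shows "kop S (\<lambda>s y. a * K s y) F x = ennreal a * kop S K F x"
proof -
  have [measurable]: "(\<lambda>x. K (f x) (g x)) \<in> borel_measurable M" if "f \<in> borel_measurable M" "g \<in> borel_measurable M" for M :: "'c measure" and f g
    using measurable_compose[OF borel_measurable_Pair[OF that] assms(2)] by simp
  show ?thesis unfolding kop_def using assms(1)
    by (subst nn_integral_cmult[symmetric]) (auto simp: ennreal_mult' mult_ac)
qed

context skew_matrix
begin

lemma kernel_measurable:
  assumes "(\<lambda>z. K (fst z) (snd z)) \<in> borel_measurable (borel :: (real \<times> (real^'d)) measure)"
    and "f \<in> borel_measurable M" "g \<in> borel_measurable M"
  shows "(\<lambda>x. K (f x) (g x)) \<in> borel_measurable M"
  using measurable_compose[OF borel_measurable_Pair[OF assms(2,3)] assms(1)] by simp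

lemma kernel_row_mass:
  assumes K: "(\<lambda>z. K (fst z) (snd z)) \<in> borel_measurable (borel :: (real \<times> (real^'d)) measure)"
  shows "(\<integral>\<^sup>+\<xi>. ennreal (K s (rot S s *v x - \<xi>)) \<partial>lborel) = (\<integral>\<^sup>+y. ennreal (K s y) \<partial>lborel)"
proof -
  have "(\<lambda>y. ennreal (K s y)) \<in> borel_measurable borel"
    using kernel_measurable[OF K, of "\<lambda>_. s" borel "\<lambda>y. y"] by simp
  then show ?thesis by (rule nn_integral_translate_minus)
qed

text \<open>For fixed \<xi> the kernel is centred at the back-rotated \<xi>, so radiality reduces
  the integral over x to a translation. Columns therefore have the same mass as rows.\<close>

lemma kernel_col_mass:
  assumes K: "(\<lambda>z. K (fst z) (snd z)) \<in> borel_measurable (borel :: (real \<times> (real^'d)) measure)"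
    and radial: "\<And>s y y'. norm y = norm y' \<Longrightarrow> K s y = K s y'"
  shows "(\<integral>\<^sup>+x. ennreal (K s (rot S s *v x - \<xi>)) \<partial>lborel) = (\<integral>\<^sup>+y. ennreal (K s y) \<partial>lborel)"
proof -
  have "(\<lambda>y. ennreal (K s y)) \<in> borel_measurable borel"
    using kernel_measurable[OF K, of "\<lambda>_. s" borel "\<lambda>y. y"] by simp
  from nn_integral_lborel_translate[OF this, of "- (\<xi> v* rot S s)"]
  show ?thesis using radial[OF norm_rot_diff] by simp
qed

lemma kop_kernel_measurable [measurable]:
  assumes K: "(\<lambda>z. K (fst z) (snd z)) \<in> borel_measurable (borel :: (real \<times> (real^'d)) measure)"
    and [measurable]: "F \<in> borel_measurable borel"
  shows "(\<lambda>(x, z). indicator {0<..} (fst z) * ennreal (K (fst z) (rot S (fst z) *v x - snd z)) * F (snd z))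
    \<in> borel_measurable (borel \<Otimes>\<^sub>M borel)"
proof -
  have [measurable]: "(\<lambda>x. K (fst (snd x)) (rot S (fst (snd x)) *v fst x - snd (snd x))) \<in> borel_measurable (borel \<Otimes>\<^sub>M borel)"
    by (rule kernel_measurable[OF K]) simp_all
  have [measurable]: "(\<lambda>x. F (snd (snd x))) \<in> borel_measurable ((borel :: (real^'d) measure) \<Otimes>\<^sub>M (borel :: (real \<times> (real^'d)) measure))"
    by (rule measurable_compose[OF _ assms(2)]) simp
  have [measurable]: "(\<lambda>x. indicator {0<..} (fst (snd x)) :: ennreal) \<in> borel_measurable ((borel :: (real^'d) measure) \<Otimes>\<^sub>M (borel :: (real \<times> (real^'d)) measure))"
    by (rule measurable_compose[of _ _ borel]) simp_all
  show ?thesis unfolding split_beta by measurable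
qed

lemma kop_measurable:
  assumes K: "(\<lambda>z. K (fst z) (snd z)) \<in> borel_measurable (borel :: (real \<times> (real^'d)) measure)"
    and F: "F \<in> borel_measurable borel"
  shows "kop S K F \<in> borel_measurable borel"
proof -
  have "(\<lambda>x. \<integral>\<^sup>+z. indicator {0<..} (fst z) * ennreal (K (fst z) (rot S (fst z) *v x - snd z)) * F (snd z) \<partial>lborel) \<in> borel_measurable borel"
    using kop_kernel_measurable[OF assms] by (intro lborel.borel_measurable_nn_integral) simp
  then show ?thesis by (simp add: kop_def[abs_def])
qed

lemma nn_integral_kop:
  assumes K: "(\<lambda>z. K (fst z) (snd z)) \<in> borel_measurable (borel :: (real \<times> (real^'d)) measure)"
    and radial: "\<And>s y y'. norm y = norm y' \<Longrightarrow> K s y = K s y'"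
    and F[measurable]: "F \<in> borel_measurable borel"
  shows "(\<integral>\<^sup>+x. kop S K F x \<partial>lborel) =
    (\<integral>\<^sup>+s. indicator {0<..} s * (\<integral>\<^sup>+y. ennreal (K s y) \<partial>lborel) \<partial>lborel) * (\<integral>\<^sup>+\<xi>. F \<xi> \<partial>lborel)"
proof -
  have gm[measurable]: "(\<lambda>s. \<integral>\<^sup>+y. ennreal (K s y) \<partial>lborel) \<in> borel_measurable borel"
  proof -
    have "(\<lambda>z. ennreal (K (fst z) (snd z))) \<in> borel_measurable (borel \<Otimes>\<^sub>M lborel)"
      using K unfolding measurable_cong_sets[OF sets_pair_measure_cong[OF refl sets_lborel] refl] borel_prod by simp
    then show ?thesis by (intro lborel.borel_measurable_nn_integral) (simp add: split_beta)
  qed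
  have "(\<integral>\<^sup>+x. kop S K F x \<partial>lborel) = (\<integral>\<^sup>+z. \<integral>\<^sup>+x. indicator {0<..} (fst z) *
      ennreal (K (fst z) (rot S (fst z) *v x - snd z)) * F (snd z) \<partial>lborel \<partial>lborel)"
    unfolding kop_def using kop_kernel_measurable[OF K F]
    by (intro lborel_pair.Fubini'[symmetric]) simp
  also have "\<dots> = (\<integral>\<^sup>+z. (indicator {0<..} (fst z) * (\<integral>\<^sup>+y. ennreal (K (fst z) y) \<partial>lborel)) * F (snd z) \<partial>lborel)"
  proof (rule nn_integral_cong)
    fix z :: "real \<times> (real^'d)"
    have [measurable]: "(\<lambda>x. ennreal (K (fst z) (rot S (fst z) *v x - snd z))) \<in> borel_measurable borel"
      using kernel_measurable[OF K, of "\<lambda>_. fst z" borel "\<lambda>x. rot S (fst z) *v x - snd z"] by simp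
    show "(\<integral>\<^sup>+x. indicator {0<..} (fst z) * ennreal (K (fst z) (rot S (fst z) *v x - snd z)) * F (snd z) \<partial>lborel)
      = (indicator {0<..} (fst z) * (\<integral>\<^sup>+y. ennreal (K (fst z) y) \<partial>lborel)) * F (snd z)"
      by (simp add: nn_integral_multc nn_integral_cmult kernel_col_mass[OF K radial])
  qed
  also have "\<dots> = (\<integral>\<^sup>+s. \<integral>\<^sup>+\<xi>. (indicator {0<..} s * (\<integral>\<^sup>+y. ennreal (K s y) \<partial>lborel)) * F \<xi> \<partial>lborel \<partial>lborel)"
    by (subst nn_integral_lborel_pair) simp_all
  also have "\<dots> = (\<integral>\<^sup>+s. indicator {0<..} s * (\<integral>\<^sup>+y. ennreal (K s y) \<partial>lborel) \<partial>lborel) * (\<integral>\<^sup>+\<xi>. F \<xi> \<partial>lborel)"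
    by (simp add: nn_integral_cmult nn_integral_multc)
  finally show ?thesis .
qed

text \<open>Jensen along the rows gives the factor m^(p-1), integration along the columns gives the
  missing m; the rotation affects neither mass.\<close>

lemma Schur_test:
  fixes p m :: real and F u :: "real^'d \<Rightarrow> real"
  assumes K: "(\<lambda>z. K (fst z) (snd z)) \<in> borel_measurable (borel :: (real \<times> (real^'d)) measure)"
    and radial: "\<And>s y y'. norm y = norm y' \<Longrightarrow> K s y = K s y'"
    and mass: "(\<integral>\<^sup>+s. indicator {0<..} s * (\<integral>\<^sup>+y. ennreal (K s y) \<partial>lborel) \<partial>lborel) \<le> ennreal m"
    and m: "m > 0" and p: "p \<ge> 1"
    and F[measurable]: "F \<in> borel_measurable borel" and F0: "\<And>x. F x \<ge> 0"
    and u: "\<And>x. u x \<ge> 0" "AE x in lborel. ennreal (u x) \<le> kop S K (\<lambda>x. ennreal (F x)) x"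
  shows "(\<integral>\<^sup>+x. ennreal (u x powr p) \<partial>lborel) \<le> ennreal (m powr p) * (\<integral>\<^sup>+x. ennreal (F x powr p) \<partial>lborel)"
proof -
  have pt: "AE x in lborel. ennreal (u x powr p) \<le> ennreal (m powr (p - 1)) * kop S K (\<lambda>x. ennreal (F x powr p)) x"
    using u(2)
  proof eventually_elim
    case (elim x)
    let ?k = "\<lambda>z. indicator {0<..} (fst z) * ennreal (K (fst z) (rot S (fst z) *v x - snd z))"
    have [measurable]: "(\<lambda>z. K (fst z) (rot S (fst z) *v x - snd z)) \<in> borel_measurable borel"
      by (rule kernel_measurable[OF K]) simp_all
    have [measurable]: "(\<lambda>z. indicator {0<..} (fst z) :: ennreal) \<in> borel_measurable (borel :: (real \<times> (real^'d)) measure)"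
      by (rule measurable_compose[of fst _ borel]) simp_all
    have [measurable]: "(\<lambda>z. F (snd z)) \<in> borel_measurable (borel :: (real \<times> (real^'d)) measure)"
      by (rule measurable_compose[OF _ F]) simp
    have [measurable]: "(\<lambda>\<xi>. K s (rot S s *v x - \<xi>)) \<in> borel_measurable borel" for s
      by (rule kernel_measurable[OF K]) simp_all
    have "(\<integral>\<^sup>+z. ?k z \<partial>lborel) \<le> ennreal m"
      using mass by (subst nn_integral_lborel_pair) (simp_all add: nn_integral_cmult kernel_row_mass[OF K])
    from nn_integral_Jensen[OF _ _ this m p, of "\<lambda>z. F (snd z)" "u x"] elim F0 u(1)
    show ?case unfolding kop_def by simp
  qed
  have [measurable]: "kop S K (\<lambda>x. ennreal (F x powr p)) \<in> borel_measurable borel"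
    by (rule kop_measurable[OF K]) simp
  have "(\<integral>\<^sup>+x. ennreal (u x powr p) \<partial>lborel) \<le> (\<integral>\<^sup>+x. ennreal (m powr (p - 1)) * kop S K (\<lambda>x. ennreal (F x powr p)) x \<partial>lborel)"
    by (rule nn_integral_mono_AE[OF pt])
  also have "\<dots> = ennreal (m powr (p - 1)) * (\<integral>\<^sup>+x. kop S K (\<lambda>x. ennreal (F x powr p)) x \<partial>lborel)"
    by (rule nn_integral_cmult) simp
  also have "\<dots> \<le> ennreal (m powr (p - 1)) * (ennreal m * (\<integral>\<^sup>+x. ennreal (F x powr p) \<partial>lborel))"
    by (subst nn_integral_kop[OF K radial]) (auto intro!: mult_left_mono mult_right_mono mass)
  also have "\<dots> = ennreal (m powr p) * (\<integral>\<^sup>+x. ennreal (F x powr p) \<partial>lborel)"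
  proof -
    have "ennreal (m powr p) = ennreal (m powr (p - 1)) * ennreal m"
      using m powr_add[of m "p - 1" 1] by (subst ennreal_mult[symmetric]) auto
    then show ?thesis by (simp add: mult.assoc)
  qed
  finally show ?thesis .
qed

end

lemma rker_mass:
  assumes "\<kappa> > 0" "\<rho> > 0"
  shows "(\<integral>\<^sup>+s. indicator {0<..} s * (\<integral>\<^sup>+y. ennreal (rker \<kappa> \<rho> s (y :: real^'d)) \<partial>lborel) \<partial>lborel)
    \<le> ennreal (gmass TYPE('d) \<kappa> / \<rho>)"
proof -
  have "(\<integral>\<^sup>+s. indicator {0<..} s * (\<integral>\<^sup>+y. ennreal (rker \<kappa> \<rho> s (y :: real^'d)) \<partial>lborel) \<partial>lborel) \<le>
    (\<integral>\<^sup>+s. ennreal (gmass TYPE('d) \<kappa>) * (ennreal (exp (- \<rho> * s)) * indicator {0..} s) \<partial>lborel)"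
    using gmass_nonneg[of "TYPE('d)" \<kappa>]
    by (intro nn_integral_mono) (auto simp: nn_integral_rker[OF assms(1)] ennreal_mult mult_ac split: split_indicator)
  also have "\<dots> = ennreal (gmass TYPE('d) \<kappa>) * (\<integral>\<^sup>+s. ennreal (exp (- \<rho> * s)) * indicator {0..} s \<partial>lborel)"
    by (rule nn_integral_cmult) simp
  also have "\<dots> \<le> ennreal (gmass TYPE('d) \<kappa>) * ennreal (1 / \<rho>)"
    by (intro mult_left_mono nn_integral_exp_halfline assms) auto
  also have "\<dots> = ennreal (gmass TYPE('d) \<kappa> / \<rho>)"
    using assms gmass_nonneg[of "TYPE('d)" \<kappa>] by (subst ennreal_mult[symmetric]) auto
  finally show ?thesis .
qed

lemma sqrt_rker_mass:
  assumes "\<kappa> > 0" "\<rho> > 0"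
  shows "(\<integral>\<^sup>+s. indicator {0<..} s * (\<integral>\<^sup>+y. ennreal (s powr (- 1 / 2) * rker \<kappa> \<rho> s (y :: real^'d)) \<partial>lborel) \<partial>lborel)
    \<le> ennreal (3 * gmass TYPE('d) \<kappa> / sqrt \<rho>)"
proof -
  have "(\<integral>\<^sup>+s. indicator {0<..} s * (\<integral>\<^sup>+y. ennreal (s powr (- 1 / 2) * rker \<kappa> \<rho> s (y :: real^'d)) \<partial>lborel) \<partial>lborel) \<le>
    (\<integral>\<^sup>+s. ennreal (gmass TYPE('d) \<kappa>) * (ennreal (s powr (- 1 / 2) * exp (- \<rho> * s)) * indicator {0<..} s) \<partial>lborel)"
  proof (rule nn_integral_mono)
    fix s :: real
    show "indicator {0<..} s * (\<integral>\<^sup>+y. ennreal (s powr (- 1 / 2) * rker \<kappa> \<rho> s (y :: real^'d)) \<partial>lborel) \<le>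
      ennreal (gmass TYPE('d) \<kappa>) * (ennreal (s powr (- 1 / 2) * exp (- \<rho> * s)) * indicator {0<..} s)"
    proof (cases "s > 0")
      case True
      have "(\<integral>\<^sup>+y. ennreal (s powr (- 1 / 2) * rker \<kappa> \<rho> s (y :: real^'d)) \<partial>lborel) =
        ennreal (s powr (- 1 / 2)) * ennreal (exp (- \<rho> * s) * gmass TYPE('d) \<kappa>)"
        by (simp add: ennreal_mult' nn_integral_cmult nn_integral_rker[OF assms(1) True])
      with True show ?thesis using gmass_nonneg[of "TYPE('d)" \<kappa>]
        by (simp add: ennreal_mult mult_ac)
    qed simp
  qed
  also have "\<dots> = ennreal (gmass TYPE('d) \<kappa>) * (\<integral>\<^sup>+s. ennreal (s powr (- 1 / 2) * exp (- \<rho> * s)) * indicator {0<..} s \<partial>lborel)"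
    by (rule nn_integral_cmult) simp
  also have "\<dots> \<le> ennreal (gmass TYPE('d) \<kappa>) * ennreal (3 / sqrt \<rho>)"
    by (intro mult_left_mono nn_integral_exp_sqrt_halfline assms) auto
  also have "\<dots> = ennreal (3 * gmass TYPE('d) \<kappa> / sqrt \<rho>)"
    using assms gmass_nonneg[of "TYPE('d)" \<kappa>] by (subst ennreal_mult[symmetric]) auto
  finally show ?thesis .
qed

lemma rker_borel: "(\<lambda>z. rker \<kappa> \<rho> (fst z) (snd z)) \<in> borel_measurable (borel :: (real \<times> (real^'d)) measure)"
  by measurable

lemma sqrt_rker_borel: "(\<lambda>z. fst z powr (- 1 / 2) * rker \<kappa> \<rho> (fst z) (snd z)) \<in> borel_measurable (borel :: (real \<times> (real^'d)) measure)"
  using rker_borel by measurable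

lemma rker_radial: "norm (y :: real^'d) = norm (y' :: real^'d) \<Longrightarrow> rker \<kappa> \<rho> s y = rker \<kappa> \<rho> s y'"
  by (simp add: rker_def)

section \<open>Representation by the heat kernel\<close>

lemma locally_integrable_weighted:
  fixes u :: "real^'d \<Rightarrow> complex"
  assumes [measurable]: "u \<in> borel_measurable borel" and u: "integrable lborel (\<lambda>x. exp (- M * norm x) *\<^sub>R u x)"
  shows "locally_integrable u"
proof (intro allI impI)
  fix K :: "(real^'d) set"
  assume K: "compact K"
  then have [measurable]: "K \<in> sets borel" by (simp add: compact_imp_closed)
  obtain r where r: "\<And>x. x \<in> K \<Longrightarrow> norm x \<le> r" using compact_imp_bounded[OF K] by (auto simp: bounded_iff)
  show "set_integrable lborel K u" unfolding set_integrable_def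
  proof (rule Bochner_Integration.integrable_bound)
    show "integrable lborel (\<lambda>x. exp (\<bar>M\<bar> * r) *\<^sub>R (exp (- M * norm x) *\<^sub>R u x))"
      using u by (rule integrable_scaleR_right)
    show "AE x in lborel. norm (indicator K x *\<^sub>R u x) \<le> norm (exp (\<bar>M\<bar> * r) *\<^sub>R (exp (- M * norm x) *\<^sub>R u x))"
    proof (intro AE_I2)
      fix x
      show "norm (indicator K x *\<^sub>R u x) \<le> norm (exp (\<bar>M\<bar> * r) *\<^sub>R (exp (- M * norm x) *\<^sub>R u x))"
      proof (cases "x \<in> K")
        case True
        have "M * norm x \<le> \<bar>M\<bar> * norm x" by (intro mult_right_mono) auto
        also have "\<dots> \<le> \<bar>M\<bar> * r" using r[OF True] by (intro mult_left_mono) auto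
        finally have "1 * norm (u x) \<le> exp (\<bar>M\<bar> * r - M * norm x) * norm (u x)"
          by (intro mult_right_mono) auto
        then show ?thesis using True by (simp add: exp_diff exp_minus divide_inverse mult.assoc)
      qed simp
    qed
  qed simp
qed

lemma integrable_lborel_pair_mult:
  fixes a :: "'a::euclidean_space \<Rightarrow> real" and b :: "'b::euclidean_space \<Rightarrow> real"
  assumes "integrable lborel a" "integrable lborel b"
  shows "integrable lborel (\<lambda>z. a (fst z) * b (snd z))"
proof (rule integrableI_bounded)
  have [measurable]: "a \<in> borel_measurable borel" "b \<in> borel_measurable borel"
    using assms by (auto dest: borel_measurable_integrable)
  show "(\<lambda>z. a (fst z) * b (snd z)) \<in> borel_measurable lborel" by simp
  have "(\<integral>\<^sup>+z. ennreal (norm (a (fst z) * b (snd z))) \<partial>lborel) =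
     (\<integral>\<^sup>+x. ennreal (norm (a x)) \<partial>lborel) * (\<integral>\<^sup>+y. ennreal (norm (b y)) \<partial>lborel)"
    by (subst nn_integral_lborel_pair) (simp_all add: abs_mult ennreal_mult nn_integral_cmult nn_integral_multc)
  also have "\<dots> < \<infinity>"
    using assms unfolding integrable_iff_bounded by (simp add: ennreal_mult_less_top)
  finally show "(\<integral>\<^sup>+z. ennreal (norm (a (fst z) * b (snd z))) \<partial>lborel) < \<infinity>" .
qed

lemma test_fun_exp_bound:
  assumes "test_fun \<phi>" "M \<ge> 0"
  obtains C where "C > 0" "\<And>x. \<bar>\<phi> x\<bar> \<le> C * exp (- M * norm x)"
proof -
  obtain r where r: "r > 0" "\<And>x. norm x \<ge> r \<Longrightarrow> \<phi> x = 0"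
    using test_fun_vanish_outside[OF assms(1)] by metis
  obtain C where C: "C > 0" "\<And>x. \<bar>\<phi> x\<bar> \<le> C" using test_fun_bounded[OF assms(1)] by metis
  have "\<bar>\<phi> x\<bar> \<le> (C * exp (M * r)) * exp (- M * norm x)" for x
  proof (cases "norm x \<ge> r")
    case True
    then show ?thesis using r C by simp
  next
    case False
    then have "M * norm x \<le> M * r" using assms(2) by (intro mult_left_mono) auto
    then have "C * 1 \<le> C * exp (M * r - M * norm x)" using C(1) by (intro mult_left_mono) auto
    then show ?thesis using C(2)[of x] by (simp add: exp_diff exp_minus divide_inverse mult.assoc)
  qed
  with C(1) that[of "C * exp (M * r)"] show ?thesis by simp
qed

lemma hker_radial: "norm (y :: real^'d) = norm (y' :: real^'d) \<Longrightarrow> hker z c s y = hker z c s y'"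
  by (simp add: hker_def)

text \<open>In closed form this is (pi/z)^(d/2). It is the factor between w and the integral of the
  unnormalised kernel, and dividing by it rests on \<open>gint_nonzero\<close>.\<close>

definition gint :: "'d::finite itself \<Rightarrow> complex \<Rightarrow> complex" where
  "gint _ z = (\<integral>y. exp (- z * of_real ((norm (y :: real^'d))\<^sup>2)) \<partial>lborel)"

locale heat_equation = skew_matrix S for S :: "real^'d^'d" +
  fixes z c :: complex and \<alpha> \<Lambda> \<theta> M :: real and w f :: "real^'d \<Rightarrow> complex"
  assumes \<alpha>: "0 < \<alpha>" "\<alpha> \<le> Re z" and \<theta>: "0 < \<theta>" "\<theta> < 1"
    and \<Lambda>: "0 < \<Lambda>" "\<Lambda> \<le> Re c" and M: "0 \<le> M" "M\<^sup>2 / (4 * \<theta> * \<alpha>) < \<Lambda>"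
    and w_meas [measurable]: "w \<in> borel_measurable borel"
    and f_meas [measurable]: "f \<in> borel_measurable borel"
    and w_int: "integrable lborel (\<lambda>x. exp (- M * norm x) *\<^sub>R w x)"
    and f_int: "integrable lborel (\<lambda>x. exp (- M * norm x) *\<^sub>R f x)"
    and weak: "\<And>\<phi>. ctest \<phi> \<Longrightarrow> (\<integral>x. \<phi> x * f x \<partial>lborel) =
      (\<integral>x. (c * \<phi> x - 1 / (4 * z) * (\<Sum>i\<in>UNIV. cpderiv i (cpderiv i \<phi>) x)
         + (\<Sum>i\<in>UNIV. (S *v x) $ i *\<^sub>R cpderiv i \<phi> x)) * w x \<partial>lborel)"
begin

text \<open>\<open>\<kappa>\<close> and \<open>\<rho>\<close> are the rates in space and time that
  remain after \<open>exp_rker_le\<close> has absorbed a weight of growth rate M.\<close>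

definition \<kappa> where "\<kappa> = (1 - \<theta>) * \<alpha>"
definition \<rho> where "\<rho> = \<Lambda> - M\<^sup>2 / (4 * \<theta> * \<alpha>)"
definition E :: "real^'d \<Rightarrow> real" where "E x = exp (- M * norm x)"
definition hk where "hk s x \<xi> = hker z c s (rot S s *v x - \<xi>)"

lemma \<kappa>: "\<kappa> > 0" and \<rho>: "\<rho> > 0" and z0: "z \<noteq> 0" and Rez: "Re z > 0"
  using \<alpha> \<theta> M by (auto simp: \<kappa>_def \<rho>_def)

lemma E_pos: "E x > 0" by (simp add: E_def)

lemma E_measurable [measurable]: "E \<in> borel_measurable borel"
  unfolding E_def[abs_def] by measurable

lemma hk_measurable [measurable]:
  assumes [measurable]: "a \<in> borel_measurable N" "b \<in> borel_measurable N" "e \<in> borel_measurable N"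
  shows "(\<lambda>x. hk (a x) (b x) (e x)) \<in> borel_measurable N"
  unfolding hk_def by measurable

lemma norm_hk_le: "s > 0 \<Longrightarrow> norm (hk s x \<xi>) \<le> rker \<alpha> \<Lambda> s (rot S s *v x - \<xi>)"
  unfolding hk_def norm_hker using \<alpha> \<Lambda> by (intro rker_mono) auto

text \<open>The rotation preserves |x|, so by the triangle inequality moving the weight from x to
  \<xi> costs an exponential of the kernel argument alone.\<close>

lemma E_le: "E x \<le> exp (M * norm (rot S s *v x - \<xi>)) * E \<xi>"
proof -
  have "norm \<xi> \<le> norm x + norm (rot S s *v x - \<xi>)"
    using norm_triangle_ineq4[of "rot S s *v x" "rot S s *v x - \<xi>"] by simp
  then have "M * norm \<xi> \<le> M * norm x + M * norm (rot S s *v x - \<xi>)"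
    using M(1) by (metis distrib_left mult_left_mono)
  then show ?thesis by (simp add: E_def exp_add[symmetric])
qed

lemma E_rker_le:
  assumes "s > 0"
  shows "E x * rker \<alpha> \<Lambda> s (rot S s *v x - \<xi>) \<le> rker \<kappa> \<rho> s (rot S s *v x - \<xi>) * E \<xi>"
proof -
  have "E x * rker \<alpha> \<Lambda> s (rot S s *v x - \<xi>) \<le> exp (M * norm (rot S s *v x - \<xi>)) * E \<xi> * rker \<alpha> \<Lambda> s (rot S s *v x - \<xi>)"
    using rker_pos less_imp_le by (intro mult_right_mono E_le) blast
  also have "\<dots> = (exp (M * norm (rot S s *v x - \<xi>)) * rker \<alpha> \<Lambda> s (rot S s *v x - \<xi>)) * E \<xi>"
    by (simp add: mult_ac)
  also have "\<dots> \<le> rker \<kappa> \<rho> s (rot S s *v x - \<xi>) * E \<xi>"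
    unfolding \<kappa>_def \<rho>_def using assms \<alpha> \<theta> E_pos[of \<xi>] by (intro mult_right_mono exp_rker_le) auto
  finally show ?thesis .
qed

lemma E_norm_hk_le: "s > 0 \<Longrightarrow> E x * norm (hk s x \<xi>) \<le> rker \<kappa> \<rho> s (rot S s *v x - \<xi>) * E \<xi>"
  using mult_left_mono[OF norm_hk_le, of s "E x" x \<xi>] E_rker_le[of s x \<xi>] E_pos[of x] by linarith

definition dhk where "dhk s x \<xi> = (of_real (- (real CARD('d) / 2) / s) - c
   + z * of_real ((norm (rot S s *v x - \<xi>))\<^sup>2 / s\<^sup>2)
   + (2 * z / of_real s) * of_real ((S *v (rot S s *v x)) \<bullet> \<xi>)) * hk s x \<xi>"

lemma dhk_measurable [measurable]:
  assumes [measurable]: "a \<in> borel_measurable N" "b \<in> borel_measurable N" "e \<in> borel_measurable N"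
  shows "(\<lambda>x. dhk (a x) (b x) (e x)) \<in> borel_measurable N"
proof -
  have [measurable]: "(\<lambda>x. S *v x) \<in> borel_measurable borel"
    by (intro borel_measurable_continuous_onI linear_continuous_on matrix_vector_mul_bounded_linear)
  show ?thesis unfolding dhk_def by measurable
qed

text \<open>Orthogonality confines the dependence on s to a single inner product, whose derivative
  is \<open>rot_inner_derivative\<close>.\<close>

lemma norm_diff_sq: "(norm (rot S s *v x - \<xi>))\<^sup>2 = (norm x)\<^sup>2 + (norm \<xi>)\<^sup>2 - 2 * ((rot S s *v x) \<bullet> \<xi>)"
proof -
  have "(norm (rot S s *v x - \<xi>))\<^sup>2 = (norm (rot S s *v x))\<^sup>2 + (norm \<xi>)\<^sup>2 - 2 * ((rot S s *v x) \<bullet> \<xi>)"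
    unfolding power2_norm_eq_inner by (simp add: inner_diff_left inner_diff_right inner_commute)
  then show ?thesis by simp
qed

lemma hk_derivative:
  assumes "s > 0"
  shows "((\<lambda>s. hk s x \<xi>) has_vector_derivative dhk s x \<xi>) (at s)"
proof -
  let ?N = "\<lambda>s. (norm x)\<^sup>2 + (norm \<xi>)\<^sup>2 - 2 * ((rot S s *v x) \<bullet> \<xi>)"
  have N': "(?N has_real_derivative - 2 * ((S *v (rot S s *v x)) \<bullet> \<xi>)) (at s)"
    by (auto intro!: derivative_eq_intros rot_inner_derivative)
  have "((\<lambda>s. ?N s / s) has_real_derivative (- 2 * ((S *v (rot S s *v x)) \<bullet> \<xi>) * s - ?N s * 1) / (s * s)) (at s)"
    using assms by (intro DERIV_divide N' DERIV_ident) auto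
  then have q: "((\<lambda>s. complex_of_real (?N s / s)) has_vector_derivative of_real ((- 2 * ((S *v (rot S s *v x)) \<bullet> \<xi>) * s - ?N s * 1) / (s * s))) (at s)"
    by (intro has_vector_derivative_of_real) (simp add: has_real_derivative_iff_has_vector_derivative)
  have l: "((\<lambda>s. complex_of_real (- (real CARD('d) / 2) * ln s)) has_vector_derivative of_real (- (real CARD('d) / 2) * (1 / s))) (at s)"
    using assms by (intro has_vector_derivative_of_real)
      (auto simp: has_real_derivative_iff_has_vector_derivative[symmetric] intro!: derivative_eq_intros)
  have i: "((\<lambda>s. complex_of_real s) has_vector_derivative of_real 1) (at s)"
    by (intro has_vector_derivative_of_real) simp
  have "((\<lambda>s. of_real (- (real CARD('d) / 2) * ln s) - c * of_real s - z * of_real (?N s / s)) has_vector_derivative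
     (of_real (- (real CARD('d) / 2) * (1 / s)) - c * of_real 1 - z * of_real ((- 2 * ((S *v (rot S s *v x)) \<bullet> \<xi>) * s - ?N s * 1) / (s * s)))) (at s)"
    by (intro has_vector_derivative_diff has_vector_derivative_mult_right l i q)
  from field_vector_diff_chain_at[OF this DERIV_exp]
  have "((\<lambda>s. hk s x \<xi>) has_vector_derivative
     (of_real (- (real CARD('d) / 2) * (1 / s)) - c * of_real 1 - z * of_real ((- 2 * ((S *v (rot S s *v x)) \<bullet> \<xi>) * s - ?N s * 1) / (s * s))) * hk s x \<xi>) (at s)"
    by (simp add: o_def hk_def hker_def norm_diff_sq)
  moreover have "of_real (- (real CARD('d) / 2) * (1 / s)) - c * of_real 1 - z * of_real ((- 2 * ((S *v (rot S s *v x)) \<bullet> \<xi>) * s - ?N s * 1) / (s * s))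
    = of_real (- (real CARD('d) / 2) / s) - c + z * of_real (?N s / s\<^sup>2) + (2 * z / of_real s) * of_real ((S *v (rot S s *v x)) \<bullet> \<xi>)"
    using assms by (simp add: field_simps power2_eq_square)
  ultimately show ?thesis unfolding dhk_def norm_diff_sq by (simp only:)
qed

lemma hk_gauss:
  assumes "s > 0"
  shows "hk s x \<xi> = exp (of_real (- (real CARD('d) / 2) * ln s) - c * of_real s) * gauss (z / of_real s) (rot S s *v x) \<xi>"
  unfolding hk_def hker_def gauss_def exp_add[symmetric] norm_minus_commute[of \<xi>] by simp

text \<open>As a function of \<xi> the kernel is a complex Gaussian with parameter z/s centred at
  the rotated x. The multiplier that \<open>gauss_equation\<close> produces for a = 1/(4z) is minus
  the one in \<open>dhk\<close>: this is the heat equation of the kernel in \<xi>, paired with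
  w.\<close>

lemma dhk_equation:
  assumes s: "s > 0"
  shows "(\<integral>\<xi>. dhk s x \<xi> * w \<xi> \<partial>lborel) = - (\<integral>\<xi>. hk s x \<xi> * f \<xi> \<partial>lborel)"
proof -
  define P where "P = exp (of_real (- (real CARD('d) / 2) * ln s) - c * of_real s)"
  have 1: "hk s x \<xi> = P * gauss (z / of_real s) (rot S s *v x) \<xi>" for \<xi>
    unfolding hk_gauss[OF s] P_def ..
  have ge: "(\<integral>\<xi>. gauss (z / of_real s) (rot S s *v x) \<xi> * f \<xi> \<partial>lborel) =
    (\<integral>\<xi>. (c + 2 * (1 / (4 * z)) * (z / of_real s) * of_nat CARD('d) - 4 * (1 / (4 * z)) * (z / of_real s)\<^sup>2 * of_real ((norm (\<xi> - rot S s *v x))\<^sup>2)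
       + 2 * (z / of_real s) * of_real ((S *v \<xi>) \<bullet> (rot S s *v x))) * gauss (z / of_real s) (rot S s *v x) \<xi> * w \<xi> \<partial>lborel)"
    using s Rez by (intro gauss_equation[OF skew _ w_meas f_meas w_int f_int weak]) auto
  have eq: "(c + 2 * (1 / (4 * z)) * (z / of_real s) * of_nat CARD('d) - 4 * (1 / (4 * z)) * (z / of_real s)\<^sup>2 * of_real ((norm (\<xi> - rot S s *v x))\<^sup>2)
       + 2 * (z / of_real s) * of_real ((S *v \<xi>) \<bullet> (rot S s *v x))) * (P * gauss (z / of_real s) (rot S s *v x) \<xi>) = - dhk s x \<xi>" for \<xi>
  proof -
    have a: "2 * (1 / (4 * z)) * (z / of_real s) * of_nat CARD('d) = of_real (real CARD('d) / 2 / s)"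
      using z0 by simp
    have b: "4 * (1 / (4 * z)) * (z / of_real s)\<^sup>2 * of_real ((norm (\<xi> - rot S s *v x))\<^sup>2) = z * of_real ((norm (rot S s *v x - \<xi>))\<^sup>2 / s\<^sup>2)"
      using z0 by (simp add: norm_minus_commute power2_eq_square)
    have e: "(S *v \<xi>) \<bullet> (rot S s *v x) = - ((S *v (rot S s *v x)) \<bullet> \<xi>)"
      using skew_inner_zero(3)[OF skew, of \<xi> "rot S s *v x"] by (simp add: inner_commute)
    show ?thesis unfolding dhk_def 1[symmetric] a b e by (simp add: algebra_simps)
  qed
  have "(\<integral>\<xi>. hk s x \<xi> * f \<xi> \<partial>lborel) = P * (\<integral>\<xi>. gauss (z / of_real s) (rot S s *v x) \<xi> * f \<xi> \<partial>lborel)"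
    unfolding 1 by (simp add: mult.assoc)
  also have "\<dots> = (\<integral>\<xi>. P * ((c + 2 * (1 / (4 * z)) * (z / of_real s) * of_nat CARD('d) - 4 * (1 / (4 * z)) * (z / of_real s)\<^sup>2 * of_real ((norm (\<xi> - rot S s *v x))\<^sup>2)
       + 2 * (z / of_real s) * of_real ((S *v \<xi>) \<bullet> (rot S s *v x))) * gauss (z / of_real s) (rot S s *v x) \<xi> * w \<xi>) \<partial>lborel)"
    unfolding ge by (rule integral_mult_right_zero[symmetric])
  also have "\<dots> = (\<integral>\<xi>. - (dhk s x \<xi> * w \<xi>) \<partial>lborel)"
  proof (intro Bochner_Integration.integral_cong refl)
    fix \<xi>
    have *: "P * (X * g * v) = (X * (P * g)) * v" for X g v :: complex by (simp only: mult_ac)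
    show "P * ((c + 2 * (1 / (4 * z)) * (z / of_real s) * of_nat CARD('d) - 4 * (1 / (4 * z)) * (z / of_real s)\<^sup>2 * of_real ((norm (\<xi> - rot S s *v x))\<^sup>2)
       + 2 * (z / of_real s) * of_real ((S *v \<xi>) \<bullet> (rot S s *v x))) * gauss (z / of_real s) (rot S s *v x) \<xi> * w \<xi>) = - (dhk s x \<xi> * w \<xi>)"
      unfolding * eq by simp
  qed
  finally show ?thesis by simp
qed

text \<open>Away from s = 0 the kernel and its time derivative are dominated by the weight,
  uniformly on compact time intervals. This is the domination behind Fubini in
  \<open>F_difference\<close>; the constant is allowed to depend on x and on the interval.\<close>

lemma hk_bounds:
  assumes t: "0 < t1" "t1 \<le> t2"
  obtains C where "C > 0" "\<And>s \<xi>. t1 \<le> s \<Longrightarrow> s \<le> t2 \<Longrightarrow> norm (hk s x \<xi>) \<le> C * E \<xi>"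
    "\<And>s \<xi>. t1 \<le> s \<Longrightarrow> s \<le> t2 \<Longrightarrow> norm (dhk s x \<xi>) \<le> C * E \<xi>"
proof -
  obtain BS where BS: "BS > 0" "\<And>x. norm (S *v x) \<le> BS * norm x"
    using bounded_linear.pos_bounded[OF matrix_vector_mul_bounded_linear[of S]] by (auto simp: mult.commute)
  define k where "k = \<alpha> / t2"
  have k: "k > 0" using t \<alpha> by (simp add: k_def)
  define L where "L = max 1 (4 / k) * exp (M\<^sup>2 / k + k * (norm x)\<^sup>2)"
  define P where "P = exp (- (real CARD('d) / 2) * ln t1)"
  define K where "K = real CARD('d) / 2 / t1 + norm c + norm z * (2 * (norm x)\<^sup>2 + 2) / t1\<^sup>2 + 2 * norm z / t1 * (BS * norm x)"
  have L0: "L > 0" and P0: "P > 0" by (auto simp: L_def P_def intro!: mult_pos_pos)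
  have K0: "K \<ge> 0" using t BS by (auto simp: K_def intro!: add_nonneg_nonneg mult_nonneg_nonneg divide_nonneg_nonneg)
  have h: "(1 + (norm \<xi>)\<^sup>2) * norm (hk s x \<xi>) \<le> P * L * E \<xi>" if s: "t1 \<le> s" "s \<le> t2" for s \<xi>
  proof -
    have s0: "s > 0" using s t by simp
    have "norm (hk s x \<xi>) \<le> rker \<alpha> 0 s (rot S s *v x - \<xi>)"
      unfolding hk_def norm_hker using \<alpha> \<Lambda> s0 by (intro rker_mono) auto
    \<comment> \<open>The smallest time controls the power of s, the largest one the Gaussian
      rate.\<close>
    also have "\<dots> \<le> P * exp (- k * (norm (\<xi> - rot S s *v x))\<^sup>2)"
    proof -
      have "ln t1 \<le> ln s" using s t by simp
      then have "- (real CARD('d) / 2) * ln s \<le> - (real CARD('d) / 2) * ln t1"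
        by (intro mult_left_mono_neg) auto
      moreover have "(\<alpha> * (norm (rot S s *v x - \<xi>))\<^sup>2) / t2 \<le> (\<alpha> * (norm (rot S s *v x - \<xi>))\<^sup>2) / s"
        using s s0 \<alpha> by (intro divide_left_mono) auto
      moreover have "\<alpha> * ((norm (rot S s *v x - \<xi>))\<^sup>2 / s) = (\<alpha> * (norm (rot S s *v x - \<xi>))\<^sup>2) / s"
        "- (\<alpha> / t2) * (norm (rot S s *v x - \<xi>))\<^sup>2 = - ((\<alpha> * (norm (rot S s *v x - \<xi>))\<^sup>2) / t2)" by simp_all
      ultimately have "- (real CARD('d) / 2) * ln s - 0 * s - \<alpha> * ((norm (rot S s *v x - \<xi>))\<^sup>2 / s) \<le>
        - (real CARD('d) / 2) * ln t1 + - (\<alpha> / t2) * (norm (rot S s *v x - \<xi>))\<^sup>2" by linarith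
      then show ?thesis
        unfolding rker_def P_def k_def exp_add[symmetric] norm_minus_commute[of \<xi>] exp_le_cancel_iff .
    qed
    finally have "(1 + (norm \<xi>)\<^sup>2) * norm (hk s x \<xi>) \<le> (1 + (norm \<xi>)\<^sup>2) * (P * exp (- k * (norm (\<xi> - rot S s *v x))\<^sup>2))"
      by (intro mult_left_mono) auto
    also have "\<dots> = P * ((1 + (norm \<xi>)\<^sup>2) * exp (- k * (norm (\<xi> - rot S s *v x))\<^sup>2))" by (simp only: mult_ac)
    also have "\<dots> \<le> P * (max 1 (4 / k) * exp (M\<^sup>2 / k + k * (norm (rot S s *v x))\<^sup>2) * exp (- M * norm \<xi>))"
      using P0 by (intro mult_left_mono gauss_beats_exp[OF k]) auto
    finally show ?thesis by (simp add: L_def E_def mult.assoc)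
  qed
  show ?thesis
  proof (rule that[of "max 1 K * (P * L)"])
    show "max 1 K * (P * L) > 0" using L0 P0 by (auto intro!: mult_pos_pos)
    fix s \<xi> assume s: "t1 \<le> s" "s \<le> t2"
    have "1 * norm (hk s x \<xi>) \<le> (1 + (norm \<xi>)\<^sup>2) * norm (hk s x \<xi>)" by (intro mult_right_mono) auto
    also note h[OF s]
    also have "P * L * E \<xi> \<le> max 1 K * (P * L * E \<xi>)"
      using mult_right_mono[of 1 "max 1 K" "P * L * E \<xi>"] P0 L0 E_pos[of \<xi>] by simp
    finally show "norm (hk s x \<xi>) \<le> max 1 K * (P * L) * E \<xi>" by (simp add: mult.assoc)
    have s0: "s > 0" using s t by simp
    have "norm (of_real (- (real CARD('d) / 2) / s) - c + z * of_real ((norm (rot S s *v x - \<xi>))\<^sup>2 / s\<^sup>2)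
        + (2 * z / of_real s) * of_real ((S *v (rot S s *v x)) \<bullet> \<xi>)) \<le> K * (1 + (norm \<xi>)\<^sup>2)"
    proof -
      let ?q = "1 + (norm \<xi>)\<^sup>2"
      have n1: "norm \<xi> \<le> ?q"
        using sum_squares_bound[of "norm \<xi>" 1] norm_ge_zero[of \<xi>] by (simp only: power_one mult_1_right)
      have "norm (of_real (- (real CARD('d) / 2) / s) - c + z * of_real ((norm (rot S s *v x - \<xi>))\<^sup>2 / s\<^sup>2)
        + (2 * z / of_real s) * of_real ((S *v (rot S s *v x)) \<bullet> \<xi>))
        \<le> norm (complex_of_real (- (real CARD('d) / 2) / s)) + norm c + norm (z * of_real ((norm (rot S s *v x - \<xi>))\<^sup>2 / s\<^sup>2))
         + norm ((2 * z / of_real s) * of_real ((S *v (rot S s *v x)) \<bullet> \<xi>))"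
        by (intro norm_triangle_le norm_triangle_le_diff add_mono order_refl)
      also have "\<dots> = real CARD('d) / 2 / s + norm c + norm z * (norm (rot S s *v x - \<xi>))\<^sup>2 / s\<^sup>2 + 2 * norm z / s * \<bar>(S *v (rot S s *v x)) \<bullet> \<xi>\<bar>"
        using s0 by (simp add: norm_mult norm_divide norm_power)
      also have "\<dots> \<le> real CARD('d) / 2 / t1 * ?q + norm c * ?q + norm z * ((2 * (norm x)\<^sup>2 + 2) * ?q) / t1\<^sup>2 + 2 * norm z / t1 * ((BS * norm x) * ?q)"
      proof (intro add_mono)
        have "real CARD('d) / 2 / s \<le> real CARD('d) / 2 / t1" using s s0 t by (intro divide_left_mono) auto
        also have "\<dots> * 1 \<le> \<dots> * ?q" using t by (intro mult_left_mono) auto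
        finally show "real CARD('d) / 2 / s \<le> real CARD('d) / 2 / t1 * ?q" by simp
        show "norm c \<le> norm c * ?q" using mult_left_mono[of 1 ?q "norm c"] by simp
        have "(norm (rot S s *v x - \<xi>))\<^sup>2 \<le> (norm x + norm \<xi>)\<^sup>2"
          using norm_triangle_ineq4[of "rot S s *v x" \<xi>] by (intro power_mono) auto
        also have "\<dots> \<le> 2 * (norm x)\<^sup>2 + 2 * (norm \<xi>)\<^sup>2"
          using sum_squares_bound[of "norm x" "norm \<xi>"] by (simp add: power2_sum)
        also have "\<dots> \<le> (2 * (norm x)\<^sup>2 + 2) * ?q" by (simp add: algebra_simps)
        finally show "norm z * (norm (rot S s *v x - \<xi>))\<^sup>2 / s\<^sup>2 \<le> norm z * ((2 * (norm x)\<^sup>2 + 2) * ?q) / t1\<^sup>2"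
          using s s0 t by (intro frac_le mult_left_mono power_mono) auto
        have "\<bar>(S *v (rot S s *v x)) \<bullet> \<xi>\<bar> \<le> norm (S *v (rot S s *v x)) * norm \<xi>" by (rule Cauchy_Schwarz_ineq2)
        also have "\<dots> \<le> (BS * norm x) * ?q" using BS(2)[of "rot S s *v x"] n1 BS(1) by (intro mult_mono) auto
        finally show "2 * norm z / s * \<bar>(S *v (rot S s *v x)) \<bullet> \<xi>\<bar> \<le> 2 * norm z / t1 * ((BS * norm x) * ?q)"
          using s s0 t by (intro mult_mono divide_left_mono) auto
      qed
      also have "\<dots> = K * ?q" unfolding K_def by (simp only: ring_distribs add_divide_distrib times_divide_eq_left times_divide_eq_right mult_ac mult_1_right)
      finally show ?thesis .
    qed
    then have "norm (dhk s x \<xi>) \<le> (K * (1 + (norm \<xi>)\<^sup>2)) * norm (hk s x \<xi>)"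
      unfolding dhk_def norm_mult by (rule mult_right_mono) simp
    also have "\<dots> \<le> K * (P * L * E \<xi>)" using h[OF s, of \<xi>] K0 by (simp only: mult.assoc) (intro mult_left_mono)
    also have "\<dots> \<le> max 1 K * (P * L * E \<xi>)"
      using P0 L0 E_pos[of \<xi>] by (intro mult_right_mono) auto
    finally show "norm (dhk s x \<xi>) \<le> max 1 K * (P * L) * E \<xi>" by (simp add: mult.assoc)
  qed
qed

text \<open>The rotated heat flow started from w, up to a constant. Paired with test functions along
  the times used below, it tends to \<open>gint\<close> times w at small times and to 0 at large
  ones.\<close>

definition F where "F t x = (\<integral>\<xi>. hk t x \<xi> * w \<xi> \<partial>lborel)"

lemma integrable_E_norm:
  assumes "integrable lborel (\<lambda>x. exp (- M * norm x) *\<^sub>R u x)"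
  shows "integrable lborel (\<lambda>\<xi>. E \<xi> * norm (u \<xi> :: complex))"
  using integrable_norm[OF assms] by (simp add: E_def)

lemma integrable_hk_w:
  assumes "t > 0"
  shows "integrable lborel (\<lambda>\<xi>. hk t x \<xi> * w \<xi>)"
proof -
  obtain C where C: "C > 0" "\<And>s \<xi>. t \<le> s \<Longrightarrow> s \<le> t \<Longrightarrow> norm (hk s x \<xi>) \<le> C * E \<xi>"
    using hk_bounds[of t t x] assms by (metis order_refl)
  show ?thesis
  proof (rule Bochner_Integration.integrable_bound)
    show "integrable lborel (\<lambda>\<xi>. C * (E \<xi> * norm (w \<xi>)))"
      by (intro integrable_mult_right integrable_E_norm w_int)
    show "AE \<xi> in lborel. norm (hk t x \<xi> * w \<xi>) \<le> norm (C * (E \<xi> * norm (w \<xi>)))"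
    proof (intro AE_I2)
      fix \<xi>
      have "norm (hk t x \<xi>) * norm (w \<xi>) \<le> C * E \<xi> * norm (w \<xi>)" by (intro mult_right_mono C(2)) auto
      then show "norm (hk t x \<xi> * w \<xi>) \<le> norm (C * (E \<xi> * norm (w \<xi>)))"
        using C(1) E_pos[of \<xi>] by (simp add: norm_mult abs_mult mult.assoc)
    qed
  qed simp
qed

lemma continuous_on_dhk:
  assumes "0 < t1"
  shows "continuous_on {t1..t2} (\<lambda>s. dhk s x \<xi>)"
proof -
  have r: "continuous_on {t1..t2} (\<lambda>s. rot S s *v x)"
    by (rule continuous_on_compose2[OF continuous_rot[of UNIV], of _ "\<lambda>s. (s, x)", simplified])
       (intro continuous_intros)
  have "continuous_on {t1..t2} (\<lambda>s. S *v (rot S s *v x))"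
    using linear_continuous_on_compose[OF r matrix_vector_mul_linear] .
  then show ?thesis
    unfolding dhk_def hk_def hker_def using assms r by (intro continuous_intros) auto
qed

text \<open>The fundamental theorem of calculus in s, then Fubini, then \<open>dhk_equation\<close>,
  which trades w for f. Compact time intervals keep every integrand absolutely integrable.\<close>

lemma F_difference:
  assumes t: "0 < t1" "t1 \<le> t2"
  shows "integrable lborel (\<lambda>y. indicator {t1..t2} (fst y) *\<^sub>R (hk (fst y) x (snd y) * f (snd y)))"
    and "F t2 x - F t1 x = - (\<integral>y. indicator {t1..t2} (fst y) *\<^sub>R (hk (fst y) x (snd y) * f (snd y)) \<partial>lborel)"
proof -
  obtain C where C: "C > 0" "\<And>s \<xi>. t1 \<le> s \<Longrightarrow> s \<le> t2 \<Longrightarrow> norm (hk s x \<xi>) \<le> C * E \<xi>"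
    "\<And>s \<xi>. t1 \<le> s \<Longrightarrow> s \<le> t2 \<Longrightarrow> norm (dhk s x \<xi>) \<le> C * E \<xi>"
    using hk_bounds[OF t, of x] by metis
  have gen: "integrable lborel (\<lambda>y. indicator {t1..t2} (fst y) *\<^sub>R (k (fst y) (snd y) * u (snd y)))"
    if [measurable]: "(\<lambda>y. k (fst y) (snd y)) \<in> borel_measurable (borel :: (real \<times> (real^'d)) measure)" "u \<in> borel_measurable borel"
      and k: "\<And>s \<xi>. t1 \<le> s \<Longrightarrow> s \<le> t2 \<Longrightarrow> norm (k s \<xi>) \<le> C * E \<xi>"
      and u: "integrable lborel (\<lambda>x. exp (- M * norm x) *\<^sub>R u x)" for k :: "real \<Rightarrow> real^'d \<Rightarrow> complex" and u
  proof (rule Bochner_Integration.integrable_bound)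
    show "integrable lborel (\<lambda>y :: real \<times> (real^'d). indicator {t1..t2} (fst y) * (C * (E (snd y) * norm (u (snd y)))))"
      by (intro integrable_lborel_pair_mult[of "indicator {t1..t2}" "\<lambda>\<xi>. C * (E \<xi> * norm (u \<xi>))"] integrable_real_indicator
          integrable_mult_right integrable_E_norm u) (use t in auto)
    show "AE y in lborel. norm (indicator {t1..t2} (fst y) *\<^sub>R (k (fst y) (snd y) * u (snd y)))
       \<le> norm (indicator {t1..t2} (fst y) * (C * (E (snd y) * norm (u (snd y)))))"
    proof (intro AE_I2)
      fix y :: "real \<times> (real^'d)"
      show "norm (indicator {t1..t2} (fst y) *\<^sub>R (k (fst y) (snd y) * u (snd y)))
       \<le> norm (indicator {t1..t2} (fst y) * (C * (E (snd y) * norm (u (snd y)))))"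
      proof (cases "fst y \<in> {t1..t2}")
        case True
        then have "norm (k (fst y) (snd y)) * norm (u (snd y)) \<le> C * E (snd y) * norm (u (snd y))"
          by (intro mult_right_mono k) auto
        then show ?thesis using True C(1) E_pos[of "snd y"] by (simp add: norm_mult abs_mult mult.assoc)
      qed simp
    qed
    show "(\<lambda>y. indicator {t1..t2} (fst y) *\<^sub>R (k (fst y) (snd y) * u (snd y))) \<in> borel_measurable lborel"
      by measurable
  qed
  show fi: "integrable lborel (\<lambda>y. indicator {t1..t2} (fst y) *\<^sub>R (hk (fst y) x (snd y) * f (snd y)))"
    by (rule gen) (use C f_int in auto)
  have wi: "integrable lborel (\<lambda>y. indicator {t1..t2} (fst y) *\<^sub>R (dhk (fst y) x (snd y) * w (snd y)))"
    by (rule gen) (use C w_int in auto)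
  have "F t2 x - F t1 x = (\<integral>\<xi>. hk t2 x \<xi> * w \<xi> - hk t1 x \<xi> * w \<xi> \<partial>lborel)"
    unfolding F_def using t by (intro Bochner_Integration.integral_diff[symmetric] integrable_hk_w) auto
  also have "\<dots> = (\<integral>\<xi>. \<integral>s. indicator {t1..t2} s *\<^sub>R (dhk s x \<xi> * w \<xi>) \<partial>lborel \<partial>lborel)"
  proof (rule Bochner_Integration.integral_cong[OF refl])
    fix \<xi>
    have "(\<integral>s. indicator {t1..t2} s *\<^sub>R (dhk s x \<xi> * w \<xi>) \<partial>lborel) = hk t2 x \<xi> * w \<xi> - hk t1 x \<xi> * w \<xi>"
    proof (rule integral_FTC_Icc[OF t(2)])
      show "((\<lambda>s. hk s x \<xi> * w \<xi>) has_vector_derivative dhk s x \<xi> * w \<xi>) (at s within {t1..t2})" if "t1 \<le> s" "s \<le> t2" for s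
        using that t by (intro has_vector_derivative_mult_left has_vector_derivative_at_within[OF hk_derivative]) auto
      show "continuous_on {t1..t2} (\<lambda>s. dhk s x \<xi> * w \<xi>)"
        by (intro continuous_intros continuous_on_dhk t)
    qed
    then show "hk t2 x \<xi> * w \<xi> - hk t1 x \<xi> * w \<xi> = (\<integral>s. indicator {t1..t2} s *\<^sub>R (dhk s x \<xi> * w \<xi>) \<partial>lborel)" by simp
  qed
  also have "\<dots> = (\<integral>s. \<integral>\<xi>. indicator {t1..t2} s *\<^sub>R (dhk s x \<xi> * w \<xi>) \<partial>lborel \<partial>lborel)"
    using integral_lborel_pair[OF wi] by simp
  also have "\<dots> = (\<integral>s. - (\<integral>\<xi>. indicator {t1..t2} s *\<^sub>R (hk s x \<xi> * f \<xi>) \<partial>lborel) \<partial>lborel)"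
  proof (rule Bochner_Integration.integral_cong[OF refl])
    fix s
    show "(\<integral>\<xi>. indicator {t1..t2} s *\<^sub>R (dhk s x \<xi> * w \<xi>) \<partial>lborel) = - (\<integral>\<xi>. indicator {t1..t2} s *\<^sub>R (hk s x \<xi> * f \<xi>) \<partial>lborel)"
      using dhk_equation[of s x] t by (cases "s \<in> {t1..t2}") auto
  qed
  also have "\<dots> = - (\<integral>y. indicator {t1..t2} (fst y) *\<^sub>R (hk (fst y) x (snd y) * f (snd y)) \<partial>lborel)"
    using integral_lborel_pair(1)[OF fi] by simp
  finally show "F t2 x - F t1 x = - (\<integral>y. indicator {t1..t2} (fst y) *\<^sub>R (hk (fst y) x (snd y) * f (snd y)) \<partial>lborel)" .
qed

end

section \<open>The mass of the complex Gaussian\<close>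

lemma gint_integrand_integrable:
  assumes "Re z > 0"
  shows "integrable lborel (\<lambda>y::real^'d. exp (- z * of_real ((norm y)\<^sup>2)))"
  by (rule Bochner_Integration.integrable_bound[OF integrable_gauss[OF assms]]) (auto simp: field_simps)

text \<open>Differentiation under the integral sign. Half of Re z is kept in reserve: for increments
  smaller than that, the difference quotient is dominated by an integrable Gaussian moment.\<close>

lemma gint_derivative:
  assumes z: "Re z > 0"
  shows "\<exists>D. (gint TYPE('d::finite) has_field_derivative D) (at z)"
proof -
  let ?r = "\<lambda>y::real^'d. (norm y)\<^sup>2"
  define k where "k = Re z / 2"
  have k: "k > 0" using z by (simp add: k_def)
  have gi: "integrable lborel (\<lambda>y::real^'d. ?r y * exp (- k * ?r y))"
  proof (rule Bochner_Integration.integrable_bound)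
    let ?C = "max 1 (4 / k) * exp (1 / k)"
    show "integrable lborel (\<lambda>y::real^'d. ?C * exp (- 1 * norm y))"
      by (intro integrable_mult_right integrable_exp_neg_norm) simp
    have "?r y * exp (- k * ?r y) \<le> ?C * exp (- 1 * norm y)" for y :: "real^'d"
    proof -
      have "?r y * exp (- k * ?r y) \<le> (1 + ?r y) * exp (- k * ?r y)"
        by (intro mult_right_mono) auto
      also have "\<dots> \<le> ?C * exp (- 1 * norm y)"
        using gauss_beats_exp[OF k, of y 0 1] by simp
      finally show ?thesis .
    qed
    then show "AE y in lborel. norm (?r y * exp (- k * ?r y)) \<le> norm (?C * exp (- 1 * norm (y::real^'d)))"
      by (simp add: abs_mult)
  qed simp
  have "((\<lambda>h. (gint TYPE('d) (z + h) - gint TYPE('d) z) / h) \<longlongrightarrow> (\<integral>y. - of_real (?r y) * exp (- z * of_real (?r y)) \<partial>lborel)) (at 0)"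
    unfolding tendsto_at_iff_sequentially
  proof (intro allI impI)
    fix h :: "nat \<Rightarrow> complex"
    assume h0: "\<forall>i. h i \<in> UNIV - {0}" and hlim: "h \<longlonglongrightarrow> 0"
    then have hn: "h i \<noteq> 0" for i by auto
    \<comment> \<open>Dropping finitely many terms makes every increment smaller than k, as the
      domination requires.\<close>
    obtain N where N: "\<And>n. n \<ge> N \<Longrightarrow> norm (h n) < k"
      using hlim k by (auto simp: lim_sequentially dist_norm)
    define q where "q n y = (exp (- (z + h (n + N)) * of_real (?r y)) - exp (- z * of_real (?r y))) / h (n + N)" for n and y :: "real^'d"
    have "(\<lambda>n. \<integral>y. q n y \<partial>lborel) \<longlonglongrightarrow> (\<integral>y. - of_real (?r y) * exp (- z * of_real (?r y)) \<partial>lborel)"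
    proof (rule integral_dominated_convergence[OF _ _ gi])
      show "AE y in lborel. (\<lambda>n. q n y) \<longlonglongrightarrow> - of_real (?r y) * exp (- z * of_real (?r y))"
      proof (intro AE_I2)
        fix y :: "real^'d"
        have "((\<lambda>u. exp (- u * of_real (?r y))) has_field_derivative - of_real (?r y) * exp (- z * of_real (?r y))) (at z)"
          by (auto intro!: derivative_eq_intros)
        then have "((\<lambda>h. (exp (- (z + h) * of_real (?r y)) - exp (- z * of_real (?r y))) / h) \<longlongrightarrow> - of_real (?r y) * exp (- z * of_real (?r y))) (at 0)"
          by (simp only: DERIV_def)
        moreover have "filterlim (\<lambda>n. h (n + N)) (at 0) sequentially"
          using LIMSEQ_ignore_initial_segment[OF hlim] hn by (auto simp: filterlim_at)
        ultimately show "(\<lambda>n. q n y) \<longlonglongrightarrow> - of_real (?r y) * exp (- z * of_real (?r y))"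
          unfolding q_def by (rule filterlim_compose)
      qed
      fix n
      show "AE y in lborel. norm (q n y) \<le> ?r y * exp (- k * ?r y)"
      proof (intro AE_I2)
        fix y :: "real^'d"
        let ?h = "h (n + N)"
        have "exp (- (z + ?h) * of_real (?r y)) - exp (- z * of_real (?r y)) = exp (- z * of_real (?r y)) * (exp (- ?h * of_real (?r y)) - 1)"
          by (simp add: algebra_simps exp_add[symmetric])
        then have "norm (q n y) = exp (- Re z * ?r y) * norm (exp (- ?h * of_real (?r y)) - 1) / norm ?h"
          by (simp add: q_def norm_mult norm_divide)
        also have "\<dots> \<le> exp (- Re z * ?r y) * (exp (norm ?h * ?r y) * (norm ?h * ?r y)) / norm ?h"
        proof (intro divide_right_mono mult_left_mono)
          have "norm (exp (- ?h * of_real (?r y)) - 1) \<le> exp \<bar>Re (- ?h * of_real (?r y))\<bar> * norm (- ?h * of_real (?r y))"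
            using Taylor_exp[of "- ?h * of_real (?r y)" 0] by simp
          also have "\<dots> \<le> exp (norm ?h * ?r y) * (norm ?h * ?r y)"
          proof (intro mult_mono)
            have "\<bar>Re ?h\<bar> * ?r y \<le> norm ?h * ?r y" by (intro mult_right_mono abs_Re_le_cmod) auto
            then show "exp \<bar>Re (- ?h * of_real (?r y))\<bar> \<le> exp (norm ?h * ?r y)" by (simp add: abs_mult)
          qed (auto simp: norm_mult norm_power)
          finally show "norm (exp (- ?h * of_real (?r y)) - 1) \<le> exp (norm ?h * ?r y) * (norm ?h * ?r y)" .
        qed auto
        also have "\<dots> = ?r y * exp (- Re z * ?r y + norm ?h * ?r y)"
          using hn[of "n + N"] by (simp add: exp_add[symmetric])
        also have "\<dots> \<le> ?r y * exp (- k * ?r y)"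
        proof -
          have "norm ?h * ?r y \<le> k * ?r y" using N[of "n + N"] by (intro mult_right_mono) auto
          moreover have "Re z * ?r y = 2 * (k * ?r y)" by (simp add: k_def)
          ultimately show ?thesis by (intro mult_left_mono) auto
        qed
        finally show "norm (q n y) \<le> ?r y * exp (- k * ?r y)" .
      qed
    qed (simp_all add: q_def)
    moreover have "(\<integral>y. q n y \<partial>lborel) = (gint TYPE('d) (z + h (n + N)) - gint TYPE('d) z) / h (n + N)" for n
    proof -
      have "\<bar>Re (h (n + N))\<bar> < k" using N[of "n + N"] abs_Re_le_cmod[of "h (n + N)"] by simp
      then have "Re (z + h (n + N)) > 0" using k by (simp add: k_def)
      from Bochner_Integration.integral_diff[OF gint_integrand_integrable[where 'd = 'd, OF this] gint_integrand_integrable[OF z]] show ?thesis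
        unfolding q_def gint_def integral_divide_zero by simp
    qed
    ultimately have "(\<lambda>n. (gint TYPE('d) (z + h (n + N)) - gint TYPE('d) z) / h (n + N)) \<longlonglongrightarrow> (\<integral>y. - of_real (?r y) * exp (- z * of_real (?r y)) \<partial>lborel)"
      by simp
    then show "((\<lambda>h. (gint TYPE('d) (z + h) - gint TYPE('d) z) / h) \<circ> h) \<longlonglongrightarrow> (\<integral>y. - of_real (?r y) * exp (- z * of_real (?r y)) \<partial>lborel)"
      unfolding o_def by (rule LIMSEQ_offset)
  qed
  then show ?thesis unfolding DERIV_def by blast
qed

text \<open>Squaring turns the Jacobian (sqrt s)^d into the integer power s^d, so that no branch of
  z^(d/2) has to be chosen for complex z.\<close>

lemma gint_scale:
  assumes "s > 0"
  shows "of_real s ^ CARD('d) * (gint TYPE('d::finite) (of_real s * z))\<^sup>2 = (gint TYPE('d) z)\<^sup>2"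
proof -
  have "gint TYPE('d) z = (sqrt s) ^ CARD('d) *\<^sub>R (\<integral>y. exp (- z * of_real ((norm (sqrt s *\<^sub>R y :: real^'d))\<^sup>2)) \<partial>lborel)"
    unfolding gint_def using assms by (subst integral_lborel_scale[of _ "sqrt s"]) auto
  also have "(\<lambda>y. exp (- z * of_real ((norm (sqrt s *\<^sub>R y :: real^'d))\<^sup>2))) = (\<lambda>y. exp (- (of_real s * z) * of_real ((norm y)\<^sup>2)))"
    using assms by (simp add: fun_eq_iff power_mult_distrib mult_ac flip: of_real_power)
  finally have "gint TYPE('d) z = of_real ((sqrt s) ^ CARD('d)) * gint TYPE('d) (of_real s * z)"
    by (simp add: gint_def scaleR_conv_of_real)
  moreover have "((sqrt s) ^ CARD('d))\<^sup>2 = s ^ CARD('d)"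
    using assms by (simp add: power_mult[symmetric] mult.commute[of _ 2]) (simp add: power_mult)
  ultimately show ?thesis by (simp add: power_mult_distrib flip: of_real_power)
qed

text \<open>Differentiating the scaling relation shows that \<open>z\<^sup>d (gint z)\<^sup>2\<close> is constant on the right
  half plane, hence equal to its positive value at \<open>1\<close>.\<close>

lemma gint_nonzero:
  assumes "Re z > 0"
  shows "gint TYPE('d::finite) z \<noteq> 0"
proof -
  let ?Z = "gint TYPE('d)" and ?d = "CARD('d)"
  have der: "((\<lambda>z. z ^ ?d * (?Z z)\<^sup>2) has_field_derivative 0) (at u)" if u: "Re u > 0" for u
  proof -
    obtain D where D: "(?Z has_field_derivative D) (at u)" using gint_derivative[OF u] by blast
    have u0: "u \<noteq> 0" using u by auto
    \<comment> \<open>The same function of s is differentiated at 1 in two ways: by the chain rule,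
      and as a constant by \<open>gint_scale\<close>. Equating the results gives the Euler identity
      that annihilates the derivative in z.\<close>
    have "((\<lambda>s. of_real s ^ ?d * (?Z (of_real s * u))\<^sup>2) has_vector_derivative
        (of_nat ?d * (?Z u)\<^sup>2 + 2 * ?Z u * (u * D))) (at 1)"
    proof -
      have "((\<lambda>s. s ^ ?d * (?Z (s * u))\<^sup>2) has_field_derivative (of_nat ?d * (?Z u)\<^sup>2 + 2 * ?Z u * (u * D))) (at 1)"
      proof -
        have "((\<lambda>s. ?Z (s * u)) has_field_derivative D * u) (at 1)"
          by (rule DERIV_chain2[of ?Z D "\<lambda>s. s * u"]) (use D in \<open>auto intro!: derivative_eq_intros\<close>)
        then show ?thesis by (auto intro!: derivative_eq_intros simp: algebra_simps)
      qed
      then show ?thesis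
        using has_vector_derivative_real_field[of "\<lambda>s. s ^ ?d * (?Z (s * u))\<^sup>2" _ "1::real"] by simp
    qed
    moreover have "((\<lambda>s. of_real s ^ ?d * (?Z (of_real s * u))\<^sup>2) has_vector_derivative 0) (at (1::real))"
    proof (rule has_vector_derivative_transform_within_open[of "\<lambda>_. (?Z u)\<^sup>2" _ _ "{0<..}"])
      show "(?Z u)\<^sup>2 = of_real s ^ ?d * (?Z (of_real s * u))\<^sup>2" if "s \<in> {0<..}" for s :: real
        using gint_scale[where 'd = 'd, of s u] that by simp
    qed auto
    ultimately have "of_nat ?d * (?Z u)\<^sup>2 + 2 * ?Z u * (u * D) = 0"
      by (rule vector_derivative_unique_at)
    moreover have "((\<lambda>z. z ^ ?d * (?Z z)\<^sup>2) has_field_derivative u ^ ?d / u * (of_nat ?d * (?Z u)\<^sup>2 + 2 * ?Z u * (u * D))) (at u)"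
      using u0 power_minus_mult[of ?d u]
      by (auto intro!: derivative_eq_intros D simp: field_simps)
    ultimately show ?thesis by simp
  qed
  \<comment> \<open>The half plane is convex, so one constant serves everywhere and can be read off
    at 1, where the integrand is positive.\<close>
  have "\<exists>C. \<forall>u\<in>{u. Re u > 0}. u ^ ?d * (?Z u)\<^sup>2 = C"
    by (rule has_field_derivative_zero_constant)
       (auto intro: has_field_derivative_at_within der convex_halfspace_Re_gt)
  then obtain C where C: "\<And>u. Re u > 0 \<Longrightarrow> u ^ ?d * (?Z u)\<^sup>2 = C" by auto
  have "z ^ ?d * (?Z z)\<^sup>2 = 1 ^ ?d * (?Z 1)\<^sup>2" using C[OF assms] C[of 1] by simp
  moreover have "?Z 1 \<noteq> 0"
  proof
    assume "?Z 1 = 0"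
    moreover have "?Z 1 = (\<integral>y. complex_of_real (exp (- (norm (y::real^'d))\<^sup>2)) \<partial>lborel)"
      unfolding gint_def by (intro Bochner_Integration.integral_cong) (simp_all add: exp_of_real[symmetric])
    ultimately have "(\<integral>y. exp (- (norm (y::real^'d))\<^sup>2) \<partial>lborel) = 0" by simp
    then have "AE y in lborel. exp (- (norm (y::real^'d))\<^sup>2) = 0"
      using integrable_gauss[of 1, where 'a = "real^'d"] by (subst (asm) integral_nonneg_eq_0_iff_AE) auto
    then show False by (simp add: AE_iff_null null_sets_def)
  qed
  ultimately show ?thesis by auto
qed

section \<open>Boundary terms in time and the representation of w\<close>

context heat_equation
begin

lemma E_nonneg [simp]: "0 \<le> E x" and E_nonzero [simp]: "E x \<noteq> 0"
  using E_pos[of x] by simp_all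

lemma rker_nonneg [simp]: "0 \<le> rker k r s y"
  using rker_pos less_imp_le by blast

text \<open>Moving the weight to \<xi> leaves a radial kernel to be integrated in x. The factor
  exp(-\<rho> t) is what makes the boundary term at infinity vanish.\<close>

lemma col_bound:
  assumes "t > 0"
  shows "(\<integral>\<^sup>+x. ennreal (E x * norm (hk t x \<xi>)) \<partial>lborel) \<le> ennreal (exp (- \<rho> * t) * gmass TYPE('d) \<kappa> * E \<xi>)"
proof -
  have "(\<integral>\<^sup>+x. ennreal (E x * norm (hk t x \<xi>)) \<partial>lborel) \<le> (\<integral>\<^sup>+x. ennreal (rker \<kappa> \<rho> t (rot S t *v x - \<xi>)) * ennreal (E \<xi>) \<partial>lborel)"
    using E_norm_hk_le[OF assms] by (intro nn_integral_mono) (simp add: ennreal_mult[symmetric] ennreal_leI)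
  also have "\<dots> = (\<integral>\<^sup>+x. ennreal (rker \<kappa> \<rho> t (rot S t *v x - \<xi>)) \<partial>lborel) * ennreal (E \<xi>)"
    by (rule nn_integral_multc) simp
  also have "(\<integral>\<^sup>+x. ennreal (rker \<kappa> \<rho> t (rot S t *v x - \<xi>)) \<partial>lborel) = (\<integral>\<^sup>+y. ennreal (rker \<kappa> \<rho> t (y :: real^'d)) \<partial>lborel)"
    by (intro kernel_col_mass rker_borel rker_radial)
  also have "\<dots> * ennreal (E \<xi>) = ennreal (exp (- \<rho> * t) * gmass TYPE('d) \<kappa> * E \<xi>)"
    unfolding nn_integral_rker[OF \<kappa> assms]
    using gmass_nonneg[of "TYPE('d)" \<kappa>] E_pos[of \<xi>] by (subst ennreal_mult[symmetric]) auto
  finally show ?thesis .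
qed

lemma double_bound:
  fixes u :: "real^'d \<Rightarrow> complex"
  assumes t: "t > 0" and [measurable]: "u \<in> borel_measurable borel"
    and u: "integrable lborel (\<lambda>x. exp (- M * norm x) *\<^sub>R u x)"
  shows "(\<integral>\<^sup>+\<xi>. \<integral>\<^sup>+x. ennreal (E x * norm (hk t x \<xi> * u \<xi>)) \<partial>lborel \<partial>lborel) \<le>
    ennreal (exp (- \<rho> * t) * gmass TYPE('d) \<kappa> * (\<integral>\<xi>. E \<xi> * norm (u \<xi>) \<partial>lborel))"
proof -
  have "(\<integral>\<^sup>+\<xi>. \<integral>\<^sup>+x. ennreal (E x * norm (hk t x \<xi> * u \<xi>)) \<partial>lborel \<partial>lborel) =
     (\<integral>\<^sup>+\<xi>. (\<integral>\<^sup>+x. ennreal (E x * norm (hk t x \<xi>)) \<partial>lborel) * ennreal (norm (u \<xi>)) \<partial>lborel)"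
    by (intro nn_integral_cong) (simp add: norm_mult mult.assoc[symmetric] ennreal_mult' nn_integral_multc)
  also have "\<dots> \<le> (\<integral>\<^sup>+\<xi>. ennreal (exp (- \<rho> * t) * gmass TYPE('d) \<kappa> * E \<xi>) * ennreal (norm (u \<xi>)) \<partial>lborel)"
    by (intro nn_integral_mono mult_right_mono col_bound t) auto
  also have "\<dots> = (\<integral>\<^sup>+\<xi>. ennreal (exp (- \<rho> * t) * gmass TYPE('d) \<kappa>) * ennreal (E \<xi> * norm (u \<xi>)) \<partial>lborel)"
    using gmass_nonneg[of "TYPE('d)" \<kappa>]
    by (intro nn_integral_cong) (simp add: ennreal_mult[symmetric] mult_ac)
  also have "\<dots> = ennreal (exp (- \<rho> * t) * gmass TYPE('d) \<kappa>) * (\<integral>\<^sup>+\<xi>. ennreal (E \<xi> * norm (u \<xi>)) \<partial>lborel)"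
    by (rule nn_integral_cmult) simp
  also have "(\<integral>\<^sup>+\<xi>. ennreal (E \<xi> * norm (u \<xi>)) \<partial>lborel) = ennreal (\<integral>\<xi>. E \<xi> * norm (u \<xi>) \<partial>lborel)"
    by (intro nn_integral_eq_integral integrable_E_norm u) simp
  also have "ennreal (exp (- \<rho> * t) * gmass TYPE('d) \<kappa>) * ennreal (\<integral>\<xi>. E \<xi> * norm (u \<xi>) \<partial>lborel) =
    ennreal (exp (- \<rho> * t) * gmass TYPE('d) \<kappa> * (\<integral>\<xi>. E \<xi> * norm (u \<xi>) \<partial>lborel))"
    using gmass_nonneg[of "TYPE('d)" \<kappa>]
    by (intro ennreal_mult[symmetric]) (auto intro!: integral_nonneg_AE mult_nonneg_nonneg)
  finally show ?thesis .
qed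

text \<open>The bound |\<phi>| <= C E lets the weight of the test function pay for the growth of w,
  so that the double integral converges absolutely. The last identity moves the kernel from w onto
  the test function.\<close>

lemma test_pairing:
  assumes t: "t > 0" and \<phi>: "test_fun \<phi>" and C: "C > 0" "\<And>x. \<bar>\<phi> x\<bar> \<le> C * E x"
  shows "integrable lborel (\<lambda>y. \<phi> (fst y) *\<^sub>R (hk t (fst y) (snd y) * w (snd y)))"
    and "integrable lborel (\<lambda>x. \<phi> x *\<^sub>R F t x)"
    and "norm (\<integral>x. \<phi> x *\<^sub>R F t x \<partial>lborel) \<le> C * (exp (- \<rho> * t) * gmass TYPE('d) \<kappa> * (\<integral>\<xi>. E \<xi> * norm (w \<xi>) \<partial>lborel))"
    and "(\<integral>x. \<phi> x *\<^sub>R F t x \<partial>lborel) = (\<integral>\<xi>. (\<integral>x. \<phi> x *\<^sub>R hk t x \<xi> \<partial>lborel) * w \<xi> \<partial>lborel)"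
proof -
  note [measurable] = test_fun_measurable[OF \<phi>]
  let ?B = "exp (- \<rho> * t) * gmass TYPE('d) \<kappa> * (\<integral>\<xi>. E \<xi> * norm (w \<xi>) \<partial>lborel)"
  have B0: "0 \<le> ?B"
    using gmass_nonneg[of "TYPE('d)" \<kappa>] by (intro mult_nonneg_nonneg integral_nonneg_AE) auto
  let ?h = "\<lambda>y. \<phi> (fst y) *\<^sub>R (hk t (fst y) (snd y) * w (snd y))"
  have "(\<integral>\<^sup>+y. ennreal (norm (?h y)) \<partial>lborel) = (\<integral>\<^sup>+\<xi>. \<integral>\<^sup>+x. ennreal (\<bar>\<phi> x\<bar> * norm (hk t x \<xi> * w \<xi>)) \<partial>lborel \<partial>lborel)"
    by (subst nn_integral_lborel_pair') simp_all
  also have "\<dots> \<le> (\<integral>\<^sup>+\<xi>. \<integral>\<^sup>+x. ennreal C * ennreal (E x * norm (hk t x \<xi> * w \<xi>)) \<partial>lborel \<partial>lborel)"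
  proof (intro nn_integral_mono)
    fix x \<xi>
    have "\<bar>\<phi> x\<bar> * norm (hk t x \<xi> * w \<xi>) \<le> (C * E x) * norm (hk t x \<xi> * w \<xi>)"
      by (intro mult_right_mono C) auto
    then show "ennreal (\<bar>\<phi> x\<bar> * norm (hk t x \<xi> * w \<xi>)) \<le> ennreal C * ennreal (E x * norm (hk t x \<xi> * w \<xi>))"
      using C(1) E_pos[of x] by (subst ennreal_mult[symmetric]) (auto intro!: ennreal_leI simp: mult.assoc)
  qed
  also have "\<dots> = ennreal C * (\<integral>\<^sup>+\<xi>. \<integral>\<^sup>+x. ennreal (E x * norm (hk t x \<xi> * w \<xi>)) \<partial>lborel \<partial>lborel)"
    by (simp add: nn_integral_cmult)
  also have "\<dots> \<le> ennreal C * ennreal ?B"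
    by (intro mult_left_mono double_bound t w_int w_meas) auto
  also have "\<dots> = ennreal (C * ?B)" by (rule ennreal_mult[symmetric, OF less_imp_le[OF C(1)] B0])
  finally have hb: "(\<integral>\<^sup>+y. ennreal (norm (?h y)) \<partial>lborel) \<le> ennreal (C * ?B)" .
  have CB: "0 \<le> C * ?B" by (rule mult_nonneg_nonneg[OF less_imp_le[OF C(1)] B0])
  show hi: "integrable lborel ?h" by (rule integral_bound_nn(1)[OF _ hb CB]) measurable
  have inner: "(\<integral>\<xi>. ?h (x, \<xi>) \<partial>lborel) = \<phi> x *\<^sub>R F t x" for x
    by (simp add: F_def)
  show "integrable lborel (\<lambda>x. \<phi> x *\<^sub>R F t x)"
    using lborel_pair.integrable_fst'[of ?h] hi unfolding inner by (simp add: lborel_prod)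
  have e: "(\<integral>x. \<phi> x *\<^sub>R F t x \<partial>lborel) = (\<integral>y. ?h y \<partial>lborel)"
    using integral_lborel_pair(1)[OF hi] unfolding inner by simp
  show "norm (\<integral>x. \<phi> x *\<^sub>R F t x \<partial>lborel) \<le> C * ?B"
    unfolding e by (rule integral_bound_nn(2)[OF _ hb CB]) measurable
  show "(\<integral>x. \<phi> x *\<^sub>R F t x \<partial>lborel) = (\<integral>\<xi>. (\<integral>x. \<phi> x *\<^sub>R hk t x \<xi> \<partial>lborel) * w \<xi> \<partial>lborel)"
    unfolding e integral_lborel_pair(2)[OF hi] by (simp add: mult_scaleR_left[symmetric] del: mult_scaleR_left)
qed

lemma test_pairing_infinity:
  assumes \<phi>: "test_fun \<phi>"
  shows "(\<lambda>n. \<integral>x. \<phi> x *\<^sub>R F (real (Suc n)) x \<partial>lborel) \<longlonglongrightarrow> 0"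
proof -
  obtain C where C: "C > 0" "\<And>x. \<bar>\<phi> x\<bar> \<le> C * E x"
    using test_fun_exp_bound[OF \<phi> M(1)] unfolding E_def by metis
  show ?thesis
  proof (rule Lim_null_comparison[OF always_eventually])
    show "\<forall>n. norm (\<integral>x. \<phi> x *\<^sub>R F (real (Suc n)) x \<partial>lborel) \<le>
      C * (exp (- \<rho> * real (Suc n)) * gmass TYPE('d) \<kappa> * (\<integral>\<xi>. E \<xi> * norm (w \<xi>) \<partial>lborel))"
      using test_pairing(3)[OF _ \<phi> C] by simp
    have "(\<lambda>n. exp (- \<rho> * real (Suc n))) \<longlonglongrightarrow> 0" using \<rho> by real_asymp
    from tendsto_mult_right[OF tendsto_mult_right[OF this, of "gmass TYPE('d) \<kappa>"], of "\<integral>\<xi>. E \<xi> * norm (w \<xi>) \<partial>lborel"]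
    show "(\<lambda>n. C * (exp (- \<rho> * real (Suc n)) * gmass TYPE('d) \<kappa> * (\<integral>\<xi>. E \<xi> * norm (w \<xi>) \<partial>lborel))) \<longlonglongrightarrow> 0"
      using tendsto_mult_left by fastforce
  qed
qed

lemma test_kernel_bound:
  assumes t: "t > 0" and \<phi>: "test_fun \<phi>" and C: "C > 0" "\<And>x. \<bar>\<phi> x\<bar> \<le> C * E x"
  shows "norm (\<integral>x. \<phi> x *\<^sub>R hk t x \<xi> \<partial>lborel) \<le> C * gmass TYPE('d) \<kappa> * E \<xi>"
proof (rule integral_bound_nn(2))
  note [measurable] = test_fun_measurable[OF \<phi>]
  show "(\<lambda>x. \<phi> x *\<^sub>R hk t x \<xi>) \<in> borel_measurable lborel" by simp
  have "(\<integral>\<^sup>+x. ennreal (norm (\<phi> x *\<^sub>R hk t x \<xi>)) \<partial>lborel) \<le> (\<integral>\<^sup>+x. ennreal C * ennreal (E x * norm (hk t x \<xi>)) \<partial>lborel)"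
  proof (intro nn_integral_mono)
    fix x
    have "\<bar>\<phi> x\<bar> * norm (hk t x \<xi>) \<le> (C * E x) * norm (hk t x \<xi>)"
      by (intro mult_right_mono C) auto
    then show "ennreal (norm (\<phi> x *\<^sub>R hk t x \<xi>)) \<le> ennreal C * ennreal (E x * norm (hk t x \<xi>))"
      using C(1) E_pos[of x] by (subst ennreal_mult[symmetric]) (auto intro!: ennreal_leI simp: mult.assoc)
  qed
  also have "\<dots> = ennreal C * (\<integral>\<^sup>+x. ennreal (E x * norm (hk t x \<xi>)) \<partial>lborel)"
    by (rule nn_integral_cmult) simp
  also have "\<dots> \<le> ennreal C * ennreal (exp (- \<rho> * t) * gmass TYPE('d) \<kappa> * E \<xi>)"
    by (intro mult_left_mono col_bound t) auto
  also have "\<dots> \<le> ennreal C * ennreal (1 * gmass TYPE('d) \<kappa> * E \<xi>)"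
    using t \<rho> gmass_nonneg[of "TYPE('d)" \<kappa>] E_pos[of \<xi>]
    by (intro mult_left_mono ennreal_leI mult_right_mono) auto
  also have "\<dots> = ennreal (C * gmass TYPE('d) \<kappa> * E \<xi>)"
    using C gmass_nonneg[of "TYPE('d)" \<kappa>] E_pos[of \<xi>] by (subst ennreal_mult[symmetric]) (auto simp: mult.assoc)
  finally show "(\<integral>\<^sup>+x. ennreal (norm (\<phi> x *\<^sub>R hk t x \<xi>)) \<partial>lborel) \<le> ennreal (C * gmass TYPE('d) \<kappa> * E \<xi>)" .
  show "0 \<le> C * gmass TYPE('d) \<kappa> * E \<xi>"
    using C gmass_nonneg[of "TYPE('d)" \<kappa>] E_pos[of \<xi>] by simp
qed

text \<open>Centring at the back-rotated \<xi> and scaling by sqrt t fixes the Gaussian. All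
  dependence on t is then in the argument of \<phi> and in exp(-c t), so that t -> 0 becomes a
  dominated limit.\<close>

lemma test_kernel_rescaled:
  assumes t: "t > 0" and \<phi>: "test_fun \<phi>"
  shows "(\<integral>x. \<phi> x *\<^sub>R hk t x \<xi> \<partial>lborel) =
    (\<integral>y. \<phi> (sqrt t *\<^sub>R y + \<xi> v* rot S t) *\<^sub>R (exp (- c * of_real t) * exp (- z * of_real ((norm y)\<^sup>2))) \<partial>lborel)"
proof -
  note [measurable] = test_fun_measurable[OF \<phi>]
  let ?\<eta> = "\<xi> v* rot S t"
  have "(\<integral>x. \<phi> x *\<^sub>R hk t x \<xi> \<partial>lborel) = (\<integral>x. \<phi> x *\<^sub>R hker z c t (x - ?\<eta>) \<partial>lborel)"
    unfolding hk_def hker_radial[OF norm_rot_diff] ..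
  also have "\<dots> = (\<integral>y. \<phi> (y + ?\<eta>) *\<^sub>R hker z c t y \<partial>lborel)"
    by (subst integral_lborel_translate[symmetric, of _ ?\<eta>]) simp
  also have "\<dots> = (sqrt t) ^ CARD('d) *\<^sub>R (\<integral>y. \<phi> (sqrt t *\<^sub>R y + ?\<eta>) *\<^sub>R hker z c t (sqrt t *\<^sub>R y) \<partial>lborel)"
    using t by (subst integral_lborel_scale[of _ "sqrt t"]) auto
  also have "\<dots> = (\<integral>y. (sqrt t) ^ CARD('d) *\<^sub>R (\<phi> (sqrt t *\<^sub>R y + ?\<eta>) *\<^sub>R hker z c t (sqrt t *\<^sub>R y)) \<partial>lborel)"
    by (simp only: scaleR_conv_of_real integral_mult_right_zero)
  also have "\<dots> = (\<integral>y. \<phi> (sqrt t *\<^sub>R y + ?\<eta>) *\<^sub>R (exp (- c * of_real t) * exp (- z * of_real ((norm y)\<^sup>2))) \<partial>lborel)"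
  proof (intro Bochner_Integration.integral_cong refl)
    fix y :: "real^'d"
    have "hker z c t (sqrt t *\<^sub>R y) = of_real (exp (- (real CARD('d) / 2) * ln t)) * (exp (- c * of_real t) * exp (- z * of_real ((norm y)\<^sup>2)))"
    proof -
      have e: "of_real (exp X) * (exp b * exp e) = exp (of_real X + (b + e))" for X and b e :: complex
        by (simp add: exp_add exp_of_real)
      show ?thesis unfolding hker_def e
        by (rule arg_cong[where f = exp]) (use t in \<open>simp add: power_mult_distrib\<close>)
    qed
    then have "of_real ((sqrt t) ^ CARD('d)) * hker z c t (sqrt t *\<^sub>R y) =
       of_real (exp (- (real CARD('d) / 2) * ln t) * (sqrt t) ^ CARD('d)) * (exp (- c * of_real t) * exp (- z * of_real ((norm y)\<^sup>2)))"
      by (simp only: of_real_mult mult_ac)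
    then show "(sqrt t) ^ CARD('d) *\<^sub>R (\<phi> (sqrt t *\<^sub>R y + ?\<eta>) *\<^sub>R hker z c t (sqrt t *\<^sub>R y)) =
       \<phi> (sqrt t *\<^sub>R y + ?\<eta>) *\<^sub>R (exp (- c * of_real t) * exp (- z * of_real ((norm y)\<^sup>2)))"
      unfolding exp_ln_half_power[OF t] by (simp add: scaleR_conv_of_real mult.left_commute)
  qed
  finally show ?thesis .
qed

lemma test_kernel_tendsto:
  assumes \<phi>: "test_fun \<phi>"
  shows "(\<lambda>n. \<integral>x. \<phi> x *\<^sub>R hk (1 / real (Suc n)) x \<xi> \<partial>lborel) \<longlonglongrightarrow> \<phi> \<xi> *\<^sub>R gint TYPE('d) z"
proof -
  note [measurable] = test_fun_measurable[OF \<phi>]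
  obtain C where C: "C > 0" "\<And>x. \<bar>\<phi> x\<bar> \<le> C" using test_fun_bounded[OF \<phi>] by metis
  let ?t = "\<lambda>n. 1 / real (Suc n)"
  have t0: "?t \<longlonglongrightarrow> 0" by real_asymp
  have "(\<lambda>n. \<integral>y. \<phi> (sqrt (?t n) *\<^sub>R y + \<xi> v* rot S (?t n)) *\<^sub>R (exp (- c * of_real (?t n)) * exp (- z * of_real ((norm y)\<^sup>2))) \<partial>lborel)
    \<longlonglongrightarrow> (\<integral>y. \<phi> \<xi> *\<^sub>R exp (- z * of_real ((norm (y::real^'d))\<^sup>2)) \<partial>lborel)"
  proof (rule integral_dominated_convergence)
    show "integrable lborel (\<lambda>y::real^'d. C * exp (- Re z * (norm y)\<^sup>2))"
      by (intro integrable_mult_right integrable_gauss Rez)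
    show "AE y in lborel. (\<lambda>n. \<phi> (sqrt (?t n) *\<^sub>R y + \<xi> v* rot S (?t n)) *\<^sub>R (exp (- c * of_real (?t n)) * exp (- z * of_real ((norm y)\<^sup>2))))
      \<longlonglongrightarrow> \<phi> \<xi> *\<^sub>R exp (- z * of_real ((norm (y::real^'d))\<^sup>2))"
    proof (intro AE_I2)
      fix y :: "real^'d"
      have "(\<lambda>n. (?t n, \<xi>)) \<longlonglongrightarrow> (0, \<xi>)" by (intro tendsto_intros t0)
      from continuous_on_tendsto_compose[OF continuous_rot_transpose[of UNIV S] this]
      have "(\<lambda>n. snd (?t n, \<xi>) v* rot S (fst (?t n, \<xi>))) \<longlonglongrightarrow> snd (0, \<xi>) v* rot S (fst (0 :: real, \<xi>))" by simp
      then have r: "(\<lambda>n. \<xi> v* rot S (?t n)) \<longlonglongrightarrow> \<xi>" by (simp only: fst_conv snd_conv rot_0 vector_matrix_mul_rid)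
      have "(\<lambda>n. sqrt (?t n) *\<^sub>R y + \<xi> v* rot S (?t n)) \<longlonglongrightarrow> sqrt 0 *\<^sub>R y + \<xi>"
        by (intro tendsto_intros t0 r)
      moreover have "isCont \<phi> (sqrt 0 *\<^sub>R y + \<xi>)"
        using test_fun_continuous[OF \<phi>, of UNIV] by (simp add: continuous_on_eq_continuous_at)
      ultimately have "(\<lambda>n. \<phi> (sqrt (?t n) *\<^sub>R y + \<xi> v* rot S (?t n))) \<longlonglongrightarrow> \<phi> (sqrt 0 *\<^sub>R y + \<xi>)"
        by (rule isCont_tendsto_compose[rotated])
      then have "(\<lambda>n. \<phi> (sqrt (?t n) *\<^sub>R y + \<xi> v* rot S (?t n)) *\<^sub>R (exp (- c * of_real (?t n)) * exp (- z * of_real ((norm y)\<^sup>2))))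
        \<longlonglongrightarrow> \<phi> (sqrt 0 *\<^sub>R y + \<xi>) *\<^sub>R (exp (- c * of_real 0) * exp (- z * of_real ((norm y)\<^sup>2)))"
        by (intro tendsto_intros t0)
      then show "(\<lambda>n. \<phi> (sqrt (?t n) *\<^sub>R y + \<xi> v* rot S (?t n)) *\<^sub>R (exp (- c * of_real (?t n)) * exp (- z * of_real ((norm y)\<^sup>2))))
        \<longlonglongrightarrow> \<phi> \<xi> *\<^sub>R exp (- z * of_real ((norm y)\<^sup>2))" by simp
    qed
    fix n
    show "AE y in lborel. norm (\<phi> (sqrt (?t n) *\<^sub>R y + \<xi> v* rot S (?t n)) *\<^sub>R (exp (- c * of_real (?t n)) * exp (- z * of_real ((norm y)\<^sup>2))))
      \<le> C * exp (- Re z * (norm (y::real^'d))\<^sup>2)"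
    proof (intro AE_I2)
      fix y :: "real^'d"
      have 1: "norm (exp (- c * of_real (?t n))) \<le> 1" using \<Lambda> by (simp del: of_nat_Suc)
      have 2: "norm (exp (- z * of_real ((norm y)\<^sup>2))) = exp (- Re z * (norm y)\<^sup>2)"
        unfolding norm_exp_eq_Re by simp
      have "norm (exp (- c * of_real (?t n))) * norm (exp (- z * of_real ((norm y)\<^sup>2))) \<le> 1 * exp (- Re z * (norm y)\<^sup>2)"
        unfolding 2 by (intro mult_right_mono 1) auto
      then have "\<bar>\<phi> (sqrt (?t n) *\<^sub>R y + \<xi> v* rot S (?t n))\<bar> * (norm (exp (- c * of_real (?t n))) * norm (exp (- z * of_real ((norm y)\<^sup>2)))) \<le> C * (1 * exp (- Re z * (norm y)\<^sup>2))"
        using C by (intro mult_mono) auto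
      then show "norm (\<phi> (sqrt (?t n) *\<^sub>R y + \<xi> v* rot S (?t n)) *\<^sub>R (exp (- c * of_real (?t n)) * exp (- z * of_real ((norm y)\<^sup>2))))
      \<le> C * exp (- Re z * (norm y)\<^sup>2)" by (simp only: norm_scaleR norm_mult mult_1)
    qed
  qed measurable
  then show ?thesis
    by (subst test_kernel_rescaled[OF _ \<phi>]) (simp_all add: gint_def)
qed

text \<open>The kernel acts as an approximate identity on the continuous test function and not on w,
  which has no continuity; dominated convergence in \<xi> then gives the limit for w.\<close>

lemma test_pairing_zero:
  assumes \<phi>: "test_fun \<phi>"
  shows "(\<lambda>n. \<integral>x. \<phi> x *\<^sub>R F (1 / real (Suc n)) x \<partial>lborel) \<longlonglongrightarrow> gint TYPE('d) z * (\<integral>x. \<phi> x *\<^sub>R w x \<partial>lborel)"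
proof -
  note [measurable] = test_fun_measurable[OF \<phi>]
  obtain C where C: "C > 0" "\<And>x. \<bar>\<phi> x\<bar> \<le> C * E x"
    using test_fun_exp_bound[OF \<phi> M(1)] unfolding E_def by metis
  have "(\<lambda>n. \<integral>\<xi>. (\<integral>x. \<phi> x *\<^sub>R hk (1 / real (Suc n)) x \<xi> \<partial>lborel) * w \<xi> \<partial>lborel) \<longlonglongrightarrow> (\<integral>\<xi>. (\<phi> \<xi> *\<^sub>R gint TYPE('d) z) * w \<xi> \<partial>lborel)"
  proof (rule integral_dominated_convergence)
    show "integrable lborel (\<lambda>\<xi>. C * gmass TYPE('d) \<kappa> * (E \<xi> * norm (w \<xi>)))"
      by (intro integrable_mult_right integrable_E_norm w_int)
    show "AE \<xi> in lborel. (\<lambda>n. (\<integral>x. \<phi> x *\<^sub>R hk (1 / real (Suc n)) x \<xi> \<partial>lborel) * w \<xi>) \<longlonglongrightarrow> (\<phi> \<xi> *\<^sub>R gint TYPE('d) z) * w \<xi>"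
      by (intro AE_I2 tendsto_mult_right test_kernel_tendsto \<phi>)
    fix n
    show "AE \<xi> in lborel. norm ((\<integral>x. \<phi> x *\<^sub>R hk (1 / real (Suc n)) x \<xi> \<partial>lborel) * w \<xi>) \<le> C * gmass TYPE('d) \<kappa> * (E \<xi> * norm (w \<xi>))"
    proof (intro AE_I2)
      fix \<xi>
      have "norm (\<integral>x. \<phi> x *\<^sub>R hk (1 / real (Suc n)) x \<xi> \<partial>lborel) * norm (w \<xi>) \<le> (C * gmass TYPE('d) \<kappa> * E \<xi>) * norm (w \<xi>)"
        by (intro mult_right_mono test_kernel_bound \<phi> C) auto
      then show "norm ((\<integral>x. \<phi> x *\<^sub>R hk (1 / real (Suc n)) x \<xi> \<partial>lborel) * w \<xi>) \<le> C * gmass TYPE('d) \<kappa> * (E \<xi> * norm (w \<xi>))"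
        by (simp add: norm_mult mult.assoc)
    qed
  qed measurable
  moreover have "(\<integral>\<xi>. (\<phi> \<xi> *\<^sub>R gint TYPE('d) z) * w \<xi> \<partial>lborel) = gint TYPE('d) z * (\<integral>x. \<phi> x *\<^sub>R w x \<partial>lborel)"
    by (subst integral_mult_right_zero[symmetric]) (simp add: mult_ac)
  ultimately show ?thesis using test_pairing(4)[OF _ \<phi> C] by simp
qed

text \<open>The time integral of the heat flow of f, that is, the unnormalised resolvent applied to
  f. Where the integral diverges it has the default value 0; by \<open>R_integrable\<close> this
  concerns a null set only.\<close>

definition R where "R x = (\<integral>y. indicator {0<..} (fst y) *\<^sub>R (hk (fst y) x (snd y) * f (snd y)) \<partial>lborel)"

lemma R_mass: "(\<integral>\<^sup>+x. \<integral>\<^sup>+y. ennreal (E x * norm (indicator {0<..} (fst y) *\<^sub>R (hk (fst y) x (snd y) * f (snd y)))) \<partial>lborel \<partial>lborel)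
   \<le> ennreal (gmass TYPE('d) \<kappa> / \<rho>) * ennreal (\<integral>\<xi>. E \<xi> * norm (f \<xi>) \<partial>lborel)"
proof -
  have "(\<integral>\<^sup>+x. \<integral>\<^sup>+y. ennreal (E x * norm (indicator {0<..} (fst y) *\<^sub>R (hk (fst y) x (snd y) * f (snd y)))) \<partial>lborel \<partial>lborel)
    \<le> (\<integral>\<^sup>+x. kop S (rker \<kappa> \<rho>) (\<lambda>\<xi>. ennreal (E \<xi> * norm (f \<xi>))) x \<partial>lborel)"
    unfolding kop_def
  proof (intro nn_integral_mono)
    fix x and y :: "real \<times> (real^'d)"
    show "ennreal (E x * norm (indicator {0<..} (fst y) *\<^sub>R (hk (fst y) x (snd y) * f (snd y)))) \<le>
      indicator {0<..} (fst y) * ennreal (rker \<kappa> \<rho> (fst y) (rot S (fst y) *v x - snd y)) * ennreal (E (snd y) * norm (f (snd y)))"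
    proof (cases "fst y > 0")
      case True
      have "(E x * norm (hk (fst y) x (snd y))) * norm (f (snd y)) \<le> (rker \<kappa> \<rho> (fst y) (rot S (fst y) *v x - snd y) * E (snd y)) * norm (f (snd y))"
        by (intro mult_right_mono E_norm_hk_le True) auto
      with True show ?thesis
        by (simp add: norm_mult ennreal_mult[symmetric] mult.assoc ennreal_leI)
    qed simp
  qed
  also have "\<dots> = (\<integral>\<^sup>+s. indicator {0<..} s * (\<integral>\<^sup>+y. ennreal (rker \<kappa> \<rho> s (y :: real^'d)) \<partial>lborel) \<partial>lborel) * (\<integral>\<^sup>+\<xi>. ennreal (E \<xi> * norm (f \<xi>)) \<partial>lborel)"
    by (rule nn_integral_kop[OF rker_borel rker_radial]) simp_all
  also have "\<dots> \<le> ennreal (gmass TYPE('d) \<kappa> / \<rho>) * (\<integral>\<^sup>+\<xi>. ennreal (E \<xi> * norm (f \<xi>)) \<partial>lborel)"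
    by (intro mult_right_mono rker_mass \<kappa> \<rho>) auto
  also have "(\<integral>\<^sup>+\<xi>. ennreal (E \<xi> * norm (f \<xi>)) \<partial>lborel) = ennreal (\<integral>\<xi>. E \<xi> * norm (f \<xi>) \<partial>lborel)"
    by (intro nn_integral_eq_integral integrable_E_norm f_int) simp
  finally show ?thesis .
qed

lemma R_integrand_integrable:
  "integrable lborel (\<lambda>q. E (fst q) *\<^sub>R (indicator {0<..} (fst (snd q)) *\<^sub>R (hk (fst (snd q)) (fst q) (snd (snd q)) * f (snd (snd q)))))"
proof (rule integrableI_bounded)
  show "(\<lambda>q. E (fst q) *\<^sub>R (indicator {0<..} (fst (snd q)) *\<^sub>R (hk (fst (snd q)) (fst q) (snd (snd q)) * f (snd (snd q))))) \<in> borel_measurable lborel"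
    by measurable
  have "(\<integral>\<^sup>+q. ennreal (norm (E (fst q) *\<^sub>R (indicator {0<..} (fst (snd q)) *\<^sub>R (hk (fst (snd q)) (fst q) (snd (snd q)) * f (snd (snd q)))))) \<partial>lborel)
    = (\<integral>\<^sup>+x. \<integral>\<^sup>+y. ennreal (E x * norm (indicator {0<..} (fst y) *\<^sub>R (hk (fst y) x (snd y) * f (snd y)))) \<partial>lborel \<partial>lborel)"
    by (subst nn_integral_lborel_pair) (simp_all add: abs_mult mult.assoc)
  also have "\<dots> < \<infinity>" using R_mass by (rule le_less_trans) (simp add: ennreal_mult_less_top)
  finally show "(\<integral>\<^sup>+q. ennreal (norm (E (fst q) *\<^sub>R (indicator {0<..} (fst (snd q)) *\<^sub>R (hk (fst (snd q)) (fst q) (snd (snd q)) * f (snd (snd q)))))) \<partial>lborel) < \<infinity>" .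
qed

lemma R_integrable:
  "AE x in lborel. integrable lborel (\<lambda>y. indicator {0<..} (fst y) *\<^sub>R (hk (fst y) x (snd y) * f (snd y)))"
  "integrable lborel (\<lambda>x. \<integral>y. norm (E x *\<^sub>R (indicator {0<..} (fst y) *\<^sub>R (hk (fst y) x (snd y) * f (snd y)))) \<partial>lborel)"
  "integrable lborel (\<lambda>x. E x *\<^sub>R R x)"
proof -
  let ?h = "\<lambda>q. E (fst q) *\<^sub>R (indicator {0<..} (fst (snd q)) *\<^sub>R (hk (fst (snd q)) (fst q) (snd (snd q)) * f (snd (snd q))))"
  have i: "integrable (lborel \<Otimes>\<^sub>M lborel) ?h" using R_integrand_integrable by (simp add: lborel_prod)
  show "AE x in lborel. integrable lborel (\<lambda>y. indicator {0<..} (fst y) *\<^sub>R (hk (fst y) x (snd y) * f (snd y)))"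
    using lborel_pair.AE_integrable_fst'[OF i]
  proof eventually_elim
    case (elim x)
    from integrable_scaleR_right[OF elim, of "inverse (E x)"] show ?case by (simp add: mult.assoc[symmetric])
  qed
  show "integrable lborel (\<lambda>x. \<integral>y. norm (E x *\<^sub>R (indicator {0<..} (fst y) *\<^sub>R (hk (fst y) x (snd y) * f (snd y)))) \<partial>lborel)"
    using lborel_pair.integrable_fst'[OF integrable_norm[OF i]] by simp
  show "integrable lborel (\<lambda>x. E x *\<^sub>R R x)"
  proof -
    have "(\<integral>y. ?h (x, y) \<partial>lborel) = E x *\<^sub>R R x" for x
      unfolding R_def fst_conv snd_conv by (simp only: scaleR_conv_of_real integral_mult_right_zero)
    then show ?thesis using lborel_pair.integrable_fst'[OF i] by (simp only:)
  qed
qed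

lemma R_measurable [measurable]: "R \<in> borel_measurable borel"
proof -
  have "(\<lambda>x. inverse (E x) *\<^sub>R (E x *\<^sub>R R x)) \<in> borel_measurable borel"
    using borel_measurable_integrable[OF R_integrable(3)]
    by (intro borel_measurable_scaleR[OF borel_measurable_inverse[OF E_measurable]]) simp
  moreover have "(\<lambda>x. inverse (E x) *\<^sub>R (E x *\<^sub>R R x)) = R" by (simp add: fun_eq_iff)
  ultimately show ?thesis by simp
qed

text \<open>For each test function, the pairings of the flow at a small and a large time differ by
  the kernel integral over the times between. Letting the interval exhaust the half line and
  removing the test function by the fundamental lemma gives the identity almost everywhere.\<close>

lemma representation: "AE x in lborel. gint TYPE('d) z * w x = R x"
proof -
  let ?Z = "gint TYPE('d) z"
  have li: "locally_integrable w" "locally_integrable R"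
    by (rule locally_integrable_weighted[OF _ w_int], simp)
       (rule locally_integrable_weighted[OF _ R_integrable(3)[unfolded E_def]], simp)
  have liZ: "locally_integrable (\<lambda>x. ?Z * w x - R x)"
    unfolding set_integrable_def
  proof (intro allI impI)
    fix K :: "(real^'d) set" assume "compact K"
    with li have "integrable lborel (\<lambda>x. ?Z * (indicator K x *\<^sub>R w x) - indicator K x *\<^sub>R R x)"
      unfolding set_integrable_def by (intro Bochner_Integration.integrable_diff integrable_mult_right) auto
    then show "integrable lborel (\<lambda>x. indicator K x *\<^sub>R (?Z * w x - R x))"
      by (simp add: scaleR_diff_right)
  qed
  have "AE x in lborel. ?Z * w x - R x = 0"
  proof (rule fundamental_lemma_complex[OF liZ])
    fix \<phi> :: "real^'d \<Rightarrow> real"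
    assume \<phi>: "test_fun \<phi>"
    note [measurable] = test_fun_measurable[OF \<phi>]
    obtain C where C: "C > 0" "\<And>x. \<bar>\<phi> x\<bar> \<le> C * E x"
      using test_fun_exp_bound[OF \<phi> M(1)] unfolding E_def by metis
    \<comment> \<open>Compact intervals exhausting the positive times, on which
      \<open>F_difference\<close> is available.\<close>
    define I where "I n = {1 / real (Suc n)..real (Suc n)}" for n
    define Rn where "Rn n x = (\<integral>y. indicator (I n) (fst y) *\<^sub>R (hk (fst y) x (snd y) * f (snd y)) \<partial>lborel)" for n x
    have Ile: "1 / real (Suc n) \<le> real (Suc n)" for n
    proof -
      have "1 / real (Suc n) \<le> 1" by (simp del: of_nat_Suc)
      also have "1 \<le> real (Suc n)" by simp
      finally show ?thesis .
    qed
    have Fd: "F (real (Suc n)) x - F (1 / real (Suc n)) x = - Rn n x" for n x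
      unfolding Rn_def I_def by (rule F_difference(2)[OF _ Ile]) simp
    have [measurable]: "Rn n \<in> borel_measurable borel" for n
    proof -
      have [measurable]: "I n \<in> sets borel" by (simp add: I_def)
      have "(\<lambda>q. indicator (I n) (fst (snd q)) *\<^sub>R (hk (fst (snd q)) (fst q) (snd (snd q)) * f (snd (snd q)))) \<in> borel_measurable (lborel \<Otimes>\<^sub>M lborel)"
        by (simp add: lborel_prod)
      then show ?thesis unfolding Rn_def[abs_def]
        using lborel.borel_measurable_lebesgue_integral[of "\<lambda>x y. indicator (I n) (fst y) *\<^sub>R (hk (fst y) x (snd y) * f (snd y))" lborel]
        by (simp add: split_beta)
    qed
    have lim: "(\<lambda>n. \<integral>x. \<phi> x *\<^sub>R Rn n x \<partial>lborel) \<longlonglongrightarrow> (\<integral>x. \<phi> x *\<^sub>R R x \<partial>lborel)"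
    proof (rule integral_dominated_convergence)
      \<comment> \<open>The bound |\<phi>| <= C E turns the weighted integrability of the absolute
        kernel integral into a domination that is uniform in n.\<close>
      let ?g = "\<lambda>x. C * (\<integral>y. norm (E x *\<^sub>R (indicator {0<..} (fst y) *\<^sub>R (hk (fst y) x (snd y) * f (snd y)))) \<partial>lborel)"
      show "integrable lborel ?g" by (intro integrable_mult_right R_integrable(2))
      show "AE x in lborel. (\<lambda>n. \<phi> x *\<^sub>R Rn n x) \<longlonglongrightarrow> \<phi> x *\<^sub>R R x"
        using R_integrable(1)
      proof eventually_elim
        case (elim x)
        have "(\<lambda>n. Rn n x) \<longlonglongrightarrow> R x" unfolding Rn_def R_def
        proof (rule integral_dominated_convergence[OF _ _ integrable_norm[OF elim]])
          show "AE y in lborel. (\<lambda>n. indicator (I n) (fst y) *\<^sub>R (hk (fst y) x (snd y) * f (snd y))) \<longlonglongrightarrow> indicator {0<..} (fst y) *\<^sub>R (hk (fst y) x (snd y) * f (snd y))"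
          proof (intro AE_I2)
            fix y :: "real \<times> (real^'d)"
            have "(\<lambda>n. indicator (I n) (fst y) :: real) \<longlonglongrightarrow> indicator {0<..} (fst y)"
            proof (cases "fst y > 0")
              case True
              obtain N where N: "max (fst y) (1 / fst y) < real N" using reals_Archimedean2 by blast
              have "indicator {0<..} (fst y) = (indicator (I n) (fst y) :: real)" if "n \<ge> N" for n
              proof -
                have n: "fst y \<le> real (Suc n)" "1 / fst y \<le> real (Suc n)" using N that by auto
                then have "1 / real (Suc n) \<le> fst y" using True by (simp add: field_simps del: of_nat_Suc)
                with n True show ?thesis by (simp add: I_def del: of_nat_Suc)
              qed
              then have "\<forall>\<^sub>F n in sequentially. indicator {0<..} (fst y) = (indicator (I n) (fst y) :: real)"
                by (rule eventually_sequentiallyI)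
              then show ?thesis by (rule Lim_transform_eventually[OF tendsto_const])
            next
              case False
              have "fst y \<notin> I n" for n
              proof -
                have "0 < 1 / real (Suc n)" by simp
                with False show ?thesis unfolding I_def by (simp only: atLeastAtMost_iff) linarith
              qed
              with False show ?thesis by simp
            qed
            then show "(\<lambda>n. indicator (I n) (fst y) *\<^sub>R (hk (fst y) x (snd y) * f (snd y))) \<longlonglongrightarrow> indicator {0<..} (fst y) *\<^sub>R (hk (fst y) x (snd y) * f (snd y))"
              by (intro tendsto_scaleR tendsto_const)
          qed
          fix n
          show "AE y in lborel. norm (indicator (I n) (fst y) *\<^sub>R (hk (fst y) x (snd y) * f (snd y))) \<le> norm (indicator {0<..} (fst y) *\<^sub>R (hk (fst y) x (snd y) * f (snd y)))"
          proof (intro AE_I2)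
            fix y :: "real \<times> (real^'d)"
            have "0 < 1 / real (Suc n)" by simp
            then have "fst y \<in> I n \<Longrightarrow> fst y > 0" unfolding I_def by (simp only: atLeastAtMost_iff) linarith
            then show "norm (indicator (I n) (fst y) *\<^sub>R (hk (fst y) x (snd y) * f (snd y))) \<le> norm (indicator {0<..} (fst y) *\<^sub>R (hk (fst y) x (snd y) * f (snd y)))"
              by (cases "fst y \<in> I n") auto
          qed
          have [measurable]: "I n \<in> sets borel" by (simp add: I_def)
          show "(\<lambda>y. indicator (I n) (fst y) *\<^sub>R (hk (fst y) x (snd y) * f (snd y))) \<in> borel_measurable lborel"
            by measurable
        qed measurable
        then show ?case by (intro tendsto_intros)
      qed
      fix n
      show "AE x in lborel. norm (\<phi> x *\<^sub>R Rn n x) \<le> ?g x"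
        using R_integrable(1)
      proof eventually_elim
        case (elim x)
        have "norm (Rn n x) \<le> (\<integral>y. norm (indicator {0<..} (fst y) *\<^sub>R (hk (fst y) x (snd y) * f (snd y))) \<partial>lborel)"
          unfolding Rn_def
        proof (rule order_trans[OF integral_norm_bound], rule integral_mono')
          show "integrable lborel (\<lambda>y. norm (indicator {0<..} (fst y) *\<^sub>R (hk (fst y) x (snd y) * f (snd y))))"
            using elim by (rule integrable_norm)
          fix y :: "real \<times> (real^'d)"
          have "0 < 1 / real (Suc n)" by simp
          then have "fst y \<in> I n \<Longrightarrow> fst y > 0" unfolding I_def by (simp only: atLeastAtMost_iff) linarith
          then show "norm (indicator (I n) (fst y) *\<^sub>R (hk (fst y) x (snd y) * f (snd y))) \<le> norm (indicator {0<..} (fst y) *\<^sub>R (hk (fst y) x (snd y) * f (snd y)))"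
            by (cases "fst y \<in> I n") auto
        qed simp
        then have "\<bar>\<phi> x\<bar> * norm (Rn n x) \<le> (C * E x) * (\<integral>y. norm (indicator {0<..} (fst y) *\<^sub>R (hk (fst y) x (snd y) * f (snd y))) \<partial>lborel)"
          using C(1) E_pos[of x] by (intro mult_mono C(2)) auto
        then show ?case using E_pos[of x] by (simp add: abs_of_pos mult.assoc)
      qed
    qed measurable
    have eq: "(\<integral>x. \<phi> x *\<^sub>R F (real (Suc n)) x \<partial>lborel) - (\<integral>x. \<phi> x *\<^sub>R F (1 / real (Suc n)) x \<partial>lborel) = - (\<integral>x. \<phi> x *\<^sub>R Rn n x \<partial>lborel)" for n
    proof -
      have "(\<integral>x. \<phi> x *\<^sub>R F (real (Suc n)) x \<partial>lborel) - (\<integral>x. \<phi> x *\<^sub>R F (1 / real (Suc n)) x \<partial>lborel) =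
        (\<integral>x. \<phi> x *\<^sub>R F (real (Suc n)) x - \<phi> x *\<^sub>R F (1 / real (Suc n)) x \<partial>lborel)"
        by (intro Bochner_Integration.integral_diff[symmetric] test_pairing(2)[OF _ \<phi> C]) auto
      also have "\<dots> = (\<integral>x. - (\<phi> x *\<^sub>R Rn n x) \<partial>lborel)"
        unfolding scaleR_diff_right[symmetric] Fd by simp
      finally show ?thesis by simp
    qed
    \<comment> \<open>One sequence with two limits: from the two ends of the time interval, and from
      its exhaustion.\<close>
    have "(\<lambda>n. (\<integral>x. \<phi> x *\<^sub>R F (real (Suc n)) x \<partial>lborel) - (\<integral>x. \<phi> x *\<^sub>R F (1 / real (Suc n)) x \<partial>lborel)) \<longlonglongrightarrow> 0 - ?Z * (\<integral>x. \<phi> x *\<^sub>R w x \<partial>lborel)"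
      by (intro tendsto_diff test_pairing_infinity test_pairing_zero \<phi>)
    moreover have "(\<lambda>n. (\<integral>x. \<phi> x *\<^sub>R F (real (Suc n)) x \<partial>lborel) - (\<integral>x. \<phi> x *\<^sub>R F (1 / real (Suc n)) x \<partial>lborel)) \<longlonglongrightarrow> - (\<integral>x. \<phi> x *\<^sub>R R x \<partial>lborel)"
      unfolding eq by (intro tendsto_minus lim)
    ultimately have "0 - ?Z * (\<integral>x. \<phi> x *\<^sub>R w x \<partial>lborel) = - (\<integral>x. \<phi> x *\<^sub>R R x \<partial>lborel)"
      by (rule LIMSEQ_unique)
    then have "?Z * (\<integral>x. \<phi> x *\<^sub>R w x \<partial>lborel) - (\<integral>x. \<phi> x *\<^sub>R R x \<partial>lborel) = 0" by simp
    moreover have "(\<integral>x. \<phi> x *\<^sub>R (?Z * w x - R x) \<partial>lborel) = ?Z * (\<integral>x. \<phi> x *\<^sub>R w x \<partial>lborel) - (\<integral>x. \<phi> x *\<^sub>R R x \<partial>lborel)"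
    proof -
      have "(\<integral>x. \<phi> x *\<^sub>R (?Z * w x - R x) \<partial>lborel) = (\<integral>x. ?Z * (\<phi> x *\<^sub>R w x) - \<phi> x *\<^sub>R R x \<partial>lborel)"
        by (simp add: scaleR_diff_right)
      also have "\<dots> = (\<integral>x. ?Z * (\<phi> x *\<^sub>R w x) \<partial>lborel) - (\<integral>x. \<phi> x *\<^sub>R R x \<partial>lborel)"
        by (intro Bochner_Integration.integral_diff integrable_mult_right integrable_test_fun_scaleR \<phi> li)
      finally show ?thesis by (simp only: integral_mult_right_zero)
    qed
    ultimately show "(\<integral>x. \<phi> x *\<^sub>R (?Z * w x - R x) \<partial>lborel) = 0" by simp
  qed
  then show ?thesis by eventually_elim simp
qed

end

section \<open>Representation of the gradient\<close>

lemma locally_integrable_continuous: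
  fixes u :: "real^'d \<Rightarrow> complex"
  assumes "continuous_on UNIV u"
  shows "locally_integrable u"
proof (intro allI impI)
  fix K :: "(real^'d) set" assume K: "compact K"
  show "set_integrable lborel K u"
    using borel_integrable_compact[OF K continuous_on_subset[OF assms]] by (simp add: set_integrable_def)
qed

lemma integral_cpderiv_ctest:
  assumes "ctest \<psi>"
  shows "(\<integral>x. cpderiv i \<psi> x \<partial>lborel) = 0"
proof -
  have "(\<integral>x. cpderiv i \<psi> x * 1 \<partial>lborel) =
    (\<integral>x. Re (cpderiv i \<psi> x) *\<^sub>R 1 \<partial>lborel) + \<i> * (\<integral>x. Im (cpderiv i \<psi> x) *\<^sub>R 1 \<partial>lborel)"
    by (intro integral_ctest_mult ctest_cpderiv assms locally_integrable_continuous continuous_intros)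
  also have "(\<integral>x. Re (cpderiv i \<psi> x) *\<^sub>R (1::complex) \<partial>lborel) = of_real (\<integral>x. pderiv_fun (\<lambda>x. Re (\<psi> x)) i x \<partial>lborel)"
    unfolding integral_complex_of_real[symmetric] by (simp add: cpderiv_def scaleR_conv_of_real)
  also have "(\<integral>x. Im (cpderiv i \<psi> x) *\<^sub>R (1::complex) \<partial>lborel) = of_real (\<integral>x. pderiv_fun (\<lambda>x. Im (\<psi> x)) i x \<partial>lborel)"
    unfolding integral_complex_of_real[symmetric] by (simp add: cpderiv_def scaleR_conv_of_real)
  finally show ?thesis using assms by (simp add: ctest_def integral_pderiv_test_fun)
qed

lemma integral_test_gauss_parts:
  assumes \<phi>: "test_fun \<phi>"
  shows "(\<integral>x. pderiv_fun \<phi> i x *\<^sub>R gauss \<zeta> Y x \<partial>lborel) =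
    - (\<integral>x. \<phi> x *\<^sub>R ((- 2 * \<zeta> * of_real ((x - Y) $ i)) * gauss \<zeta> Y x) \<partial>lborel)"
proof -
  have sm: "smooth_fun \<phi>" using \<phi> by (simp add: test_fun_def)
  have cont: "continuous_on UNIV (gauss \<zeta> Y)"
    unfolding gauss_def by (intro continuous_intros)
  have cont': "continuous_on UNIV (\<lambda>x. (- 2 * \<zeta> * of_real ((x - Y) $ i)) * gauss \<zeta> Y x)"
    unfolding gauss_def vector_minus_component by (intro continuous_intros continuous_on_component)
  have 1: "integrable lborel (\<lambda>x. \<phi> x *\<^sub>R ((- 2 * \<zeta> * of_real ((x - Y) $ i)) * gauss \<zeta> Y x))"
    by (intro integrable_test_fun_scaleR \<phi> locally_integrable_continuous cont')
  have 2: "integrable lborel (\<lambda>x. pderiv_fun \<phi> i x *\<^sub>R gauss \<zeta> Y x)"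
    by (intro integrable_test_fun_scaleR test_fun_pderiv \<phi> locally_integrable_continuous cont)
  have "0 = (\<integral>x. \<phi> x *\<^sub>R ((- 2 * \<zeta> * of_real ((x - Y) $ i)) * gauss \<zeta> Y x) + pderiv_fun \<phi> i x *\<^sub>R gauss \<zeta> Y x \<partial>lborel)"
    using integral_cpderiv_ctest[OF ctest_scaleR[OF \<phi> csmooth_gauss], of i \<zeta> Y]
    unfolding cpderiv_scaleR[OF sm csmooth_gauss] cpderiv_gauss ..
  also have "\<dots> = (\<integral>x. \<phi> x *\<^sub>R ((- 2 * \<zeta> * of_real ((x - Y) $ i)) * gauss \<zeta> Y x) \<partial>lborel) + (\<integral>x. pderiv_fun \<phi> i x *\<^sub>R gauss \<zeta> Y x \<partial>lborel)"
    by (rule Bochner_Integration.integral_add[OF 1 2])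
  finally show ?thesis by (simp only: eq_neg_iff_add_eq_0 add.commute)
qed

context heat_equation
begin

text \<open>The i-th partial derivative in x of \<open>hk\<close>, read off from the Gaussian
  centred at the back-rotated \<xi>.\<close>

definition dxk where
  "dxk i s x \<xi> = (- 2 * (z / of_real s) * of_real ((x - \<xi> v* rot S s) $ i)) * hk s x \<xi>"

lemma dxk_measurable [measurable]:
  assumes [measurable]: "a \<in> borel_measurable N" "b \<in> borel_measurable N" "e \<in> borel_measurable N"
  shows "(\<lambda>x. dxk i (a x) (b x) (e x)) \<in> borel_measurable N"
proof -
  have [measurable]: "(\<lambda>x :: real^'d. x $ i) \<in> borel_measurable borel"
    by (intro borel_measurable_continuous_onI continuous_on_component continuous_on_id)
  show ?thesis unfolding dxk_def by measurable
qed

lemma hk_gauss':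
  assumes "s > 0"
  shows "hk s x \<xi> = exp (of_real (- (real CARD('d) / 2) * ln s) - c * of_real s) * gauss (z / of_real s) (\<xi> v* rot S s) x"
  unfolding hk_def hker_def gauss_def exp_add[symmetric] norm_rot_diff by simp

lemma hk_parts:
  assumes s: "s > 0" and \<phi>: "test_fun \<phi>"
  shows "(\<integral>x. pderiv_fun \<phi> i x *\<^sub>R hk s x \<xi> \<partial>lborel) = - (\<integral>x. \<phi> x *\<^sub>R dxk i s x \<xi> \<partial>lborel)"
proof -
  define P where "P = exp (of_real (- (real CARD('d) / 2) * ln s) - c * of_real s)"
  define Y where "Y = \<xi> v* rot S s"
  define \<zeta> where "\<zeta> = z / of_real s"
  have h: "hk s x \<xi> = P * gauss \<zeta> Y x" for x
    unfolding hk_gauss'[OF s] P_def Y_def \<zeta>_def ..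
  have "(\<integral>x. pderiv_fun \<phi> i x *\<^sub>R hk s x \<xi> \<partial>lborel) = P * (\<integral>x. pderiv_fun \<phi> i x *\<^sub>R gauss \<zeta> Y x \<partial>lborel)"
    unfolding h by (simp only: mult_scaleR_right[symmetric] integral_mult_right_zero)
  also have "\<dots> = - (P * (\<integral>x. \<phi> x *\<^sub>R ((- 2 * \<zeta> * of_real ((x - Y) $ i)) * gauss \<zeta> Y x) \<partial>lborel))"
    unfolding integral_test_gauss_parts[OF \<phi>] by simp
  also have "\<dots> = - (\<integral>x. P * (\<phi> x *\<^sub>R ((- 2 * \<zeta> * of_real ((x - Y) $ i)) * gauss \<zeta> Y x)) \<partial>lborel)"
    by (simp only: integral_mult_right_zero)
  also have "(\<lambda>x. P * (\<phi> x *\<^sub>R ((- 2 * \<zeta> * of_real ((x - Y) $ i)) * gauss \<zeta> Y x))) = (\<lambda>x. \<phi> x *\<^sub>R dxk i s x \<xi>)"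
    unfolding dxk_def h Y_def[symmetric] \<zeta>_def[symmetric] by (simp add: fun_eq_iff mult_ac)
  finally show ?thesis .
qed

lemma norm_dxk_le:
  assumes "s > 0"
  shows "norm (dxk i s x \<xi>) \<le> 2 * norm z * (norm (rot S s *v x - \<xi>) / s * rker \<alpha> \<Lambda> s (rot S s *v x - \<xi>))"
proof -
  have "\<bar>(x - \<xi> v* rot S s) $ i\<bar> \<le> norm (rot S s *v x - \<xi>)"
    using component_le_norm_cart[of "x - \<xi> v* rot S s" i] by (simp add: norm_rot_diff)
  then have "(2 * (norm z / s) * \<bar>(x - \<xi> v* rot S s) $ i\<bar>) * norm (hk s x \<xi>) \<le>
     (2 * (norm z / s) * norm (rot S s *v x - \<xi>)) * rker \<alpha> \<Lambda> s (rot S s *v x - \<xi>)"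
    using assms by (intro mult_mono mult_left_mono norm_hk_le) auto
  then show ?thesis
    using assms unfolding dxk_def norm_mult by (simp add: norm_divide mult_ac del: vector_minus_component)
qed

lemma E_norm_dxk_le:
  assumes "s > 0"
  shows "E x * norm (dxk i s x \<xi>) \<le> (2 * norm z / sqrt \<kappa>) * (s powr (- 1 / 2) * rker (\<kappa> / 2) \<rho> s (rot S s *v x - \<xi>)) * E \<xi>"
proof -
  let ?y = "rot S s *v x - \<xi>"
  have "E x * norm (dxk i s x \<xi>) \<le> E x * (2 * norm z * (norm ?y / s * rker \<alpha> \<Lambda> s ?y))"
    by (intro mult_left_mono norm_dxk_le assms) simp
  also have "\<dots> = 2 * norm z * (norm ?y / s * (E x * rker \<alpha> \<Lambda> s ?y))" by simp
  also have "\<dots> \<le> 2 * norm z * (norm ?y / s * (rker \<kappa> \<rho> s ?y * E \<xi>))"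
    using assms by (intro mult_left_mono E_rker_le) auto
  also have "\<dots> = 2 * norm z * (norm ?y / s * rker \<kappa> \<rho> s ?y) * E \<xi>" by simp
  also have "\<dots> \<le> 2 * norm z * ((1 / sqrt \<kappa>) * (s powr (- 1 / 2) * rker (\<kappa> / 2) \<rho> s ?y)) * E \<xi>"
    using assms \<kappa> by (intro mult_right_mono mult_left_mono norm_div_rker_le) auto
  finally show ?thesis by simp
qed

definition R1 where "R1 i x = (\<integral>y. indicator {0<..} (fst y) *\<^sub>R (dxk i (fst y) x (snd y) * f (snd y)) \<partial>lborel)"

lemma R1_integrand_integrable:
  "integrable lborel (\<lambda>q. E (fst q) *\<^sub>R (indicator {0<..} (fst (snd q)) *\<^sub>R (dxk i (fst (snd q)) (fst q) (snd (snd q)) * f (snd (snd q)))))"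
proof (rule integrableI_bounded)
  let ?K = "\<lambda>s y. s powr (- 1 / 2) * rker (\<kappa> / 2) \<rho> s (y :: real^'d)"
  let ?c = "2 * norm z / sqrt \<kappa>"
  have c0: "0 \<le> ?c" using \<kappa> by simp
  show "(\<lambda>q. E (fst q) *\<^sub>R (indicator {0<..} (fst (snd q)) *\<^sub>R (dxk i (fst (snd q)) (fst q) (snd (snd q)) * f (snd (snd q))))) \<in> borel_measurable lborel"
    by measurable
  have "(\<integral>\<^sup>+q. ennreal (norm (E (fst q) *\<^sub>R (indicator {0<..} (fst (snd q)) *\<^sub>R (dxk i (fst (snd q)) (fst q) (snd (snd q)) * f (snd (snd q)))))) \<partial>lborel)
    = (\<integral>\<^sup>+x. \<integral>\<^sup>+y. ennreal (E x * norm (indicator {0<..} (fst y) *\<^sub>R (dxk i (fst y) x (snd y) * f (snd y)))) \<partial>lborel \<partial>lborel)"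
    by (subst nn_integral_lborel_pair) (simp_all add: abs_mult mult.assoc)
  also have "\<dots> \<le> (\<integral>\<^sup>+x. kop S ?K (\<lambda>\<xi>. ennreal (?c * (E \<xi> * norm (f \<xi>)))) x \<partial>lborel)"
    unfolding kop_def
  proof (intro nn_integral_mono)
    fix x and y :: "real \<times> (real^'d)"
    show "ennreal (E x * norm (indicator {0<..} (fst y) *\<^sub>R (dxk i (fst y) x (snd y) * f (snd y)))) \<le>
      indicator {0<..} (fst y) * ennreal (?K (fst y) (rot S (fst y) *v x - snd y)) * ennreal (?c * (E (snd y) * norm (f (snd y))))"
    proof (cases "fst y > 0")
      case True
      have "(E x * norm (dxk i (fst y) x (snd y))) * norm (f (snd y)) \<le> (?c * ?K (fst y) (rot S (fst y) *v x - snd y) * E (snd y)) * norm (f (snd y))"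
        by (intro mult_right_mono E_norm_dxk_le True) auto
      also have "\<dots> = ?K (fst y) (rot S (fst y) *v x - snd y) * (?c * (E (snd y) * norm (f (snd y))))"
        by (simp only: mult_ac)
      finally have "ennreal (E x * norm (dxk i (fst y) x (snd y)) * norm (f (snd y))) \<le>
         ennreal (?K (fst y) (rot S (fst y) *v x - snd y)) * ennreal (?c * (E (snd y) * norm (f (snd y))))"
        using mult_nonneg_nonneg[OF c0, of "E (snd y) * norm (f (snd y))"]
        by (subst ennreal_mult[symmetric]) (auto intro!: ennreal_leI)
      with True show ?thesis
        by (simp add: norm_mult mult.assoc)
    qed simp
  qed
  also have "\<dots> = (\<integral>\<^sup>+s. indicator {0<..} s * (\<integral>\<^sup>+y. ennreal (?K s y) \<partial>lborel) \<partial>lborel) * (\<integral>\<^sup>+\<xi>. ennreal (?c * (E \<xi> * norm (f \<xi>))) \<partial>lborel)"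
    by (rule nn_integral_kop[OF sqrt_rker_borel]) (simp_all add: rker_def)
  also have "\<dots> < \<infinity>"
  proof -
    have "(\<integral>\<^sup>+\<xi>. ennreal (?c * (E \<xi> * norm (f \<xi>))) \<partial>lborel) = ennreal (\<integral>\<xi>. ?c * (E \<xi> * norm (f \<xi>)) \<partial>lborel)"
      by (intro nn_integral_eq_integral integrable_mult_right integrable_E_norm f_int AE_I2 mult_nonneg_nonneg[OF c0]) simp_all
    moreover have "(\<integral>\<^sup>+s. indicator {0<..} s * (\<integral>\<^sup>+y. ennreal (?K s y) \<partial>lborel) \<partial>lborel) < \<infinity>"
      using sqrt_rker_mass[of "\<kappa> / 2" \<rho>, where 'd = 'd] \<kappa> \<rho> by (auto simp: le_less_trans)
    ultimately show ?thesis by (simp add: ennreal_mult_less_top)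
  qed
  finally show "(\<integral>\<^sup>+q. ennreal (norm (E (fst q) *\<^sub>R (indicator {0<..} (fst (snd q)) *\<^sub>R (dxk i (fst (snd q)) (fst q) (snd (snd q)) * f (snd (snd q)))))) \<partial>lborel) < \<infinity>" .
qed

lemma R1_integrable: "integrable lborel (\<lambda>x. E x *\<^sub>R R1 i x)"
proof -
  let ?h = "\<lambda>q. E (fst q) *\<^sub>R (indicator {0<..} (fst (snd q)) *\<^sub>R (dxk i (fst (snd q)) (fst q) (snd (snd q)) * f (snd (snd q))))"
  have i: "integrable (lborel \<Otimes>\<^sub>M lborel) ?h" using R1_integrand_integrable by (simp add: lborel_prod)
  have "(\<integral>y. ?h (x, y) \<partial>lborel) = E x *\<^sub>R R1 i x" for x
    unfolding R1_def fst_conv snd_conv by (simp only: scaleR_conv_of_real integral_mult_right_zero)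
  then show ?thesis using lborel_pair.integrable_fst'[OF i] by (simp only:)
qed

lemma R1_measurable [measurable]: "R1 i \<in> borel_measurable borel"
proof -
  have "(\<lambda>x. inverse (E x) *\<^sub>R (E x *\<^sub>R R1 i x)) \<in> borel_measurable borel"
    using borel_measurable_integrable[OF R1_integrable]
    by (intro borel_measurable_scaleR[OF borel_measurable_inverse[OF E_measurable]]) simp
  moreover have "(\<lambda>x. inverse (E x) *\<^sub>R (E x *\<^sub>R R1 i x)) = R1 i" by (simp add: fun_eq_iff)
  ultimately show ?thesis by simp
qed

lemma test_weighted_integrable:
  assumes \<phi>: "test_fun \<phi>" and h: "integrable lborel (\<lambda>q. E (fst q) *\<^sub>R h q)"
    and [measurable]: "h \<in> borel_measurable (borel :: ((real^'d) \<times> (real \<times> (real^'d))) measure)"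
  shows "integrable lborel (\<lambda>q. \<phi> (fst q) *\<^sub>R (h q :: complex))"
proof -
  note [measurable] = test_fun_measurable[OF \<phi>]
  obtain C where C: "C > 0" "\<And>x. \<bar>\<phi> x\<bar> \<le> C * E x"
    using test_fun_exp_bound[OF \<phi> M(1)] unfolding E_def by metis
  show ?thesis
  proof (rule Bochner_Integration.integrable_bound[OF integrable_scaleR_right[OF h, of C]])
    show "AE q in lborel. norm (\<phi> (fst q) *\<^sub>R h q) \<le> norm (C *\<^sub>R (E (fst q) *\<^sub>R h q))"
      using C by (intro AE_I2) (auto simp: mult.assoc[symmetric] intro!: mult_right_mono)
  qed measurable
qed

text \<open>The derivative is put on the test function, \<open>representation\<close> is inserted
  for w, and the integration by parts takes place in x for each fixed pair (s, \<xi>). Instead of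
  differentiating under a singular integral, this uses only Fubini with the integrable singularity
  s^(-1/2).\<close>

lemma gradient_representation:
  assumes Dw: "weak_deriv i w Dw"
  shows "AE x in lborel. gint TYPE('d) z * Dw x = R1 i x"
proof -
  let ?Z = "gint TYPE('d) z"
  have li: "locally_integrable w" "locally_integrable Dw"
    using Dw by (auto simp: weak_deriv_def)
  have liR: "locally_integrable (R1 i)"
    by (rule locally_integrable_weighted[OF _ R1_integrable[unfolded E_def]]) simp
  note [measurable] = locally_integrable_measurable[OF li(2)]
  have liZ: "locally_integrable (\<lambda>x. ?Z * Dw x - R1 i x)"
    unfolding set_integrable_def
  proof (intro allI impI)
    fix K :: "(real^'d) set" assume "compact K"
    with li liR have "integrable lborel (\<lambda>x. ?Z * (indicator K x *\<^sub>R Dw x) - indicator K x *\<^sub>R R1 i x)"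
      unfolding set_integrable_def by (intro Bochner_Integration.integrable_diff integrable_mult_right) auto
    then show "integrable lborel (\<lambda>x. indicator K x *\<^sub>R (?Z * Dw x - R1 i x))"
      by (simp add: scaleR_diff_right)
  qed
  have "AE x in lborel. ?Z * Dw x - R1 i x = 0"
  proof (rule fundamental_lemma_complex[OF liZ])
    fix \<phi> :: "real^'d \<Rightarrow> real"
    assume \<phi>: "test_fun \<phi>"
    let ?\<psi> = "pderiv_fun \<phi> i"
    note [measurable] = test_fun_measurable[OF \<phi>] test_fun_measurable[OF test_fun_pderiv[OF \<phi>]]
    let ?h = "\<lambda>q. indicator {0<..} (fst (snd q)) *\<^sub>R (hk (fst (snd q)) (fst q) (snd (snd q)) * f (snd (snd q)))"
    let ?h1 = "\<lambda>q. indicator {0<..} (fst (snd q)) *\<^sub>R (dxk i (fst (snd q)) (fst q) (snd (snd q)) * f (snd (snd q)))"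
    have i: "integrable lborel (\<lambda>q. ?\<psi> (fst q) *\<^sub>R ?h q)"
      by (rule test_weighted_integrable[OF test_fun_pderiv[OF \<phi>] R_integrand_integrable]) measurable
    have i1: "integrable lborel (\<lambda>q. \<phi> (fst q) *\<^sub>R ?h1 q)"
      by (rule test_weighted_integrable[OF \<phi> R1_integrand_integrable]) measurable
    have "?Z * (\<integral>x. \<phi> x *\<^sub>R Dw x \<partial>lborel) = - (?Z * (\<integral>x. ?\<psi> x *\<^sub>R w x \<partial>lborel))"
      using Dw \<phi> by (simp add: weak_deriv_def)
    also have "\<dots> = - (\<integral>x. ?Z * (?\<psi> x *\<^sub>R w x) \<partial>lborel)" by (simp only: integral_mult_right_zero)
    also have "(\<integral>x. ?Z * (?\<psi> x *\<^sub>R w x) \<partial>lborel) = (\<integral>x. ?\<psi> x *\<^sub>R R x \<partial>lborel)"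
    proof (rule integral_cong_AE)
      show "AE x in lborel. ?Z * (?\<psi> x *\<^sub>R w x) = ?\<psi> x *\<^sub>R R x"
        using representation by eventually_elim (simp add: mult_scaleR_right)
    qed measurable
    also have "\<dots> = (\<integral>x. \<integral>y. ?\<psi> (fst (x, y)) *\<^sub>R ?h (x, y) \<partial>lborel \<partial>lborel)"
      unfolding R_def fst_conv snd_conv by (simp only: scaleR_conv_of_real integral_mult_right_zero)
    also have "\<dots> = (\<integral>y. \<integral>x. ?\<psi> (fst (x, y)) *\<^sub>R ?h (x, y) \<partial>lborel \<partial>lborel)"
      using integral_lborel_pair[OF i] by (simp only:)
    also have "\<dots> = (\<integral>y. - (\<integral>x. \<phi> (fst (x, y)) *\<^sub>R ?h1 (x, y) \<partial>lborel) \<partial>lborel)"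
    proof (intro Bochner_Integration.integral_cong refl)
      fix y :: "real \<times> (real^'d)"
      \<comment> \<open>Pulls out the factors that depend on (s, \<xi>) only, so that
        \<open>hk_parts\<close> applies in x; for s <= 0 both sides vanish.\<close>
      have e: "(\<integral>x. a x *\<^sub>R (indicator {0<..} (fst y) *\<^sub>R (k x * f (snd y))) \<partial>lborel) = (of_real (indicator {0<..} (fst y)) * f (snd y)) * (\<integral>x. a x *\<^sub>R k x \<partial>lborel)"
        for a :: "real^'d \<Rightarrow> real" and k :: "real^'d \<Rightarrow> complex"
        by (subst integral_mult_right_zero[symmetric]) (simp add: scaleR_conv_of_real mult_ac)
      show "(\<integral>x. ?\<psi> (fst (x, y)) *\<^sub>R ?h (x, y) \<partial>lborel) = - (\<integral>x. \<phi> (fst (x, y)) *\<^sub>R ?h1 (x, y) \<partial>lborel)"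
        unfolding fst_conv snd_conv e using hk_parts[OF _ \<phi>, of "fst y" i "snd y"] by (cases "fst y > 0") simp_all
    qed
    also have "\<dots> = - (\<integral>y. \<integral>x. \<phi> (fst (x, y)) *\<^sub>R ?h1 (x, y) \<partial>lborel \<partial>lborel)"
      by (rule Bochner_Integration.integral_minus)
    also have "\<dots> = - (\<integral>x. \<integral>y. \<phi> (fst (x, y)) *\<^sub>R ?h1 (x, y) \<partial>lborel \<partial>lborel)"
      using integral_lborel_pair[OF i1] by (simp only:)
    also have "\<dots> = - (\<integral>x. \<phi> x *\<^sub>R R1 i x \<partial>lborel)"
      unfolding R1_def fst_conv snd_conv by (simp only: scaleR_conv_of_real integral_mult_right_zero)
    finally have key: "?Z * (\<integral>x. \<phi> x *\<^sub>R Dw x \<partial>lborel) - (\<integral>x. \<phi> x *\<^sub>R R1 i x \<partial>lborel) = 0" by simp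
    have "(\<integral>x. \<phi> x *\<^sub>R (?Z * Dw x - R1 i x) \<partial>lborel) = (\<integral>x. ?Z * (\<phi> x *\<^sub>R Dw x) - \<phi> x *\<^sub>R R1 i x \<partial>lborel)"
      by (simp add: scaleR_diff_right)
    also have "\<dots> = (\<integral>x. ?Z * (\<phi> x *\<^sub>R Dw x) \<partial>lborel) - (\<integral>x. \<phi> x *\<^sub>R R1 i x \<partial>lborel)"
      by (intro Bochner_Integration.integral_diff integrable_mult_right integrable_test_fun_scaleR \<phi> li liR)
    finally show "(\<integral>x. \<phi> x *\<^sub>R (?Z * Dw x - R1 i x) \<partial>lborel) = 0"
      using key by (simp only: integral_mult_right_zero)
  qed
  then show ?thesis by eventually_elim simp
qed

text \<open>Taking moduli discards Im z and Im c: on the right only the lower bounds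
  \<open>\<alpha>\<close> and \<open>\<Lambda>\<close> remain, which is the source of the uniformity
  in Im lam.\<close>

lemma pointwise_bound:
  "AE x in lborel. ennreal (norm (gint TYPE('d) z) * norm (w x)) \<le> kop S (rker \<alpha> \<Lambda>) (\<lambda>\<xi>. ennreal (norm (f \<xi>))) x"
  using representation
proof eventually_elim
  case (elim x)
  have "ennreal (norm (gint TYPE('d) z) * norm (w x)) = ennreal (norm (R x))"
    using elim by (simp add: norm_mult[symmetric])
  also have "\<dots> \<le> (\<integral>\<^sup>+y. ennreal (norm (indicator {0<..} (fst y) *\<^sub>R (hk (fst y) x (snd y) * f (snd y)))) \<partial>lborel)"
    unfolding R_def by (rule norm_integral_le_nn_integral)
  also have "\<dots> \<le> kop S (rker \<alpha> \<Lambda>) (\<lambda>\<xi>. ennreal (norm (f \<xi>))) x"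
    unfolding kop_def
  proof (rule nn_integral_mono)
    fix y :: "real \<times> (real^'d)"
    show "ennreal (norm (indicator {0<..} (fst y) *\<^sub>R (hk (fst y) x (snd y) * f (snd y)))) \<le>
      indicator {0<..} (fst y) * ennreal (rker \<alpha> \<Lambda> (fst y) (rot S (fst y) *v x - snd y)) * ennreal (norm (f (snd y)))"
    proof (cases "fst y > 0")
      case True
      then have "norm (hk (fst y) x (snd y)) * norm (f (snd y)) \<le> rker \<alpha> \<Lambda> (fst y) (rot S (fst y) *v x - snd y) * norm (f (snd y))"
        by (intro mult_right_mono norm_hk_le) auto
      with True show ?thesis by (simp add: norm_mult ennreal_mult[symmetric] ennreal_leI)
    qed simp
  qed
  finally show ?case .
qed

lemma pointwise_gradient_bound:
  assumes "weak_deriv i w Dw"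
  shows "AE x in lborel. ennreal (norm (gint TYPE('d) z) * norm (Dw x)) \<le>
    kop S (\<lambda>s y. 2 * norm z * (norm y / s * rker \<alpha> \<Lambda> s y)) (\<lambda>\<xi>. ennreal (norm (f \<xi>))) x"
  using gradient_representation[OF assms]
proof eventually_elim
  case (elim x)
  have "ennreal (norm (gint TYPE('d) z) * norm (Dw x)) = ennreal (norm (R1 i x))"
    using elim by (simp add: norm_mult[symmetric])
  also have "\<dots> \<le> (\<integral>\<^sup>+y. ennreal (norm (indicator {0<..} (fst y) *\<^sub>R (dxk i (fst y) x (snd y) * f (snd y)))) \<partial>lborel)"
    unfolding R1_def by (rule norm_integral_le_nn_integral)
  also have "\<dots> \<le> kop S (\<lambda>s y. 2 * norm z * (norm y / s * rker \<alpha> \<Lambda> s y)) (\<lambda>\<xi>. ennreal (norm (f \<xi>))) x"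
    unfolding kop_def
  proof (rule nn_integral_mono)
    fix y :: "real \<times> (real^'d)"
    let ?y = "rot S (fst y) *v x - snd y"
    show "ennreal (norm (indicator {0<..} (fst y) *\<^sub>R (dxk i (fst y) x (snd y) * f (snd y)))) \<le>
      indicator {0<..} (fst y) * ennreal (2 * norm z * (norm ?y / fst y * rker \<alpha> \<Lambda> (fst y) ?y)) * ennreal (norm (f (snd y)))"
    proof (cases "fst y > 0")
      case True
      then have "norm (dxk i (fst y) x (snd y)) * norm (f (snd y)) \<le> (2 * norm z * (norm ?y / fst y * rker \<alpha> \<Lambda> (fst y) ?y)) * norm (f (snd y))"
        by (intro mult_right_mono norm_dxk_le) auto
      with True show ?thesis by (simp add: norm_mult ennreal_mult[symmetric] ennreal_leI)
    qed simp
  qed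
  finally show ?case .
qed

end

section \<open>Exponentially weighted estimates\<close>

lemma exp_weight_pos: "exp_weight \<mu> x > 0"
  by (simp add: exp_weight_def)

lemma exp_weight_measurable [measurable]: "exp_weight \<mu> \<in> borel_measurable borel"
  unfolding exp_weight_def[abs_def] by measurable

lemma sqrt_norm_le: "sqrt ((norm x)\<^sup>2 + 1) \<le> 1 + norm x"
  by (rule real_le_lsqrt) (auto simp: power2_sum)

text \<open>A nonnegative t satisfies t <= 1 + t^p. Applied to the weighted modulus this replaces
  Hoelder's inequality: the gap between |\<mu>| and M makes the term 1 integrable, and t^p is
  integrable by assumption.\<close>

lemma Lp_weighted_integrable_exp:
  fixes u :: "real^'d \<Rightarrow> complex^'m"
  assumes u: "Lp_weighted p (exp_weight \<mu>) u" and p: "p \<ge> 1" and M: "\<bar>\<mu>\<bar> < M"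
  shows "integrable lborel (\<lambda>x. exp (- M * norm x) *\<^sub>R u x)"
proof (rule Bochner_Integration.integrable_bound)
  let ?t = "\<lambda>x. norm (exp_weight \<mu> x *\<^sub>R u x)"
  have [measurable]: "u \<in> borel_measurable borel" using u by (simp add: Lp_weighted_def)
  show "(\<lambda>x. exp (- M * norm x) *\<^sub>R u x) \<in> borel_measurable lborel" by measurable
  have i: "integrable lborel (\<lambda>x. ?t x powr p)"
    using u by (intro integrableI_bounded) (auto simp: Lp_weighted_def)
  show "integrable lborel (\<lambda>x. exp \<bar>\<mu>\<bar> * (exp (- (M - \<bar>\<mu>\<bar>) * norm x) + ?t x powr p))"
    using M by (intro integrable_mult_right Bochner_Integration.integrable_add integrable_exp_neg_norm i) auto
  show "AE x in lborel. norm (exp (- M * norm x) *\<^sub>R u x) \<le> norm (exp \<bar>\<mu>\<bar> * (exp (- (M - \<bar>\<mu>\<bar>) * norm x) + ?t x powr p))"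
  proof (intro AE_I2)
    fix x
    have t0: "?t x \<ge> 0" by simp
    have a: "exp (- \<mu> * sqrt ((norm x)\<^sup>2 + 1)) * exp (- M * norm x) \<le> exp \<bar>\<mu>\<bar> * exp (- (M - \<bar>\<mu>\<bar>) * norm x)"
    proof -
      have "- \<mu> * sqrt ((norm x)\<^sup>2 + 1) \<le> \<bar>\<mu>\<bar> * sqrt ((norm x)\<^sup>2 + 1)" by (intro mult_right_mono) auto
      also have "\<dots> \<le> \<bar>\<mu>\<bar> * (1 + norm x)" by (intro mult_left_mono sqrt_norm_le) auto
      finally show ?thesis unfolding exp_add[symmetric] by (simp add: algebra_simps)
    qed
    have b: "?t x \<le> 1 + ?t x powr p"
    proof (cases "?t x \<le> 1")
      case True
      then show ?thesis by (simp add: add_increasing2)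
    next
      case False
      then have "?t x powr 1 \<le> ?t x powr p" using p by (intro powr_mono) auto
      then show ?thesis using False by simp
    qed
    have "norm (exp (- M * norm x) *\<^sub>R u x) = (exp (- \<mu> * sqrt ((norm x)\<^sup>2 + 1)) * exp (- M * norm x)) * ?t x"
      by (simp add: exp_weight_def exp_minus)
    also have "\<dots> \<le> (exp \<bar>\<mu>\<bar> * exp (- (M - \<bar>\<mu>\<bar>) * norm x)) * (1 + ?t x powr p)"
      by (intro mult_mono a b) auto
    also have "\<dots> \<le> exp \<bar>\<mu>\<bar> * (exp (- (M - \<bar>\<mu>\<bar>) * norm x) + ?t x powr p)"
    proof -
      have "- (M - \<bar>\<mu>\<bar>) * norm x \<le> 0" using M by (intro mult_nonpos_nonneg) auto
      then have "exp (- (M - \<bar>\<mu>\<bar>) * norm x) \<le> 1" by (simp only: exp_le_one_iff)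
      then have "exp (- (M - \<bar>\<mu>\<bar>) * norm x) * ?t x powr p \<le> 1 * ?t x powr p"
        by (intro mult_right_mono) auto
      then have "exp (- (M - \<bar>\<mu>\<bar>) * norm x) * (1 + ?t x powr p) \<le> exp (- (M - \<bar>\<mu>\<bar>) * norm x) + ?t x powr p"
        by (simp add: distrib_left)
      then show ?thesis by (simp add: mult.assoc)
    qed
    finally show "norm (exp (- M * norm x) *\<^sub>R u x) \<le> norm (exp \<bar>\<mu>\<bar> * (exp (- (M - \<bar>\<mu>\<bar>) * norm x) + ?t x powr p))"
      by (rule order_trans) simp
  qed
qed

lemma matrix_vector_mult_bounded_linear: "bounded_linear (\<lambda>u. M *v (u :: complex^'m))"
proof -
  have "linear (\<lambda>u. M *v (u :: complex^'m))"
    by (rule linearI, rule matrix_vector_right_distrib)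
       (simp add: vec_eq_iff matrix_vector_mult_def scaleR_sum_right)
  then show ?thesis by (rule linear_conv_bounded_linear[THEN iffD1])
qed

lemma matrix_component_bounded_linear: "bounded_linear (\<lambda>u. (M *v (u :: complex^'m)) $ i)"
  using bounded_linear_compose[OF bounded_linear_vec_nth matrix_vector_mult_bounded_linear] .

section \<open>Decoupling in a common eigenbasis\<close>

locale diagonalizable_pair =
  fixes A B P Pinv :: "complex^'m^'m" and av bv :: "'m \<Rightarrow> complex" and a0 amax b0 :: real
  assumes PP: "P ** Pinv = mat 1" "Pinv ** P = mat 1"
    and A_diag: "\<And>u i. (Pinv *v (A *v u)) $ i = av i * (Pinv *v u) $ i"
    and B_diag: "\<And>u i. (Pinv *v (B *v u)) $ i = bv i * (Pinv *v u) $ i"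
    and a0: "a0 > 0" "\<And>i. a0 \<le> Re (av i)" and amax: "\<And>i. cmod (av i) \<le> amax"
    and b0: "\<And>i. b0 \<le> Re (bv i)"
begin

text \<open>Since Re (1/(4a)) = Re a / (4 |a|^2), this is a Gaussian rate that serves all
  eigenvalues a at once.\<close>

definition \<alpha>0 where "\<alpha>0 = a0 / (4 * amax\<^sup>2)"

lemma av: "Re (av i) > 0" "av i \<noteq> 0" "cmod (av i) \<ge> a0"
  using a0(1) a0(2)[of i] complex_Re_le_cmod[of "av i"] by auto

lemma amax_pos: "amax > 0"
  using av(3)[of undefined] amax[of undefined] a0(1) by linarith

lemma \<alpha>0_pos: "\<alpha>0 > 0"
  using a0(1) amax_pos by (simp add: \<alpha>0_def)

lemma Re_z_ge: "\<alpha>0 \<le> Re (1 / (4 * av i))"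
proof -
  have "Re (1 / (4 * av i)) = Re (av i) / (4 * (cmod (av i))\<^sup>2)"
  proof -
    have "1 / (4 * av i) = (1 / 4) *\<^sub>R inverse (av i)"
      using av(2)[of i] by (simp add: scaleR_conv_of_real field_simps)
    then show ?thesis by (simp add: cmod_power2)
  qed
  moreover have "a0 / (4 * amax\<^sup>2) \<le> Re (av i) / (4 * (cmod (av i))\<^sup>2)"
    using a0 amax av[of i] less_imp_le[OF av(1)[of i]] by (intro frac_le mult_left_mono power_mono) auto
  ultimately show ?thesis by (simp add: \<alpha>0_def)
qed

lemma norm_z_le: "2 * cmod (1 / (4 * av i)) \<le> 1 / (2 * a0)"
proof -
  have "2 * cmod (1 / (4 * av i)) = 1 / (2 * cmod (av i))" by (simp add: norm_divide norm_mult)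
  also have "\<dots> \<le> 1 / (2 * a0)" using av(2,3)[of i] a0(1) by (intro divide_left_mono mult_pos_pos) auto
  finally show ?thesis .
qed

text \<open>The constant K is fixed before S, lam, the exponents and the functions, which is the
  uniformity claimed in the end. It collects the norms of the basis change and the inverse masses
  \<open>gint\<close> of the component kernels.\<close>

lemma vector_bounds:
  assumes \<epsilon>: "0 < \<epsilon>" "\<epsilon> < 1"
  obtains K where "K > 0"
    "\<And>(S::real^'d^'d) lam \<mu>1 v Dv D2v f p. transpose S = - S \<Longrightarrow> 0 < Re lam + b0 \<Longrightarrow>
       \<mu>1\<^sup>2 \<le> 4 * \<epsilon> * \<alpha>0 * (Re lam + b0) \<Longrightarrow> p \<ge> 1 \<Longrightarrow>
       W2p_loc_derivs p v Dv D2v \<Longrightarrow> Lp_weighted p (exp_weight \<mu>1) v \<Longrightarrow> Lp_weighted p (exp_weight \<mu>1) f \<Longrightarrow>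
       AE x in lborel. lam *s v x - A *v (\<Sum>i\<in>UNIV. D2v i i x) - (\<Sum>i\<in>UNIV. (S *v x)$i *\<^sub>R Dv i x) + B *v v x = f x \<Longrightarrow>
       (AE x in lborel. ennreal (norm (v x)) \<le> ennreal K * kop S (rker \<alpha>0 (Re lam + b0)) (\<lambda>\<xi>. ennreal (norm (f \<xi>))) x) \<and>
       (\<forall>i. AE x in lborel. ennreal (norm (Dv i x)) \<le>
          ennreal K * kop S (\<lambda>s y. norm y / s * rker \<alpha>0 (Re lam + b0) s y) (\<lambda>\<xi>. ennreal (norm (f \<xi>))) x)"
proof -
  define z where "z i = 1 / (4 * av i)" for i
  have Z: "gint TYPE('d) (z i) \<noteq> 0" for i
    using Re_z_ge[of i] \<alpha>0_pos by (intro gint_nonzero) (simp add: z_def)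
  obtain K1 where K1: "K1 > 0" "\<And>u. norm (Pinv *v u) \<le> K1 * norm u"
    using bounded_linear.pos_bounded[OF matrix_vector_mult_bounded_linear[of Pinv]] by (auto simp: mult.commute)
  obtain K2 where K2: "K2 > 0" "\<And>u. norm (P *v u) \<le> K2 * norm u"
    using bounded_linear.pos_bounded[OF matrix_vector_mult_bounded_linear[of P]] by (auto simp: mult.commute)
  define KK where "KK = (\<Sum>i\<in>UNIV. K2 * K1 / norm (gint TYPE('d) (z i)))"
  have KK0: "KK \<ge> 0" using K1 K2 by (auto simp: KK_def intro!: sum_nonneg)
  \<comment> \<open>The term 1 / (2 a0) bounds the factor 2 |z| of the gradient kernel, so that one
    constant serves both estimates.\<close>
  define K where "K = KK * (1 + 1 / (2 * a0)) + 1"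
  have K0: "K > 0" using KK0 a0(1) by (simp add: K_def add_nonneg_pos)
  have KK1: "KK \<le> K" "KK * (1 / (2 * a0)) \<le> K" using KK0 a0(1) by (simp_all add: K_def distrib_left)
  have recover: "norm u \<le> K2 * (\<Sum>i\<in>UNIV. norm ((Pinv *v u) $ i))" for u :: "complex^'m"
  proof -
    have "u = P *v (Pinv *v u)" using PP by (simp add: matrix_vector_mul_assoc)
    then have "norm u \<le> K2 * norm (Pinv *v u)" using K2(2)[of "Pinv *v u"] by simp
    also have "\<dots> \<le> K2 * (\<Sum>i\<in>UNIV. norm ((Pinv *v u) $ i))"
      unfolding norm_vec_def using K2(1) by (intro mult_left_mono L2_set_le_sum) auto
    finally show ?thesis .
  qed
  \<comment> \<open>The kernel integral X may be infinite at a point; the claim then holds because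
    KK is strictly positive.\<close>
  have combine: "ennreal (norm u) \<le> ennreal KK * X"
    if X: "\<And>i. ennreal (norm (gint TYPE('d) (z i)) * norm ((Pinv *v u) $ i)) \<le> ennreal K1 * X" for u :: "complex^'m" and X
  proof (cases "X = \<infinity>")
    case True
    have "KK > 0" unfolding KK_def using K1 K2 Z by (intro sum_pos) auto
    with True show ?thesis by (simp add: ennreal_mult_top)
  next
    case False
    then obtain r where r: "X = ennreal r" "r \<ge> 0" by (cases X) auto
    have "norm ((Pinv *v u) $ i) \<le> K1 / norm (gint TYPE('d) (z i)) * r" for i
    proof -
      have "ennreal (norm (gint TYPE('d) (z i)) * norm ((Pinv *v u) $ i)) \<le> ennreal (K1 * r)"
        using X[of i] K1(1) r by (simp add: ennreal_mult)
      then have "norm (gint TYPE('d) (z i)) * norm ((Pinv *v u) $ i) \<le> K1 * r"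
        using K1(1) r by (subst (asm) ennreal_le_iff) auto
      then show ?thesis using Z[of i] by (simp add: field_simps)
    qed
    then have "norm u \<le> K2 * (\<Sum>i\<in>UNIV. K1 / norm (gint TYPE('d) (z i)) * r)"
      using K2(1) by (intro order_trans[OF recover] mult_left_mono sum_mono) auto
    also have "\<dots> = KK * r" by (simp add: KK_def sum_distrib_left sum_distrib_right mult_ac)
    finally show ?thesis using r KK0 by (simp add: ennreal_mult[symmetric] ennreal_leI)
  qed
  show ?thesis
  proof (rule that[OF K0])
    fix S :: "real^'d^'d" and lam \<mu>1 v Dv D2v f p
    assume S: "transpose S = - S" and \<Lambda>: "0 < Re lam + b0" and \<mu>: "\<mu>1\<^sup>2 \<le> 4 * \<epsilon> * \<alpha>0 * (Re lam + b0)"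
      and p: "p \<ge> 1" and W: "W2p_loc_derivs p v Dv D2v" and vL: "Lp_weighted p (exp_weight \<mu>1) v"
      and fL: "Lp_weighted p (exp_weight \<mu>1) f"
      and eq: "AE x in lborel. lam *s v x - A *v (\<Sum>i\<in>UNIV. D2v i i x) - (\<Sum>i\<in>UNIV. (S *v x)$i *\<^sub>R Dv i x) + B *v v x = f x"
    define \<Lambda>' where "\<Lambda>' = Re lam + b0"
    \<comment> \<open>M^2 is built from the midpoint of \<epsilon> < \<theta>. Being above
      \<epsilon> gives the strict gap |\<mu>1| < M needed for integrability, being below \<theta>
      gives M^2 / (4 \<theta> \<alpha>0) < \<Lambda>'.\<close>
    define \<theta> where "\<theta> = sqrt \<epsilon>"
    define M where "M = sqrt (4 * ((\<epsilon> + \<theta>) / 2) * \<alpha>0 * \<Lambda>')"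
    have \<theta>: "0 < \<theta>" "\<theta> < 1" "\<epsilon> < \<theta>"
      using \<epsilon> mult_strict_left_mono[of \<theta> 1 \<theta>] by (auto simp: \<theta>_def)
    have M0: "M \<ge> 0" by (simp add: M_def \<theta>_def \<epsilon> \<alpha>0_pos less_imp_le \<Lambda> \<Lambda>'_def)
    have M2: "M\<^sup>2 = 4 * ((\<epsilon> + \<theta>) / 2) * \<alpha>0 * \<Lambda>'"
      unfolding M_def using \<epsilon> \<theta> \<alpha>0_pos \<Lambda> by (intro real_sqrt_pow2) (auto simp: \<Lambda>'_def intro!: mult_nonneg_nonneg)
    have Ml: "M\<^sup>2 / (4 * \<theta> * \<alpha>0) < \<Lambda>'"
    proof -
      have "M\<^sup>2 / (4 * \<theta> * \<alpha>0) = ((\<epsilon> + \<theta>) / 2 / \<theta>) * \<Lambda>'" unfolding M2 using \<theta> \<alpha>0_pos by (simp add: field_simps)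
      also have "\<dots> < 1 * \<Lambda>'" using \<theta> \<Lambda> by (intro mult_strict_right_mono) (auto simp: \<Lambda>'_def)
      finally show ?thesis by simp
    qed
    have M\<mu>: "\<bar>\<mu>1\<bar> < M"
    proof (rule power2_less_imp_less)
      have "\<bar>\<mu>1\<bar>\<^sup>2 \<le> \<epsilon> * (4 * \<alpha>0 * \<Lambda>')" using \<mu> by (simp add: \<Lambda>'_def mult_ac)
      also have "\<dots> < ((\<epsilon> + \<theta>) / 2) * (4 * \<alpha>0 * \<Lambda>')"
        using \<theta> \<alpha>0_pos \<Lambda> by (intro mult_strict_right_mono) (auto simp: \<Lambda>'_def)
      finally show "\<bar>\<mu>1\<bar>\<^sup>2 < M\<^sup>2" unfolding M2 by (simp add: mult_ac)
    qed (rule M0)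
    define l where "l i u = (Pinv *v u) $ i" for i and u :: "complex^'m"
    have lb: "bounded_linear (l i)" for i unfolding l_def[abs_def] by (rule matrix_component_bounded_linear)
    have ll: "linear (l i)" for i by (rule bounded_linear.linear[OF lb])
    have ls: "l i (k *s u) = k * l i u" for i k u
      by (simp add: l_def matrix_vector_mult_def sum_distrib_left mult_ac)
    have lA: "l i (A *v u) = av i * l i u" "l i (B *v u) = bv i * l i u" for i u
      by (simp_all add: l_def A_diag B_diag)
    have lm: "l i \<in> borel_measurable borel" for i
      by (intro borel_measurable_continuous_onI linear_continuous_on lb)
    have vm: "v \<in> borel_measurable borel" "f \<in> borel_measurable borel"
      using vL fL by (simp_all add: Lp_weighted_def)
    have heat: "heat_equation S (z i) (lam + bv i) \<alpha>0 \<Lambda>' \<theta> M (\<lambda>x. l i (v x)) (\<lambda>x. l i (f x))" for i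
    proof unfold_locales
      show "transpose S = - S" by (rule S)
      show "0 < \<alpha>0" by (rule \<alpha>0_pos)
      show "\<alpha>0 \<le> Re (z i)" using Re_z_ge by (simp add: z_def)
      show "0 < \<theta>" "\<theta> < 1" "0 < \<Lambda>'" "0 \<le> M" "M\<^sup>2 / (4 * \<theta> * \<alpha>0) < \<Lambda>'"
        using \<theta> \<Lambda> M0 Ml by (simp_all add: \<Lambda>'_def)
      show "\<Lambda>' \<le> Re (lam + bv i)" using b0[of i] by (simp add: \<Lambda>'_def)
      show lvm: "(\<lambda>x. l i (v x)) \<in> borel_measurable borel" "(\<lambda>x. l i (f x)) \<in> borel_measurable borel"
        using measurable_compose[OF vm(1) lm] measurable_compose[OF vm(2) lm] by simp_all
      show "integrable lborel (\<lambda>x. exp (- M * norm x) *\<^sub>R l i (v x))"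
        using integrable_bounded_linear[OF lb Lp_weighted_integrable_exp[OF vL p M\<mu>]] by (simp add: linear_cmul[OF ll])
      show "integrable lborel (\<lambda>x. exp (- M * norm x) *\<^sub>R l i (f x))"
        using integrable_bounded_linear[OF lb Lp_weighted_integrable_exp[OF fL p M\<mu>]] by (simp add: linear_cmul[OF ll])
      fix \<phi> :: "real^'d \<Rightarrow> complex"
      assume \<phi>: "ctest \<phi>"
      have a: "1 / (4 * z i) = av i" using av(2)[of i] by (simp add: z_def)
      show "(\<integral>x. \<phi> x * l i (f x) \<partial>lborel) =
        (\<integral>x. ((lam + bv i) * \<phi> x - 1 / (4 * z i) * (\<Sum>j\<in>UNIV. cpderiv j (cpderiv j \<phi>) x)
         + (\<Sum>j\<in>UNIV. (S *v x) $ j *\<^sub>R cpderiv j \<phi> x)) * l i (v x) \<partial>lborel)"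
        unfolding a
      proof (rule weak_equation[OF S _ _ _ lvm(2) \<phi>])
        show "weak_deriv j (\<lambda>x. l i (v x)) (\<lambda>x. l i (Dv j x))" for j
          using W by (intro weak_pderiv_component lb) (simp add: W2p_loc_derivs_def)
        show "weak_deriv j (\<lambda>x. l i (Dv j x)) (\<lambda>x. l i (D2v j j x))" for j
          using W by (intro weak_pderiv_component lb) (simp add: W2p_loc_derivs_def)
        show "AE x in lborel. l i (f x) = (lam + bv i) * l i (v x) - av i * (\<Sum>j\<in>UNIV. l i (D2v j j x)) - (\<Sum>j\<in>UNIV. (S *v x) $ j *\<^sub>R l i (Dv j x))"
          using eq
        proof eventually_elim
          case (elim x)
          have "l i (f x) = l i (lam *s v x - A *v (\<Sum>j\<in>UNIV. D2v j j x) - (\<Sum>j\<in>UNIV. (S *v x)$j *\<^sub>R Dv j x) + B *v v x)"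
            using elim by simp
          also have "\<dots> = lam * l i (v x) - av i * (\<Sum>j\<in>UNIV. l i (D2v j j x)) - (\<Sum>j\<in>UNIV. (S *v x) $ j *\<^sub>R l i (Dv j x)) + bv i * l i (v x)"
            by (simp only: linear_add[OF ll] linear_diff[OF ll] linear_sum[OF ll] linear_cmul[OF ll] ls lA)
          finally show ?case by (simp add: algebra_simps)
        qed
      qed
    qed
    have kf: "kop S k (\<lambda>\<xi>. ennreal (norm (l i (f \<xi>)))) x \<le> ennreal K1 * kop S k (\<lambda>\<xi>. ennreal (norm (f \<xi>))) x"
      if "(\<lambda>z. k (fst z) (snd z)) \<in> borel_measurable (borel :: (real \<times> (real^'d)) measure)" for k i x
    proof -
      interpret skew_matrix S by unfold_locales (rule S)
      note [measurable] = vm(2)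
      have [measurable]: "(\<lambda>z. k (fst z) (rot S (fst z) *v x - snd z)) \<in> borel_measurable borel"
        by (rule kernel_measurable[OF that]) simp_all
      have "kop S k (\<lambda>\<xi>. ennreal (norm (l i (f \<xi>)))) x \<le> kop S k (\<lambda>\<xi>. ennreal K1 * ennreal (norm (f \<xi>))) x"
      proof (intro kop_mono)
        fix \<xi>
        have "norm (l i (f \<xi>)) \<le> norm (Pinv *v f \<xi>)" unfolding l_def by (rule Finite_Cartesian_Product.norm_nth_le)
        also have "\<dots> \<le> K1 * norm (f \<xi>)" by (rule K1(2))
        finally show "ennreal (norm (l i (f \<xi>))) \<le> ennreal K1 * ennreal (norm (f \<xi>))"
          using K1(1) by (simp add: ennreal_mult[symmetric] ennreal_leI)
      qed simp
      also have "\<dots> = ennreal K1 * kop S k (\<lambda>\<xi>. ennreal (norm (f \<xi>))) x"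
        unfolding kop_def by (subst nn_integral_cmult[symmetric]) (simp_all add: mult_ac)
      finally show ?thesis .
    qed
    have grad_borel: "(\<lambda>z. norm (snd z) / fst z * rker \<alpha>0 \<Lambda>' (fst z) (snd z)) \<in> borel_measurable (borel :: (real \<times> (real^'d)) measure)"
      using rker_borel by measurable
    have "AE x in lborel. ennreal (norm (v x)) \<le> ennreal K * kop S (rker \<alpha>0 \<Lambda>') (\<lambda>\<xi>. ennreal (norm (f \<xi>))) x"
    proof -
      have "AE x in lborel. \<forall>i. ennreal (norm (gint TYPE('d) (z i)) * norm (l i (v x))) \<le> kop S (rker \<alpha>0 \<Lambda>') (\<lambda>\<xi>. ennreal (norm (l i (f \<xi>)))) x"
        using heat_equation.pointwise_bound[OF heat] by (subst AE_all_countable) blast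
      then show ?thesis
      proof eventually_elim
        case (elim x)
        have "ennreal (norm (v x)) \<le> ennreal KK * kop S (rker \<alpha>0 \<Lambda>') (\<lambda>\<xi>. ennreal (norm (f \<xi>))) x"
        proof (intro combine)
          fix i
          show "ennreal (norm (gint TYPE('d) (z i)) * norm ((Pinv *v v x) $ i)) \<le> ennreal K1 * kop S (rker \<alpha>0 \<Lambda>') (\<lambda>\<xi>. ennreal (norm (f \<xi>))) x"
            using order_trans[OF spec[OF elim, of i] kf[OF rker_borel]] by (simp add: l_def)
        qed
        also have "\<dots> \<le> ennreal K * kop S (rker \<alpha>0 \<Lambda>') (\<lambda>\<xi>. ennreal (norm (f \<xi>))) x"
          by (intro mult_right_mono ennreal_leI KK1) auto
        finally show ?case .
      qed
    qed
    moreover have "AE x in lborel. ennreal (norm (Dv j x)) \<le> ennreal K * kop S (\<lambda>s y. norm y / s * rker \<alpha>0 \<Lambda>' s y) (\<lambda>\<xi>. ennreal (norm (f \<xi>))) x" for j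
    proof -
      have wd: "weak_deriv j (\<lambda>x. l i (v x)) (\<lambda>x. l i (Dv j x))" for i
        using W by (intro weak_pderiv_component lb) (simp add: W2p_loc_derivs_def)
      have "AE x in lborel. \<forall>i. ennreal (norm (gint TYPE('d) (z i)) * norm (l i (Dv j x))) \<le>
        kop S (\<lambda>s y. 2 * norm (z i) * (norm y / s * rker \<alpha>0 \<Lambda>' s y)) (\<lambda>\<xi>. ennreal (norm (l i (f \<xi>)))) x"
        using heat_equation.pointwise_gradient_bound[OF heat wd] by (subst AE_all_countable) blast
      then show ?thesis
      proof eventually_elim
        case (elim x)
        let ?k = "\<lambda>s y. norm y / s * rker \<alpha>0 \<Lambda>' s (y :: real^'d)"
        have "ennreal (norm (Dv j x)) \<le> ennreal KK * (ennreal (1 / (2 * a0)) * kop S ?k (\<lambda>\<xi>. ennreal (norm (f \<xi>))) x)"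
        proof (intro combine)
          fix i
          have [measurable]: "(\<lambda>\<xi>. l i (f \<xi>)) \<in> borel_measurable borel"
            using measurable_compose[OF vm(2) lm] by simp
          have "ennreal (norm (gint TYPE('d) (z i)) * norm ((Pinv *v Dv j x) $ i)) \<le> kop S (\<lambda>s y. 2 * norm (z i) * ?k s y) (\<lambda>\<xi>. ennreal (norm (l i (f \<xi>)))) x"
            using elim by (simp add: l_def)
          also have "\<dots> = ennreal (2 * norm (z i)) * kop S ?k (\<lambda>\<xi>. ennreal (norm (l i (f \<xi>)))) x"
            by (rule kop_cmult[OF _ grad_borel]) simp_all
          also have "\<dots> \<le> ennreal (1 / (2 * a0)) * (ennreal K1 * kop S ?k (\<lambda>\<xi>. ennreal (norm (f \<xi>))) x)"
            using norm_z_le by (intro mult_mono kf[OF grad_borel] ennreal_leI) (auto simp: z_def)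
          finally show "ennreal (norm (gint TYPE('d) (z i)) * norm ((Pinv *v Dv j x) $ i)) \<le> ennreal K1 * (ennreal (1 / (2 * a0)) * kop S ?k (\<lambda>\<xi>. ennreal (norm (f \<xi>))) x)"
            by (simp add: mult_ac)
        qed
        also have "\<dots> = ennreal (KK * (1 / (2 * a0))) * kop S ?k (\<lambda>\<xi>. ennreal (norm (f \<xi>))) x"
          using KK0 a0(1) by (simp only: mult.assoc[symmetric]) (subst ennreal_mult, auto)
        also have "\<dots> \<le> ennreal K * kop S ?k (\<lambda>\<xi>. ennreal (norm (f \<xi>))) x"
          by (intro mult_right_mono ennreal_leI KK1) auto
        finally show ?case .
      qed
    qed
    ultimately show "(AE x in lborel. ennreal (norm (v x)) \<le> ennreal K * kop S (rker \<alpha>0 (Re lam + b0)) (\<lambda>\<xi>. ennreal (norm (f \<xi>))) x) \<and>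
       (\<forall>i. AE x in lborel. ennreal (norm (Dv i x)) \<le>
          ennreal K * kop S (\<lambda>s y. norm y / s * rker \<alpha>0 (Re lam + b0) s y) (\<lambda>\<xi>. ennreal (norm (f \<xi>))) x)"
      by (simp add: \<Lambda>'_def)
  qed
qed

end

section \<open>Weighted norms and absorption of the potential\<close>

lemma powr_sum3_le:
  fixes a b c p :: real
  assumes "a \<ge> 0" "b \<ge> 0" "c \<ge> 0" "p \<ge> 0"
  shows "(a + b + c) powr p \<le> 3 powr p * (a powr p + b powr p + c powr p)"
proof -
  define m where "m = max a (max b c)"
  have m: "a \<le> m" "b \<le> m" "c \<le> m" "m = a \<or> m = b \<or> m = c" by (auto simp: m_def max_def)
  have "(a + b + c) powr p \<le> (3 * m) powr p"
    using assms m by (intro powr_mono2) auto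
  also have "\<dots> = 3 powr p * m powr p" using assms m by (intro powr_mult)
  also have "m powr p \<le> a powr p + b powr p + c powr p"
    using m(4) by auto
  finally show ?thesis by simp
qed

context skew_matrix
begin

text \<open>The weight depends on |x| only and its exponent is \<mu>-Lipschitz, so the rotation
  drops out and moving the weight from x to \<xi> costs exp(\<mu> |y|). Assumption
  \<open>dom\<close> absorbs this factor into the kernel k', and Schur's test applies to the
  weighted functions.\<close>

lemma weighted_Schur:
  fixes p \<mu> c K mm :: real and \<tau> :: "real \<Rightarrow> real" and u h :: "real^'d \<Rightarrow> real"
  assumes k: "(\<lambda>z. k (fst z) (snd z)) \<in> borel_measurable (borel :: (real \<times> (real^'d)) measure)"
    and k': "(\<lambda>z. k' (fst z) (snd z)) \<in> borel_measurable (borel :: (real \<times> (real^'d)) measure)"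
    and radial: "\<And>s y y'. norm y = norm y' \<Longrightarrow> k' s y = k' s y'"
    and kpos: "\<And>s y. s > 0 \<Longrightarrow> 0 \<le> k s y"
    and dom: "\<And>s y. s > 0 \<Longrightarrow> exp (\<mu> * norm y) * k s y \<le> c * k' s y"
    and mass: "(\<integral>\<^sup>+s. indicator {0<..} s * (\<integral>\<^sup>+y. ennreal (k' s y) \<partial>lborel) \<partial>lborel) \<le> ennreal mm"
    and pos: "mm > 0" "p \<ge> 1" "c \<ge> 0" "K \<ge> 0" "\<mu> \<ge> 0"
    and \<tau>[measurable]: "\<tau> \<in> borel_measurable borel" and lip: "\<And>r r'. \<bar>\<tau> r - \<tau> r'\<bar> \<le> \<mu> * \<bar>r - r'\<bar>"
    and h[measurable]: "h \<in> borel_measurable borel" and h0: "\<And>x. h x \<ge> 0" and u0: "\<And>x. u x \<ge> 0"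
    and u: "AE x in lborel. ennreal (u x) \<le> ennreal K * kop S k (\<lambda>\<xi>. ennreal (h \<xi>)) x"
  shows "(\<integral>\<^sup>+x. ennreal ((exp (\<tau> (norm x)) * u x) powr p) \<partial>lborel) \<le>
    ennreal ((K * c * mm) powr p) * (\<integral>\<^sup>+x. ennreal ((exp (\<tau> (norm x)) * h x) powr p) \<partial>lborel)"
proof -
  let ?T = "\<lambda>x. exp (\<tau> (norm x))"
  have T: "?T x \<le> exp (\<mu> * norm (rot S s *v x - \<xi>)) * ?T \<xi>" for x \<xi> s
  proof -
    have "\<tau> (norm x) - \<tau> (norm \<xi>) \<le> \<mu> * \<bar>norm x - norm \<xi>\<bar>" using lip[of "norm x" "norm \<xi>"] by linarith
    also have "\<dots> \<le> \<mu> * norm (rot S s *v x - \<xi>)"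
      using pos norm_triangle_ineq3[of "rot S s *v x" \<xi>] by (intro mult_left_mono) auto
    finally show ?thesis by (simp add: exp_add[symmetric])
  qed
  have ae: "AE x in lborel. ennreal (?T x * u x) \<le> kop S k' (\<lambda>\<xi>. ennreal (K * c * (?T \<xi> * h \<xi>))) x"
    using u
  proof eventually_elim
    case (elim x)
    have [measurable]: "(\<lambda>z. k (fst z) (rot S (fst z) *v x - snd z)) \<in> borel_measurable borel"
      by (rule kernel_measurable[OF k]) simp_all
    have "ennreal (?T x * u x) = ennreal (?T x) * ennreal (u x)" by (intro ennreal_mult) (auto simp: u0)
    also have "\<dots> \<le> ennreal (?T x) * (ennreal K * kop S k (\<lambda>\<xi>. ennreal (h \<xi>)) x)"
      by (intro mult_left_mono elim) auto
    also have "\<dots> = ennreal (?T x * K) * kop S k (\<lambda>\<xi>. ennreal (h \<xi>)) x"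
      using pos by (simp add: ennreal_mult mult.assoc)
    also have "\<dots> = (\<integral>\<^sup>+z. ennreal (?T x * K) * (indicator {0<..} (fst z) * ennreal (k (fst z) (rot S (fst z) *v x - snd z)) * ennreal (h (snd z))) \<partial>lborel)"
      unfolding kop_def by (rule nn_integral_cmult[symmetric]) measurable
    also have "\<dots> \<le> kop S k' (\<lambda>\<xi>. ennreal (K * c * (?T \<xi> * h \<xi>))) x"
      unfolding kop_def
    proof (rule nn_integral_mono)
      fix z :: "real \<times> (real^'d)"
      let ?y = "rot S (fst z) *v x - snd z"
      show "ennreal (?T x * K) * (indicator {0<..} (fst z) * ennreal (k (fst z) ?y) * ennreal (h (snd z))) \<le>
        indicator {0<..} (fst z) * ennreal (k' (fst z) ?y) * ennreal (K * c * (?T (snd z) * h (snd z)))"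
      proof (cases "fst z > 0")
        case True
        have "?T x * k (fst z) ?y \<le> (exp (\<mu> * norm ?y) * ?T (snd z)) * k (fst z) ?y"
          by (intro mult_right_mono T kpos True)
        also have "\<dots> = (exp (\<mu> * norm ?y) * k (fst z) ?y) * ?T (snd z)" by (simp only: mult_ac)
        also have "\<dots> \<le> (c * k' (fst z) ?y) * ?T (snd z)" by (intro mult_right_mono dom True) auto
        finally have "(?T x * k (fst z) ?y) * (K * h (snd z)) \<le> ((c * k' (fst z) ?y) * ?T (snd z)) * (K * h (snd z))"
          using pos h0 by (intro mult_right_mono mult_nonneg_nonneg) auto
        then have le: "(?T x * K) * (k (fst z) ?y * h (snd z)) \<le> k' (fst z) ?y * (K * c * (?T (snd z) * h (snd z)))"
          by (simp only: mult_ac)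
        have "ennreal (?T x * K) * (ennreal (k (fst z) ?y) * ennreal (h (snd z))) = ennreal ((?T x * K) * (k (fst z) ?y * h (snd z)))"
          using pos h0 kpos[OF True] by (simp add: ennreal_mult mult_nonneg_nonneg)
        also have "\<dots> \<le> ennreal (k' (fst z) ?y * (K * c * (?T (snd z) * h (snd z))))" by (rule ennreal_leI[OF le])
        also have "\<dots> = ennreal (k' (fst z) ?y) * ennreal (K * c * (?T (snd z) * h (snd z)))"
          using pos h0 by (intro ennreal_mult'') auto
        finally show ?thesis using True by simp
      qed simp
    qed
    finally show ?case .
  qed
  have "(\<integral>\<^sup>+x. ennreal ((?T x * u x) powr p) \<partial>lborel) \<le> ennreal (mm powr p) * (\<integral>\<^sup>+x. ennreal ((K * c * (?T x * h x)) powr p) \<partial>lborel)"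
  proof (rule Schur_test[OF k' radial mass pos(1,2)])
    show "(\<lambda>x. K * c * (?T x * h x)) \<in> borel_measurable borel" by measurable
    show "0 \<le> K * c * (?T x * h x)" for x using pos h0 by simp
    show "0 \<le> ?T x * u x" for x using u0 by simp
    show "AE x in lborel. ennreal (?T x * u x) \<le> kop S k' (\<lambda>x. ennreal (K * c * (?T x * h x))) x" by (rule ae)
  qed
  also have "(\<lambda>x. ennreal ((K * c * (?T x * h x)) powr p)) = (\<lambda>x. ennreal ((K * c) powr p) * ennreal ((?T x * h x) powr p))"
  proof
    fix x
    have "(K * c * (?T x * h x)) powr p = (K * c) powr p * (?T x * h x) powr p"
      by (rule powr_mult)
    then show "ennreal ((K * c * (?T x * h x)) powr p) = ennreal ((K * c) powr p) * ennreal ((?T x * h x) powr p)"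
      by (simp add: ennreal_mult)
  qed
  also have "(\<integral>\<^sup>+x. ennreal ((K * c) powr p) * ennreal ((?T x * h x) powr p) \<partial>lborel) =
    ennreal ((K * c) powr p) * (\<integral>\<^sup>+x. ennreal ((?T x * h x) powr p) \<partial>lborel)"
    by (rule nn_integral_cmult) measurable
  also have "ennreal (mm powr p) * (ennreal ((K * c) powr p) * (\<integral>\<^sup>+x. ennreal ((?T x * h x) powr p) \<partial>lborel))
     = ennreal ((K * c * mm) powr p) * (\<integral>\<^sup>+x. ennreal ((?T x * h x) powr p) \<partial>lborel)"
  proof -
    have "(K * c * mm) powr p = (K * c) powr p * mm powr p" by (rule powr_mult)
    then show ?thesis by (simp add: ennreal_mult mult_ac)
  qed
  finally show ?thesis .
qed

end

lemma grad_rker_borel: "(\<lambda>z. norm (snd z) / fst z * rker \<alpha> \<Lambda> (fst z) (snd z)) \<in> borel_measurable (borel :: (real \<times> (real^'d)) measure)"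
  using rker_borel by measurable

text \<open>The exponential weight costs a fraction \<open>\<theta>\<close> of both the Gaussian decay in space and the
  exponential decay in time.\<close>

lemma weighted_estimates:
  fixes S :: "real^'d^'d" and u h :: "real^'d \<Rightarrow> real" and \<tau> :: "real \<Rightarrow> real"
  assumes S: "transpose S = - S" and \<alpha>: "\<alpha> > 0" and \<Lambda>: "\<Lambda> > 0" and \<theta>: "0 < \<theta>" "\<theta> < 1"
    and \<mu>: "\<mu> \<ge> 0" "\<mu>\<^sup>2 \<le> 4 * \<theta>\<^sup>2 * \<alpha> * \<Lambda>" and p: "p \<ge> 1" and K: "K \<ge> 0"
    and \<tau>: "\<tau> \<in> borel_measurable borel" and lip: "\<And>r r'. \<bar>\<tau> r - \<tau> r'\<bar> \<le> \<mu> * \<bar>r - r'\<bar>"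
    and h: "h \<in> borel_measurable borel" and h0: "\<And>x. h x \<ge> 0" and u0: "\<And>x. u x \<ge> 0"
  shows "AE x in lborel. ennreal (u x) \<le> ennreal K * kop S (rker \<alpha> \<Lambda>) (\<lambda>\<xi>. ennreal (h \<xi>)) x \<Longrightarrow>
    (\<integral>\<^sup>+x. ennreal ((exp (\<tau> (norm x)) * u x) powr p) \<partial>lborel) \<le>
    ennreal ((K * ((gmass TYPE('d) ((1 - \<theta>) * \<alpha>) + 1) / (1 - \<theta>)) / \<Lambda>) powr p) * (\<integral>\<^sup>+x. ennreal ((exp (\<tau> (norm x)) * h x) powr p) \<partial>lborel)"
    and "AE x in lborel. ennreal (u x) \<le> ennreal K * kop S (\<lambda>s y. norm y / s * rker \<alpha> \<Lambda> s y) (\<lambda>\<xi>. ennreal (h \<xi>)) x \<Longrightarrow>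
    (\<integral>\<^sup>+x. ennreal ((exp (\<tau> (norm x)) * u x) powr p) \<partial>lborel) \<le>
    ennreal ((K * (1 / sqrt ((1 - \<theta>) * \<alpha>)) * (3 * (gmass TYPE('d) ((1 - \<theta>) * \<alpha> / 2) + 1) / sqrt (1 - \<theta>)) / sqrt \<Lambda>) powr p)
      * (\<integral>\<^sup>+x. ennreal ((exp (\<tau> (norm x)) * h x) powr p) \<partial>lborel)"
proof -
  interpret skew_matrix S by unfold_locales (rule S)
  define \<kappa> where "\<kappa> = (1 - \<theta>) * \<alpha>"
  define \<rho> where "\<rho> = (1 - \<theta>) * \<Lambda>"
  have \<kappa>: "\<kappa> > 0" and \<rho>: "\<rho> > 0" using \<alpha> \<Lambda> \<theta> by (simp_all add: \<kappa>_def \<rho>_def)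
  note g0 = gmass_nonneg[of "TYPE('d)" \<kappa>] gmass_nonneg[of "TYPE('d)" "\<kappa> / 2"]
  have decay: "exp (\<mu> * norm y) * rker \<alpha> \<Lambda> s y \<le> rker \<kappa> \<rho> s y" if "s > 0" for s and y :: "real^'d"
  proof -
    \<comment> \<open>The square of \<theta> in the bound on \<mu> makes the loss in the time decay
      at most the fraction \<theta> of \<Lambda>.\<close>
    have "\<mu>\<^sup>2 / (4 * \<theta> * \<alpha>) \<le> (4 * \<theta>\<^sup>2 * \<alpha> * \<Lambda>) / (4 * \<theta> * \<alpha>)"
      using \<mu> \<theta> \<alpha> by (intro divide_right_mono) auto
    also have "\<dots> = \<theta> * \<Lambda>" using \<theta> \<alpha> by (simp add: power2_eq_square)
    finally have "\<rho> \<le> \<Lambda> - \<mu>\<^sup>2 / (4 * \<theta> * \<alpha>)" by (simp add: \<rho>_def algebra_simps)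
    then have "rker ((1 - \<theta>) * \<alpha>) (\<Lambda> - \<mu>\<^sup>2 / (4 * \<theta> * \<alpha>)) s y \<le> rker \<kappa> \<rho> s y"
      using that by (intro rker_mono) (auto simp: \<kappa>_def)
    then show ?thesis using exp_rker_le[OF \<theta>(1) \<alpha> that, of \<mu> y \<Lambda>] by linarith
  qed
  {
    assume u: "AE x in lborel. ennreal (u x) \<le> ennreal K * kop S (rker \<alpha> \<Lambda>) (\<lambda>\<xi>. ennreal (h \<xi>)) x"
    have mm: "(gmass TYPE('d) \<kappa> + 1) / \<rho> > 0" using g0 \<rho> by simp
    have "(\<integral>\<^sup>+s. indicator {0<..} s * (\<integral>\<^sup>+y. ennreal (rker \<kappa> \<rho> s (y :: real^'d)) \<partial>lborel) \<partial>lborel)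
      \<le> ennreal ((gmass TYPE('d) \<kappa> + 1) / \<rho>)"
      using \<rho> by (intro order_trans[OF rker_mass[OF \<kappa> \<rho>]] ennreal_leI divide_right_mono) auto
    from weighted_Schur[OF rker_borel rker_borel rker_radial _ _ this mm p _ K \<mu>(1) \<tau> lip h h0 u0 u, of 1]
    show "(\<integral>\<^sup>+x. ennreal ((exp (\<tau> (norm x)) * u x) powr p) \<partial>lborel) \<le>
      ennreal ((K * ((gmass TYPE('d) ((1 - \<theta>) * \<alpha>) + 1) / (1 - \<theta>)) / \<Lambda>) powr p) * (\<integral>\<^sup>+x. ennreal ((exp (\<tau> (norm x)) * h x) powr p) \<partial>lborel)"
      using decay by (simp add: \<rho>_def \<kappa>_def less_imp_le[OF rker_pos])
  }
  {
    assume u: "AE x in lborel. ennreal (u x) \<le> ennreal K * kop S (\<lambda>s y. norm y / s * rker \<alpha> \<Lambda> s y) (\<lambda>\<xi>. ennreal (h \<xi>)) x"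
    have mm: "3 * (gmass TYPE('d) (\<kappa> / 2) + 1) / sqrt \<rho> > 0" using g0 \<rho> by simp
    have "(\<integral>\<^sup>+s. indicator {0<..} s * (\<integral>\<^sup>+y. ennreal (s powr (- 1 / 2) * rker (\<kappa> / 2) \<rho> s (y :: real^'d)) \<partial>lborel) \<partial>lborel)
      \<le> ennreal (3 * (gmass TYPE('d) (\<kappa> / 2) + 1) / sqrt \<rho>)"
      using \<rho> \<kappa> by (intro order_trans[OF sqrt_rker_mass[OF _ \<rho>]] ennreal_leI divide_right_mono) auto
    note W = weighted_Schur[where k = "\<lambda>s y. norm y / s * rker \<alpha> \<Lambda> s y" and k' = "\<lambda>s y. s powr (- 1 / 2) * rker (\<kappa> / 2) \<rho> s y",
        OF grad_rker_borel sqrt_rker_borel _ _ _ this mm p _ K \<mu>(1) \<tau> lip h h0 u0 u, of "1 / sqrt \<kappa>"]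
    have "(\<integral>\<^sup>+x. ennreal ((exp (\<tau> (norm x)) * u x) powr p) \<partial>lborel) \<le>
      ennreal ((K * (1 / sqrt \<kappa>) * (3 * (gmass TYPE('d) (\<kappa> / 2) + 1) / sqrt \<rho>)) powr p) * (\<integral>\<^sup>+x. ennreal ((exp (\<tau> (norm x)) * h x) powr p) \<partial>lborel)"
    proof (rule W)
      show "s powr (- 1 / 2) * rker (\<kappa> / 2) \<rho> s y = s powr (- 1 / 2) * rker (\<kappa> / 2) \<rho> s y'" if "norm y = norm y'" for s and y y' :: "real^'d"
        using that by (simp add: rker_def)
      show "0 \<le> norm y / s * rker \<alpha> \<Lambda> s y" if "s > 0" for s and y :: "real^'d"
        using that rker_pos[of \<alpha> \<Lambda> s y] by simp
      show "exp (\<mu> * norm y) * (norm y / s * rker \<alpha> \<Lambda> s y) \<le> 1 / sqrt \<kappa> * (s powr (- 1 / 2) * rker (\<kappa> / 2) \<rho> s y)"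
        if "s > 0" for s and y :: "real^'d"
      proof -
        have "norm y / s * (exp (\<mu> * norm y) * rker \<alpha> \<Lambda> s y) \<le> norm y / s * rker \<kappa> \<rho> s y"
          using that by (intro mult_left_mono decay) auto
        also have "\<dots> \<le> 1 / sqrt \<kappa> * (s powr (- 1 / 2) * rker (\<kappa> / 2) \<rho> s y)"
          by (rule norm_div_rker_le[OF \<kappa> that])
        finally show ?thesis by (simp add: mult.left_commute)
      qed
      show "0 \<le> 1 / sqrt \<kappa>" using \<kappa> by simp
    qed
    then show "(\<integral>\<^sup>+x. ennreal ((exp (\<tau> (norm x)) * u x) powr p) \<partial>lborel) \<le>
    ennreal ((K * (1 / sqrt ((1 - \<theta>) * \<alpha>)) * (3 * (gmass TYPE('d) ((1 - \<theta>) * \<alpha> / 2) + 1) / sqrt (1 - \<theta>)) / sqrt \<Lambda>) powr p)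
      * (\<integral>\<^sup>+x. ennreal ((exp (\<tau> (norm x)) * h x) powr p) \<partial>lborel)"
      by (simp add: \<rho>_def \<kappa>_def real_sqrt_mult mult.assoc)
  }
qed

text \<open>The root is the modulus of the complex number r + i, so this is the reverse triangle
  inequality.\<close>

lemma sqrt_sq_plus_one_lipschitz: "\<bar>sqrt (r\<^sup>2 + 1) - sqrt (s\<^sup>2 + 1)\<bar> \<le> \<bar>r - s\<bar>"
proof -
  have "\<bar>cmod (Complex r 1) - cmod (Complex s 1)\<bar> \<le> cmod (Complex r 1 - Complex s 1)"
    by (rule norm_triangle_ineq3)
  then show ?thesis by (simp add: cmod_def)
qed

lemma min_lipschitz:
  fixes a b a' b' D :: real
  assumes "\<bar>a - a'\<bar> \<le> D" "\<bar>b - b'\<bar> \<le> D"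
  shows "\<bar>min a b - min a' b'\<bar> \<le> D"
  using assms by (simp add: min_def abs_le_iff)

lemma specnorm_bound: "norm (M *v u) \<le> specnorm M * norm (u :: complex^'m)"
  unfolding specnorm_def by (rule onorm[OF matrix_vector_mult_bounded_linear])

lemma specnorm_nonneg: "0 \<le> specnorm M"
  unfolding specnorm_def by (rule onorm_pos_le[OF matrix_vector_mult_bounded_linear])

lemma specnorm_le_sum: "specnorm M \<le> (\<Sum>i\<in>UNIV. \<Sum>j\<in>UNIV. norm (M $ i $ j))"
  unfolding specnorm_def
proof (rule onorm_le)
  fix u :: "complex^'a"
  have "norm (M *v u) \<le> (\<Sum>i\<in>UNIV. norm ((M *v u) $ i))"
    unfolding norm_vec_def[of "M *v u"] by (rule L2_set_le_sum) simp
  also have "\<dots> \<le> (\<Sum>i\<in>UNIV. \<Sum>j\<in>UNIV. norm (M $ i $ j) * norm u)"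
  proof (intro sum_mono)
    fix i
    have "norm ((M *v u) $ i) \<le> (\<Sum>j\<in>UNIV. norm (M $ i $ j * u $ j))"
      unfolding matrix_vector_mult_def by (simp add: norm_sum)
    also have "\<dots> \<le> (\<Sum>j\<in>UNIV. norm (M $ i $ j) * norm u)"
      unfolding norm_mult by (intro sum_mono mult_left_mono Finite_Cartesian_Product.norm_nth_le) auto
    finally show "norm ((M *v u) $ i) \<le> (\<Sum>j\<in>UNIV. norm (M $ i $ j) * norm u)" .
  qed
  also have "\<dots> = (\<Sum>i\<in>UNIV. \<Sum>j\<in>UNIV. norm (M $ i $ j)) * norm u"
    by (simp add: sum_distrib_right)
  finally show "norm (M *v u) \<le> (\<Sum>i\<in>UNIV. \<Sum>j\<in>UNIV. norm (M $ i $ j)) * norm u" .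
qed

text \<open>A real supremum is meaningful only for a bounded range: continuity bounds Q on the ball,
  the smallness assumption bounds it outside.\<close>

lemma specnorm_le_Linf:
  fixes Q :: "real^'d \<Rightarrow> complex^'m^'m"
  assumes Q: "continuous_on UNIV Q" and b: "\<And>x. norm x \<ge> R0 \<Longrightarrow> specnorm (Q x) \<le> \<eta>"
  shows "specnorm (Q x) \<le> Linf_mat_norm Q"
proof -
  let ?n = "\<lambda>x. \<Sum>i\<in>UNIV. \<Sum>j\<in>UNIV. norm (Q x $ i $ j)"
  have "continuous_on (cball 0 R0) ?n"
    by (intro continuous_intros continuous_on_component continuous_on_subset[OF Q]) auto
  then have "bounded (?n ` cball 0 R0)" by (intro compact_imp_bounded compact_continuous_image) auto
  then obtain N where N: "\<And>x. norm x \<le> R0 \<Longrightarrow> \<bar>?n x\<bar> \<le> N" by (force simp: bounded_iff)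
  have "specnorm (Q x) \<le> max N \<eta>" for x
  proof (cases "norm x \<le> R0")
    case True
    have "specnorm (Q x) \<le> ?n x" by (rule specnorm_le_sum)
    also have "\<dots> \<le> N" using N[OF True] by linarith
    finally show ?thesis by simp
  qed (use b[of x] in simp)
  then have "bdd_above (range (\<lambda>x. specnorm (Q x)))" by (auto intro!: bdd_aboveI)
  then show ?thesis unfolding Linf_mat_norm_def by (rule cSUP_upper2) auto
qed

lemma matrix_vector_measurable:
  fixes Q :: "real^'d \<Rightarrow> complex^'m^'m"
  assumes "continuous_on UNIV Q" "v \<in> borel_measurable borel"
  shows "(\<lambda>x. Q x *v v x) \<in> borel_measurable borel"
proof -
  have "continuous_on UNIV (\<lambda>z. fst z *v snd (z :: (complex^'m^'m) \<times> (complex^'m)))"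
    unfolding matrix_vector_mult_def
    by (intro continuous_on_vec_lambda continuous_on_sum continuous_on_mult continuous_on_component continuous_on_fst continuous_on_snd continuous_on_id)
  from borel_measurable_continuous_on[OF this borel_measurable_Pair[OF borel_measurable_continuous_onI[OF assms(1)] assms(2)]]
  show ?thesis by simp
qed

text \<open>The p-th power of a weighted norm, as an extended real and for an arbitrary weight, so
  that truncated weights and norms not yet known to be finite are treated alike.\<close>

definition wint :: "real \<Rightarrow> (real^'d \<Rightarrow> real) \<Rightarrow> (real^'d \<Rightarrow> complex^'m) \<Rightarrow> ennreal" where
  "wint p T u = (\<integral>\<^sup>+x. ennreal ((T x * norm (u x)) powr p) \<partial>lborel)"

lemma Lp_weighted_iff_wint:
  "Lp_weighted p (exp_weight \<mu>) u \<longleftrightarrow> u \<in> borel_measurable borel \<and> wint p (exp_weight \<mu>) u < \<infinity>"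
  by (simp add: Lp_weighted_def wint_def abs_of_pos[OF exp_weight_pos])

lemma Lp_wnorm_wint: "Lp_wnorm p (exp_weight \<mu>) u = (enn2real (wint p (exp_weight \<mu>) u)) powr (1 / p)"
  by (simp add: Lp_wnorm_def wint_def abs_of_pos[OF exp_weight_pos])

lemma wint_mono:
  assumes "\<And>x. 0 \<le> T x" "\<And>x. T x \<le> c * T' x" "c \<ge> 0" "p \<ge> 0" "\<And>x. 0 \<le> T' x"
    and [measurable]: "T' \<in> borel_measurable borel" "u \<in> borel_measurable borel"
  shows "wint p T u \<le> ennreal (c powr p) * wint p T' u"
proof -
  have "wint p T u \<le> (\<integral>\<^sup>+x. ennreal (c powr p) * ennreal ((T' x * norm (u x)) powr p) \<partial>lborel)"
    unfolding wint_def
  proof (rule nn_integral_mono)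
    fix x
    have "T x * norm (u x) \<le> (c * T' x) * norm (u x)" by (intro mult_right_mono assms) auto
    then have "(T x * norm (u x)) powr p \<le> (c * (T' x * norm (u x))) powr p"
      using assms by (intro powr_mono2) (auto simp: mult.assoc)
    then show "ennreal ((T x * norm (u x)) powr p) \<le> ennreal (c powr p) * ennreal ((T' x * norm (u x)) powr p)"
      by (simp add: powr_mult ennreal_mult[symmetric] ennreal_leI)
  qed
  also have "\<dots> = ennreal (c powr p) * wint p T' u"
    unfolding wint_def by (rule nn_integral_cmult) simp
  finally show ?thesis .
qed

context diagonalizable_pair
begin

text \<open>All constants are chosen before S, Q, lam and the solution, and \<open>C1\<close> sees Q
  only through \<open>R0\<close> and its supremum. Both exponents are held to one bound on their
  squares, which makes every weight used below admissible for
  \<open>weighted_estimates\<close>.\<close>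

lemma core_estimate:
  fixes p \<gamma> \<epsilon> :: real
  assumes p: "1 < p" and \<gamma>: "\<gamma> > 0" and \<epsilon>: "0 < \<epsilon>" "\<epsilon> < 1"
  obtains \<eta>0 and C1 :: "real \<Rightarrow> real \<Rightarrow> real \<Rightarrow> real" where "\<eta>0 > 0" "\<And>a b c. C1 a b c > 0"
    "\<And>(S::real^'d^'d) Q R0 lam \<mu>1 \<mu>2 v Dv D2v g.
       transpose S = - S \<Longrightarrow> continuous_on UNIV Q \<Longrightarrow> R0 > 0 \<Longrightarrow>
       (\<And>x. norm x \<ge> R0 \<Longrightarrow> specnorm (Q x) \<le> \<eta>0) \<Longrightarrow> Re lam \<ge> - b0 + \<gamma> \<Longrightarrow>
       \<mu>1 \<le> 0 \<Longrightarrow> 0 \<le> \<mu>2 \<Longrightarrow> \<mu>1\<^sup>2 \<le> 4 * \<epsilon> * \<alpha>0 * \<gamma> \<Longrightarrow> \<mu>2\<^sup>2 \<le> 4 * \<epsilon> * \<alpha>0 * \<gamma> \<Longrightarrow>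
       W2p_loc_derivs p v Dv D2v \<Longrightarrow> Lp_weighted p (exp_weight \<mu>1) v \<Longrightarrow> Lp_weighted p (exp_weight \<mu>2) g \<Longrightarrow>
       AE x in lborel. resolvent_op lam A S B Q v Dv D2v x = g x \<Longrightarrow>
         Lp_weighted p (exp_weight \<mu>2) v \<and> (\<forall>i. Lp_weighted p (exp_weight \<mu>2) (Dv i)) \<and>
         Lp_wnorm p (exp_weight \<mu>2) v \<le> C1 \<bar>\<mu>2 - \<mu>1\<bar> R0 (Linf_mat_norm Q) *
            (Lp_wnorm p (exp_weight \<mu>1) v + Lp_wnorm p (exp_weight \<mu>2) g) \<and>
         W1p_wnorm p (exp_weight \<mu>2) v Dv \<le> C1 \<bar>\<mu>2 - \<mu>1\<bar> R0 (Linf_mat_norm Q) * (Re lam + b0) powr (- 1 / 2) *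
            (Lp_wnorm p (exp_weight \<mu>1) v + Lp_wnorm p (exp_weight \<mu>2) g)"
proof -
  obtain K where K: "K > 0"
    and Kb: "\<And>(S::real^'d^'d) lam \<mu>1 v Dv D2v f p. transpose S = - S \<Longrightarrow> 0 < Re lam + b0 \<Longrightarrow>
       \<mu>1\<^sup>2 \<le> 4 * \<epsilon> * \<alpha>0 * (Re lam + b0) \<Longrightarrow> p \<ge> 1 \<Longrightarrow>
       W2p_loc_derivs p v Dv D2v \<Longrightarrow> Lp_weighted p (exp_weight \<mu>1) v \<Longrightarrow> Lp_weighted p (exp_weight \<mu>1) f \<Longrightarrow>
       AE x in lborel. lam *s v x - A *v (\<Sum>i\<in>UNIV. D2v i i x) - (\<Sum>i\<in>UNIV. (S *v x)$i *\<^sub>R Dv i x) + B *v v x = f x \<Longrightarrow>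
       (AE x in lborel. ennreal (norm (v x)) \<le> ennreal K * kop S (rker \<alpha>0 (Re lam + b0)) (\<lambda>\<xi>. ennreal (norm (f \<xi>))) x) \<and>
       (\<forall>i. AE x in lborel. ennreal (norm (Dv i x)) \<le>
          ennreal K * kop S (\<lambda>s y. norm y / s * rker \<alpha>0 (Re lam + b0) s y) (\<lambda>\<xi>. ennreal (norm (f \<xi>))) x)"
    by (rule vector_bounds[OF \<epsilon>, where 'd = 'd]) (rule that)
  \<comment> \<open>Then \<theta>^2 = \<epsilon>, and the condition of
    \<open>weighted_estimates\<close> follows from the assumed bound 4 \<epsilon> \<alpha>0
    \<gamma>, since \<gamma> <= \<Lambda>.\<close>
  define \<theta> where "\<theta> = sqrt \<epsilon>"
  have \<theta>: "0 < \<theta>" "\<theta> < 1" "\<theta>\<^sup>2 = \<epsilon>" using \<epsilon> by (simp_all add: \<theta>_def)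
  define K0 where "K0 = K * ((gmass TYPE('d) ((1 - \<theta>) * \<alpha>0) + 1) / (1 - \<theta>))"
  define K1 where "K1 = K * (1 / sqrt ((1 - \<theta>) * \<alpha>0)) * (3 * (gmass TYPE('d) ((1 - \<theta>) * \<alpha>0 / 2) + 1) / sqrt (1 - \<theta>))"
  have K0: "K0 > 0" and K1: "K1 > 0"
    using K \<theta> \<alpha>0_pos gmass_nonneg[of "TYPE('d)" "(1 - \<theta>) * \<alpha>0"] gmass_nonneg[of "TYPE('d)" "(1 - \<theta>) * \<alpha>0 / 2"]
    unfolding K0_def K1_def by (intro mult_pos_pos divide_pos_pos; simp)+
  \<comment> \<open>Chosen such that 3 K0 \<eta> / \<gamma> = 1/2; the 3 comes from splitting g + Q
    v into three terms by \<open>powr_sum3_le\<close>.\<close>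
  define \<eta> where "\<eta> = \<gamma> / (6 * K0)"
  have \<eta>: "\<eta> > 0" using \<gamma> K0 by (simp add: \<eta>_def)
  \<comment> \<open>The factor 2 is the cost of absorbing a term with coefficient at most
    1/2.\<close>
  define N where "N = 2 * (3 * K0 / \<gamma>) powr p"
  \<comment> \<open>For Q inside the ball, where the two weights differ by a factor of at most
    exp(|\<mu>2 - \<mu>1| sqrt (R0^2 + 1)). The modulus of c keeps X nonnegative for all arguments,
    because \<open>C1\<close> is to be positive everywhere.\<close>
  define X where "X a b c = \<bar>c\<bar> * exp (a * sqrt (b\<^sup>2 + 1))" for a b c :: real
  define Y where "Y a b c = 3 powr p * (1 + \<eta> powr p * N) * (1 + X a b c powr p)" for a b c
  \<comment> \<open>The first order norm is to decay like \<Lambda>^(-1/2) only, so in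
    (K0/\<Lambda>)^p one factor \<Lambda>^(-p/2) is traded for \<gamma>^(-p/2).\<close>
  define H where "H = K0 powr p * \<gamma> powr (- (p / 2)) + real CARD('d) * K1 powr p"
  define C1 where "C1 a b c = (K0 / \<gamma> + H powr (1 / p)) * Y a b c powr (1 / p)" for a b c
  have N0: "N \<ge> 0" by (simp add: N_def)
  have X0: "X a b c \<ge> 0" for a b c by (simp add: X_def)
  have Y0: "Y a b c > 0" for a b c
    unfolding Y_def using N0 by (intro mult_pos_pos add_pos_nonneg) auto
  have H0: "H \<ge> 0" using K0 K1 by (simp add: H_def)
  have C10: "C1 a b c > 0" for a b c
    unfolding C1_def using K0 \<gamma> Y0[of a b c] H0 by (intro mult_pos_pos add_pos_nonneg) auto
  show ?thesis
  proof (rule that[OF \<eta> C10])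
    fix S :: "real^'d^'d" and Q :: "real^'d \<Rightarrow> complex^'m^'m" and R0 lam \<mu>1 \<mu>2 v Dv D2v and g :: "real^'d \<Rightarrow> complex^'m"
    assume S: "transpose S = - S" and Q: "continuous_on UNIV Q" and R0: "R0 > 0"
      and Qs: "\<And>x. norm x \<ge> R0 \<Longrightarrow> specnorm (Q x) \<le> \<eta>" and lam: "Re lam \<ge> - b0 + \<gamma>"
      and \<mu>: "\<mu>1 \<le> 0" "0 \<le> \<mu>2" and \<mu>1: "\<mu>1\<^sup>2 \<le> 4 * \<epsilon> * \<alpha>0 * \<gamma>" and \<mu>2: "\<mu>2\<^sup>2 \<le> 4 * \<epsilon> * \<alpha>0 * \<gamma>"
      and W: "W2p_loc_derivs p v Dv D2v" and vL: "Lp_weighted p (exp_weight \<mu>1) v" and gL: "Lp_weighted p (exp_weight \<mu>2) g"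
      and eq: "AE x in lborel. resolvent_op lam A S B Q v Dv D2v x = g x"
    define \<Lambda> where "\<Lambda> = Re lam + b0"
    have \<Lambda>: "\<Lambda> \<ge> \<gamma>" "\<Lambda> > 0" using lam \<gamma> by (simp_all add: \<Lambda>_def)
    have big: "4 * \<epsilon> * \<alpha>0 * \<gamma> \<le> 4 * \<epsilon> * \<alpha>0 * \<Lambda>" using \<Lambda> \<epsilon> \<alpha>0_pos by (intro mult_left_mono) auto
    define L where "L = Linf_mat_norm Q"
    have L: "specnorm (Q x) \<le> L" for x unfolding L_def by (rule specnorm_le_Linf[OF Q Qs])
    have L0: "L \<ge> 0" using L[of 0] specnorm_nonneg[of "Q 0"] by linarith
    define x0 where "x0 = X \<bar>\<mu>2 - \<mu>1\<bar> R0 L"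
    have vm[measurable]: "v \<in> borel_measurable borel" and gm[measurable]: "g \<in> borel_measurable borel"
      using vL gL by (simp_all add: Lp_weighted_def)
    have Dm: "Dv i \<in> borel_measurable borel" for i
      using W by (simp add: W2p_loc_derivs_def Lp_loc_def)
    define f where "f x = g x + Q x *v v x" for x
    have fm[measurable]: "f \<in> borel_measurable borel"
      unfolding f_def[abs_def] by (intro borel_measurable_add gm matrix_vector_measurable Q vm)
    let ?T1 = "exp_weight \<mu>1 :: real^'d \<Rightarrow> real" and ?T2 = "exp_weight \<mu>2 :: real^'d \<Rightarrow> real"
    have T12: "?T1 x \<le> ?T2 x" for x
      using \<mu> by (auto simp: exp_weight_def intro!: mult_right_mono)
    \<comment> \<open>The three terms are g in the target weight, the small outer part of Q in the
      weight T, and the inner part of Q in the given weight of v. T stays open because it will be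
      each of the two given weights and all truncations.\<close>
    have F: "wint p T f \<le> ennreal (3 powr p) * (wint p ?T2 g + ennreal (\<eta> powr p) * wint p T v + ennreal (x0 powr p) * wint p ?T1 v)"
      if T: "\<And>x. 0 \<le> T x" "\<And>x. T x \<le> ?T2 x" and [measurable]: "T \<in> borel_measurable borel" for T
    proof -
      have pt: "T x * norm (f x) \<le> ?T2 x * norm (g x) + \<eta> * (T x * norm (v x)) + x0 * (?T1 x * norm (v x))" for x
      proof -
        have "norm (f x) \<le> norm (g x) + norm (Q x *v v x)" unfolding f_def by (rule norm_triangle_ineq)
        also have "\<dots> \<le> norm (g x) + specnorm (Q x) * norm (v x)" using specnorm_bound by (intro add_left_mono)
        finally have "T x * norm (f x) \<le> T x * (norm (g x) + specnorm (Q x) * norm (v x))"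
          using T(1) by (intro mult_left_mono)
        also have "\<dots> = T x * norm (g x) + T x * (specnorm (Q x) * norm (v x))" by (simp add: distrib_left)
        also have "T x * norm (g x) \<le> ?T2 x * norm (g x)" using T(2) by (intro mult_right_mono) auto
        also have "T x * (specnorm (Q x) * norm (v x)) \<le> \<eta> * (T x * norm (v x)) + x0 * (?T1 x * norm (v x))"
        proof (cases "norm x \<ge> R0")
          case True
          have "T x * (specnorm (Q x) * norm (v x)) \<le> T x * (\<eta> * norm (v x))"
            using T(1) Qs[OF True] by (intro mult_left_mono mult_right_mono) auto
          moreover have "0 \<le> x0 * (?T1 x * norm (v x))"
            using X0 exp_weight_pos[of \<mu>1 x] by (simp add: x0_def)
          ultimately show ?thesis by (simp add: mult.left_commute)
        next
          case False
          have sq: "sqrt ((norm x)\<^sup>2 + 1) \<le> sqrt (R0\<^sup>2 + 1)"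
            using False by (intro real_sqrt_le_mono add_right_mono power_mono) auto
          have "?T2 x = exp ((\<mu>2 - \<mu>1) * sqrt ((norm x)\<^sup>2 + 1)) * ?T1 x"
            by (simp add: exp_weight_def exp_add[symmetric] algebra_simps)
          also have "\<dots> \<le> exp (\<bar>\<mu>2 - \<mu>1\<bar> * sqrt (R0\<^sup>2 + 1)) * ?T1 x"
            using sq exp_weight_pos[of \<mu>1 x] by (intro mult_right_mono) (auto intro!: mult_mono)
          finally have "T x \<le> exp (\<bar>\<mu>2 - \<mu>1\<bar> * sqrt (R0\<^sup>2 + 1)) * ?T1 x" using T(2)[of x] by linarith
          then have "T x * (specnorm (Q x) * norm (v x)) \<le> (exp (\<bar>\<mu>2 - \<mu>1\<bar> * sqrt (R0\<^sup>2 + 1)) * ?T1 x) * (L * norm (v x))"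
            using T(1) L L0 specnorm_nonneg[of "Q x"] exp_weight_pos[of \<mu>1 x] by (intro mult_mono) auto
          also have "\<dots> = x0 * (?T1 x * norm (v x))" using L0 by (simp add: x0_def X_def)
          also have "\<dots> \<le> \<eta> * (T x * norm (v x)) + x0 * (?T1 x * norm (v x))" using \<eta> T(1)[of x] by simp
          finally show ?thesis .
        qed
        finally show ?thesis by simp
      qed
      have x00: "x0 \<ge> 0" using X0 by (simp add: x0_def)
      have "wint p T f \<le> (\<integral>\<^sup>+x. ennreal (3 powr p) * (ennreal ((?T2 x * norm (g x)) powr p) + ennreal (\<eta> powr p) * ennreal ((T x * norm (v x)) powr p)
         + ennreal (x0 powr p) * ennreal ((?T1 x * norm (v x)) powr p)) \<partial>lborel)"
        unfolding wint_def
      proof (rule nn_integral_mono)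
        fix x
        note nn = T(1)[of x] exp_weight_pos[of \<mu>1 x, THEN less_imp_le] exp_weight_pos[of \<mu>2 x, THEN less_imp_le] x00 \<eta>[THEN less_imp_le]
        have "(T x * norm (f x)) powr p \<le> (?T2 x * norm (g x) + \<eta> * (T x * norm (v x)) + x0 * (?T1 x * norm (v x))) powr p"
          using p nn by (intro powr_mono2 pt) auto
        also have "\<dots> \<le> 3 powr p * ((?T2 x * norm (g x)) powr p + (\<eta> * (T x * norm (v x))) powr p + (x0 * (?T1 x * norm (v x))) powr p)"
          using p nn by (intro powr_sum3_le mult_nonneg_nonneg) auto
        finally have "ennreal ((T x * norm (f x)) powr p) \<le> ennreal (3 powr p * ((?T2 x * norm (g x)) powr p + \<eta> powr p * (T x * norm (v x)) powr p + x0 powr p * (?T1 x * norm (v x)) powr p))"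
          by (intro ennreal_leI) (simp only: powr_mult[of \<eta>] powr_mult[of x0])
        also have "\<dots> = ennreal (3 powr p) * (ennreal ((?T2 x * norm (g x)) powr p) + ennreal (\<eta> powr p) * ennreal ((T x * norm (v x)) powr p)
         + ennreal (x0 powr p) * ennreal ((?T1 x * norm (v x)) powr p))"
          by (simp only: ennreal_mult ennreal_plus powr_ge_zero add_nonneg_nonneg mult_nonneg_nonneg)
        finally show "ennreal ((T x * norm (f x)) powr p) \<le> ennreal (3 powr p) * (ennreal ((?T2 x * norm (g x)) powr p) + ennreal (\<eta> powr p) * ennreal ((T x * norm (v x)) powr p)
         + ennreal (x0 powr p) * ennreal ((?T1 x * norm (v x)) powr p))" .
      qed
      also have "\<dots> = ennreal (3 powr p) * (wint p ?T2 g + ennreal (\<eta> powr p) * wint p T v + ennreal (x0 powr p) * wint p ?T1 v)"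
        unfolding wint_def by (simp add: nn_integral_cmult nn_integral_add)
      finally show ?thesis .
    qed
    have Vfin: "wint p ?T1 v < \<infinity>" and Gfin: "wint p ?T2 g < \<infinity>"
      using vL gL by (simp_all add: Lp_weighted_iff_wint)
    obtain V G where V: "wint p ?T1 v = ennreal V" "V \<ge> 0" and G: "wint p ?T2 g = ennreal G" "G \<ge> 0"
      using Vfin Gfin by (cases "wint p ?T1 v"; cases "wint p ?T2 g") auto
    \<comment> \<open>At this stage v is known in its given weight only; that f lies in the same
      weighted space is what \<open>Kb\<close> needs.\<close>
    have fL: "Lp_weighted p (exp_weight \<mu>1) f"
    proof -
      have "wint p ?T1 f \<le> ennreal (3 powr p) * (wint p ?T2 g + ennreal (\<eta> powr p) * wint p ?T1 v + ennreal (x0 powr p) * wint p ?T1 v)"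
        using exp_weight_pos[of \<mu>1, THEN less_imp_le] T12 by (intro F) auto
      also have "\<dots> < \<infinity>" using Vfin Gfin by (simp add: ennreal_mult_less_top)
      finally show ?thesis by (simp add: Lp_weighted_iff_wint)
    qed
    have "AE x in lborel. lam *s v x - A *v (\<Sum>i\<in>UNIV. D2v i i x) - (\<Sum>i\<in>UNIV. (S *v x)$i *\<^sub>R Dv i x) + B *v v x = f x"
      using eq by eventually_elim (simp add: resolvent_op_def f_def algebra_simps)
    from Kb[OF S _ order_trans[OF \<mu>1] _ W vL fL this]
    have vb: "AE x in lborel. ennreal (norm (v x)) \<le> ennreal K * kop S (rker \<alpha>0 \<Lambda>) (\<lambda>\<xi>. ennreal (norm (f \<xi>))) x"
      and Db: "\<And>i. AE x in lborel. ennreal (norm (Dv i x)) \<le> ennreal K * kop S (\<lambda>s y. norm y / s * rker \<alpha>0 \<Lambda> s y) (\<lambda>\<xi>. ennreal (norm (f \<xi>))) x"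
      using \<Lambda> big p by (simp_all add: \<Lambda>_def)
    have est: "wint p T v \<le> ennreal ((K0 / \<Lambda>) powr p) * wint p T f"
      "\<And>i. wint p T (Dv i) \<le> ennreal ((K1 / sqrt \<Lambda>) powr p) * wint p T f"
      if T: "\<And>x. T x = exp (\<tau> (norm x))" and \<tau>: "\<tau> \<in> borel_measurable borel"
        and lip: "\<And>r r'. \<bar>\<tau> r - \<tau> r'\<bar> \<le> \<mu> * \<bar>r - r'\<bar>" and \<mu>: "\<mu> \<ge> 0" "\<mu>\<^sup>2 \<le> 4 * \<epsilon> * \<alpha>0 * \<gamma>" for T \<tau> \<mu>
    proof -
      have \<mu>': "\<mu>\<^sup>2 \<le> 4 * \<theta>\<^sup>2 * \<alpha>0 * \<Lambda>" using \<mu>(2) big unfolding \<theta>(3) by (rule order_trans)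
      have Kn: "K \<ge> 0" and p1: "p \<ge> 1" using K p by simp_all
      have fn: "(\<lambda>x. norm (f x)) \<in> borel_measurable borel" by simp
      show "wint p T v \<le> ennreal ((K0 / \<Lambda>) powr p) * wint p T f"
        unfolding wint_def T K0_def
        by (rule weighted_estimates(1)[OF S \<alpha>0_pos \<Lambda>(2) \<theta>(1,2) \<mu>(1) \<mu>' p1 Kn \<tau> lip fn _ _ vb]) simp_all
      show "wint p T (Dv i) \<le> ennreal ((K1 / sqrt \<Lambda>) powr p) * wint p T f" for i
        unfolding wint_def T K1_def
        by (rule weighted_estimates(2)[OF S \<alpha>0_pos \<Lambda>(2) \<theta>(1,2) \<mu>(1) \<mu>' p1 Kn \<tau> lip fn _ _ Db]) simp_all
    qed
    define \<tau> where "\<tau> n r = min (\<mu>2 * sqrt (r\<^sup>2 + 1)) (real n + \<mu>1 * sqrt (r\<^sup>2 + 1))" for n r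
    define T where "T n x = exp (\<tau> n (norm x))" for n and x :: "real^'d"
    \<comment> \<open>A common Lipschitz rate for both branches of the truncated exponent.\<close>
    define mu where "mu = max \<mu>2 (- \<mu>1)"
    have mu: "mu \<ge> 0" "mu\<^sup>2 \<le> 4 * \<epsilon> * \<alpha>0 * \<gamma>"
      using \<mu> \<mu>1 \<mu>2 by (auto simp: mu_def max_def)
    have \<tau>m[measurable]: "\<tau> n \<in> borel_measurable borel" for n unfolding \<tau>_def[abs_def] by measurable
    have Tm[measurable]: "T n \<in> borel_measurable borel" for n unfolding T_def[abs_def] by measurable
    have \<tau>lip: "\<bar>\<tau> n r - \<tau> n r'\<bar> \<le> mu * \<bar>r - r'\<bar>" for n r r'
      unfolding \<tau>_def
    proof (rule min_lipschitz)
      have a: "\<bar>m * sqrt (r\<^sup>2 + 1) - m * sqrt (r'\<^sup>2 + 1)\<bar> \<le> mu * \<bar>r - r'\<bar>" if "\<bar>m\<bar> \<le> mu" for m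
      proof -
        have "\<bar>m * sqrt (r\<^sup>2 + 1) - m * sqrt (r'\<^sup>2 + 1)\<bar> = \<bar>m\<bar> * \<bar>sqrt (r\<^sup>2 + 1) - sqrt (r'\<^sup>2 + 1)\<bar>"
          unfolding right_diff_distrib[symmetric] abs_mult ..
        also have "\<dots> \<le> mu * \<bar>r - r'\<bar>"
          using that mu by (intro mult_mono sqrt_sq_plus_one_lipschitz) auto
        finally show ?thesis .
      qed
      show "\<bar>\<mu>2 * sqrt (r\<^sup>2 + 1) - \<mu>2 * sqrt (r'\<^sup>2 + 1)\<bar> \<le> mu * \<bar>r - r'\<bar>"
        by (rule a) (use \<mu> in \<open>simp add: mu_def\<close>)
      show "\<bar>real n + \<mu>1 * sqrt (r\<^sup>2 + 1) - (real n + \<mu>1 * sqrt (r'\<^sup>2 + 1))\<bar> \<le> mu * \<bar>r - r'\<bar>"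
        using a[of \<mu>1] \<mu> by (simp add: mu_def)
    qed
    have T0: "0 \<le> T n x" for n x by (simp add: T_def)
    have TT2: "T n x \<le> ?T2 x" for n x by (simp add: T_def \<tau>_def exp_weight_def)
    \<comment> \<open>Makes the truncated norm of v finite, without which the absorption below would
      be void.\<close>
    have TT1: "T n x \<le> exp (real n) * ?T1 x" for n x
      by (simp add: T_def \<tau>_def exp_weight_def exp_add[symmetric])
    have Tn: "wint p (T n) v \<le> ennreal (N * (G + x0 powr p * V))" for n
    proof -
      have "wint p (T n) v \<le> ennreal (exp (real n) powr p) * wint p ?T1 v"
        using p T0 TT1 exp_weight_pos[of \<mu>1, THEN less_imp_le] by (intro wint_mono) auto
      also have "\<dots> < \<infinity>" using V by (simp add: ennreal_mult_less_top)
      finally obtain j where j: "wint p (T n) v = ennreal j" "j \<ge> 0" by (cases "wint p (T n) v") auto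
      have "ennreal j \<le> ennreal ((K0 / \<Lambda>) powr p) * wint p (T n) f"
        unfolding j(1)[symmetric] by (rule est(1)[OF T_def \<tau>m \<tau>lip mu])
      also have "\<dots> \<le> ennreal ((K0 / \<gamma>) powr p) * (ennreal (3 powr p) * (ennreal G + ennreal (\<eta> powr p) * ennreal j + ennreal (x0 powr p) * ennreal V))"
      proof (rule mult_mono)
        show "ennreal ((K0 / \<Lambda>) powr p) \<le> ennreal ((K0 / \<gamma>) powr p)"
          using K0 \<Lambda> \<gamma> p by (intro ennreal_leI powr_mono2 divide_left_mono) auto
        show "wint p (T n) f \<le> ennreal (3 powr p) * (ennreal G + ennreal (\<eta> powr p) * ennreal j + ennreal (x0 powr p) * ennreal V)"
          using F[OF T0 TT2 Tm, of n] unfolding G V j .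
      qed auto
      also have "\<dots> = ennreal ((K0 / \<gamma>) powr p * (3 powr p * (G + \<eta> powr p * j + x0 powr p * V)))"
        using G(2) V(2) j(2) by (simp add: ennreal_mult)
      finally have "j \<le> (K0 / \<gamma>) powr p * (3 powr p * (G + \<eta> powr p * j + x0 powr p * V))"
        using G(2) V(2) j(2) by (subst (asm) ennreal_le_iff) auto
      also have "\<dots> = (3 * K0 / \<gamma>) powr p * (G + x0 powr p * V) + (3 * K0 / \<gamma> * \<eta>) powr p * j"
      proof -
        have "(3 * K0 / \<gamma>) powr p = (K0 / \<gamma>) powr p * 3 powr p" by (simp flip: powr_mult add: mult.commute)
        moreover have "(3 * K0 / \<gamma> * \<eta>) powr p = (K0 / \<gamma>) powr p * 3 powr p * \<eta> powr p" by (simp flip: powr_mult add: mult.commute)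
        ultimately show ?thesis by (simp only: ring_distribs mult_ac)
      qed
      \<comment> \<open>By the choice of \<eta> the base is 1/2, and its p-th power is at most 1/2
        since p > 1; as j is finite, half of it can be subtracted.\<close>
      also have "(3 * K0 / \<gamma> * \<eta>) powr p \<le> 1 / 2"
      proof -
        have "3 * K0 / \<gamma> * \<eta> = 1 / 2" using K0 \<gamma> by (simp add: \<eta>_def)
        moreover have "(1 / 2 :: real) powr p \<le> (1 / 2) powr 1" using p by (intro powr_mono') auto
        ultimately show ?thesis by simp
      qed
      finally have "j \<le> (3 * K0 / \<gamma>) powr p * (G + x0 powr p * V) + 1 / 2 * j"
        using j(2) by (simp add: mult_right_mono)
      then show ?thesis unfolding j(1) by (intro ennreal_leI) (simp add: N_def)
    qed
    \<comment> \<open>The bound does not depend on n, and the truncations increase and are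
      eventually equal to the full weight at every point, so monotone convergence applies.\<close>
    have T2v: "wint p ?T2 v \<le> ennreal (N * (G + x0 powr p * V))"
    proof (rule LIMSEQ_le_const2)
      show "(\<lambda>n. wint p (T n) v) \<longlonglongrightarrow> wint p ?T2 v"
        unfolding wint_def
      proof (rule nn_integral_LIMSEQ)
        show "incseq (\<lambda>n x. ennreal ((T n x * norm (v x)) powr p))"
        proof (intro monoI le_funI ennreal_leI powr_mono2 mult_right_mono)
          show "T m x \<le> T n x" if "m \<le> n" for m n x
            using that by (auto simp: T_def \<tau>_def)
        qed (use p T0 in auto)
        show "(\<lambda>x. ennreal ((T n x * norm (v x)) powr p)) \<in> borel_measurable lborel" for n by simp
        fix x :: "real^'d"
        obtain n0 where n0: "(\<mu>2 - \<mu>1) * sqrt ((norm x)\<^sup>2 + 1) \<le> real n0" using real_arch_simple by blast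
        have "T n x = ?T2 x" if "n \<ge> n0" for n
        proof -
          have "\<mu>2 * sqrt ((norm x)\<^sup>2 + 1) \<le> real n + \<mu>1 * sqrt ((norm x)\<^sup>2 + 1)"
            using n0 that of_nat_mono[OF that, where 'a = real] by (simp add: left_diff_distrib)
          then show ?thesis by (simp add: T_def \<tau>_def exp_weight_def)
        qed
        then have "\<forall>\<^sub>F n in sequentially. ennreal ((?T2 x * norm (v x)) powr p) = ennreal ((T n x * norm (v x)) powr p)"
          by (intro eventually_sequentiallyI[of n0]) simp
        then show "(\<lambda>n. ennreal ((T n x * norm (v x)) powr p)) \<longlonglongrightarrow> ennreal ((?T2 x * norm (v x)) powr p)"
          by (rule Lim_transform_eventually[OF tendsto_const])
      qed
    qed (use Tn in auto)
    obtain j where j: "wint p ?T2 v = ennreal j" "j \<ge> 0"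
      using T2v by (cases "wint p ?T2 v") (auto simp: top_unique)
    have jN: "j \<le> N * (G + x0 powr p * V)"
      using T2v N0 G(2) V(2) unfolding j(1) by (subst (asm) ennreal_le_iff) auto
    let ?Y = "Y \<bar>\<mu>2 - \<mu>1\<bar> R0 L"
    have Ff: "wint p ?T2 f \<le> ennreal (?Y * (G + V))"
    proof -
      have "wint p ?T2 f \<le> ennreal (3 powr p) * (ennreal G + ennreal (\<eta> powr p) * ennreal j + ennreal (x0 powr p) * ennreal V)"
        unfolding G(1)[symmetric] V(1)[symmetric] j(1)[symmetric]
        using exp_weight_pos[of \<mu>2, THEN less_imp_le] by (intro F) auto
      also have "\<dots> = ennreal (3 powr p * (G + \<eta> powr p * j + x0 powr p * V))"
        using G(2) V(2) j(2) by (simp add: ennreal_mult)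
      also have "\<dots> \<le> ennreal (?Y * (G + V))"
      proof (rule ennreal_leI)
        have "G + x0 powr p * V \<le> (1 + x0 powr p) * (G + V)"
          using G(2) V(2) by (simp add: algebra_simps)
        then have "(1 + \<eta> powr p * N) * (G + x0 powr p * V) \<le> (1 + \<eta> powr p * N) * ((1 + x0 powr p) * (G + V))"
          using N0 by (intro mult_left_mono) auto
        moreover have "G + \<eta> powr p * j + x0 powr p * V \<le> (1 + \<eta> powr p * N) * (G + x0 powr p * V)"
          using mult_left_mono[OF jN, of "\<eta> powr p"] by (simp add: algebra_simps)
        ultimately have "3 powr p * (G + \<eta> powr p * j + x0 powr p * V) \<le> 3 powr p * ((1 + \<eta> powr p * N) * ((1 + x0 powr p) * (G + V)))"
          by (intro mult_left_mono) auto
        then show "3 powr p * (G + \<eta> powr p * j + x0 powr p * V) \<le> ?Y * (G + V)"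
          by (simp add: Y_def x0_def mult.assoc)
      qed
      finally show ?thesis .
    qed
    define y where "y = ?Y * (G + V)"
    have y0: "y \<ge> 0" using Y0[of "\<bar>\<mu>2 - \<mu>1\<bar>" R0 L] G(2) V(2) by (simp add: y_def)
    have lip2: "\<bar>\<mu>2 * sqrt (r\<^sup>2 + 1) - \<mu>2 * sqrt (r'\<^sup>2 + 1)\<bar> \<le> \<mu>2 * \<bar>r - r'\<bar>" for r r'
      using mult_left_mono[OF sqrt_sq_plus_one_lipschitz \<mu>(2)] \<mu>(2)
      unfolding right_diff_distrib[symmetric] abs_mult by simp
    have m2: "(\<lambda>r. \<mu>2 * sqrt (r\<^sup>2 + 1)) \<in> borel_measurable borel" by measurable
    \<comment> \<open>Now that v has finite norm in the target weight, the estimates are applied a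
      second time with that weight itself. This recovers the powers of \<Lambda>, which the
      absorption had replaced by powers of \<gamma>.\<close>
    note est2 = est[OF exp_weight_def m2 lip2 \<mu>(2) \<mu>2]
    have jy: "j \<le> (K0 / \<Lambda>) powr p * y"
    proof -
      have "ennreal j \<le> ennreal ((K0 / \<Lambda>) powr p) * ennreal y"
        unfolding j(1)[symmetric] y_def by (rule order_trans[OF est2(1) mult_left_mono[OF Ff]]) simp
      then show ?thesis using y0 by (simp add: ennreal_mult[symmetric])
    qed
    have Dy: "wint p ?T2 (Dv i) \<le> ennreal ((K1 / sqrt \<Lambda>) powr p * y)" for i
    proof -
      have "wint p ?T2 (Dv i) \<le> ennreal ((K1 / sqrt \<Lambda>) powr p) * ennreal y"
        unfolding y_def by (rule order_trans[OF est2(2) mult_left_mono[OF Ff]]) simp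
      then show ?thesis using y0 by (simp add: ennreal_mult)
    qed
    have Dfin: "wint p ?T2 (Dv i) < \<infinity>" for i
      using Dy[of i] by (rule le_less_trans) simp
    have Dreal: "enn2real (wint p ?T2 (Dv i)) \<le> (K1 / sqrt \<Lambda>) powr p * y" for i
      using Dy[of i] y0 by (intro enn2real_leI) auto
    have yr: "y powr (1 / p) \<le> ?Y powr (1 / p) * (Lp_wnorm p ?T1 v + Lp_wnorm p ?T2 g)"
    proof -
      have "(G + V) powr (1 / p) \<le> G powr (1 / p) + V powr (1 / p)"
        if "\<And>a b. a \<ge> 0 \<Longrightarrow> b \<ge> 0 \<Longrightarrow> (a + b) powr (1 / p) \<le> a powr (1 / p) + b powr (1 / p)"
        using that G(2) V(2) by simp
      \<comment> \<open>Subadditivity of the p-th root: a fraction x between 0 and 1 satisfies x <=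
        x^(1/p), and the two fractions of a + b add up to 1.\<close>
      moreover have "(a + b) powr (1 / p) \<le> a powr (1 / p) + b powr (1 / p)" if ab: "a \<ge> 0" "b \<ge> 0" for a b
      proof (cases "a + b = 0")
        case False
        then have s: "a + b > 0" using ab by simp
        have sub: "x / (a + b) \<le> (x / (a + b)) powr (1 / p)" if "0 \<le> x" "x \<le> a + b" for x
        proof (cases "x = 0")
          case False
          have "(x / (a + b)) powr 1 \<le> (x / (a + b)) powr (1 / p)"
            using that s False p by (intro powr_mono') auto
          then show ?thesis using that s by simp
        qed simp
        have "1 = a / (a + b) + b / (a + b)" using s by (simp add: add_divide_distrib[symmetric])
        also have "\<dots> \<le> (a / (a + b)) powr (1 / p) + (b / (a + b)) powr (1 / p)"
          using ab by (intro add_mono sub) auto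
        also have "\<dots> = (a powr (1 / p) + b powr (1 / p)) / (a + b) powr (1 / p)"
          using ab s by (simp add: powr_divide add_divide_distrib)
        finally show ?thesis using s by (simp add: pos_le_divide_eq)
      qed (use ab in auto)
      ultimately have "(G + V) powr (1 / p) \<le> G powr (1 / p) + V powr (1 / p)" by blast
      then have "?Y powr (1 / p) * (G + V) powr (1 / p) \<le> ?Y powr (1 / p) * (G powr (1 / p) + V powr (1 / p))"
        by (intro mult_left_mono) auto
      then show ?thesis using G V by (simp add: y_def powr_mult Lp_wnorm_wint add.commute)
    qed
    define nrm where "nrm = Lp_wnorm p ?T1 v + Lp_wnorm p ?T2 g"
    have nrm0: "nrm \<ge> 0" by (simp add: nrm_def Lp_wnorm_def)
    have c1: "Lp_wnorm p ?T2 v \<le> C1 \<bar>\<mu>2 - \<mu>1\<bar> R0 L * nrm"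
    proof -
      have "Lp_wnorm p ?T2 v = j powr (1 / p)" using j by (simp add: Lp_wnorm_wint)
      also have "\<dots> \<le> ((K0 / \<Lambda>) powr p * y) powr (1 / p)" using jy j(2) p by (intro powr_mono2) auto
      also have "\<dots> = (K0 / \<Lambda>) * y powr (1 / p)" using K0 \<Lambda> p by (simp add: powr_mult powr_powr)
      also have "\<dots> \<le> (K0 / \<gamma>) * (?Y powr (1 / p) * nrm)"
        unfolding nrm_def using K0 \<Lambda> \<gamma> by (intro mult_mono yr divide_left_mono) auto
      also have "\<dots> \<le> (K0 / \<gamma> + H powr (1 / p)) * (?Y powr (1 / p) * nrm)"
        using nrm0 by (intro mult_right_mono) auto
      finally show ?thesis by (simp add: C1_def mult.assoc)
    qed
    have c2: "W1p_wnorm p ?T2 v Dv \<le> C1 \<bar>\<mu>2 - \<mu>1\<bar> R0 L * \<Lambda> powr (- 1 / 2) * nrm"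
    proof -
      have pw: "(Lp_wnorm p ?T2 u) powr p = enn2real (wint p ?T2 u)" for u :: "real^'d \<Rightarrow> complex^'m"
        using p by (simp add: Lp_wnorm_wint powr_powr)
      have "(Lp_wnorm p ?T2 v) powr p + (\<Sum>i\<in>UNIV. (Lp_wnorm p ?T2 (Dv i)) powr p) \<le> H * \<Lambda> powr (- (p / 2)) * y"
      proof -
        have "(K0 / \<Lambda>) powr p = K0 powr p * (\<Lambda> powr (- (p / 2)) * \<Lambda> powr (- (p / 2)))"
          by (simp add: powr_divide powr_add[symmetric] powr_minus_divide)
        also have "\<dots> \<le> K0 powr p * (\<gamma> powr (- (p / 2)) * \<Lambda> powr (- (p / 2)))"
          using \<Lambda> \<gamma> p by (intro mult_left_mono mult_right_mono powr_mono2') auto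
        finally have a: "(K0 / \<Lambda>) powr p * y \<le> K0 powr p * (\<gamma> powr (- (p / 2)) * \<Lambda> powr (- (p / 2))) * y"
          using y0 by (intro mult_right_mono)
        have "sqrt \<Lambda> powr p = \<Lambda> powr (p / 2)"
          using \<Lambda> by (simp add: powr_half_sqrt[symmetric] powr_powr)
        then have b: "(K1 / sqrt \<Lambda>) powr p = K1 powr p * \<Lambda> powr (- (p / 2))"
          by (simp add: powr_divide powr_minus_divide)
        have "enn2real (wint p ?T2 v) \<le> K0 powr p * (\<gamma> powr (- (p / 2)) * \<Lambda> powr (- (p / 2))) * y"
          using jy a j by simp
        moreover have "(\<Sum>i\<in>UNIV. enn2real (wint p ?T2 (Dv i))) \<le> (\<Sum>i\<in>(UNIV::'d set). K1 powr p * \<Lambda> powr (- (p / 2)) * y)"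
          using Dreal unfolding b by (intro sum_mono)
        ultimately show ?thesis unfolding pw H_def by (simp add: algebra_simps)
      qed
      then have "W1p_wnorm p ?T2 v Dv \<le> (H * \<Lambda> powr (- (p / 2)) * y) powr (1 / p)"
        unfolding W1p_wnorm_def using p by (intro powr_mono2 add_nonneg_nonneg sum_nonneg) auto
      also have "\<dots> = H powr (1 / p) * \<Lambda> powr (- 1 / 2) * y powr (1 / p)"
        using p by (simp add: powr_mult powr_powr)
      also have "\<dots> \<le> H powr (1 / p) * \<Lambda> powr (- 1 / 2) * (?Y powr (1 / p) * nrm)"
        unfolding nrm_def by (intro mult_left_mono yr) auto
      also have "\<dots> \<le> (K0 / \<gamma> + H powr (1 / p)) * \<Lambda> powr (- 1 / 2) * (?Y powr (1 / p) * nrm)"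
        using nrm0 K0 \<gamma> by (intro mult_right_mono) auto
      finally show ?thesis by (simp add: C1_def mult_ac)
    qed
    show "Lp_weighted p (exp_weight \<mu>2) v \<and> (\<forall>i. Lp_weighted p (exp_weight \<mu>2) (Dv i)) \<and>
         Lp_wnorm p (exp_weight \<mu>2) v \<le> C1 \<bar>\<mu>2 - \<mu>1\<bar> R0 (Linf_mat_norm Q) *
            (Lp_wnorm p (exp_weight \<mu>1) v + Lp_wnorm p (exp_weight \<mu>2) g) \<and>
         W1p_wnorm p (exp_weight \<mu>2) v Dv \<le> C1 \<bar>\<mu>2 - \<mu>1\<bar> R0 (Linf_mat_norm Q) * (Re lam + b0) powr (- 1 / 2) *
            (Lp_wnorm p (exp_weight \<mu>1) v + Lp_wnorm p (exp_weight \<mu>2) g)"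
      using c1 c2 j Dfin Dm vm unfolding Lp_weighted_iff_wint nrm_def[symmetric] L_def[symmetric] \<Lambda>_def[symmetric]
      by simp
  qed
qed

end

section \<open>Eigenvalues and adjoints\<close>

lemma matrix_vector_mult_minus_left: "(- M) *v w = - (M *v (w :: complex^'m))"
  by (simp add: vec_eq_iff matrix_vector_mult_def sum_negf)

lemma diagonalized_action:
  fixes M P Pinv :: "complex^'m^'m"
  assumes PP: "P ** Pinv = mat 1" and diag: "is_diag (Pinv ** M ** P)"
  shows "(Pinv *v (M *v u)) $ i = (Pinv ** M ** P) $ i $ i * (Pinv *v u) $ i"
proof -
  have "u = P *v (Pinv *v u)" using PP by (simp add: matrix_vector_mul_assoc)
  then have "Pinv *v (M *v u) = (Pinv ** M ** P) *v (Pinv *v u)"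
    by (metis matrix_vector_mul_assoc)
  then have "(Pinv *v (M *v u)) $ i = (\<Sum>j\<in>UNIV. (Pinv ** M ** P) $ i $ j * (Pinv *v u) $ j)"
    by (simp add: matrix_vector_mult_def)
  also have "\<dots> = (\<Sum>j\<in>UNIV. if j = i then (Pinv ** M ** P) $ i $ i * (Pinv *v u) $ i else 0)"
    using diag by (intro sum.cong) (auto simp: is_diag_def)
  finally show ?thesis by simp
qed

text \<open>Every diagonal entry has the corresponding column of P as eigenvector, and an
  eigenvector has some nonzero coordinate in this basis. The spectrum is thus a finite nonempty set,
  on which the maxima in \<open>spec_abscissa\<close> and \<open>spec_radius\<close> are
  attained.\<close>

lemma diagonalized_spectrum:
  fixes M P Pinv :: "complex^'m^'m"
  assumes PP: "P ** Pinv = mat 1" "Pinv ** P = mat 1"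
    and act: "\<And>u i. (Pinv *v (M *v u)) $ i = av i * (Pinv *v u) $ i"
  shows "cspectrum M = range av"
proof (intro subset_antisym subsetI)
  fix \<mu> assume "\<mu> \<in> cspectrum M"
  then obtain w where w: "w \<noteq> 0" "M *v w = \<mu> *s w" by (auto simp: cspectrum_def)
  have "Pinv *v w \<noteq> 0"
  proof
    assume "Pinv *v w = 0"
    then have "P *v (Pinv *v w) = 0" by simp
    then show False using w PP by (simp add: matrix_vector_mul_assoc)
  qed
  then obtain i where i: "(Pinv *v w) $ i \<noteq> 0" by (auto simp: vec_eq_iff)
  have "av i * (Pinv *v w) $ i = \<mu> * (Pinv *v w) $ i"
    unfolding act[symmetric] w(2) by (simp add: matrix_vector_mult_def sum_distrib_left mult_ac)
  with i have "\<mu> = av i" by simp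
  then show "\<mu> \<in> range av" by blast
next
  fix \<mu> assume "\<mu> \<in> range av"
  then obtain i where i: "\<mu> = av i" by blast
  define w where "w = P *v axis i 1"
  have w: "Pinv *v w = axis i 1" using PP by (simp add: w_def matrix_vector_mul_assoc)
  then have "w \<noteq> 0" by (metis axis_eq_0_iff matrix_vector_mult_0_right zero_neq_one)
  moreover have "Pinv *v (M *v w) = Pinv *v (\<mu> *s w)"
    unfolding vec_eq_iff
  proof
    fix j
    have "(Pinv *v (\<mu> *s w)) $ j = \<mu> * (Pinv *v w) $ j"
      by (simp add: matrix_vector_mult_def sum_distrib_left mult_ac)
    then show "(Pinv *v (M *v w)) $ j = (Pinv *v (\<mu> *s w)) $ j"
      unfolding act w i by (cases "j = i") (simp_all add: axis_def)
  qed
  then have "P *v (Pinv *v (M *v w)) = P *v (Pinv *v (\<mu> *s w))" by simp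
  then have "M *v w = \<mu> *s w" using PP by (simp add: matrix_vector_mul_assoc matrix_mul_assoc)
  ultimately show "\<mu> \<in> cspectrum M" by (auto simp: cspectrum_def)
qed

lemma cinner_self: "cinner w w = of_real ((norm w)\<^sup>2)"
proof -
  have "(norm w)\<^sup>2 = (\<Sum>i\<in>UNIV. (norm (w $ i))\<^sup>2)"
    unfolding norm_vec_def L2_set_def by (simp add: sum_nonneg)
  then show ?thesis unfolding cinner_def by (simp only: of_real_sum complex_norm_square mult.commute)
qed

lemma cinner_scale: "cinner u (k *s v) = k * cinner u v" "cinner (k *s u) v = cnj k * cinner u v"
  by (simp_all add: cinner_def sum_distrib_left mult_ac)

text \<open>For z = i w the number <w, z> is purely imaginary, so the term with p - 2 disappears
  whatever p is and only the eigenvalue remains.\<close>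

lemma A4_le_eigenvalue:
  assumes A4: "A4 p M c" and \<mu>: "\<mu> \<in> cspectrum M"
  shows "c \<le> Re \<mu>"
proof -
  obtain w where w: "w \<noteq> 0" "M *v w = \<mu> *s w" using \<mu> by (auto simp: cspectrum_def)
  define z where "z = \<i> *s w"
  have nz: "norm z = norm w" unfolding z_def norm_vec_def by (simp add: norm_mult)
  have zero: "Re (cinner w z) = 0" unfolding z_def cinner_scale cinner_self by simp
  have one: "Re (cinner w (M *v w)) = Re \<mu> * (norm w)\<^sup>2"
    unfolding w(2) cinner_scale cinner_self by simp
  have "c * (norm z)\<^sup>2 * (norm w)\<^sup>2 \<le> (norm z)\<^sup>2 * Re (cinner w (M *v w)) + (p - 2) * Re (cinner w z) * Re (cinner z (M *v w))"
    using A4 by (simp add: A4_def)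
  then have "c * ((norm w)\<^sup>2 * (norm w)\<^sup>2) \<le> Re \<mu> * ((norm w)\<^sup>2 * (norm w)\<^sup>2)"
    unfolding zero one nz by (simp add: mult_ac)
  then show ?thesis by (rule mult_right_le_imp_le) (use w(1) in simp)
qed

lemma numerical_bound_le_eigenvalue:
  assumes "\<forall>w. Re (cinner w (M *v w)) \<ge> \<beta> * (norm w)\<^sup>2" and \<mu>: "\<mu> \<in> cspectrum M"
  shows "\<beta> \<le> Re \<mu>"
proof -
  obtain w where w: "w \<noteq> 0" "M *v w = \<mu> *s w" using \<mu> by (auto simp: cspectrum_def)
  have "\<beta> * (norm w)\<^sup>2 \<le> Re (cinner w (M *v w))" using assms(1) by blast
  also have "\<dots> = Re \<mu> * (norm w)\<^sup>2" unfolding w(2) cinner_scale cinner_self by simp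
  finally show ?thesis by (rule mult_right_le_imp_le) (use w(1) in simp)
qed

lemma eigenvalue_le_specnorm:
  assumes "\<mu> \<in> cspectrum M"
  shows "cmod \<mu> \<le> specnorm M"
proof -
  obtain w where w: "w \<noteq> 0" "M *v w = \<mu> *s w" using assms by (auto simp: cspectrum_def)
  have "norm (\<mu> *s w) = cmod \<mu> * norm w"
    unfolding norm_vec_def by (simp add: norm_mult L2_set_right_distrib)
  then have "cmod \<mu> * norm w \<le> specnorm M * norm w" using specnorm_bound[of M w] w(2) by simp
  then show ?thesis by (rule mult_right_le_imp_le) (use w(1) in simp)
qed

lemma mat_H_mult: "mat_H (M ** N) = mat_H N ** mat_H M"
  by (simp add: mat_H_def matrix_matrix_mult_def vec_eq_iff mult.commute)

lemma mat_H_one: "mat_H (mat 1) = mat 1"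
  by (auto simp: mat_H_def mat_def vec_eq_iff)

lemma mat_H_mat_H [simp]: "mat_H (mat_H M) = M"
  by (simp add: mat_H_def vec_eq_iff)

lemma mat_H_minus: "mat_H (- M) = - mat_H M"
  by (simp add: mat_H_def vec_eq_iff)

lemma is_diag_mat_H: "is_diag M \<Longrightarrow> is_diag (mat_H M)"
  by (simp add: is_diag_def mat_H_def)

lemma simult_diagonalizable_mat_H:
  fixes M N :: "complex^'m^'m"
  assumes "simult_diagonalizable M N"
  shows "simult_diagonalizable (mat_H M) (mat_H N)"
proof -
  obtain P Pinv :: "complex^'m^'m" where P: "P ** Pinv = mat 1" "Pinv ** P = mat 1"
    "is_diag (Pinv ** M ** P)" "is_diag (Pinv ** N ** P)"
    using assms unfolding simult_diagonalizable_def by blast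
  have "mat_H Pinv ** mat_H P = mat 1" "mat_H P ** mat_H Pinv = mat 1"
    unfolding mat_H_mult[symmetric] P mat_H_one by simp_all
  moreover have "is_diag (mat_H P ** mat_H M ** mat_H Pinv)" "is_diag (mat_H P ** mat_H N ** mat_H Pinv)"
    using P(3,4)[THEN is_diag_mat_H] by (simp_all add: mat_H_mult matrix_mul_assoc)
  ultimately show ?thesis unfolding simult_diagonalizable_def by blast
qed

text \<open>Taking adjoints in the diagonalisation exchanges the roles of P and its inverse and
  conjugates the diagonal. Real parts and moduli of eigenvalues are unaffected, which is what the
  adjoint problem needs.\<close>

lemma diagonalizable_cspectrum_mat_H:
  fixes M P Pinv :: "complex^'m^'m"
  assumes P: "P ** Pinv = mat 1" "Pinv ** P = mat 1" and d: "is_diag (Pinv ** M ** P)"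
  shows "cspectrum (mat_H M) = cnj ` cspectrum M"
proof -
  have P': "mat_H Pinv ** mat_H P = mat 1" "mat_H P ** mat_H Pinv = mat 1"
    unfolding mat_H_mult[symmetric] P mat_H_one by simp_all
  have D: "mat_H P ** mat_H M ** mat_H Pinv = mat_H (Pinv ** M ** P)"
    by (simp add: mat_H_mult matrix_mul_assoc)
  have "cspectrum (mat_H M) = range (\<lambda>i. (mat_H P ** mat_H M ** mat_H Pinv) $ i $ i)"
    by (rule diagonalized_spectrum[OF P']) (rule diagonalized_action[OF P'(1)], simp add: D is_diag_mat_H d)
  also have "\<dots> = cnj ` range (\<lambda>i. (Pinv ** M ** P) $ i $ i)"
    unfolding D by (simp add: mat_H_def image_image)
  also have "range (\<lambda>i. (Pinv ** M ** P) $ i $ i) = cspectrum M"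
    by (rule diagonalized_spectrum[OF P, symmetric]) (rule diagonalized_action[OF P(1) d])
  finally show ?thesis .
qed

lemma is_diag_minus: "is_diag (Pinv ** M ** P) \<Longrightarrow> is_diag (Pinv ** (- M) ** (P :: complex^'m^'m))"
proof -
  have "Pinv ** (- M) ** P = - (Pinv ** M ** P)"
    by (simp add: vec_eq_iff matrix_matrix_mult_def sum_negf)
  then show "is_diag (Pinv ** M ** P) \<Longrightarrow> is_diag (Pinv ** (- M) ** P)"
    by (simp add: is_diag_def)
qed

lemma spectral_bounds_mat_H:
  fixes M N :: "complex^'m^'m"
  assumes "simult_diagonalizable M N"
  shows "spec_abscissa (- mat_H M) = spec_abscissa (- M)" "spec_abscissa (- mat_H N) = spec_abscissa (- N)"
    "spec_radius (mat_H M) = spec_radius M"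
proof -
  obtain P Pinv :: "complex^'m^'m" where P: "P ** Pinv = mat 1" "Pinv ** P = mat 1"
    and d: "is_diag (Pinv ** M ** P)" "is_diag (Pinv ** N ** P)"
    using assms unfolding simult_diagonalizable_def by blast
  show "spec_abscissa (- mat_H M) = spec_abscissa (- M)" "spec_abscissa (- mat_H N) = spec_abscissa (- N)"
    "spec_radius (mat_H M) = spec_radius M"
    unfolding spec_abscissa_def spec_radius_def mat_H_minus[symmetric]
      diagonalizable_cspectrum_mat_H[OF P d(1)] diagonalizable_cspectrum_mat_H[OF P is_diag_minus[OF d(1)]]
      diagonalizable_cspectrum_mat_H[OF P is_diag_minus[OF d(2)]]
    by (simp_all add: image_image)
qed

lemma cinner_mat_H: "cinner u (mat_H M *v w) = cnj (cinner w (M *v u))"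
proof -
  have "cinner u (mat_H M *v w) = (\<Sum>i\<in>UNIV. \<Sum>j\<in>UNIV. cnj (u $ i) * (cnj (M $ j $ i) * w $ j))"
    by (simp add: cinner_def matrix_vector_mult_def mat_H_def sum_distrib_left)
  also have "\<dots> = (\<Sum>j\<in>UNIV. \<Sum>i\<in>UNIV. cnj (u $ i) * (cnj (M $ j $ i) * w $ j))"
    by (rule sum.swap)
  also have "\<dots> = cnj (cinner w (M *v u))"
    by (simp add: cinner_def matrix_vector_mult_def sum_distrib_left mult_ac)
  finally show ?thesis .
qed

lemma Re_cinner: "Re (cinner u v) = u \<bullet> v"
  by (simp add: cinner_def inner_vec_def inner_complex_def)

text \<open>With w = M^H u one has |w|^2 = Re <u, M w> <= |u| |M| |w|, and a factor |w|
  cancels.\<close>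

lemma specnorm_mat_H_le: "specnorm (mat_H M) \<le> specnorm M"
proof (unfold specnorm_def[of "mat_H M"], rule onorm_le)
  fix u :: "complex^'a"
  let ?w = "mat_H M *v u"
  have "(norm ?w)\<^sup>2 = Re (cinner ?w (mat_H M *v u))" unfolding cinner_self by simp
  also have "\<dots> = u \<bullet> (M *v ?w)" unfolding cinner_mat_H by (simp add: Re_cinner)
  also have "\<dots> \<le> norm u * norm (M *v ?w)" by (rule norm_cauchy_schwarz)
  also have "\<dots> \<le> norm u * (specnorm M * norm ?w)" by (intro mult_left_mono specnorm_bound) simp
  finally have "norm ?w * norm ?w \<le> (specnorm M * norm u) * norm ?w" by (simp add: power2_eq_square mult_ac)
  then show "norm ?w \<le> specnorm M * norm u"
    using specnorm_nonneg[of M] by (cases "norm ?w = 0") (auto simp: mult_le_cancel_right)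
qed

lemma specnorm_mat_H: "specnorm (mat_H M) = specnorm M"
  using specnorm_mat_H_le[of M] specnorm_mat_H_le[of "mat_H M"] by simp

lemma adj_resolvent_op_eq:
  "adj_resolvent_op lam A S B Q v Dv D2v x =
    resolvent_op (cnj lam) (mat_H A) (- S) (mat_H B) (\<lambda>x. mat_H (Q x)) v Dv D2v x"
proof -
  have "(- S) *v x = - (S *v x)" by (simp add: vec_eq_iff matrix_vector_mult_def sum_negf)
  then show ?thesis by (simp add: adj_resolvent_op_def resolvent_op_def sum_negf)
qed

text \<open>Diagonal entries are eigenvalues, so spectral abscissa and radius supply the data of
  \<open>diagonalizable_pair\<close>. Both exponent ranges then reduce to the single condition
  \<mu>^2 <= \<epsilon> a0 \<gamma> / amax^2 of \<open>core_estimate\<close>.\<close>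

lemma exponential_estimate:
  fixes A B :: "complex^'m^'m" and p \<gamma>A \<beta>inf \<gamma> \<epsilon> :: real
  assumes p: "1 < p" and A4: "A4 p A \<gamma>A" and sdiag: "simult_diagonalizable A B"
    and beta: "\<forall>w::complex^'m. Re (cinner w (B *v w)) \<ge> \<beta>inf * (norm w)^2"
    and gam: "\<gamma> > 0" "\<beta>inf - (- spec_abscissa (- B)) + \<gamma> > 0"
    and eps: "0 < \<epsilon>" "\<epsilon> < 1"
  obtains \<eta>0 and C1 :: "real \<Rightarrow> real \<Rightarrow> real \<Rightarrow> real" where "\<eta>0 > 0" "\<And>a b c. C1 a b c > 0"
    "\<And>(S::real^'d^'d) Q R0 lam \<mu>1 \<mu>2 v Dv D2v g.
       transpose S = - S \<Longrightarrow> continuous_on UNIV Q \<Longrightarrow> R0 > 0 \<Longrightarrow>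
       (\<And>x. norm x \<ge> R0 \<Longrightarrow> specnorm (Q x) \<le> \<eta>0) \<Longrightarrow> Re lam \<ge> - (- spec_abscissa (- B)) + \<gamma> \<Longrightarrow>
       - sqrt (\<epsilon> * \<gamma>A * (\<beta>inf - (- spec_abscissa (- B)) + \<gamma>) / (2 * real CARD('d) * (specnorm A)^2)) \<le> \<mu>1 \<Longrightarrow> \<mu>1 \<le> 0 \<Longrightarrow>
       0 \<le> \<mu>2 \<Longrightarrow> \<mu>2 \<le> \<epsilon> * sqrt (- spec_abscissa (- A) * \<gamma>) / (spec_radius A * p) \<Longrightarrow>
       W2p_loc_derivs p v Dv D2v \<Longrightarrow> Lp_weighted p (exp_weight \<mu>1) v \<Longrightarrow> Lp_weighted p (exp_weight \<mu>2) g \<Longrightarrow>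
       AE x in lborel. resolvent_op lam A S B Q v Dv D2v x = g x \<Longrightarrow>
         Lp_weighted p (exp_weight \<mu>2) v \<and> (\<forall>i. Lp_weighted p (exp_weight \<mu>2) (Dv i)) \<and>
         Lp_wnorm p (exp_weight \<mu>2) v \<le> C1 \<bar>\<mu>2 - \<mu>1\<bar> R0 (Linf_mat_norm Q) *
            (Lp_wnorm p (exp_weight \<mu>1) v + Lp_wnorm p (exp_weight \<mu>2) g) \<and>
         W1p_wnorm p (exp_weight \<mu>2) v Dv \<le> C1 \<bar>\<mu>2 - \<mu>1\<bar> R0 (Linf_mat_norm Q) * (Re lam + (- spec_abscissa (- B))) powr (- 1 / 2) *
            (Lp_wnorm p (exp_weight \<mu>1) v + Lp_wnorm p (exp_weight \<mu>2) g)"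
proof -
  obtain P Pinv :: "complex^'m^'m" where P: "P ** Pinv = mat 1" "Pinv ** P = mat 1"
    and d: "is_diag (Pinv ** A ** P)" "is_diag (Pinv ** B ** P)"
    using sdiag unfolding simult_diagonalizable_def by blast
  define av where "av i = (Pinv ** A ** P) $ i $ i" for i
  define bv where "bv i = (Pinv ** B ** P) $ i $ i" for i
  have act: "(Pinv *v (A *v u)) $ i = av i * (Pinv *v u) $ i" "(Pinv *v (B *v u)) $ i = bv i * (Pinv *v u) $ i" for u i
    unfolding av_def bv_def by (rule diagonalized_action[OF P(1) d(1)], rule diagonalized_action[OF P(1) d(2)])
  have spA: "cspectrum A = range av" and spB: "cspectrum B = range bv"
    by (rule diagonalized_spectrum[OF P act(1)], rule diagonalized_spectrum[OF P act(2)])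
  have neg: "Pinv *v ((- M) *v u) = - (Pinv *v (M *v u))" for M u
    by (simp add: matrix_vector_mult_minus_left vec_eq_iff matrix_vector_mult_def sum_negf)
  have spA': "cspectrum (- A) = range (\<lambda>i. - av i)" and spB': "cspectrum (- B) = range (\<lambda>i. - bv i)"
    by (rule diagonalized_spectrum[OF P], simp add: neg act)+
  define a0 where "a0 = - spec_abscissa (- A)"
  define b0 where "b0 = - spec_abscissa (- B)"
  define amax where "amax = spec_radius A"
  have a0_le: "a0 \<le> Re (av i)" for i
  proof -
    have "Re (- av i) \<le> spec_abscissa (- A)" unfolding spec_abscissa_def spA' by (rule Max_ge) (simp, rule imageI, rule rangeI)
    then show ?thesis by (simp add: a0_def)
  qed
  have b0_le: "b0 \<le> Re (bv i)" for i
  proof -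
    have "Re (- bv i) \<le> spec_abscissa (- B)" unfolding spec_abscissa_def spB' by (rule Max_ge) (simp, rule imageI, rule rangeI)
    then show ?thesis by (simp add: b0_def)
  qed
  have amax_ge: "cmod (av i) \<le> amax" for i
    unfolding amax_def spec_radius_def spA by (rule Max_ge) (simp, rule imageI, rule rangeI)
  have "spec_abscissa (- A) \<in> Re ` cspectrum (- A)"
    unfolding spec_abscissa_def spA' by (rule Max_in) simp_all
  then obtain i where "spec_abscissa (- A) = Re (- av i)" unfolding spA' by blast
  then have "a0 = Re (av i)" by (simp add: a0_def)
  then have \<gamma>A: "\<gamma>A \<le> a0" using A4_le_eigenvalue[OF A4, of "av i"] by (simp add: spA)
  have \<gamma>A0: "\<gamma>A > 0" using A4 by (simp add: A4_def)
  have "spec_abscissa (- B) \<in> Re ` cspectrum (- B)"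
    unfolding spec_abscissa_def spB' by (rule Max_in) simp_all
  then obtain k where "spec_abscissa (- B) = Re (- bv k)" unfolding spB' by blast
  then have "b0 = Re (bv k)" by (simp add: b0_def)
  then have \<beta>: "\<beta>inf \<le> b0" using numerical_bound_le_eigenvalue[OF beta, of "bv k"] by (simp add: spB)
  have "spec_radius A \<in> cmod ` cspectrum A"
    unfolding spec_radius_def spA by (rule Max_in) simp_all
  then have nA: "amax \<le> specnorm A" using eigenvalue_le_specnorm by (auto simp: amax_def)
  interpret D: diagonalizable_pair A B P Pinv av bv a0 amax b0
    by unfold_locales (use P act a0_le b0_le amax_ge \<gamma>A \<gamma>A0 in auto)
  obtain \<eta>0 and C1 :: "real \<Rightarrow> real \<Rightarrow> real \<Rightarrow> real" where \<eta>0: "\<eta>0 > 0" and C1: "\<And>a b c. C1 a b c > 0"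
    and core: "\<And>(S::real^'d^'d) Q R0 lam \<mu>1 \<mu>2 v Dv D2v g.
       transpose S = - S \<Longrightarrow> continuous_on UNIV Q \<Longrightarrow> R0 > 0 \<Longrightarrow>
       (\<And>x. norm x \<ge> R0 \<Longrightarrow> specnorm (Q x) \<le> \<eta>0) \<Longrightarrow> Re lam \<ge> - b0 + \<gamma> \<Longrightarrow>
       \<mu>1 \<le> 0 \<Longrightarrow> 0 \<le> \<mu>2 \<Longrightarrow> \<mu>1\<^sup>2 \<le> 4 * \<epsilon> * D.\<alpha>0 * \<gamma> \<Longrightarrow> \<mu>2\<^sup>2 \<le> 4 * \<epsilon> * D.\<alpha>0 * \<gamma> \<Longrightarrow>
       W2p_loc_derivs p v Dv D2v \<Longrightarrow> Lp_weighted p (exp_weight \<mu>1) v \<Longrightarrow> Lp_weighted p (exp_weight \<mu>2) g \<Longrightarrow>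
       AE x in lborel. resolvent_op lam A S B Q v Dv D2v x = g x \<Longrightarrow>
         Lp_weighted p (exp_weight \<mu>2) v \<and> (\<forall>i. Lp_weighted p (exp_weight \<mu>2) (Dv i)) \<and>
         Lp_wnorm p (exp_weight \<mu>2) v \<le> C1 \<bar>\<mu>2 - \<mu>1\<bar> R0 (Linf_mat_norm Q) *
            (Lp_wnorm p (exp_weight \<mu>1) v + Lp_wnorm p (exp_weight \<mu>2) g) \<and>
         W1p_wnorm p (exp_weight \<mu>2) v Dv \<le> C1 \<bar>\<mu>2 - \<mu>1\<bar> R0 (Linf_mat_norm Q) * (Re lam + b0) powr (- 1 / 2) *
            (Lp_wnorm p (exp_weight \<mu>1) v + Lp_wnorm p (exp_weight \<mu>2) g)"
    proof (rule D.core_estimate[OF p gam(1) eps, where 'd = 'd], goal_cases)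
      case (1 \<eta> C)
      show ?case by (rule that[of \<eta> C]) (fact 1)+
    qed
  have limit: "4 * \<epsilon> * D.\<alpha>0 * \<gamma> = \<epsilon> * (a0 * \<gamma> / amax\<^sup>2)" by (simp add: D.\<alpha>0_def)
  note amax0 = D.amax_pos
  have a0\<gamma>: "0 \<le> a0 * \<gamma>" using \<gamma>A \<gamma>A0 gam(1) by simp
  show ?thesis
  proof (rule that[OF \<eta>0 C1], unfold b0_def[symmetric] a0_def[symmetric] amax_def[symmetric], rule core)
    fix \<mu>1 :: real
    assume \<mu>1: "- sqrt (\<epsilon> * \<gamma>A * (\<beta>inf - b0 + \<gamma>) / (2 * real CARD('d) * (specnorm A)^2)) \<le> \<mu>1" "\<mu>1 \<le> 0"
    have pos: "0 \<le> \<beta>inf - b0 + \<gamma>" using gam(2) by (simp add: b0_def)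
    have "\<bar>\<mu>1\<bar> \<le> sqrt (\<epsilon> * \<gamma>A * (\<beta>inf - b0 + \<gamma>) / (2 * real CARD('d) * (specnorm A)^2))" using \<mu>1 by linarith
    then have "\<bar>\<mu>1\<bar>\<^sup>2 \<le> (sqrt (\<epsilon> * \<gamma>A * (\<beta>inf - b0 + \<gamma>) / (2 * real CARD('d) * (specnorm A)^2)))\<^sup>2"
      by (intro power_mono) auto
    also have "\<dots> = \<epsilon> * \<gamma>A * (\<beta>inf - b0 + \<gamma>) / (2 * real CARD('d) * (specnorm A)^2)"
      using eps \<gamma>A0 pos by (intro real_sqrt_pow2) auto
    \<comment> \<open>Four comparisons: \<gamma>A <= a0, \<beta>inf - b0 + \<gamma> <= \<gamma>
      because \<beta>inf <= b0, 2 d >= 1, and amax <= |A|.\<close>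
    also have "\<dots> \<le> \<epsilon> * a0 * \<gamma> / (1 * amax\<^sup>2)"
    proof (intro frac_le mult_mono)
      show "1 \<le> 2 * real CARD('d)"
        using zero_less_card_finite[where 'a = 'd] by linarith
      show "amax\<^sup>2 \<le> (specnorm A)\<^sup>2" using nA amax0 by (intro power_mono) auto
    qed (use eps \<gamma>A \<gamma>A0 \<beta> pos amax0 gam in \<open>auto intro!: mult_nonneg_nonneg\<close>)
    finally show "\<mu>1\<^sup>2 \<le> 4 * \<epsilon> * D.\<alpha>0 * \<gamma>" unfolding limit by (simp add: mult_ac)
  next
    fix \<mu>2 :: real
    assume \<mu>2: "0 \<le> \<mu>2" "\<mu>2 \<le> \<epsilon> * sqrt (a0 * \<gamma>) / (amax * p)"
    have "\<mu>2\<^sup>2 \<le> (\<epsilon> * sqrt (a0 * \<gamma>) / (amax * p))\<^sup>2" using \<mu>2 by (intro power_mono) auto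
    also have "\<dots> = (\<epsilon> * \<epsilon>) * (a0 * \<gamma>) / (amax\<^sup>2 * p\<^sup>2)"
      using a0\<gamma> by (simp add: power_divide power_mult_distrib power2_eq_square[of \<epsilon>])
    \<comment> \<open>From \<epsilon>^2 <= \<epsilon> and p^2 >= 1: the prescribed range lies inside
      the one that the kernel admits.\<close>
    also have "\<dots> \<le> (\<epsilon> * 1) * (a0 * \<gamma>) / (amax\<^sup>2 * 1)"
      using eps p a0\<gamma> amax0 gam(1) \<gamma>A \<gamma>A0 by (intro frac_le mult_mono) auto
    finally show "\<mu>2\<^sup>2 \<le> 4 * \<epsilon> * D.\<alpha>0 * \<gamma>" unfolding limit by simp
  qed assumption+
qed

theorem theorem4p7:
  fixes A B :: "complex^'m^'m"
    and p q \<gamma>A \<delta>A \<beta>inf \<gamma> \<epsilon> :: real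
  assumes d2: "CARD('d) \<ge> 2"
    and p: "1 < p"
    and q: "q = p / (p - 1)"
    and A4p: "A4 p A \<gamma>A"
    and A4q: "A4 q (mat_H A) \<delta>A"
    and sdiag: "simult_diagonalizable A B"
    and beta: "\<forall>w::complex^'m. Re (cinner w (B *v w)) \<ge> \<beta>inf * (norm w)^2"
    and gam: "\<gamma> > 0" "\<beta>inf - (- spec_abscissa (- B)) + \<gamma> > 0"
    and eps: "0 < \<epsilon>" "\<epsilon> < 1"
  shows "\<exists>\<eta>0 > 0. \<exists>C1 C3 :: real \<Rightarrow> real \<Rightarrow> real \<Rightarrow> real.
     (\<forall>a b c. C1 a b c > 0 \<and> C3 a b c > 0) \<and>
     (\<forall>(S::real^'d^'d) (Q::real^'d \<Rightarrow> complex^'m^'m) R0 (lam::complex) \<mu>1 \<mu>2 \<mu>3 \<mu>4.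
        let b0 = - spec_abscissa (- B); a0 = - spec_abscissa (- A);
            amax = spec_radius A; nA = specnorm A; d = real CARD('d) in
        transpose S = - S \<and> continuous_on UNIV Q \<and> R0 > 0 \<and>
        (\<forall>x. norm x \<ge> R0 \<longrightarrow> specnorm (Q x) \<le> \<eta>0) \<and>
        Re lam \<ge> - b0 + \<gamma> \<and>
        - sqrt (\<epsilon> * \<gamma>A * (\<beta>inf - b0 + \<gamma>) / (2 * d * nA^2)) \<le> \<mu>1 \<and> \<mu>1 \<le> 0 \<and>
        0 \<le> \<mu>2 \<and> \<mu>2 \<le> \<epsilon> * sqrt (a0 * \<gamma>) / (amax * p) \<and>
        - sqrt (\<epsilon> * \<delta>A * (\<beta>inf - b0 + \<gamma>) / (2 * d * nA^2)) \<le> \<mu>3 \<and> \<mu>3 \<le> 0 \<and>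
        0 \<le> \<mu>4 \<and> \<mu>4 \<le> \<epsilon> * sqrt (a0 * \<gamma>) / (amax * q)
        \<longrightarrow>
        (\<forall>v Dv D2v g.
           W2p_loc_derivs p v Dv D2v \<and> Lp_weighted p (exp_weight \<mu>1) v \<and>
           Lp_weighted p (exp_weight \<mu>2) g \<and>
           (AE x in lborel. resolvent_op lam A S B Q v Dv D2v x = g x)
           \<longrightarrow>
           Lp_weighted p (exp_weight \<mu>2) v \<and> (\<forall>i. Lp_weighted p (exp_weight \<mu>2) (Dv i)) \<and>
           Lp_wnorm p (exp_weight \<mu>2) v
             \<le> C1 \<bar>\<mu>2 - \<mu>1\<bar> R0 (Linf_mat_norm Q) *
                (Lp_wnorm p (exp_weight \<mu>1) v + Lp_wnorm p (exp_weight \<mu>2) g) \<and>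
           W1p_wnorm p (exp_weight \<mu>2) v Dv
             \<le> C1 \<bar>\<mu>2 - \<mu>1\<bar> R0 (Linf_mat_norm Q) * (Re lam + b0) powr (- 1 / 2) *
                (Lp_wnorm p (exp_weight \<mu>1) v + Lp_wnorm p (exp_weight \<mu>2) g)) \<and>
        (\<forall>\<psi> D\<psi> D2\<psi> \<phi>.
           W2p_loc_derivs q \<psi> D\<psi> D2\<psi> \<and> Lp_weighted q (exp_weight \<mu>3) \<psi> \<and>
           Lp_weighted q (exp_weight \<mu>4) \<phi> \<and>
           (AE x in lborel. adj_resolvent_op lam A S B Q \<psi> D\<psi> D2\<psi> x = \<phi> x)
           \<longrightarrow>
           Lp_weighted q (exp_weight \<mu>4) \<psi> \<and> (\<forall>i. Lp_weighted q (exp_weight \<mu>4) (D\<psi> i)) \<and>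
           Lp_wnorm q (exp_weight \<mu>4) \<psi>
             \<le> C3 \<bar>\<mu>4 - \<mu>3\<bar> R0 (Linf_mat_norm Q) *
                (Lp_wnorm q (exp_weight \<mu>3) \<psi> + Lp_wnorm q (exp_weight \<mu>4) \<phi>) \<and>
           W1p_wnorm q (exp_weight \<mu>4) \<psi> D\<psi>
             \<le> C3 \<bar>\<mu>4 - \<mu>3\<bar> R0 (Linf_mat_norm Q) * (Re lam + b0) powr (- 1 / 2) *
                (Lp_wnorm q (exp_weight \<mu>3) \<psi> + Lp_wnorm q (exp_weight \<mu>4) \<phi>)))"
proof -
  have q1: "1 < q" using p by (simp add: q field_simps)
  \<comment> \<open>Passing to the adjoint conjugates the quadratic form, and its real part stays
    the same.\<close>
  have beta': "\<forall>w::complex^'m. Re (cinner w (mat_H B *v w)) \<ge> \<beta>inf * (norm w)^2"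
    using beta by (simp add: cinner_mat_H)
  have gam': "\<beta>inf - (- spec_abscissa (- mat_H B)) + \<gamma> > 0" using gam(2) by (simp add: spectral_bounds_mat_H[OF sdiag])
  obtain \<eta>1 and C1 :: "real \<Rightarrow> real \<Rightarrow> real \<Rightarrow> real" where \<eta>1: "\<eta>1 > 0" and C1: "\<And>a b c. C1 a b c > 0"
    and E1: "\<And>(S::real^'d^'d) Q R0 lam \<mu>1 \<mu>2 v Dv D2v g.
       transpose S = - S \<Longrightarrow> continuous_on UNIV Q \<Longrightarrow> R0 > 0 \<Longrightarrow>
       (\<And>x. norm x \<ge> R0 \<Longrightarrow> specnorm (Q x) \<le> \<eta>1) \<Longrightarrow> Re lam \<ge> - (- spec_abscissa (- B)) + \<gamma> \<Longrightarrow>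
       - sqrt (\<epsilon> * \<gamma>A * (\<beta>inf - (- spec_abscissa (- B)) + \<gamma>) / (2 * real CARD('d) * (specnorm A)^2)) \<le> \<mu>1 \<Longrightarrow> \<mu>1 \<le> 0 \<Longrightarrow>
       0 \<le> \<mu>2 \<Longrightarrow> \<mu>2 \<le> \<epsilon> * sqrt (- spec_abscissa (- A) * \<gamma>) / (spec_radius A * p) \<Longrightarrow>
       W2p_loc_derivs p v Dv D2v \<Longrightarrow> Lp_weighted p (exp_weight \<mu>1) v \<Longrightarrow> Lp_weighted p (exp_weight \<mu>2) g \<Longrightarrow>
       AE x in lborel. resolvent_op lam A S B Q v Dv D2v x = g x \<Longrightarrow>
         Lp_weighted p (exp_weight \<mu>2) v \<and> (\<forall>i. Lp_weighted p (exp_weight \<mu>2) (Dv i)) \<and>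
         Lp_wnorm p (exp_weight \<mu>2) v \<le> C1 \<bar>\<mu>2 - \<mu>1\<bar> R0 (Linf_mat_norm Q) *
            (Lp_wnorm p (exp_weight \<mu>1) v + Lp_wnorm p (exp_weight \<mu>2) g) \<and>
         W1p_wnorm p (exp_weight \<mu>2) v Dv \<le> C1 \<bar>\<mu>2 - \<mu>1\<bar> R0 (Linf_mat_norm Q) * (Re lam + (- spec_abscissa (- B))) powr (- 1 / 2) *
            (Lp_wnorm p (exp_weight \<mu>1) v + Lp_wnorm p (exp_weight \<mu>2) g)"
    proof (rule exponential_estimate[OF p A4p sdiag beta gam eps, where 'd = 'd], goal_cases)
      case (1 \<eta> C)
      show ?case by (rule that[of \<eta> C]) (fact 1)+
    qed
  obtain \<eta>2 and C3 :: "real \<Rightarrow> real \<Rightarrow> real \<Rightarrow> real" where \<eta>2: "\<eta>2 > 0" and C3: "\<And>a b c. C3 a b c > 0"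
    and E2: "\<And>(S::real^'d^'d) Q R0 lam \<mu>1 \<mu>2 v Dv D2v g.
       transpose S = - S \<Longrightarrow> continuous_on UNIV Q \<Longrightarrow> R0 > 0 \<Longrightarrow>
       (\<And>x. norm x \<ge> R0 \<Longrightarrow> specnorm (Q x) \<le> \<eta>2) \<Longrightarrow> Re lam \<ge> - (- spec_abscissa (- mat_H B)) + \<gamma> \<Longrightarrow>
       - sqrt (\<epsilon> * \<delta>A * (\<beta>inf - (- spec_abscissa (- mat_H B)) + \<gamma>) / (2 * real CARD('d) * (specnorm (mat_H A))^2)) \<le> \<mu>1 \<Longrightarrow> \<mu>1 \<le> 0 \<Longrightarrow>
       0 \<le> \<mu>2 \<Longrightarrow> \<mu>2 \<le> \<epsilon> * sqrt (- spec_abscissa (- mat_H A) * \<gamma>) / (spec_radius (mat_H A) * q) \<Longrightarrow>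
       W2p_loc_derivs q v Dv D2v \<Longrightarrow> Lp_weighted q (exp_weight \<mu>1) v \<Longrightarrow> Lp_weighted q (exp_weight \<mu>2) g \<Longrightarrow>
       AE x in lborel. resolvent_op lam (mat_H A) S (mat_H B) Q v Dv D2v x = g x \<Longrightarrow>
         Lp_weighted q (exp_weight \<mu>2) v \<and> (\<forall>i. Lp_weighted q (exp_weight \<mu>2) (Dv i)) \<and>
         Lp_wnorm q (exp_weight \<mu>2) v \<le> C3 \<bar>\<mu>2 - \<mu>1\<bar> R0 (Linf_mat_norm Q) *
            (Lp_wnorm q (exp_weight \<mu>1) v + Lp_wnorm q (exp_weight \<mu>2) g) \<and>
         W1p_wnorm q (exp_weight \<mu>2) v Dv \<le> C3 \<bar>\<mu>2 - \<mu>1\<bar> R0 (Linf_mat_norm Q) * (Re lam + (- spec_abscissa (- mat_H B))) powr (- 1 / 2) *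
            (Lp_wnorm q (exp_weight \<mu>1) v + Lp_wnorm q (exp_weight \<mu>2) g)"
    proof (rule exponential_estimate[OF q1 A4q simult_diagonalizable_mat_H[OF sdiag] beta' gam(1) gam' eps, where 'd = 'd], goal_cases)
      case (1 \<eta> C)
      show ?case by (rule that[of \<eta> C]) (fact 1)+
    qed
  have trS: "transpose (- S) = - (- S)" if "transpose S = - S" for S :: "real^'d^'d"
  proof -
    have "transpose (- S) = - transpose S" by (simp add: transpose_def vec_eq_iff)
    with that show ?thesis by simp
  qed
  have contH: "continuous_on UNIV (\<lambda>x. mat_H (Q x))" if "continuous_on UNIV Q" for Q :: "real^'d \<Rightarrow> complex^'m^'m"
    unfolding mat_H_def using that by (intro continuous_on_vec_lambda continuous_on_cnj continuous_on_component)
  have LinfH: "Linf_mat_norm (\<lambda>x. mat_H (Q x)) = Linf_mat_norm Q" for Q :: "real^'d \<Rightarrow> complex^'m^'m"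
    by (simp add: Linf_mat_norm_def specnorm_mat_H)
  have E3: "Lp_weighted q (exp_weight \<mu>4) \<psi> \<and> (\<forall>i. Lp_weighted q (exp_weight \<mu>4) (D\<psi> i)) \<and>
           Lp_wnorm q (exp_weight \<mu>4) \<psi>
             \<le> C3 \<bar>\<mu>4 - \<mu>3\<bar> R0 (Linf_mat_norm Q) *
                (Lp_wnorm q (exp_weight \<mu>3) \<psi> + Lp_wnorm q (exp_weight \<mu>4) \<phi>) \<and>
           W1p_wnorm q (exp_weight \<mu>4) \<psi> D\<psi>
             \<le> C3 \<bar>\<mu>4 - \<mu>3\<bar> R0 (Linf_mat_norm Q) * (Re lam + (- spec_abscissa (- B))) powr (- 1 / 2) *
                (Lp_wnorm q (exp_weight \<mu>3) \<psi> + Lp_wnorm q (exp_weight \<mu>4) \<phi>)"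
    if "transpose S = - S" "continuous_on UNIV Q" "R0 > 0" "\<And>x. norm x \<ge> R0 \<Longrightarrow> specnorm (Q x) \<le> \<eta>2"
      "Re lam \<ge> - (- spec_abscissa (- B)) + \<gamma>"
      "- sqrt (\<epsilon> * \<delta>A * (\<beta>inf - (- spec_abscissa (- B)) + \<gamma>) / (2 * real CARD('d) * (specnorm A)^2)) \<le> \<mu>3" "\<mu>3 \<le> 0"
      "0 \<le> \<mu>4" "\<mu>4 \<le> \<epsilon> * sqrt (- spec_abscissa (- A) * \<gamma>) / (spec_radius A * q)"
      "W2p_loc_derivs q \<psi> D\<psi> D2\<psi>" "Lp_weighted q (exp_weight \<mu>3) \<psi>" "Lp_weighted q (exp_weight \<mu>4) \<phi>"
      "AE x in lborel. adj_resolvent_op lam A S B Q \<psi> D\<psi> D2\<psi> x = \<phi> x"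
    for S :: "real^'d^'d" and Q R0 lam \<mu>3 \<mu>4 \<psi> D\<psi> D2\<psi> \<phi>
    \<comment> \<open>The conjugate of lam has the same real part, and spectral bounds, spectral
      norm and the supremum of Q are invariant under adjoints, so the hypotheses and constants carry
      over verbatim.\<close>
    by (rule E2[of "- S" "\<lambda>x. mat_H (Q x)" R0 "cnj lam" \<mu>3 \<mu>4 \<psi> D\<psi> D2\<psi> \<phi>, OF trS contH,
        unfolded spectral_bounds_mat_H[OF sdiag] specnorm_mat_H LinfH cnj.sel(1), folded adj_resolvent_op_eq, OF that])
  show ?thesis
    unfolding Let_def
  proof (rule exI[of _ "min \<eta>1 \<eta>2"], rule conjI, goal_cases)
    case 1
    show ?case using \<eta>1 \<eta>2 by simp
  next
    case 2
    show ?case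
    proof (rule exI[of _ C1], rule exI[of _ C3], rule conjI, goal_cases)
      case 1
      show ?case using C1 C3 by blast
    next
      case 2
      show ?case
      proof (intro allI impI, elim conjE, rule conjI, goal_cases)
        case (1 S Q R0 lam \<mu>1 \<mu>2 \<mu>3 \<mu>4)
        have "specnorm (Q x) \<le> \<eta>1" if "R0 \<le> norm x" for x using 1(4) that by auto
        then show ?case using E1[OF 1(1-3) _ 1(5-9)] by blast
      next
        case (2 S Q R0 lam \<mu>1 \<mu>2 \<mu>3 \<mu>4)
        have "specnorm (Q x) \<le> \<eta>2" if "R0 \<le> norm x" for x using 2(4) that by auto
        then show ?case using E3[OF 2(1-3) _ 2(5,10-13)] by blast
      qed
    qed
  qed
qed

end
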